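(* Let $0\le\varepsilon\le\delta\le\delta_0$ be constants such that $f(x,\varepsilon)\ge0$ and $f(x,\delta)\le0$ for a.a. $x\in\Omega$. Then the problem $$\begin{cases}-\operatorname{div}\mathbf{a}(x,\nabla U(x))=f(x,U(x)), & x\in\Omega\\ \mathbf{a}(x,\nabla U)\cdot\nu=0, & x\in\partial\Omega\\ \varepsilon\le U(x)\le\delta, & x\in\Omega\end{cases}$$ admits at least one weak solution. Furthermore, there are a minimal and a maximal weak solution $\underline{U}_{[\varepsilon,\delta]}$ and $\overline{U}_{[\varepsilon,\delta]}$ of this problem, i.e. any weak solution $U$ of it satisfies $\underline{U}_{[\varepsilon,\delta]}\le U\le\overline{U}_{[\varepsilon,\delta]}$ a.e. on $\Omega$.
   Context: Setting. $\Omega\subset\mathbb{R}^N$, $N\ge 2$, is an open, bounded, connected Lipschitz domain. $p:\overline{\Omega}\to(1,\infty)$ is either log-Hölder continuous with $p^-:=\min_{\overline\Omega}p\ge\frac{2N}{N+2}$, or continuous with $p^->\frac{2N}{N+2}$; put $p^+:=\max_{\overline\Omega}p$ and $p'(x)=\frac{p(x)}{p(x)-1}$. (In both cases $W^{1,p(x)}(\Omega)\hookrightarrow L^2(\Omega)$.) $L^{p(x)}(\Omega)$ is the space of measurable $u$ with $\int_\Omega|u|^{p(x)}dx<\infty$, with the Luxemburg norm $\inf\{\lambda>0:\int_\Omega|u/\lambda|^{p(x)}dx\le1\}$, and $W^{1,p(x)}(\Omega)$ is the corresponding Sobolev space of $u\in L^{p(x)}(\Omega)$ with $|\nabla u|\in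 L^{p(x)}(\Omega)$, with its usual norm. $\Psi:\overline{\Omega}\times(0,\infty)\to(0,\infty)$ satisfies: $\Psi(\cdot,s)$ is measurable for each $s>0$; for a.a. $x\in\Omega$, $\Psi(x,\cdot)$ is locally absolutely continuous on $(0,\infty)$, $\lim_{s\to0^+}\Psi(x,s)s=0$, and $s\mapsto\Psi(x,s)s$ is strictly increasing on $(0,\infty)$. Put $\mathbf{a}(x,\xi)=\Psi(x,|\xi|)\xi$ for $\xi\in\mathbb{R}^N\setminus\{\mathbf 0\}$, $\mathbf{a}(x,\mathbf 0)=\mathbf 0$; $\Phi(x,s)=\Psi(x,|s|)|s|$ for $s\ne0$, $\Phi(x,0)=0$; $A(x,\xi)=\int_0^{|\xi|}\Phi(x,s)\,ds$. It is assumed that $\Phi(\cdot,v(\cdot))\in L^{p'(x)}(\Omega)$ for every $v\in L^{p(x)}(\Omega)$, and that for any sequence $(V_n)\subset W^{1,p(x)}(\Omega)$ with $\int_\Omega|\nabla V_n|^{p(x)}dx\to\infty$ one has $\int_\Omega A(x,\nabla V_n)\,dx\to\infty$. $0<\delta_0<\infty$ is a constant. $b:\overline\Omega\times[0,\delta_0]\to[0,\infty)$ is a Carathéodory function (measurable in $x$ for every $s$, continuous in $s$ for a.a. $x$) such that $b(\cdot,0),b(\cdot,\delta_0)\in L^2(\Omega)$ and $s\mapsto b(x,s)$ is strictly increasing on $[0,\delta_0]$ for a.a. $x\in\Omega$. The source $f:\overline\Omega\times\mathbb{R}\to\mathbb{R}$ (only its restriction to $\overline\Omega\times[0,\delta_0]$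 matters) satisfies $f(x,0)\ge0$ and $f(x,\delta_0)\le0$ for a.a. $x\in\Omega$, its restriction to $\overline\Omega\times[0,\delta_0]$ is a Carathéodory function, and there is a constant $\lambda_0>0$ such that $s\mapsto f(x,s)+\lambda_0b(x,s)$ is strictly increasing on $[0,\delta_0]$ for a.a. $x\in\Omega$. Definition. $U\in W^{1,p(x)}(\Omega)$ is a weak solution of the problem in the claim if $\varepsilon\le U\le\delta$ a.e. on $\Omega$ and for every $\phi\in W^{1,p(x)}(\Omega)$: $$\int_\Omega\mathbf{a}(x,\nabla U)\cdot\nabla\phi\,dx=\int_\Omega f(x,U)\phi\,dx.$$ *)

theory Defs
  imports "HOL-Analysis.Analysis"
begin

text \<open>
  Functions given on \<open>\<Omega>\<close> or on its closure are total here; only their values there matter.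
  Elements of \<open>Lp_var\<close> and \<open>W1p_var\<close> are functions and not equivalence classes,
  so every (in)equality between them is stated almost everywhere.
\<close>

text \<open>
  Near each boundary point, after a rigid motion turning \<open>e\<close> into the last coordinate direction,
  \<open>\<Omega>\<close> is the strict epigraph of a Lipschitz function \<open>\<gamma>\<close> of the remaining coordinates
  \<open>x - (x \<bullet> e) e\<close>.
\<close>

definition lipschitz_boundary :: "'a::euclidean_space set \<Rightarrow> bool" where
  "lipschitz_boundary \<Omega> \<longleftrightarrow>
     (\<forall>z\<in>frontier \<Omega>. \<exists>e r L. \<exists>\<gamma>::'a \<Rightarrow> real. norm e = 1 \<and> 0 < r \<and>
        L-lipschitz_on {y. y \<bullet> e = 0} \<gamma> \<and>
        \<Omega> \<inter> ball z r = {x \<in> ball z r. \<gamma> (x - (x \<bullet> e) *\<^sub>R e) < x \<bullet> e})"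

definition lipschitz_domain :: "'a::euclidean_space set \<Rightarrow> bool" where
  "lipschitz_domain \<Omega> \<longleftrightarrow>
     \<Omega> \<noteq> {} \<and> open \<Omega> \<and> bounded \<Omega> \<and> connected \<Omega> \<and> lipschitz_boundary \<Omega>"

definition log_holder_on :: "'a::metric_space set \<Rightarrow> ('a \<Rightarrow> real) \<Rightarrow> bool" where
  "log_holder_on S p \<longleftrightarrow>
     (\<exists>C>0. \<forall>x\<in>S. \<forall>y\<in>S. 0 < dist x y \<and> dist x y < 1/2 \<longrightarrow>
        \<bar>p x - p y\<bar> \<le> C / (- ln (dist x y)))"

text \<open>For \<open>p\<close> continuous and \<open>\<Omega>\<close> bounded and nonempty, the infimum is attained.\<close>

definition p_minus :: "'a::euclidean_space set \<Rightarrow> ('a \<Rightarrow> real) \<Rightarrow> real" where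
  "p_minus \<Omega> p = (INF x\<in>closure \<Omega>. p x)"

definition conj_exponent :: "('a \<Rightarrow> real) \<Rightarrow> 'a \<Rightarrow> real" where
  "conj_exponent p x = p x / (p x - 1)"

definition Lp_var :: "'a::euclidean_space set \<Rightarrow> ('a \<Rightarrow> real) \<Rightarrow> ('a \<Rightarrow> real) set" where
  "Lp_var \<Omega> p = {u. u \<in> borel_measurable (lebesgue_on \<Omega>) \<and>
                     integrable (lebesgue_on \<Omega>) (\<lambda>x. \<bar>u x\<bar> powr p x)}"

primrec continuously_differentiable :: "nat \<Rightarrow> ('a::euclidean_space \<Rightarrow> real) \<Rightarrow> bool" where
  "continuously_differentiable 0 \<phi> \<longleftrightarrow> continuous_on UNIV \<phi>"
| "continuously_differentiable (Suc k) \<phi> \<longleftrightarrow>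
     (\<forall>x. \<phi> differentiable (at x)) \<and>
     (\<forall>i\<in>Basis. continuously_differentiable k (\<lambda>x. frechet_derivative \<phi> (at x) i))"

definition test_function :: "'a::euclidean_space set \<Rightarrow> ('a \<Rightarrow> real) \<Rightarrow> bool" where
  "test_function \<Omega> \<phi> \<longleftrightarrow>
     (\<forall>k. continuously_differentiable k \<phi>) \<and>
     compact (closure {x. \<phi> x \<noteq> 0}) \<and> closure {x. \<phi> x \<noteq> 0} \<subseteq> \<Omega>"

definition locally_integrable ::
  "'a::euclidean_space set \<Rightarrow> ('a \<Rightarrow> 'b::euclidean_space) \<Rightarrow> bool" where
  "locally_integrable \<Omega> g \<longleftrightarrow> (\<forall>K. compact K \<and> K \<subseteq> \<Omega> \<longrightarrow> integrable (lebesgue_on K) g)"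

definition has_weak_gradient ::
  "'a::euclidean_space set \<Rightarrow> ('a \<Rightarrow> real) \<Rightarrow> ('a \<Rightarrow> 'a) \<Rightarrow> bool" where
  "has_weak_gradient \<Omega> u G \<longleftrightarrow>
     locally_integrable \<Omega> u \<and> locally_integrable \<Omega> G \<and>
     (\<forall>\<phi>. test_function \<Omega> \<phi> \<longrightarrow> (\<forall>i\<in>Basis.
        (LINT x|lebesgue_on \<Omega>. u x * frechet_derivative \<phi> (at x) i) =
        - (LINT x|lebesgue_on \<Omega>. (G x \<bullet> i) * \<phi> x)))"

text \<open>The weak gradient is unique up to null sets; this is an arbitrary representative.\<close>

definition weak_gradient :: "'a::euclidean_space set \<Rightarrow> ('a \<Rightarrow> real) \<Rightarrow> 'a \<Rightarrow> 'a" where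
  "weak_gradient \<Omega> u = (SOME G. has_weak_gradient \<Omega> u G)"

definition W1p_var :: "'a::euclidean_space set \<Rightarrow> ('a \<Rightarrow> real) \<Rightarrow> ('a \<Rightarrow> real) set" where
  "W1p_var \<Omega> p = {u \<in> Lp_var \<Omega> p.
     \<exists>G. has_weak_gradient \<Omega> u G \<and> (\<lambda>x. norm (G x)) \<in> Lp_var \<Omega> p}"

definition absolutely_continuous_on :: "real set \<Rightarrow> (real \<Rightarrow> real) \<Rightarrow> bool" where
  "absolutely_continuous_on S g \<longleftrightarrow>
     (\<forall>\<eta>>0. \<exists>\<theta>>0. \<forall>(n::nat) l r.
        (\<forall>i<n. l i \<le> r i \<and> {l i..r i} \<subseteq> S) \<and>
        disjoint_family_on (\<lambda>i. {l i<..<r i}) {..<n} \<and>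
        (\<Sum>i<n. r i - l i) < \<theta> \<longrightarrow>
        (\<Sum>i<n. \<bar>g (r i) - g (l i)\<bar>) < \<eta>)"

definition locally_absolutely_continuous_on :: "real set \<Rightarrow> (real \<Rightarrow> real) \<Rightarrow> bool" where
  "locally_absolutely_continuous_on S g \<longleftrightarrow>
     (\<forall>c d. {c..d} \<subseteq> S \<longrightarrow> absolutely_continuous_on {c..d} g)"

definition caratheodory ::
  "'a::euclidean_space set \<Rightarrow> real set \<Rightarrow> ('a \<Rightarrow> real \<Rightarrow> real) \<Rightarrow> bool" where
  "caratheodory \<Omega> S g \<longleftrightarrow>
     (\<forall>s\<in>S. (\<lambda>x. g x s) \<in> borel_measurable (lebesgue_on (closure \<Omega>))) \<and>
     (AE x in lebesgue_on \<Omega>. continuous_on S (g x))"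

definition a_field ::
  "('a::euclidean_space \<Rightarrow> real \<Rightarrow> real) \<Rightarrow> 'a \<Rightarrow> 'a \<Rightarrow> 'a" where
  "a_field \<Psi> x \<xi> = (if \<xi> = 0 then 0 else \<Psi> x (norm \<xi>) *\<^sub>R \<xi>)"

definition Phi :: "('a::euclidean_space \<Rightarrow> real \<Rightarrow> real) \<Rightarrow> 'a \<Rightarrow> real \<Rightarrow> real" where
  "Phi \<Psi> x s = (if s = 0 then 0 else \<Psi> x \<bar>s\<bar> * \<bar>s\<bar>)"

definition A_pot :: "('a::euclidean_space \<Rightarrow> real \<Rightarrow> real) \<Rightarrow> 'a \<Rightarrow> 'a \<Rightarrow> real" where
  "A_pot \<Psi> x \<xi> = integral {0..norm \<xi>} (Phi \<Psi> x)"

definition weak_solution ::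
  "'a::euclidean_space set \<Rightarrow> ('a \<Rightarrow> real) \<Rightarrow> ('a \<Rightarrow> real \<Rightarrow> real) \<Rightarrow>
   ('a \<Rightarrow> real \<Rightarrow> real) \<Rightarrow> real \<Rightarrow> real \<Rightarrow> ('a \<Rightarrow> real) \<Rightarrow> bool" where
  "weak_solution \<Omega> p \<Psi> f \<epsilon> \<delta> U \<longleftrightarrow>
     U \<in> W1p_var \<Omega> p \<and>
     (AE x in lebesgue_on \<Omega>. \<epsilon> \<le> U x \<and> U x \<le> \<delta>) \<and>
     (\<forall>\<phi>\<in>W1p_var \<Omega> p.
        (LINT x|lebesgue_on \<Omega>. a_field \<Psi> x (weak_gradient \<Omega> U x) \<bullet> weak_gradient \<Omega> \<phi> x) =
        (LINT x|lebesgue_on \<Omega>. f x (U x) * \<phi> x))"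

end

(*
Write the equation as -div a(x, grad U) + lam b(x, U) = g with g = f(x, U) + lam b(x, U), where g is
increasing in U. For a fixed source g between lam b(x, eps) and lam b(x, delta), the solution with
values in [eps, delta] is the minimiser of the convex functional
  J_g(V) = int A(x, grad V) + lam int B(x, V) - int g V,   B(x, .) a primitive of b(x, .),
among all V in W^{1,p(x)} with eps <= V <= delta; truncations show that the obstacles do not act.
The solution depends monotonically on g (test the difference of two equations with its positive part),
so solving repeatedly with g = f(x, U_n) + lam b(x, U_n) from U_0 = delta (U_0 = eps) gives a decreasing
(increasing) sequence above (below) every solution. Its limit minimises J_g for its own source g,
because J_g(U_{n+1}) tends to min J_g and b is strictly increasing; so it is the maximal (minimal) solution.

Weak compactness is avoided: among almost minimisers of J_g one selects almost minimisers of the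
auxiliary functional int |(1, V, grad V)|, whose convexity forces V and grad V to converge a.e.
along a subsequence. The test functions in the weak formulation need W^{1,p(x)} in L^2; this is the
embedding W^{1,q} in L^2 for q = 2N/(N+2), which follows from the Gagliardo inequality along N
directions pointing into the domain near a given boundary point.
*)

theory Submission
  imports Defs
begin

subsection \<open>Test functions\<close>

text \<open>Functions in \<open>W\<close> are never approximated by smooth ones. Weak gradients act
  through one consequence: for almost every \<open>x\<close> whose segment to \<open>x + v\<close>
  stays in \<open>\<Omega>\<close>, the difference \<open>u (x + v) - u x\<close> is the integral of
  \<open>G \<bullet> v\<close> along it. The chain rule, the vanishing of gradients on level sets
  and the Sobolev inequality all rest on this. No power bounds for the principal part are at hand:
  the growth assumption only makes pairings with gradients finite, and coercivity speaks about
  sequences. Hence energies pass to the limit by Fatou, sublevel sets are bounded by contradiction,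
  and \<open>p0 > 1\<close> turns bounded modulars into uniform integrability. Along the iteration
  nothing is known about convergence of gradients, so the equation itself is not passed to the
  limit. A minimiser for the limit source is produced independently and identified with the
  pointwise limit by strict convexity of \<open>B\<close>. All sources stay between
  \<open>lam * b x \<epsilon>\<close> and \<open>lam * b x \<delta>\<close>: this makes both
  constants barriers and keeps the sources in L^2, which is why test functions must be square
  integrable.\<close>

definition flat_exp :: "nat \<Rightarrow> real \<Rightarrow> real" where
  "flat_exp m t = (if 0 < t then exp (- (1 / t)) / t ^ m else 0)"

lemma flat_exp_nonneg [simp]: "0 \<le> flat_exp m t"
  by (simp add: flat_exp_def)

lemma power_div_fact_le_exp: "x ^ n / fact n \<le> exp x" if "0 \<le> x" for x :: real
proof -
  have "(\<Sum>k\<in>{n}. inverse (fact k) * x ^ k) \<le> (\<Sum>k. inverse (fact k) * x ^ k)"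
    using that by (intro sum_le_suminf summable_exp) auto
  then show ?thesis
    by (simp add: exp_def field_simps scaleR_conv_of_real)
qed

text \<open>\<open>exp (1 / t)\<close> dominates the term of degree \<open>m + 2\<close> of its
  series. The square on the right leaves \<open>flat_exp m h / h\<close> of order \<open>h\<close>,
  so the derivative at 0 vanishes.\<close>

lemma flat_exp_le: "flat_exp m t \<le> fact (m + 2) * t\<^sup>2"
proof (cases "0 < t")
  case True
  have "(1 / t) ^ (m + 2) / fact (m + 2) \<le> exp (1 / t)"
    by (rule power_div_fact_le_exp) (use True in simp)
  then have "1 \<le> exp (1 / t) * (fact (m + 2) * t ^ (m + 2))"
    using True by (simp add: power_one_over divide_simps mult.commute del: fact_Suc power_Suc add_2_eq_Suc')
  then have "exp (- (1 / t)) \<le> fact (m + 2) * t ^ (m + 2)"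
    by (simp add: exp_minus divide_simps mult.commute del: fact_Suc power_Suc add_2_eq_Suc')
  then show ?thesis
    using True by (simp add: flat_exp_def divide_simps power_add mult.assoc mult.commute[of "t ^ m"] del: fact_Suc power_Suc add_2_eq_Suc')
qed (simp add: flat_exp_def)

text \<open>The family is closed under differentiation up to linear combinations, which is the
  reason for carrying the power \<open>t ^ m\<close>. Smoothness of all orders is thereby reduced to
  one first derivative.\<close>

lemma flat_exp_has_derivative:
  "(flat_exp m has_real_derivative flat_exp (m + 2) t - real m * flat_exp (m + 1) t) (at t)"
proof -
  consider "t < 0" | "t = 0" | "0 < t" by linarith
  then show ?thesis
  proof cases
    case 1
    then have "((\<lambda>s. 0) has_real_derivative flat_exp (m + 2) t - real m * flat_exp (m + 1) t) (at t)"
      by (simp add: flat_exp_def)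
    then show ?thesis
      by (rule has_field_derivative_transform_within_open[where S = "{..<0}"])
        (use 1 in \<open>auto simp: flat_exp_def\<close>)
  next
    case 2
    have "((\<lambda>h. flat_exp m h / h) \<longlongrightarrow> 0) (at 0)"
    proof (rule Lim_null_comparison)
      show "\<forall>\<^sub>F h in at 0. norm (flat_exp m h / h) \<le> fact (m + 2) * \<bar>h\<bar>"
      proof (rule always_eventually, rule allI)
        fix h :: real
        show "norm (flat_exp m h / h) \<le> fact (m + 2) * \<bar>h\<bar>"
          using flat_exp_le[of m h]
          by (cases "h = 0") (simp_all add: divide_simps power2_eq_square abs_mult_self_eq mult.assoc
              del: fact_Suc add_2_eq_Suc')
      qed
      show "((\<lambda>h. fact (m + 2) * \<bar>h\<bar>) \<longlongrightarrow> 0) (at (0::real))"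
        by (auto intro!: tendsto_eq_intros)
    qed
    then show ?thesis
      using 2 by (simp add: has_field_derivative_iff flat_exp_def)
  next
    case 3
    have "((\<lambda>s. exp (- (1 / s)) / s ^ m) has_real_derivative
        flat_exp (m + 2) t - real m * flat_exp (m + 1) t) (at t)"
    proof -
      have e: "real m * t ^ (m - 1) = real m * t ^ m / t"
        using 3 by (cases m) auto
      have "((\<lambda>s. exp (- (1 / s)) / s ^ m) has_real_derivative
          (exp (- (1 / t)) * (1 / (t * t)) * t ^ m - exp (- (1 / t)) * (real m * t ^ (m - 1))) / (t ^ m * t ^ m))
          (at t)"
        using 3 by (auto intro!: derivative_eq_intros)
      moreover have "(exp (- (1 / t)) * (1 / (t * t)) * t ^ m - exp (- (1 / t)) * (real m * t ^ m / t)) /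
          (t ^ m * t ^ m) = flat_exp (m + 2) t - real m * flat_exp (m + 1) t"
        using 3 by (simp add: flat_exp_def divide_simps) (simp add: algebra_simps)
      ultimately show ?thesis
        by (simp only: e)
    qed
    then show ?thesis
      by (rule has_field_derivative_transform_within_open[where S = "{0<..}"])
        (use 3 in \<open>auto simp: flat_exp_def\<close>)
  qed
qed

text \<open>An algebra stable under every directional derivative: smoothness follows from membership
  alone, with no formula for higher derivatives. Functions of a single affine coordinate suffice to
  build bumps on boxes.\<close>

inductive_set flat_algebra :: "('a::euclidean_space \<Rightarrow> real) set" where
  const: "(\<lambda>x. c) \<in> flat_algebra"
| flat: "(\<lambda>x. flat_exp m (x \<bullet> w + d)) \<in> flat_algebra"
| add: "f \<in> flat_algebra \<Longrightarrow> g \<in> flat_algebra \<Longrightarrow> (\<lambda>x. f x + g x) \<in> flat_algebra"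
| mult: "f \<in> flat_algebra \<Longrightarrow> g \<in> flat_algebra \<Longrightarrow> (\<lambda>x. f x * g x) \<in> flat_algebra"

lemma flat_algebra_derivative:
  assumes "f \<in> flat_algebra"
  shows "\<exists>f'. (\<forall>x. (f has_derivative f' x) (at x)) \<and> (\<forall>i. (\<lambda>x. f' x i) \<in> flat_algebra)"
  using assms
proof induction
  case (const c)
  then show ?case
    by (intro exI[of _ "\<lambda>x i. 0"]) (auto intro: flat_algebra.const)
next
  case (flat m w d)
  let ?D = "\<lambda>t. flat_exp (m + 2) t - real m * flat_exp (m + 1) t"
  have "((\<lambda>x. flat_exp m (x \<bullet> w + d)) has_derivative (\<lambda>i. (i \<bullet> w) * ?D (x \<bullet> w + d))) (at x)" for x
  proof -
    have "((\<lambda>x. x \<bullet> w + d) has_derivative (\<lambda>i. i \<bullet> w)) (at x)"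
      by (auto intro!: derivative_eq_intros)
    from has_derivative_compose[OF this, of "flat_exp m" "(*) (?D (x \<bullet> w + d))"]
    show ?thesis
      using flat_exp_has_derivative[of m "x \<bullet> w + d"]
      by (simp add: has_field_derivative_def mult.commute)
  qed
  moreover have "(\<lambda>x. (i \<bullet> w) * ?D (x \<bullet> w + d)) \<in> flat_algebra" for i
  proof -
    have "(\<lambda>x. (i \<bullet> w) * (flat_exp (m + 2) (x \<bullet> w + d) + (- real m) * flat_exp (m + 1) (x \<bullet> w + d)))
      \<in> flat_algebra"
      by (intro flat_algebra.mult flat_algebra.const flat_algebra.add flat_algebra.flat)
    then show ?thesis by simp
  qed
  ultimately show ?case
    by (intro exI[of _ "\<lambda>x i. (i \<bullet> w) * ?D (x \<bullet> w + d)"]) auto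
next
  case (add f g)
  then obtain f' g' where "\<forall>x. (f has_derivative f' x) (at x)" "\<forall>i. (\<lambda>x. f' x i) \<in> flat_algebra"
    "\<forall>x. (g has_derivative g' x) (at x)" "\<forall>i. (\<lambda>x. g' x i) \<in> flat_algebra"
    by blast
  then show ?case
    by (intro exI[of _ "\<lambda>x i. f' x i + g' x i"])
      (auto intro!: has_derivative_add flat_algebra.add)
next
  case (mult f g)
  then obtain f' g' where "\<forall>x. (f has_derivative f' x) (at x)" "\<forall>i. (\<lambda>x. f' x i) \<in> flat_algebra"
    "\<forall>x. (g has_derivative g' x) (at x)" "\<forall>i. (\<lambda>x. g' x i) \<in> flat_algebra"
    by blast
  with mult show ?case
    by (intro exI[of _ "\<lambda>x i. f x * g' x i + f' x i * g x"])
      (auto intro!: has_derivative_mult flat_algebra.add flat_algebra.mult)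
qed

lemma flat_algebra_smooth: "f \<in> flat_algebra \<Longrightarrow> continuously_differentiable k f"
proof (induction k arbitrary: f)
  case 0
  then obtain f' where "\<forall>x. (f has_derivative f' x) (at x)"
    using flat_algebra_derivative by blast
  then show ?case
    by (auto intro!: continuous_at_imp_continuous_on has_derivative_continuous)
next
  case (Suc k)
  then obtain f' where f': "\<forall>x. (f has_derivative f' x) (at x)" "\<forall>i. (\<lambda>x. f' x i) \<in> flat_algebra"
    using flat_algebra_derivative by blast
  then have "frechet_derivative f (at x) = f' x" for x
    using frechet_derivative_at by metis
  with f' Suc.IH show ?case
    by (auto simp: differentiable_def)
qed

lemma flat_algebra_prod:
  "finite I \<Longrightarrow> (\<And>i. i \<in> I \<Longrightarrow> f i \<in> flat_algebra) \<Longrightarrow> (\<lambda>x. \<Prod>i\<in>I. f i x) \<in> flat_algebra"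
  by (induction I rule: finite_induct) (auto intro: flat_algebra.intros)

text \<open>Each factor is \<open>exp (- (1 / (k * s)))\<close> in the distance \<open>s\<close> to
  a face, so the support stays fixed while the bump tends to the indicator of the open box as
  \<open>k\<close> grows.\<close>

definition box_bump :: "real \<Rightarrow> 'a::euclidean_space \<Rightarrow> 'a \<Rightarrow> 'a \<Rightarrow> real" where
  "box_bump k a d x =
     (\<Prod>b\<in>Basis. flat_exp 0 (k * (x \<bullet> b - a \<bullet> b)) * flat_exp 0 (k * (d \<bullet> b - x \<bullet> b)))"

lemma box_bump_eq_0_iff: "0 < k \<Longrightarrow> box_bump k a d x = 0 \<longleftrightarrow> x \<notin> box a d"
  by (auto simp: box_bump_def flat_exp_def mem_box zero_less_mult_iff not_less not_le) (metis not_le)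

lemma box_bump_nonneg: "0 \<le> box_bump k a d x"
  by (auto simp: box_bump_def intro!: prod_nonneg)

lemma flat_exp_0_le_1: "flat_exp 0 t \<le> 1"
  by (simp add: flat_exp_def)

lemma box_bump_le_1: "box_bump k a d x \<le> 1"
  by (auto simp: box_bump_def intro!: prod_le_1 mult_le_one flat_exp_0_le_1)

lemma box_bump_tendsto:
  "(\<lambda>n. box_bump (real (Suc n)) a d x) \<longlonglongrightarrow> indicator (box a d) x"
proof (cases "x \<in> box a d")
  case True
  have lim: "(\<lambda>n. flat_exp 0 (real (Suc n) * s)) \<longlonglongrightarrow> 1" if "0 < s" for s
  proof -
    have "(\<lambda>n. exp (- (inverse (real (Suc n)) * (1 / s)))) \<longlonglongrightarrow> exp (- (0 * (1 / s)))"
      by (intro tendsto_intros LIMSEQ_inverse_real_of_nat)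
    moreover have "flat_exp 0 (real (Suc n) * s) = exp (- (inverse (real (Suc n)) * (1 / s)))" for n
      using that by (simp add: flat_exp_def divide_simps zero_less_mult_iff del: of_nat_Suc)
    ultimately show ?thesis by simp
  qed
  have "(\<lambda>n. box_bump (real (Suc n)) a d x) \<longlonglongrightarrow> (\<Prod>b\<in>(Basis::'a set). 1 * 1)"
    unfolding box_bump_def
    by (intro tendsto_prod tendsto_mult lim) (use True in \<open>auto simp: mem_box\<close>)
  with True show ?thesis by simp
next
  case False
  then have "box_bump (real (Suc n)) a d x = 0" for n
    by (subst box_bump_eq_0_iff) auto
  with False show ?thesis by simp
qed

lemma test_function_box_bump:
  assumes "0 < k" and "cbox a d \<subseteq> \<Omega>"
  shows "test_function \<Omega> (box_bump k a d)"
proof -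
  have "box_bump k a d =
      (\<lambda>x. \<Prod>b\<in>Basis. flat_exp 0 (x \<bullet> (k *\<^sub>R b) + (- k * (a \<bullet> b))) * flat_exp 0 (x \<bullet> (- k *\<^sub>R b) + k * (d \<bullet> b)))"
    by (auto simp: box_bump_def algebra_simps fun_eq_iff)
  also have "\<dots> \<in> flat_algebra"
    by (intro flat_algebra_prod flat_algebra.intros) auto
  finally have "continuously_differentiable j (box_bump k a d)" for j
    by (rule flat_algebra_smooth)
  moreover have "{x. box_bump k a d x \<noteq> 0} = box a d"
    using assms by (auto simp: box_bump_eq_0_iff)
  moreover have "closure (box a d) \<subseteq> cbox a d"
    by (rule closure_minimal) (auto simp: box_subset_cbox)
  ultimately show ?thesis
    using assms(2) by (auto simp: test_function_def)
qed

section \<open>Translates, supports and bounds of test functions\<close>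

lemma continuously_differentiable_shift:
  "continuously_differentiable k \<phi> \<Longrightarrow> continuously_differentiable k (\<lambda>x. \<phi> (x - v))"
proof (induction k arbitrary: \<phi>)
  case 0
  then show ?case
    by (auto intro!: continuous_on_compose2[of UNIV \<phi>] continuous_intros)
next
  case (Suc k)
  have D: "((\<lambda>x. \<phi> (x - v)) has_derivative frechet_derivative \<phi> (at (x - v))) (at x)" for x
  proof -
    have "(\<phi> has_derivative frechet_derivative \<phi> (at (x - v))) (at (x - v))"
      using Suc.prems by (simp add: frechet_derivative_works[symmetric])
    moreover have "((\<lambda>x. x - v) has_derivative (\<lambda>h. h)) (at x)"
      by (auto intro!: derivative_eq_intros)
    ultimately show ?thesis
      using has_derivative_compose by fastforce
  qed
  then have "frechet_derivative (\<lambda>x. \<phi> (x - v)) (at x) = frechet_derivative \<phi> (at (x - v))" for x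
    using frechet_derivative_at by metis
  moreover have "continuously_differentiable k (\<lambda>x. frechet_derivative \<phi> (at (x - v)) i)"
    if "i \<in> Basis" for i
    using Suc.IH[of "\<lambda>x. frechet_derivative \<phi> (at x) i"] Suc.prems that by simp
  ultimately show ?case
    using D by (auto simp: differentiable_def)
qed

lemma test_function_continuously_differentiable:
  "test_function \<Omega> \<phi> \<Longrightarrow> continuously_differentiable k \<phi>"
  by (simp add: test_function_def)

lemma test_function_has_derivative:
  "test_function \<Omega> \<phi> \<Longrightarrow> (\<phi> has_derivative frechet_derivative \<phi> (at x)) (at x)"
  using test_function_continuously_differentiable[of \<Omega> \<phi> "Suc 0"]
  by (simp add: frechet_derivative_works[symmetric])

lemma test_function_derivative_shift:
  "test_function \<Omega> \<phi> \<Longrightarrow>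
    ((\<lambda>x. \<phi> (x - v)) has_derivative frechet_derivative \<phi> (at (x - v))) (at x)"
proof -
  assume "test_function \<Omega> \<phi>"
  then have "(\<phi> has_derivative frechet_derivative \<phi> (at (x - v))) (at (x - v))"
    by (rule test_function_has_derivative)
  moreover have "((\<lambda>x. x - v) has_derivative (\<lambda>h. h)) (at x)"
    by (auto intro!: derivative_eq_intros)
  ultimately show ?thesis
    using has_derivative_compose by fastforce
qed

lemma frechet_derivative_shift:
  "test_function \<Omega> \<phi> \<Longrightarrow>
    frechet_derivative (\<lambda>x. \<phi> (x - v)) (at x) = frechet_derivative \<phi> (at (x - v))"
  using test_function_derivative_shift frechet_derivative_at by metis

lemma test_function_shift:
  assumes "test_function \<Omega> \<phi>" and "\<And>x. x \<in> closure {x. \<phi> x \<noteq> 0} \<Longrightarrow> x + v \<in> \<Omega>'"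
  shows "test_function \<Omega>' (\<lambda>x. \<phi> (x - v))"
proof -
  have "{x. \<phi> (x - v) \<noteq> 0} = (+) v ` {x. \<phi> x \<noteq> 0}"
    by (auto simp: image_iff algebra_simps) (metis add.commute diff_add_cancel)
  then have "closure {x. \<phi> (x - v) \<noteq> 0} = (+) v ` closure {x. \<phi> x \<noteq> 0}"
    by (simp only: closure_translation)
  moreover have "compact ((+) v ` closure {x. \<phi> x \<noteq> 0})"
    using assms(1) by (intro compact_translation) (simp only: test_function_def)
  ultimately show ?thesis
    using assms by (auto simp: test_function_def continuously_differentiable_shift add.commute
        simp del: compact_closure)
qed

lemma test_function_eq_0: "test_function \<Omega> \<phi> \<Longrightarrow> x \<notin> \<Omega> \<Longrightarrow> \<phi> x = 0"
  using closure_subset[of "{x. \<phi> x \<noteq> 0}"] by (auto simp: test_function_def)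

lemma test_function_derivative_eq_0:
  assumes "test_function \<Omega> \<phi>" and "x \<notin> closure {x. \<phi> x \<noteq> 0}"
  shows "frechet_derivative \<phi> (at x) v = 0"
proof -
  have "((\<lambda>x. 0) has_derivative frechet_derivative \<phi> (at x)) (at x)"
    by (rule has_derivative_transform_within_open[OF test_function_has_derivative[OF assms(1)],
          where s = "- closure {x. \<phi> x \<noteq> 0}"])
      (use assms(2) closure_subset[of "{x. \<phi> x \<noteq> 0}"] in auto)
  then have "frechet_derivative \<phi> (at x) = (\<lambda>h. 0)"
    using has_derivative_unique[of "\<lambda>x. 0" _ x "\<lambda>h. 0"] by auto
  then show ?thesis by simp
qed

lemma test_function_continuous: "test_function \<Omega> \<phi> \<Longrightarrow> continuous_on UNIV \<phi>"
  using test_function_continuously_differentiable[of \<Omega> \<phi> 0] by simp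

lemma test_function_derivative_sum:
  fixes \<phi> :: "'a::euclidean_space \<Rightarrow> real"
  assumes "test_function \<Omega> \<phi>"
  shows "frechet_derivative \<phi> (at x) v = (\<Sum>i\<in>Basis. (v \<bullet> i) * frechet_derivative \<phi> (at x) i)"
proof -
  have lin: "linear (frechet_derivative \<phi> (at x))"
    using test_function_has_derivative[OF assms] by (rule has_derivative_linear)
  have "frechet_derivative \<phi> (at x) v = frechet_derivative \<phi> (at x) (\<Sum>i\<in>Basis. (v \<bullet> i) *\<^sub>R i)"
    by (simp add: euclidean_representation)
  also have "\<dots> = (\<Sum>i\<in>Basis. (v \<bullet> i) * frechet_derivative \<phi> (at x) i)"
    using lin by (simp add: linear_sum linear_cmul)
  finally show ?thesis .
qed

lemma test_function_derivative_continuous: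
  fixes \<phi> :: "'a::euclidean_space \<Rightarrow> real"
  assumes "test_function \<Omega> \<phi>"
  shows "continuous_on UNIV (\<lambda>x. frechet_derivative \<phi> (at x) v)"
proof -
  have "continuous_on UNIV (\<lambda>x. frechet_derivative \<phi> (at x) i)" if "i \<in> Basis" for i
    using test_function_continuously_differentiable[OF assms, of "Suc 0"] that by simp
  then have "continuous_on UNIV (\<lambda>x. \<Sum>i\<in>Basis. (v \<bullet> i) * frechet_derivative \<phi> (at x) i)"
    by (intro continuous_intros) auto
  then show ?thesis
    by (subst test_function_derivative_sum[OF assms])
qed

lemma bounded_if_continuous_compact_support:
  fixes g :: "'a::euclidean_space \<Rightarrow> real"
  assumes "continuous_on UNIV g" "compact K" "\<And>x. x \<notin> K \<Longrightarrow> g x = 0"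
  obtains B where "0 \<le> B" "\<And>x. \<bar>g x\<bar> \<le> B"
proof -
  have "compact (g ` K)"
    using assms by (auto intro!: compact_continuous_image continuous_on_subset[OF assms(1)])
  then obtain B where "\<And>y. y \<in> g ` K \<Longrightarrow> norm y \<le> B"
    using compact_imp_bounded bounded_iff by metis
  then have "\<bar>g x\<bar> \<le> max B 0" for x
    using assms(3)[of x] by (cases "x \<in> K") (force simp: max_def)+
  then show ?thesis
    by (intro that[of "max B 0"]) auto
qed

lemma test_function_bounded:
  assumes "test_function \<Omega> \<phi>"
  obtains B where "0 \<le> B" "\<And>x. \<bar>\<phi> x\<bar> \<le> B"
proof -
  have "compact (closure {x. \<phi> x \<noteq> 0})"
    using assms by (simp only: test_function_def)
  moreover have "\<phi> x = 0" if "x \<notin> closure {x. \<phi> x \<noteq> 0}" for x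
    using that closure_subset[of "{x. \<phi> x \<noteq> 0}"] by auto
  ultimately show ?thesis
    using bounded_if_continuous_compact_support[OF test_function_continuous[OF assms]] that by metis
qed

lemma test_function_derivative_bounded:
  assumes "test_function \<Omega> \<phi>"
  obtains B where "0 \<le> B" "\<And>x. \<bar>frechet_derivative \<phi> (at x) v\<bar> \<le> B"
proof -
  have "compact (closure {x. \<phi> x \<noteq> 0})"
    using assms by (simp only: test_function_def)
  then show ?thesis
    using bounded_if_continuous_compact_support[OF test_function_derivative_continuous[OF assms]]
      test_function_derivative_eq_0[OF assms] that by metis
qed

lemma test_function_measurable [measurable (raw)]:
  "test_function \<Omega> \<phi> \<Longrightarrow> \<phi> \<in> borel_measurable borel"
  by (intro borel_measurable_continuous_onI test_function_continuous)

lemma test_function_derivative_measurable: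
  "test_function \<Omega> \<phi> \<Longrightarrow> (\<lambda>x. frechet_derivative \<phi> (at x) v) \<in> borel_measurable borel"
  by (intro borel_measurable_continuous_onI test_function_derivative_continuous)

section \<open>Translation invariance of Lebesgue integrals\<close>

lemma nn_integral_lborel_shift:
  fixes f :: "'a::euclidean_space \<Rightarrow> ennreal"
  assumes [measurable]: "f \<in> borel_measurable borel"
  shows "(\<integral>\<^sup>+x. f (x + c) \<partial>lborel) = (\<integral>\<^sup>+x. f x \<partial>lborel)"
proof -
  have "(\<integral>\<^sup>+x. f x \<partial>lborel) = (\<integral>\<^sup>+x. f x \<partial>distr lborel borel ((+) c))"
    by (simp add: lborel_distr_plus)
  also have "\<dots> = (\<integral>\<^sup>+x. f (x + c) \<partial>lborel)"
    by (subst nn_integral_distr) (auto simp: add.commute)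
  finally show ?thesis by simp
qed

lemma integral_lborel_shift:
  fixes f :: "'a::euclidean_space \<Rightarrow> 'b::{banach, second_countable_topology}"
  assumes [measurable]: "f \<in> borel_measurable borel"
  shows "(\<integral>x. f (x + c) \<partial>lborel) = (\<integral>x. f x \<partial>lborel)"
proof -
  have "(\<integral>x. f x \<partial>lborel) = (\<integral>x. f x \<partial>distr lborel borel ((+) c))"
    by (simp add: lborel_distr_plus)
  also have "\<dots> = (\<integral>x. f (x + c) \<partial>lborel)"
    by (subst integral_distr) (auto simp: add.commute)
  finally show ?thesis by simp
qed

lemma integrable_lborel_shift:
  fixes f :: "'a::euclidean_space \<Rightarrow> 'b::{banach, second_countable_topology}"
  assumes "integrable lborel f"
  shows "integrable lborel (\<lambda>x. f (x + c))"
proof -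
  have [measurable]: "f \<in> borel_measurable borel"
    using assms by auto
  have "integrable (distr lborel borel ((+) c)) f"
    using assms by (simp add: lborel_distr_plus)
  then have "integrable lborel (\<lambda>x. f (c + x))"
    by (subst (asm) integrable_distr_eq) auto
  then show ?thesis by (simp add: add.commute)
qed

subsection \<open>The fundamental lemma\<close>

text \<open>Positive and negative part of \<open>g\<close> are densities of two finite measures.
  These agree on open boxes, a generator stable under intersections, hence everywhere, and densities
  of finite measures are unique almost everywhere.\<close>

lemma AE_eq_0_if_box_integrals_0:
  fixes g :: "'a::euclidean_space \<Rightarrow> real"
  assumes g: "integrable lborel g"
    and 0: "\<And>a b. (\<integral>x. indicator (box a b) x * g x \<partial>lborel) = 0"
  shows "AE x in lborel. g x = 0"
proof -
  have [measurable]: "g \<in> borel_measurable borel"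
    using g by auto
  let ?p = "\<lambda>x. ennreal (g x)" and ?n = "\<lambda>x. ennreal (- g x)"
  have fin: "(\<integral>\<^sup>+x. ?p x \<partial>lborel) \<noteq> \<infinity>" "(\<integral>\<^sup>+x. ?n x \<partial>lborel) \<noteq> \<infinity>"
    using g by (auto simp: real_integrable_def)
  have box: "emeasure (density lborel ?p) (box a b) = emeasure (density lborel ?n) (box a b)" for a b
  proof -
    have i: "integrable lborel (\<lambda>x. indicator (box a b) x * g x)"
      using integrable_mult_indicator[OF _ g, of "box a b"] by (simp add: mult.commute)
    have "emeasure (density lborel ?p) (box a b) = (\<integral>\<^sup>+x. ennreal (indicator (box a b) x * g x) \<partial>lborel)"
      by (subst emeasure_density) (auto intro!: nn_integral_cong split: split_indicator)
    moreover have "emeasure (density lborel ?n) (box a b) = (\<integral>\<^sup>+x. ennreal (- (indicator (box a b) x * g x)) \<partial>lborel)"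
      by (subst emeasure_density) (auto intro!: nn_integral_cong split: split_indicator)
    moreover have "(\<integral>\<^sup>+x. ennreal (indicator (box a b) x * g x) \<partial>lborel) \<noteq> \<infinity>"
      "(\<integral>\<^sup>+x. ennreal (- (indicator (box a b) x * g x)) \<partial>lborel) \<noteq> \<infinity>"
      using i by (auto simp: real_integrable_def)
    ultimately show ?thesis
      using real_lebesgue_integral_def[OF i] 0[of a b]
      by (metis enn2real_positive_iff ennreal_enn2real_if eq_iff_diff_eq_0 infinity_ennreal_def)
  qed
  have "density lborel ?p = density lborel ?n"
  proof (rule measure_eqI_generator_eq[where E = "range (\<lambda>(a, b). box a b)" and \<Omega> = UNIV
        and A = "\<lambda>i. box (- (real i *\<^sub>R One)) (real i *\<^sub>R One)"])
    show "Int_stable (range (\<lambda>(a, b). box a b :: 'a set))"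
      by (auto simp: Int_stable_def box_Int_box)
    show "emeasure (density lborel ?p) X = emeasure (density lborel ?n) X"
      if "X \<in> range (\<lambda>(a, b). box a b)" for X
      using that box by auto
    show "emeasure (density lborel ?p) (box (- (real i *\<^sub>R One)) (real i *\<^sub>R One)) \<noteq> \<infinity>" for i
    proof -
      have "emeasure (density lborel ?p) (box (- (real i *\<^sub>R One)) (real i *\<^sub>R One)) \<le> (\<integral>\<^sup>+x. ?p x \<partial>lborel)"
        by (subst emeasure_density) (auto intro!: nn_integral_mono split: split_indicator)
      then show ?thesis
        using fin by (auto simp: top_unique)
    qed
  qed (auto simp: borel_eq_box UN_box_eq_UNIV)
  then have "AE x in lborel. ?p x = ?n x"
    using finite_density_unique[of ?p lborel ?n] fin by auto
  then show ?thesis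
    by eventually_elim (smt (verit) ennreal_eq_0_iff ennreal_inj ennreal_neg)
qed

text \<open>The bumps converge boundedly to indicators of boxes, so vanishing against test functions
  becomes vanishing of integrals over boxes.\<close>

lemma fundamental_lemma_box:
  fixes h :: "'a::euclidean_space \<Rightarrow> real"
  assumes h: "integrable lborel (\<lambda>x. indicator (cbox a d) x * h x)"
    and 0: "\<And>\<phi>. test_function (cbox a d) \<phi> \<Longrightarrow> (\<integral>x. h x * \<phi> x \<partial>lborel) = 0"
  shows "AE x in lborel. x \<in> box a d \<longrightarrow> h x = 0"
proof -
  let ?g = "\<lambda>x. indicator (box a d) x * h x"
  let ?h = "\<lambda>x. indicator (cbox a d) x * h x"
  have [measurable]: "?h \<in> borel_measurable borel"
    using h by auto
  have "?g = (\<lambda>x. indicator (box a d) x * ?h x)"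
    using box_subset_cbox[of a d] by (auto simp: fun_eq_iff split: split_indicator)
  then have g: "integrable lborel ?g"
    using integrable_mult_indicator[OF _ h, of "box a d"] by (simp add: mult.commute)
  have "AE x in lborel. ?g x = 0"
  proof (rule AE_eq_0_if_box_integrals_0[OF g])
    fix c e :: 'a
    \<comment> \<open>Cutting with \<open>box a d\<close> gives a box whose closure, unless empty,
      lies in \<open>cbox a d\<close>, so that the bumps on it are admissible test
      functions.\<close>
    obtain c' e' where eq: "box a d \<inter> box c e = box c' e'"
      by (simp add: box_Int_box)
    show "(\<integral>x. indicator (box c e) x * ?g x \<partial>lborel) = 0"
    proof (cases "box c' e' = {}")
      case True
      have "(\<integral>x. indicator (box c e) x * ?g x \<partial>lborel) = integral\<^sup>L (lborel :: 'a measure) (\<lambda>x. 0)"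
        by (rule Bochner_Integration.integral_cong) (use True eq in \<open>auto split: split_indicator\<close>)
      then show ?thesis by simp
    next
      case False
      then have "cbox c' e' \<subseteq> cbox a d"
        using eq by (metis Int_lower1 box_subset_cbox closure_box closure_cbox closure_mono order_trans)
      let ?b = "\<lambda>n. box_bump (real (Suc n)) c' e'"
      have t: "test_function (cbox a d) (?b n)" for n
        using \<open>cbox c' e' \<subseteq> cbox a d\<close> by (intro test_function_box_bump) auto
      have "(\<lambda>n. \<integral>x. ?h x * ?b n x \<partial>lborel) \<longlonglongrightarrow> (\<integral>x. ?h x * indicator (box c' e') x \<partial>lborel)"
      proof (rule integral_dominated_convergence[where w = "\<lambda>x. \<bar>?h x\<bar>"])
        show "integrable lborel (\<lambda>x. \<bar>?h x\<bar>)" using h by (rule integrable_abs)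
        show "AE x in lborel. (\<lambda>n. ?h x * ?b n x) \<longlonglongrightarrow> ?h x * indicator (box c' e') x"
          by (intro AE_I2 tendsto_mult tendsto_const box_bump_tendsto)
        show "AE x in lborel. norm (?h x * ?b n x) \<le> \<bar>?h x\<bar>" for n
          by (intro AE_I2) (simp add: abs_mult mult_left_le box_bump_le_1 box_bump_nonneg)
        show "(\<lambda>x. ?h x * ?b n x) \<in> borel_measurable lborel" for n
          using test_function_measurable[OF t[of n]] by measurable
      qed auto
      moreover have "(\<integral>x. ?h x * ?b n x \<partial>lborel) = 0" for n
      proof -
        have eq: "(\<lambda>x. ?h x * ?b n x) = (\<lambda>x. h x * ?b n x)"
          using test_function_eq_0[OF t] by (auto simp: fun_eq_iff split: split_indicator)
        show ?thesis unfolding eq by (rule 0[OF t])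
      qed
      ultimately have "(\<lambda>n::nat. 0) \<longlonglongrightarrow> (\<integral>x. ?h x * indicator (box c' e') x \<partial>lborel)"
        by (simp only:)
      then have "(\<integral>x. ?h x * indicator (box c' e') x \<partial>lborel) = 0"
        using LIMSEQ_const_iff by metis
      moreover have "(\<lambda>x. ?h x * indicator (box c' e') x) = (\<lambda>x. indicator (box c e) x * ?g x)"
        unfolding eq[symmetric] using box_subset_cbox[of a d]
        by (auto simp: fun_eq_iff split: split_indicator)
      ultimately show ?thesis by (simp only:)
    qed
  qed
  then show ?thesis
    by eventually_elim (auto split: split_indicator_asm)
qed

text \<open>By Lindelof countably many boxes with closure in \<open>\<Omega>\<close> cover
  \<open>\<Omega>\<close>, so the exceptional null sets can be united.\<close>

lemma fundamental_lemma:
  fixes h :: "'a::euclidean_space \<Rightarrow> real"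
  assumes "open \<Omega>"
    and h: "\<And>a d. cbox a d \<subseteq> \<Omega> \<Longrightarrow> integrable lborel (\<lambda>x. indicator (cbox a d) x * h x)"
    and 0: "\<And>\<phi>. test_function \<Omega> \<phi> \<Longrightarrow> (\<integral>x. h x * \<phi> x \<partial>lborel) = 0"
  shows "AE x in lborel. x \<in> \<Omega> \<longrightarrow> h x = 0"
proof -
  let ?F = "{box a d | a d. cbox a d \<subseteq> \<Omega>}"
  obtain F' where F': "F' \<subseteq> ?F" "countable F'" "\<Union>F' = \<Union>?F"
    by (rule Lindelof[of ?F]) auto
  have "\<Omega> \<subseteq> \<Union>?F"
    using open_contains_cbox[OF assms(1)] by (smt (verit) UnionI mem_Collect_eq subsetI)
  have "AE x in lborel. \<forall>B\<in>F'. x \<in> B \<longrightarrow> h x = 0"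
  proof (rule AE_ball_countable'[OF _ F'(2)])
    fix B assume "B \<in> F'"
    then obtain a d where B: "B = box a d" "cbox a d \<subseteq> \<Omega>"
      using F'(1) by blast
    have "test_function \<Omega> \<phi>" if "test_function (cbox a d) \<phi>" for \<phi>
      using that B by (auto simp: test_function_def)
    then show "AE x in lborel. x \<in> B \<longrightarrow> h x = 0"
      unfolding B using h[OF B(2)] 0 by (intro fundamental_lemma_box) auto
  qed
  then show ?thesis
  proof eventually_elim
    case (elim x)
    have "\<Omega> \<subseteq> \<Union>F'"
      using \<open>\<Omega> \<subseteq> \<Union>?F\<close> by (simp only: F'(3))
    with elim show ?case by blast
  qed
qed

subsection \<open>Weak gradients on segments\<close>

text \<open>The weak gradient relation for globally integrable functions that are Borel on the whole
  space; their values outside \<open>\<Omega>\<close> are irrelevant because test functions vanish there.\<close>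

definition weak_grad :: "'a::euclidean_space set \<Rightarrow> ('a \<Rightarrow> real) \<Rightarrow> ('a \<Rightarrow> 'a) \<Rightarrow> bool" where
  "weak_grad \<Omega> u G \<longleftrightarrow> integrable lborel u \<and> integrable lborel G \<and>
     (\<forall>\<phi> v. test_function \<Omega> \<phi> \<longrightarrow>
        (\<integral>x. u x * frechet_derivative \<phi> (at x) v \<partial>lborel) = - (\<integral>x. (G x \<bullet> v) * \<phi> x \<partial>lborel))"

text \<open>The complement is the sum of the closed set \<open>- \<Omega>\<close> and a compact
  segment, hence closed.\<close>

lemma open_segment_shift_set:
  fixes v :: "'a::euclidean_space"
  assumes "open \<Omega>"
  shows "open {x. \<forall>t\<in>{0..1}. x + t *\<^sub>R v \<in> \<Omega>}"
proof -
  have "closed (\<Union>x\<in>-\<Omega>. \<Union>y\<in>(\<lambda>t. - (t *\<^sub>R v)) ` {0..1::real}. {x + y})"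
    by (intro closed_compact_sums compact_continuous_image continuous_intros) (use assms in auto)
  moreover have "(\<Union>x\<in>-\<Omega>. \<Union>y\<in>(\<lambda>t. - (t *\<^sub>R v)) ` {0..1::real}. {x + y}) =
      - {x. \<forall>t\<in>{0..1}. x + t *\<^sub>R v \<in> \<Omega>}"
  proof (intro set_eqI iffI)
    fix x assume "x \<in> - {x. \<forall>t\<in>{0..1}. x + t *\<^sub>R v \<in> \<Omega>}"
    then obtain t where "t \<in> {0..1}" "x + t *\<^sub>R v \<notin> \<Omega>" by auto
    moreover have "x = (x + t *\<^sub>R v) + - (t *\<^sub>R v)" by simp
    ultimately show "x \<in> (\<Union>x\<in>-\<Omega>. \<Union>y\<in>(\<lambda>t. - (t *\<^sub>R v)) ` {0..1::real}. {x + y})"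
      by blast
  qed force
  ultimately show ?thesis
    by (simp only: closed_def double_complement)
qed

lemma lborel_pair_sigma_finite:
  "pair_sigma_finite (lborel :: 'a::euclidean_space measure) (lborel :: 'b::euclidean_space measure)"
  by (simp add: pair_sigma_finite_def sigma_finite_lborel)

text \<open>L1 bounds on the slices that are uniform over a parameter interval of length 1 give
  joint integrability, as Fubini requires.\<close>

lemma integrable_unit_interval_prod:
  fixes f :: "real \<Rightarrow> 'a::euclidean_space \<Rightarrow> real"
  assumes [measurable]: "case_prod f \<in> borel_measurable (lborel \<Otimes>\<^sub>M lborel)"
    and i: "\<And>t. integrable lborel (f t)"
    and 0: "\<And>t x. t \<notin> {0..1} \<Longrightarrow> f t x = 0"
    and C: "\<And>t. t \<in> {0..1} \<Longrightarrow> (\<integral>x. \<bar>f t x\<bar> \<partial>lborel) \<le> C"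
  shows "integrable (lborel \<Otimes>\<^sub>M lborel) (case_prod f)"
proof -
  note psf = lborel_pair_sigma_finite[where 'a = real and 'b = 'a]
  show ?thesis
  proof (rule pair_sigma_finite.Fubini_integrable[OF psf])
    show "integrable lborel (\<lambda>t. \<integral>x. norm (case_prod f (t, x)) \<partial>lborel)"
    proof (rule Bochner_Integration.integrable_bound)
      show "integrable lborel (\<lambda>t. indicator {0..1::real} t * C)"
        by simp
      show "AE t in lborel. norm (\<integral>x. norm (case_prod f (t, x)) \<partial>lborel) \<le> norm (indicator {0..1} t * C)"
      proof (rule AE_I2)
        fix t :: real
        show "norm (\<integral>x. norm (case_prod f (t, x)) \<partial>lborel) \<le> norm (indicator {0..1} t * C)"
          using 0 C[of t] by (cases "t \<in> {0..1}") auto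
      qed
    qed (use assms in measurable)
  qed (use i in \<open>auto intro!: assms(1)\<close>)
qed

lemma integral_unit_interval_test_derivative:
  assumes "test_function \<Omega> \<phi>"
  shows "(\<integral>t. indicator {0..1} t * frechet_derivative \<phi> (at (x - t *\<^sub>R v)) v \<partial>lborel) = \<phi> x - \<phi> (x - v)"
proof -
  let ?F = "\<lambda>t. - \<phi> (x - t *\<^sub>R v)"
  have lin: "linear (frechet_derivative \<phi> (at y))" for y
    using test_function_has_derivative[OF assms] by (rule has_derivative_linear)
  have "(\<integral>t. frechet_derivative \<phi> (at (x - t *\<^sub>R v)) v * indicator {0..1} t \<partial>lborel) = ?F 1 - ?F 0"
  proof (rule integral_FTC_Icc_real)
    fix t :: real
    have "((\<lambda>t. x - t *\<^sub>R v) has_derivative (\<lambda>s. - (s *\<^sub>R v))) (at t)"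
      by (auto intro!: derivative_eq_intros)
    from has_derivative_compose[OF this test_function_has_derivative[OF assms]]
    have "((\<lambda>t. \<phi> (x - t *\<^sub>R v)) has_derivative (\<lambda>s. frechet_derivative \<phi> (at (x - t *\<^sub>R v)) (- (s *\<^sub>R v)))) (at t)" .
    then have "(?F has_derivative (\<lambda>s. - frechet_derivative \<phi> (at (x - t *\<^sub>R v)) (- (s *\<^sub>R v)))) (at t)"
      by (rule has_derivative_minus)
    moreover have "(\<lambda>s. - frechet_derivative \<phi> (at (x - t *\<^sub>R v)) (- (s *\<^sub>R v))) =
        (*) (frechet_derivative \<phi> (at (x - t *\<^sub>R v)) v)"
      using lin by (auto simp: linear_neg linear_cmul fun_eq_iff)
    ultimately show "DERIV ?F t :> frechet_derivative \<phi> (at (x - t *\<^sub>R v)) v"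
      by (simp add: has_field_derivative_def)
    show "isCont (\<lambda>t. frechet_derivative \<phi> (at (x - t *\<^sub>R v)) v) t"
      using continuous_on_compose2[OF test_function_derivative_continuous[OF assms, of v],
          of UNIV "\<lambda>t. x - t *\<^sub>R v"]
      by (auto simp: continuous_on_eq_continuous_at intro!: continuous_intros)
  qed simp
  then show ?thesis
    by (simp add: mult.commute)
qed

lemma integrable_mult_bounded:
  fixes f g :: "'a \<Rightarrow> real"
  assumes "integrable M f" "g \<in> borel_measurable M" "\<And>x. \<bar>g x\<bar> \<le> B"
  shows "integrable M (\<lambda>x. f x * g x)"
proof (rule Bochner_Integration.integrable_bound)
  show "integrable M (\<lambda>x. B * f x)" using assms(1) by simp
  show "(\<lambda>x. f x * g x) \<in> borel_measurable M" using assms by measurable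
  have "0 \<le> B" using assms(3) abs_ge_zero order_trans by blast
  then show "AE x in M. norm (f x * g x) \<le> norm (B * f x)"
    using assms(3) by (auto simp: abs_mult mult.commute[of B] intro!: mult_left_mono)
qed

lemma integrable_segment_prod:
  fixes G :: "'a::euclidean_space \<Rightarrow> 'a"
  assumes G: "integrable lborel G"
  shows "integrable (lborel \<Otimes>\<^sub>M lborel) (\<lambda>(t, x). indicator {0..1::real} t * (G (x + t *\<^sub>R v) \<bullet> v))"
proof (rule integrable_unit_interval_prod)
  have [measurable]: "G \<in> borel_measurable borel" using G by auto
  show "(\<lambda>(t, x). indicator {0..1::real} t * (G (x + t *\<^sub>R v) \<bullet> v)) \<in> borel_measurable (lborel \<Otimes>\<^sub>M lborel)"
    by measurable
  fix t :: real
  show "integrable lborel (\<lambda>x. indicator {0..1} t * (G (x + t *\<^sub>R v) \<bullet> v))"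
    using integrable_lborel_shift[OF G, of "t *\<^sub>R v"] by simp
  assume "t \<in> {0..1}"
  then show "(\<integral>x. \<bar>indicator {0..1} t * (G (x + t *\<^sub>R v) \<bullet> v)\<bar> \<partial>lborel) \<le> (\<integral>x. \<bar>G x \<bullet> v\<bar> \<partial>lborel)"
    by (simp add: abs_mult integral_lborel_shift[of "\<lambda>x. \<bar>G x \<bullet> v\<bar>" "t *\<^sub>R v"])
qed auto

text \<open>For each \<open>t\<close> in the unit interval the weak relation is tested with the
  translate of \<open>\<phi>\<close> by \<open>t *\<^sub>R v\<close>. Integrated in
  \<open>t\<close>, the directional derivatives of the translates collapse to a difference of two
  values of \<open>\<phi>\<close>, and a translation of the variable turns it into a difference of
  values of \<open>u\<close>. The fundamental lemma then removes \<open>\<phi>\<close>.\<close>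

lemma weak_grad_segment:
  fixes v :: "'a::euclidean_space"
  assumes "open \<Omega>" and wg: "weak_grad \<Omega> u G"
  shows "AE x in lborel. (\<forall>t\<in>{0..1}. x + t *\<^sub>R v \<in> \<Omega>) \<longrightarrow>
    u (x + v) - u x = (\<integral>t. indicator {0..1} t * (G (x + t *\<^sub>R v) \<bullet> v) \<partial>lborel)"
proof -
  note psf = lborel_pair_sigma_finite[where 'a = real and 'b = 'a]
  have u: "integrable lborel u" and G: "integrable lborel G"
    using wg by (auto simp: weak_grad_def)
  then have [measurable]: "u \<in> borel_measurable borel" "G \<in> borel_measurable borel" by auto
  \<comment> \<open>The fundamental lemma is applied on this set rather than on
    \<open>\<Omega>\<close>: if a test function is supported in it, all translates used below are
    supported in \<open>\<Omega>\<close>.\<close>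
  define O' where "O' = {x. \<forall>t\<in>{0..1}. x + t *\<^sub>R v \<in> \<Omega>}"
  define g where "g = (\<lambda>t x. indicator {0..1::real} t * (G (x + t *\<^sub>R v) \<bullet> v))"
  define S where "S x = (\<integral>t. g t x \<partial>lborel)" for x
  have g: "integrable (lborel \<Otimes>\<^sub>M lborel) (case_prod g)"
    unfolding g_def by (rule integrable_segment_prod[OF G])
  have S: "integrable lborel S"
    unfolding S_def using pair_sigma_finite.integrable_snd[OF psf, of "\<lambda>t x. g t x"] g by simp
  define H where "H x = u (x + v) - u x - S x" for x
  have H: "integrable lborel H"
    unfolding H_def using integrable_lborel_shift[OF u] u S by auto
  then have [measurable]: "H \<in> borel_measurable borel" "S \<in> borel_measurable borel"
    using S by auto
  have "AE x in lborel. x \<in> O' \<longrightarrow> H x = 0"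
  proof (rule fundamental_lemma)
    show "open O'"
      unfolding O'_def by (rule open_segment_shift_set[OF assms(1)])
    show "integrable lborel (\<lambda>x. indicator (cbox a d) x * H x)" for a d
      using integrable_mult_indicator[OF _ H, of "cbox a d"] by (simp add: mult.commute)
    fix \<phi> :: "'a \<Rightarrow> real" assume \<phi>: "test_function O' \<phi>"
    obtain B where B: "\<And>x. \<bar>\<phi> x\<bar> \<le> B" using test_function_bounded[OF \<phi>] by metis
    let ?D = "\<lambda>x. frechet_derivative \<phi> (at x) v"
    obtain B' where B': "\<And>x. \<bar>?D x\<bar> \<le> B'" using test_function_derivative_bounded[OF \<phi>, of v] by metis
    have [measurable]: "\<phi> \<in> borel_measurable borel" "?D \<in> borel_measurable borel"
      using \<phi> by (auto intro: test_function_measurable test_function_derivative_measurable)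
    have shift: "test_function \<Omega> (\<lambda>x. \<phi> (x - t *\<^sub>R v))" if "t \<in> {0..1}" for t
      using \<phi> that by (intro test_function_shift[OF \<phi>]) (auto simp: test_function_def O'_def)
    have int_shift: "integrable lborel (\<lambda>x. u (x + v) * \<phi> x)" "integrable lborel (\<lambda>x. u x * \<phi> x)"
      "integrable lborel (\<lambda>x. S x * \<phi> x)" "integrable lborel (\<lambda>x. u x * \<phi> (x - v))"
      using B by (auto intro!: integrable_mult_bounded[where B = B] integrable_lborel_shift u S)
    have "(\<integral>x. S x * \<phi> x \<partial>lborel) = (\<integral>x. (\<integral>t. g t x * \<phi> x \<partial>lborel) \<partial>lborel)"
      unfolding S_def by (intro Bochner_Integration.integral_cong) auto
    also have "\<dots> = (\<integral>t. (\<integral>x. g t x * \<phi> x \<partial>lborel) \<partial>lborel)"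
    proof (rule pair_sigma_finite.Fubini_integral[OF psf])
      have "integrable (lborel \<Otimes>\<^sub>M lborel) (\<lambda>z. case_prod g z * \<phi> (snd z))"
        using B by (intro integrable_mult_bounded[OF g, of _ B]) auto
      then show "integrable (lborel \<Otimes>\<^sub>M lborel) (\<lambda>(t, x). g t x * \<phi> x)"
        by (simp add: case_prod_beta')
    qed
    also have "\<dots> = (\<integral>t. (\<integral>x. - (indicator {0..1} t * (u x * ?D (x - t *\<^sub>R v))) \<partial>lborel) \<partial>lborel)"
    proof (rule Bochner_Integration.integral_cong[OF refl])
      fix t :: real
      show "(\<integral>x. g t x * \<phi> x \<partial>lborel) = (\<integral>x. - (indicator {0..1} t * (u x * ?D (x - t *\<^sub>R v))) \<partial>lborel)"
      proof (cases "t \<in> {0..1}")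
        case True
        have "(\<integral>x. g t x * \<phi> x \<partial>lborel) = (\<integral>x. (G (x + t *\<^sub>R v) \<bullet> v) * \<phi> (x + t *\<^sub>R v - t *\<^sub>R v) \<partial>lborel)"
          using True by (simp add: g_def)
        also have "\<dots> = (\<integral>x. (G x \<bullet> v) * \<phi> (x - t *\<^sub>R v) \<partial>lborel)"
          by (rule integral_lborel_shift[of "\<lambda>x. (G x \<bullet> v) * \<phi> (x - t *\<^sub>R v)"]) simp
        also have "\<dots> = - (\<integral>x. u x * frechet_derivative (\<lambda>x. \<phi> (x - t *\<^sub>R v)) (at x) v \<partial>lborel)"
          using wg shift[OF True] by (auto simp: weak_grad_def)
        also have "\<dots> = - (\<integral>x. u x * ?D (x - t *\<^sub>R v) \<partial>lborel)"
          by (simp add: frechet_derivative_shift[OF \<phi>])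
        finally show ?thesis
          using True by simp
      qed (auto simp: g_def)
    qed
    also have "\<dots> = (\<integral>x. (\<integral>t. - (indicator {0..1} t * (u x * ?D (x - t *\<^sub>R v))) \<partial>lborel) \<partial>lborel)"
    proof (rule pair_sigma_finite.Fubini_integral[OF psf, symmetric], rule integrable_unit_interval_prod)
      fix t :: real
      show i: "integrable lborel (\<lambda>x. - (indicator {0..1} t * (u x * ?D (x - t *\<^sub>R v))))"
        using B' by (auto intro!: integrable_mult_bounded[OF u, where B = B'])
      assume "t \<in> {0..1}"
      have "(\<integral>x. \<bar>- (indicator {0..1} t * (u x * ?D (x - t *\<^sub>R v)))\<bar> \<partial>lborel) \<le> (\<integral>x. \<bar>u x\<bar> * B' \<partial>lborel)"
      proof (rule integral_mono)
        fix x
        show "\<bar>- (indicator {0..1} t * (u x * ?D (x - t *\<^sub>R v)))\<bar> \<le> \<bar>u x\<bar> * B'"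
          using B'[of "x - t *\<^sub>R v"] order_trans[OF abs_ge_zero B'[of 0]]
          by (auto simp: abs_mult intro!: mult_left_mono split: split_indicator)
      qed (use integrable_abs[OF i] u in auto)
      then show "(\<integral>x. \<bar>- (indicator {0..1} t * (u x * ?D (x - t *\<^sub>R v)))\<bar> \<partial>lborel) \<le> (\<integral>x. \<bar>u x\<bar> * B' \<partial>lborel)" .
    qed auto
    also have "\<dots> = (\<integral>x. u x * \<phi> (x - v) - u x * \<phi> x \<partial>lborel)"
    proof (rule Bochner_Integration.integral_cong[OF refl])
      fix x
      have "(\<integral>t. - (indicator {0..1} t * (u x * ?D (x - t *\<^sub>R v))) \<partial>lborel) =
          - (u x * (\<integral>t. indicator {0..1} t * ?D (x - t *\<^sub>R v) \<partial>lborel))"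
        by (simp add: mult.left_commute)
      then show "(\<integral>t. - (indicator {0..1} t * (u x * ?D (x - t *\<^sub>R v))) \<partial>lborel) = u x * \<phi> (x - v) - u x * \<phi> x"
        unfolding integral_unit_interval_test_derivative[OF \<phi>] by (simp add: algebra_simps)
    qed
    also have "\<dots> = (\<integral>x. u x * \<phi> (x - v) \<partial>lborel) - (\<integral>x. u x * \<phi> x \<partial>lborel)"
      using int_shift by simp
    also have "(\<integral>x. u x * \<phi> (x - v) \<partial>lborel) = (\<integral>x. u (x + v) * \<phi> x \<partial>lborel)"
      using integral_lborel_shift[of "\<lambda>x. u x * \<phi> (x - v)" v] by simp
    finally show "(\<integral>x. H x * \<phi> x \<partial>lborel) = 0"
      using int_shift by (simp add: H_def left_diff_distrib)
  qed
  then show ?thesis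
    by eventually_elim (auto simp: H_def S_def g_def O'_def)
qed

subsection \<open>Difference quotients\<close>

definition translation_continuous_L1 :: "('a::euclidean_space \<Rightarrow> real) \<Rightarrow> bool" where
  "translation_continuous_L1 f \<longleftrightarrow>
     (\<forall>e>0. \<exists>d>0. \<forall>h. norm h < d \<longrightarrow> (\<integral>x. \<bar>f (x + h) - f x\<bar> \<partial>lborel) < e)"

text \<open>Three-term splitting through \<open>s i\<close>. The bound by
  \<open>2 * \<bar>f x\<bar>\<close> is the one supplied by the induction principle for integrable
  functions; it dominates \<open>s i x - f x\<close> by \<open>3 * \<bar>f x\<bar>\<close>.\<close>

lemma translation_continuous_L1_limit:
  fixes f :: "'a::euclidean_space \<Rightarrow> real"
  assumes s: "\<And>i. integrable lborel (s i)" "\<And>i. translation_continuous_L1 (s i)"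
    and f: "integrable lborel f"
    and lim: "\<And>x. (\<lambda>i. s i x) \<longlonglongrightarrow> f x" and dom: "\<And>i x. \<bar>s i x\<bar> \<le> 2 * \<bar>f x\<bar>"
  shows "translation_continuous_L1 f"
  unfolding translation_continuous_L1_def
proof (intro allI impI)
  fix e :: real assume "0 < e"
  have meas[measurable]: "f \<in> borel_measurable borel" "\<And>i. s i \<in> borel_measurable borel"
    using f s by auto
  have "(\<lambda>i. \<integral>x. \<bar>s i x - f x\<bar> \<partial>lborel) \<longlonglongrightarrow> (\<integral>x. 0 \<partial>(lborel :: 'a measure))"
  proof (rule integral_dominated_convergence[where w = "\<lambda>x. 3 * \<bar>f x\<bar>"])
    show "AE x in lborel. (\<lambda>i. \<bar>s i x - f x\<bar>) \<longlonglongrightarrow> 0"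
      using lim by (intro AE_I2 tendsto_rabs_zero) (auto intro: LIM_zero)
    show "AE x in lborel. norm \<bar>s i x - f x\<bar> \<le> 3 * \<bar>f x\<bar>" for i
      using dom[of i] by (intro AE_I2) (smt (verit) real_norm_def)
  qed (use f in auto)
  then have "\<forall>\<^sub>F i in sequentially. (\<integral>x. \<bar>s i x - f x\<bar> \<partial>lborel) < e / 3"
    by (rule order_tendstoD(2)) (use \<open>0 < e\<close> in simp)
  then obtain i where i: "(\<integral>x. \<bar>s i x - f x\<bar> \<partial>lborel) < e / 3"
    using eventually_happens'[OF sequentially_bot] by blast
  obtain d where d: "d > 0" "\<And>h. norm h < d \<Longrightarrow> (\<integral>x. \<bar>s i (x + h) - s i x\<bar> \<partial>lborel) < e / 3"
    using s(2)[of i] \<open>0 < e\<close> unfolding translation_continuous_L1_def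
    by (metis zero_less_divide_iff zero_less_numeral)
  have "(\<integral>x. \<bar>f (x + h) - f x\<bar> \<partial>lborel) < e" if h: "norm h < d" for h
  proof -
    have int: "integrable lborel (\<lambda>x. \<bar>s i (x + h) - f (x + h)\<bar>)" "integrable lborel (\<lambda>x. \<bar>s i (x + h) - s i x\<bar>)"
      "integrable lborel (\<lambda>x. \<bar>s i x - f x\<bar>)" "integrable lborel (\<lambda>x. \<bar>f (x + h) - f x\<bar>)"
      using f s(1)[of i] integrable_lborel_shift[OF f, of h] integrable_lborel_shift[OF s(1)[of i], of h] by auto
    have "(\<integral>x. \<bar>f (x + h) - f x\<bar> \<partial>lborel) \<le>
        (\<integral>x. \<bar>s i (x + h) - f (x + h)\<bar> + \<bar>s i (x + h) - s i x\<bar> + \<bar>s i x - f x\<bar> \<partial>lborel)"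
      using int by (intro integral_mono) auto
    also have "\<dots> = (\<integral>x. \<bar>s i (x + h) - f (x + h)\<bar> \<partial>lborel) + (\<integral>x. \<bar>s i (x + h) - s i x\<bar> \<partial>lborel)
        + (\<integral>x. \<bar>s i x - f x\<bar> \<partial>lborel)"
      using int by simp
    also have "(\<integral>x. \<bar>s i (x + h) - f (x + h)\<bar> \<partial>lborel) = (\<integral>x. \<bar>s i x - f x\<bar> \<partial>lborel)"
      by (rule integral_lborel_shift[of "\<lambda>x. \<bar>s i x - f x\<bar>"]) measurable
    finally show ?thesis
      using i d(2)[OF h] by linarith
  qed
  then show "\<exists>d>0. \<forall>h. norm h < d \<longrightarrow> (\<integral>x. \<bar>f (x + h) - f x\<bar> \<partial>lborel) < e"
    using d(1) by blast
qed

text \<open>Regularity of the measure gives a closed \<open>C\<close> and an open \<open>T\<close>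
  with \<open>C \<subseteq> A \<subseteq> T\<close> and small gaps. As \<open>C\<close> is compact,
  all sufficiently short shifts move it into \<open>T\<close>.\<close>

lemma translation_continuous_L1_indicator_bounded:
  fixes A :: "'a::euclidean_space set"
  assumes A: "A \<in> sets borel" "bounded A"
  shows "translation_continuous_L1 (indicator A :: 'a \<Rightarrow> real)"
  unfolding translation_continuous_L1_def
proof (intro allI impI)
  fix e :: real assume "0 < e"
  have A': "A \<in> sets lebesgue" using A(1) by simp
  have fin: "emeasure lborel A < \<infinity>"
    using emeasure_bounded_finite[OF A(2)] by simp
  obtain T where T: "open T" "A \<subseteq> T" "emeasure lebesgue (T - A) < ennreal (e / 4)"
    using sets_lebesgue_outer_open[OF A', of "e / 4"] \<open>0 < e\<close> by (metis zero_less_divide_iff zero_less_numeral)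
  obtain C where C: "closed C" "C \<subseteq> A" "emeasure lebesgue (A - C) < ennreal (e / 4)"
    using sets_lebesgue_inner_closed[OF A', of "e / 4"] \<open>0 < e\<close> by (metis zero_less_divide_iff zero_less_numeral)
  have "compact C"
    using C A(2) bounded_subset compact_eq_bounded_closed by blast
  then obtain d where d: "d > 0" "(\<Union>x\<in>C. cball x d) \<subseteq> T"
    using compact_subset_open_imp_cball_epsilon_subset[OF _ T(1), of C] T(2) C(2) by blast
  have [measurable]: "T \<in> sets borel" "C \<in> sets borel" "A \<in> sets borel"
    using T C A by auto
  have e1: "emeasure lborel (T - A) < ennreal (e / 4)" "emeasure lborel (A - C) < ennreal (e / 4)"
    using T(3) C(3) by auto
  have tT: "emeasure lborel T < \<infinity>"
  proof -
    have "emeasure lborel T = emeasure lborel A + emeasure lborel (T - A)"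
      using T(2) by (subst plus_emeasure) (auto simp: Un_absorb1)
    then show ?thesis using fin e1 by (auto simp: less_top[symmetric] intro: order_less_trans)
  qed
  have tC: "emeasure lborel C < \<infinity>"
    by (rule le_less_trans[OF emeasure_mono fin]) (use C(2) in auto)
  have int: "integrable lborel (indicator T :: 'a \<Rightarrow> real)" "integrable lborel (indicator C :: 'a \<Rightarrow> real)"
      "integrable lborel (indicator A :: 'a \<Rightarrow> real)"
    using tT tC fin by auto
  have m: "measure lborel T - measure lborel A < e / 4" "measure lborel A - measure lborel C < e / 4"
  proof -
    have "measure lborel (T - A) = measure lborel T - measure lborel A"
      using T(2) tT by (intro measure_Diff) auto
    moreover have "measure lborel (A - C) = measure lborel A - measure lborel C"
      using C(2) fin by (intro measure_Diff) auto
    ultimately show "measure lborel T - measure lborel A < e / 4" "measure lborel A - measure lborel C < e / 4"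
      using e1 \<open>0 < e\<close> by (metis (no_types, lifting) enn2real_less_iff ennreal_less_top measure_def order_less_trans)+
  qed
  have "(\<integral>x. \<bar>indicator A (x + h) - indicator A x\<bar> \<partial>lborel) < e" if h: "norm h < d" for h :: 'a
  proof -
    have sub: "x + h \<in> T" if "x \<in> C" for x
    proof -
      have "x + h \<in> cball x d" using h by (simp add: dist_norm)
      with that d(2) show ?thesis by blast
    qed
    \<comment> \<open>The three summands are nonnegative and one of them is 1 wherever the two
      indicators differ. Together they integrate to twice the sum of both gaps, hence the choice
      \<open>e / 4\<close>.\<close>
    have "(\<integral>x. \<bar>indicator A (x + h) - indicator A x :: real\<bar> \<partial>lborel) \<le>
        (\<integral>x. (indicator T (x + h) - indicator A (x + h)) + (indicator T (x + h) - indicator C x)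
          + (indicator A x - indicator C x) \<partial>lborel)"
    proof (rule integral_mono)
      show "\<bar>indicator A (x + h) - indicator A x :: real\<bar> \<le> (indicator T (x + h) - indicator A (x + h)) +
          (indicator T (x + h) - indicator C x) + (indicator A x - indicator C x)" for x
        using sub[of x] T(2) C(2) by (auto split: split_indicator)
    qed (use int in \<open>auto intro!: integrable_abs Bochner_Integration.integrable_diff
          Bochner_Integration.integrable_add integrable_lborel_shift\<close>)
    also have "\<dots> = ((\<integral>x. indicator T (x + h) \<partial>lborel) - (\<integral>x. indicator A (x + h) \<partial>lborel)) +
        ((\<integral>x. indicator T (x + h) \<partial>lborel) - measure lborel C) + (measure lborel A - measure lborel C)"
      using int integrable_lborel_shift[OF int(1), of h] integrable_lborel_shift[OF int(3), of h] by simp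
    also have "(\<integral>x. indicator T (x + h) \<partial>lborel) = measure lborel T"
      using integral_lborel_shift[of "indicator T :: 'a \<Rightarrow> real" h] by simp
    also have "(\<integral>x. indicator A (x + h) \<partial>lborel) = measure lborel A"
      using integral_lborel_shift[of "indicator A :: 'a \<Rightarrow> real" h] by simp
    finally show ?thesis
      using m by linarith
  qed
  then show "\<exists>d>0. \<forall>h::'a. norm h < d \<longrightarrow>
      (\<integral>x. \<bar>indicator A (x + h) - indicator A x :: real\<bar> \<partial>lborel) < e"
    using d(1) by blast
qed

lemma translation_continuous_L1_add:
  fixes f g :: "'a::euclidean_space \<Rightarrow> real"
  assumes i: "integrable lborel f" "integrable lborel g"
    and t: "translation_continuous_L1 f" "translation_continuous_L1 g"
  shows "translation_continuous_L1 (\<lambda>x. f x + g x)"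
  unfolding translation_continuous_L1_def
proof (intro allI impI)
  fix e :: real assume "0 < e"
  then have "0 < e / 2" by simp
  then obtain d1 d2 where d: "d1 > 0" "\<And>h. norm h < d1 \<Longrightarrow> (\<integral>x. \<bar>f (x + h) - f x\<bar> \<partial>lborel) < e / 2"
    "d2 > 0" "\<And>h. norm h < d2 \<Longrightarrow> (\<integral>x. \<bar>g (x + h) - g x\<bar> \<partial>lborel) < e / 2"
    using t unfolding translation_continuous_L1_def by blast
  have "(\<integral>x. \<bar>f (x + h) + g (x + h) - (f x + g x)\<bar> \<partial>lborel) < e" if "norm h < min d1 d2" for h
  proof -
    have int: "integrable lborel (\<lambda>x. \<bar>f (x + h) - f x\<bar>)" "integrable lborel (\<lambda>x. \<bar>g (x + h) - g x\<bar>)"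
      using i integrable_lborel_shift[OF i(1), of h] integrable_lborel_shift[OF i(2), of h] by auto
    have "(\<integral>x. \<bar>f (x + h) + g (x + h) - (f x + g x)\<bar> \<partial>lborel) \<le>
        (\<integral>x. \<bar>f (x + h) - f x\<bar> + \<bar>g (x + h) - g x\<bar> \<partial>lborel)"
      using int i integrable_lborel_shift[OF i(1), of h] integrable_lborel_shift[OF i(2), of h]
      by (intro integral_mono) auto
    also have "\<dots> < e"
      using int d(2)[of h] d(4)[of h] that by simp
    finally show ?thesis .
  qed
  then show "\<exists>d>0. \<forall>h. norm h < d \<longrightarrow> (\<integral>x. \<bar>f (x + h) + g (x + h) - (f x + g x)\<bar> \<partial>lborel) < e"
    using d by (intro exI[of _ "min d1 d2"]) auto
qed

lemma translation_continuous_L1_indicator: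
  fixes A :: "'a::euclidean_space set"
  assumes [measurable]: "A \<in> sets borel" and fin: "emeasure lborel A < \<infinity>"
  shows "translation_continuous_L1 (indicator A :: 'a \<Rightarrow> real)"
proof (rule translation_continuous_L1_limit)
  let ?s = "\<lambda>n. indicator (A \<inter> cball 0 (real n)) :: 'a \<Rightarrow> real"
  show "integrable lborel (?s n)" for n
  proof -
    have "emeasure lborel (A \<inter> cball 0 (real n)) < \<infinity>"
      by (rule le_less_trans[OF emeasure_mono fin]) auto
    then show ?thesis by simp
  qed
  show "translation_continuous_L1 (?s n)" for n
    by (intro translation_continuous_L1_indicator_bounded) auto
  show "(\<lambda>n. ?s n x) \<longlonglongrightarrow> indicator A x" for x
  proof (rule tendsto_eventually)
    obtain k where "norm x \<le> real k" using real_arch_simple by blast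
    then show "\<forall>\<^sub>F n in sequentially. ?s n x = indicator A x"
      by (intro eventually_sequentiallyI[of k]) (auto split: split_indicator)
  qed
qed (use fin in \<open>auto split: split_indicator\<close>)

lemma translation_continuous_L1_integrable:
  fixes f :: "'a::euclidean_space \<Rightarrow> real"
  assumes "integrable lborel f"
  shows "translation_continuous_L1 f"
  using assms
proof (induction f rule: integrable_induct)
  case (base A c)
  have "translation_continuous_L1 (indicator A :: 'a \<Rightarrow> real)"
    using base by (intro translation_continuous_L1_indicator) auto
  show ?case
    unfolding translation_continuous_L1_def
  proof (intro allI impI)
    fix e :: real assume "0 < e"
    then obtain d where d: "d > 0"
      "\<And>h. norm h < d \<Longrightarrow> (\<integral>x. \<bar>indicator A (x + h) - indicator A x :: real\<bar> \<partial>lborel) < e / (\<bar>c\<bar> + 1)"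
      using \<open>translation_continuous_L1 (indicator A :: 'a \<Rightarrow> real)\<close>
      unfolding translation_continuous_L1_def by (metis abs_ge_zero add_nonneg_pos divide_pos_pos zero_less_one)
    have "(\<integral>x. \<bar>indicator A (x + h) *\<^sub>R c - indicator A x *\<^sub>R c\<bar> \<partial>lborel) < e" if "norm h < d" for h
    proof -
      have "(\<integral>x. \<bar>indicator A (x + h) *\<^sub>R c - indicator A x *\<^sub>R c\<bar> \<partial>lborel) =
          (\<integral>x. \<bar>indicator A (x + h) - indicator A x :: real\<bar> \<partial>lborel) * \<bar>c\<bar>"
        by (simp add: left_diff_distrib[symmetric] abs_mult)
      also have "\<dots> \<le> (\<integral>x. \<bar>indicator A (x + h) - indicator A x :: real\<bar> \<partial>lborel) * (\<bar>c\<bar> + 1)"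
        by (intro mult_left_mono) auto
      also have "\<dots> < e"
        using d(2)[OF that] by (simp add: field_simps)
      finally show ?thesis .
    qed
    then show "\<exists>d>0. \<forall>h. norm h < d \<longrightarrow> (\<integral>x. \<bar>indicator A (x + h) *\<^sub>R c - indicator A x *\<^sub>R c\<bar> \<partial>lborel) < e"
      using d(1) by blast
  qed
next
  case (add f g)
  then show ?case by (intro translation_continuous_L1_add)
next
  case (lim f s)
  then show ?case by (intro translation_continuous_L1_limit[of s f]) auto
qed

text \<open>The subsequence is so fast that its integrals are bounded by powers of 1/2; the series
  of the selected functions then converges almost everywhere, and its sum is the integrable majorant
  \<open>w\<close> wanted for dominated convergence.\<close>

lemma L1_null_sequence_subsequence:
  fixes f :: "nat \<Rightarrow> 'a \<Rightarrow> real"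
  assumes f: "\<And>n. integrable M (f n)" "\<And>n x. 0 \<le> f n x"
    and lim: "(\<lambda>n. \<integral>x. f n x \<partial>M) \<longlonglongrightarrow> 0"
  obtains r w where "strict_mono r" "integrable M w" "AE x in M. (\<lambda>n. f (r n) x) \<longlonglongrightarrow> 0"
    "AE x in M. \<forall>n. f (r n) x \<le> w x"
proof -
  have "\<exists>N. \<forall>m\<ge>N. (\<integral>x. f m x \<partial>M) < (1 / 2) ^ n" for n
    using order_tendstoD(2)[OF lim, of "(1 / 2) ^ n"] by (simp add: eventually_sequentially)
  then obtain N where N: "\<And>n m. m \<ge> N n \<Longrightarrow> (\<integral>x. f m x \<partial>M) < (1 / 2) ^ n"
    by metis
  define r where "r = rec_nat (N 0) (\<lambda>n k. max (Suc k) (N (Suc n)))"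
  have "r n < r (Suc n)" for n by (simp add: r_def)
  then have r: "strict_mono r" by (simp add: strict_mono_Suc_iff)
  have "N n \<le> r n" for n by (cases n) (auto simp: r_def)
  then have b: "(\<integral>x. f (r n) x \<partial>M) \<le> (1 / 2) ^ n" for n
    using N less_imp_le by blast
  have meas[measurable]: "\<And>n. f n \<in> borel_measurable M" using f by auto
  have "(\<integral>\<^sup>+x. (\<Sum>n. ennreal (f (r n) x)) \<partial>M) = (\<Sum>n. \<integral>\<^sup>+x. ennreal (f (r n) x) \<partial>M)"
    by (rule nn_integral_suminf) measurable
  also have "\<dots> = (\<Sum>n. ennreal (\<integral>x. f (r n) x \<partial>M))"
    using f by (intro suminf_cong nn_integral_eq_integral) auto
  also have "\<dots> \<le> (\<Sum>n. ennreal ((1 / 2) ^ n))"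
    using b by (intro suminf_le ennreal_leI) auto
  also have "\<dots> = ennreal (\<Sum>n. (1 / 2) ^ n)"
    by (rule suminf_ennreal2) auto
  finally have "(\<integral>\<^sup>+x. (\<Sum>n. ennreal (f (r n) x)) \<partial>M) \<noteq> \<infinity>"
    by (auto simp: top_unique)
  then have "AE x in M. (\<Sum>n. ennreal (f (r n) x)) \<noteq> \<infinity>"
    by (intro nn_integral_PInf_AE) measurable
  then have sm: "AE x in M. summable (\<lambda>n. f (r n) x)"
    by eventually_elim (use f(2) in \<open>auto intro: summable_suminf_not_top\<close>)
  have "integrable M (\<lambda>x. \<Sum>n. f (r n) x)"
  proof (rule integrable_suminf)
    show "AE x in M. summable (\<lambda>n. norm (f (r n) x))"
      using sm f(2) by simp
    show "summable (\<lambda>n. \<integral>x. norm (f (r n) x) \<partial>M)"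
    proof (rule summable_comparison_test'[where g = "\<lambda>n. (1 / 2) ^ n" and N = 0])
      show "norm (\<integral>x. norm (f (r n) x) \<partial>M) \<le> (1 / 2) ^ n" for n
        using b[of n] f(2) by (simp add: integral_nonneg)
    qed (simp add: summable_geometric)
  qed (use f in auto)
  moreover have "AE x in M. (\<lambda>n. f (r n) x) \<longlonglongrightarrow> 0"
    using sm by eventually_elim (rule summable_LIMSEQ_zero)
  moreover have "AE x in M. \<forall>n. f (r n) x \<le> (\<Sum>n. f (r n) x)"
    using sm
  proof eventually_elim
    case (elim x)
    show ?case
    proof
      fix n
      show "f (r n) x \<le> (\<Sum>n. f (r n) x)"
        using sum_le_suminf[OF elim, of "{n}"] f(2) by simp
    qed
  qed
  ultimately show ?thesis
    using r that by blast
qed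

lemma AE_open_if_AE_box:
  fixes \<Omega> :: "'a::euclidean_space set"
  assumes "open \<Omega>" and P: "\<And>a d. cbox a d \<subseteq> \<Omega> \<Longrightarrow> AE x in lborel. x \<in> box a d \<longrightarrow> P x"
  shows "AE x in lborel. x \<in> \<Omega> \<longrightarrow> P x"
proof -
  let ?F = "{box a d | a d. cbox a d \<subseteq> \<Omega>}"
  obtain F' where F': "F' \<subseteq> ?F" "countable F'" "\<Union>F' = \<Union>?F"
    by (rule Lindelof[of ?F]) auto
  have "\<Omega> \<subseteq> \<Union>?F"
    using open_contains_cbox[OF assms(1)] by (smt (verit) UnionI mem_Collect_eq subsetI)
  then have cover: "\<Omega> \<subseteq> \<Union>F'" by (simp only: F'(3))
  have "AE x in lborel. \<forall>B\<in>F'. x \<in> B \<longrightarrow> P x"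
  proof (rule AE_ball_countable'[OF _ F'(2)])
    fix B assume "B \<in> F'"
    then obtain a d where B: "B = box a d" "cbox a d \<subseteq> \<Omega>"
      using F'(1) by blast
    show "AE x in lborel. x \<in> B \<longrightarrow> P x"
      using P[OF B(2)] unfolding B(1) .
  qed
  then show ?thesis
    by eventually_elim (use cover in blast)
qed

lemma compact_shift_subset:
  fixes K :: "'a::euclidean_space set"
  assumes "compact K" "open \<Omega>" "K \<subseteq> \<Omega>"
  obtains d where "d > 0" "\<And>x w. x \<in> K \<Longrightarrow> norm w \<le> d \<Longrightarrow> x + w \<in> \<Omega>"
proof -
  obtain d where d: "d > 0" "(\<Union>x\<in>K. cball x d) \<subseteq> \<Omega>"
    using compact_subset_open_imp_cball_epsilon_subset[OF assms] by blast
  show ?thesis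
  proof (rule that[OF d(1)])
    fix x w :: 'a assume "x \<in> K" "norm w \<le> d"
    then have "x + w \<in> cball x d" by (simp add: dist_norm)
    with \<open>x \<in> K\<close> d(2) show "x + w \<in> \<Omega>" by blast
  qed
qed

text \<open>On \<open>K\<close> the quotient is the mean of \<open>G \<bullet> v\<close> over a
  segment, so its error is at most the mean of the translation errors of
  \<open>G \<bullet> v\<close>, and these are uniformly small for short segments.\<close>

lemma difference_quotient_L1:
  fixes v :: "'a::euclidean_space"
  assumes "open \<Omega>" "compact K" "K \<subseteq> \<Omega>" and wg: "weak_grad \<Omega> u G"
    and "0 < e"
  obtains d where "d > 0"
    "\<And>\<tau>. 0 < \<bar>\<tau>\<bar> \<Longrightarrow> \<bar>\<tau>\<bar> < d \<Longrightarrow>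
      (\<integral>x. indicator K x * \<bar>(u (x + \<tau> *\<^sub>R v) - u x) / \<tau> - G x \<bullet> v\<bar> \<partial>lborel) \<le> e"
proof -
  have u: "integrable lborel u" and G: "integrable lborel G"
    using wg by (auto simp: weak_grad_def)
  then have [measurable]: "u \<in> borel_measurable borel" "G \<in> borel_measurable borel" by auto
  have [measurable]: "K \<in> sets borel" using assms(2) by (simp add: compact_imp_closed)
  obtain d1 where d1: "d1 > 0" "\<And>x w. x \<in> K \<Longrightarrow> norm w \<le> d1 \<Longrightarrow> x + w \<in> \<Omega>"
    using compact_shift_subset[OF assms(2,1,3)] by blast
  let ?g = "\<lambda>x. G x \<bullet> v"
  have g: "integrable lborel ?g" using G by simp
  obtain d2 where d2: "d2 > 0" "\<And>h. norm h < d2 \<Longrightarrow> (\<integral>x. \<bar>?g (x + h) - ?g x\<bar> \<partial>lborel) < e"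
    using translation_continuous_L1_integrable[OF g] \<open>0 < e\<close> unfolding translation_continuous_L1_def by blast
  \<comment> \<open>The \<open>+ 1\<close> covers \<open>v = 0\<close>. The choice keeps every shift
    \<open>t *\<^sub>R \<tau> *\<^sub>R v\<close> below both thresholds, one for staying in
    \<open>\<Omega>\<close> and one for translation continuity.\<close>
  define d where "d = min d1 d2 / (norm v + 1)"
  have "d > 0" using d1 d2 by (simp add: d_def add_nonneg_pos)
  moreover have "(\<integral>x. indicator K x * \<bar>(u (x + \<tau> *\<^sub>R v) - u x) / \<tau> - ?g x\<bar> \<partial>lborel) \<le> e"
    if \<tau>: "0 < \<bar>\<tau>\<bar>" "\<bar>\<tau>\<bar> < d" for \<tau>
  proof -
    have tn: "norm (t *\<^sub>R \<tau> *\<^sub>R v) < min d1 d2" if "t \<in> {0..1}" for t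
    proof -
      have "norm (t *\<^sub>R \<tau> *\<^sub>R v) \<le> \<bar>\<tau>\<bar> * norm v"
        using that by (auto simp: abs_mult intro!: mult_right_mono mult_left_le_one_le)
      also have "\<dots> \<le> \<bar>\<tau>\<bar> * (norm v + 1)" by (intro mult_left_mono) auto
      also have "\<dots> < min d1 d2"
        using \<tau>(2) unfolding d_def by (simp add: pos_less_divide_eq add_nonneg_pos)
      finally show ?thesis .
    qed
    let ?q = "\<lambda>x. indicator K x * \<bar>(u (x + \<tau> *\<^sub>R v) - u x) / \<tau> - ?g x\<bar>"
    let ?s = "\<lambda>t x. indicator {0..1} t * \<bar>?g (x + t *\<^sub>R \<tau> *\<^sub>R v) - ?g x\<bar>"
    have seg: "AE x in lborel. (\<forall>t\<in>{0..1}. x + t *\<^sub>R \<tau> *\<^sub>R v \<in> \<Omega>) \<longrightarrow>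
      u (x + \<tau> *\<^sub>R v) - u x = (\<integral>t. indicator {0..1} t * (G (x + t *\<^sub>R \<tau> *\<^sub>R v) \<bullet> (\<tau> *\<^sub>R v)) \<partial>lborel)"
      by (rule weak_grad_segment[OF assms(1) wg])
    have "AE x in lborel. integrable lborel (\<lambda>t. indicator {0..1::real} t * (G (x + t *\<^sub>R \<tau> *\<^sub>R v) \<bullet> \<tau> *\<^sub>R v))"
      using pair_sigma_finite.AE_integrable_snd[OF lborel_pair_sigma_finite,
          of "\<lambda>t x. indicator {0..1::real} t * (G (x + t *\<^sub>R \<tau> *\<^sub>R v) \<bullet> \<tau> *\<^sub>R v)"]
        integrable_segment_prod[OF G, of "\<tau> *\<^sub>R v"] by simp
    with seg have "AE x in lborel. ennreal (?q x) \<le> (\<integral>\<^sup>+t. ennreal (?s t x) \<partial>lborel)"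
    proof eventually_elim
      case (elim x)
      show ?case
      proof (cases "x \<in> K")
        case True
        have int: "integrable lborel (\<lambda>t. indicator {0..1::real} t * ?g (x + t *\<^sub>R \<tau> *\<^sub>R v))"
          using elim(2) \<tau>(1) by (auto simp: mult.left_commute)
        have "(\<forall>t\<in>{0..1}. x + t *\<^sub>R \<tau> *\<^sub>R v \<in> \<Omega>)"
          using tn d1(2)[OF True] by force
        with elim(1) have "(u (x + \<tau> *\<^sub>R v) - u x) / \<tau> = (\<integral>t. indicator {0..1} t * ?g (x + t *\<^sub>R \<tau> *\<^sub>R v) \<partial>lborel)"
          using \<tau>(1) by (simp add: mult.left_commute[of _ \<tau>])
        then have "(u (x + \<tau> *\<^sub>R v) - u x) / \<tau> - ?g x =
            (\<integral>t. indicator {0..1} t * ?g (x + t *\<^sub>R \<tau> *\<^sub>R v) - indicator {0..1} t * ?g x \<partial>lborel)"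
          using int by simp
        also have "\<bar>\<dots>\<bar> \<le> (\<integral>\<^sup>+t. norm (indicator {0..1} t * ?g (x + t *\<^sub>R \<tau> *\<^sub>R v) - indicator {0..1} t * ?g x) \<partial>lborel)"
          by (subst real_norm_def[symmetric], rule integral_norm_bound_ennreal) (use int in auto)
        also have "\<dots> = (\<integral>\<^sup>+t. ennreal (?s t x) \<partial>lborel)"
          by (intro nn_integral_cong) (auto simp: right_diff_distrib[symmetric] abs_mult)
        finally show ?thesis using True by simp
      qed simp
    qed
    then have "(\<integral>\<^sup>+x. ennreal (?q x) \<partial>lborel) \<le> (\<integral>\<^sup>+x. (\<integral>\<^sup>+t. ennreal (?s t x) \<partial>lborel) \<partial>lborel)"
      by (rule nn_integral_mono_AE)
    also have "\<dots> = (\<integral>\<^sup>+t. (\<integral>\<^sup>+x. ennreal (?s t x) \<partial>lborel) \<partial>lborel)"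
      by (rule pair_sigma_finite.Fubini'[OF lborel_pair_sigma_finite]) measurable
    also have "\<dots> \<le> (\<integral>\<^sup>+t. ennreal e * indicator {0..1::real} t \<partial>lborel)"
    proof (rule nn_integral_mono)
      fix t :: real
      have i: "integrable lborel (\<lambda>x. \<bar>?g (x + t *\<^sub>R \<tau> *\<^sub>R v) - ?g x\<bar>)"
        using g integrable_lborel_shift[OF g, of "t *\<^sub>R \<tau> *\<^sub>R v"] by simp
      show "(\<integral>\<^sup>+x. ennreal (?s t x) \<partial>lborel) \<le> ennreal e * indicator {0..1::real} t"
      proof (cases "t \<in> {0..1}")
        case True
        then have "(\<integral>\<^sup>+x. ennreal (?s t x) \<partial>lborel) = ennreal (\<integral>x. \<bar>?g (x + t *\<^sub>R \<tau> *\<^sub>R v) - ?g x\<bar> \<partial>lborel)"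
          using i by (simp add: nn_integral_eq_integral)
        also have "\<dots> \<le> ennreal e"
          using d2(2)[of "t *\<^sub>R \<tau> *\<^sub>R v"] tn[OF True] by (intro ennreal_leI) simp
        finally show ?thesis using True by simp
      qed simp
    qed
    also have "\<dots> = ennreal e"
      by (subst nn_integral_cmult_indicator) auto
    finally have "(\<integral>\<^sup>+x. ennreal (?q x) \<partial>lborel) \<le> ennreal e" .
    moreover have "(\<integral>x. ?q x \<partial>lborel) = enn2real (\<integral>\<^sup>+x. ennreal (?q x) \<partial>lborel)"
      by (rule integral_eq_nn_integral) auto
    ultimately show ?thesis
      using \<open>0 < e\<close> by (simp add: enn2real_leI)
  qed
  ultimately show ?thesis using that by blast
qed

lemma difference_quotient_L1_tendsto:
  fixes v :: "'a::euclidean_space"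
  assumes "open \<Omega>" "compact K" "K \<subseteq> \<Omega>" and wg: "weak_grad \<Omega> u G"
  shows "(\<lambda>n. \<integral>x. indicator K x *
      \<bar>(u (x + inverse (real (Suc n)) *\<^sub>R v) - u x) / inverse (real (Suc n)) - G x \<bullet> v\<bar> \<partial>lborel) \<longlonglongrightarrow> 0"
proof (rule LIMSEQ_I)
  fix e :: real assume "0 < e"
  then have "0 < e / 2" by simp
  from difference_quotient_L1[OF assms this, of v]
  obtain d where d: "d > 0" "\<And>\<tau>. 0 < \<bar>\<tau>\<bar> \<Longrightarrow> \<bar>\<tau>\<bar> < d \<Longrightarrow>
      (\<integral>x. indicator K x * \<bar>(u (x + \<tau> *\<^sub>R v) - u x) / \<tau> - G x \<bullet> v\<bar> \<partial>lborel) \<le> e / 2"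
    by blast
  obtain N where N: "\<And>n. n \<ge> N \<Longrightarrow> norm (inverse (real (Suc n)) - 0) < d"
    using LIMSEQ_D[OF LIMSEQ_inverse_real_of_nat d(1)] by blast
  show "\<exists>no. \<forall>n\<ge>no. norm ((\<integral>x. indicator K x *
      \<bar>(u (x + inverse (real (Suc n)) *\<^sub>R v) - u x) / inverse (real (Suc n)) - G x \<bullet> v\<bar> \<partial>lborel) - 0) < e"
  proof (intro exI allI impI)
    fix n assume "N \<le> n"
    let ?I = "\<integral>x. indicator K x *
      \<bar>(u (x + inverse (real (Suc n)) *\<^sub>R v) - u x) / inverse (real (Suc n)) - G x \<bullet> v\<bar> \<partial>lborel"
    have "?I \<le> e / 2"
      using N[OF \<open>N \<le> n\<close>] by (intro d(2)) (simp_all del: of_nat_Suc)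
    moreover have "0 \<le> ?I"
      by (intro Bochner_Integration.integral_nonneg) auto
    ultimately show "norm (?I - 0) < e"
      using \<open>0 < e\<close> by simp
  qed
qed

subsection \<open>Level sets and the chain rule\<close>

text \<open>Let \<open>E\<close> be the level set. By translation continuity of its indicator, along
  a subsequence of shifts almost every point of \<open>E\<close> in the box is eventually moved to
  points of \<open>E\<close>. There the difference quotients of \<open>u\<close> are 0, while they
  converge to \<open>G x \<bullet> v\<close>.\<close>

lemma weak_grad_level_set_direction:
  fixes \<Omega> :: "'a::euclidean_space set"
  assumes "open \<Omega>" "bounded \<Omega>" and wg: "weak_grad \<Omega> u G"
  shows "AE x in lborel. x \<in> \<Omega> \<longrightarrow> u x = c \<longrightarrow> G x \<bullet> v = 0"
proof (rule AE_open_if_AE_box[OF assms(1)])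
  fix a d assume K: "cbox a d \<subseteq> \<Omega>"
  have u: "integrable lborel u" and G: "integrable lborel G"
    using wg by (auto simp: weak_grad_def)
  then have [measurable]: "u \<in> borel_measurable borel" "G \<in> borel_measurable borel" by auto
  have [measurable]: "\<Omega> \<in> sets borel" using assms(1) by simp
  define E where "E = {x \<in> \<Omega>. u x = c}"
  have E[measurable]: "E \<in> sets borel"
    unfolding E_def by measurable
  have "emeasure lborel E < \<infinity>"
    by (rule le_less_trans[OF emeasure_mono emeasure_bounded_finite[OF assms(2)]]) (auto simp: E_def)
  then have iE: "integrable lborel (indicator E :: 'a \<Rightarrow> real)" by simp
  define \<tau> where "\<tau> n = inverse (real (Suc n))" for n
  have \<tau>0: "\<tau> n \<noteq> 0" for n by (simp add: \<tau>_def)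
  define D where "D n x = (u (x + \<tau> n *\<^sub>R v) - u x) / \<tau> n" for n x
  \<comment> \<open>Both errors are added so that a single subsequence serves both limits.\<close>
  define F where "F n x = indicator (cbox a d) x * \<bar>D n x - G x \<bullet> v\<bar> +
    \<bar>indicator E (x + \<tau> n *\<^sub>R v) - indicator E x\<bar>" for n x
  have iD: "integrable lborel (\<lambda>x. indicator (cbox a d) x * \<bar>D n x - G x \<bullet> v\<bar>)" for n
  proof -
    have "integrable lborel (\<lambda>x. \<bar>D n x - G x \<bullet> v\<bar>)"
      unfolding D_def using u G integrable_lborel_shift[OF u] by auto
    from integrable_mult_indicator[OF _ this, of "cbox a d"] show ?thesis by simp
  qed
  have iE': "integrable lborel (\<lambda>x. \<bar>indicator E (x + \<tau> n *\<^sub>R v) - indicator E x :: real\<bar>)" for n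
    using iE integrable_lborel_shift[OF iE, of "\<tau> n *\<^sub>R v"] by (intro integrable_abs Bochner_Integration.integrable_diff)
  have lim1: "(\<lambda>n. \<integral>x. indicator (cbox a d) x * \<bar>D n x - G x \<bullet> v\<bar> \<partial>lborel) \<longlonglongrightarrow> 0"
    unfolding D_def \<tau>_def by (rule difference_quotient_L1_tendsto[OF assms(1) compact_cbox K wg])
  have lim2: "(\<lambda>n. \<integral>x. \<bar>indicator E (x + \<tau> n *\<^sub>R v) - indicator E x :: real\<bar> \<partial>lborel) \<longlonglongrightarrow> 0"
  proof (rule LIMSEQ_I)
    fix e :: real assume "0 < e"
    obtain r where r: "r > 0" "\<And>h. norm h < r \<Longrightarrow> (\<integral>x. \<bar>indicator E (x + h) - indicator E x :: real\<bar> \<partial>lborel) < e"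
      using translation_continuous_L1_integrable[OF iE] \<open>0 < e\<close> unfolding translation_continuous_L1_def by blast
    have "(\<lambda>n. \<tau> n *\<^sub>R v) \<longlonglongrightarrow> 0 *\<^sub>R v"
      unfolding \<tau>_def by (intro tendsto_intros LIMSEQ_inverse_real_of_nat)
    then have "(\<lambda>n. \<tau> n *\<^sub>R v) \<longlonglongrightarrow> 0" by simp
    from LIMSEQ_D[OF this r(1)] obtain N where N: "\<And>n. n \<ge> N \<Longrightarrow> norm (\<tau> n *\<^sub>R v - 0) < r" by blast
    show "\<exists>no. \<forall>n\<ge>no. norm ((\<integral>x. \<bar>indicator E (x + \<tau> n *\<^sub>R v) - indicator E x :: real\<bar> \<partial>lborel) - 0) < e"
    proof (intro exI allI impI)
      fix n assume "N \<le> n"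
      have "0 \<le> (\<integral>x. \<bar>indicator E (x + \<tau> n *\<^sub>R v) - indicator E x :: real\<bar> \<partial>lborel)"
        by (intro Bochner_Integration.integral_nonneg) auto
      with r(2)[of "\<tau> n *\<^sub>R v"] N[OF \<open>N \<le> n\<close>]
      show "norm ((\<integral>x. \<bar>indicator E (x + \<tau> n *\<^sub>R v) - indicator E x :: real\<bar> \<partial>lborel) - 0) < e"
        by simp
    qed
  qed
  have limF: "(\<lambda>n. \<integral>x. F n x \<partial>lborel) \<longlonglongrightarrow> 0"
    using tendsto_add[OF lim1 lim2] iD iE' by (simp add: F_def)
  have iF: "integrable lborel (F n)" for n
    unfolding F_def using iD iE' by (intro Bochner_Integration.integrable_add)
  have nF: "0 \<le> F n x" for n x by (simp add: F_def)
  obtain r w where r: "strict_mono r" and lim: "AE x in lborel. (\<lambda>n. F (r n) x) \<longlonglongrightarrow> 0"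
    using L1_null_sequence_subsequence[OF iF nF limF] by metis
  show "AE x in lborel. x \<in> box a d \<longrightarrow> u x = c \<longrightarrow> G x \<bullet> v = 0"
    using lim
  proof (eventually_elim, intro impI)
    fix x assume lim: "(\<lambda>n. F (r n) x) \<longlonglongrightarrow> 0" and "x \<in> box a d" "u x = c"
    then have x: "x \<in> cbox a d" "u x = c" using box_subset_cbox by auto
    have "\<forall>\<^sub>F n in sequentially. F (r n) x < 1"
      using order_tendstoD(2)[OF lim, of 1] by simp
    then have "\<forall>\<^sub>F n in sequentially. \<bar>G x \<bullet> v\<bar> \<le> F (r n) x"
    proof eventually_elim
      case (elim n)
      have "x \<in> E" using x K by (auto simp: E_def)
      \<comment> \<open>The absolute difference of the indicators takes only the values 0 and 1, so
        \<open>F\<close> below 1 forces it to be 0.\<close>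
      then have "x + \<tau> (r n) *\<^sub>R v \<in> E"
        using elim x by (auto simp: F_def split: split_indicator_asm)
      then have "D (r n) x = 0" using x by (simp add: D_def E_def)
      then show ?case using x by (simp add: F_def)
    qed
    then have "\<bar>G x \<bullet> v\<bar> \<le> 0"
      by (rule tendsto_lowerbound[OF lim]) simp
    then show "G x \<bullet> v = 0" by simp
  qed
qed

lemma weak_grad_level_set:
  fixes \<Omega> :: "'a::euclidean_space set"
  assumes "open \<Omega>" "bounded \<Omega>" "weak_grad \<Omega> u G"
  shows "AE x in lborel. x \<in> \<Omega> \<longrightarrow> u x = c \<longrightarrow> G x = 0"
proof -
  have "AE x in lborel. \<forall>i\<in>Basis. x \<in> \<Omega> \<longrightarrow> u x = c \<longrightarrow> G x \<bullet> i = 0"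
    by (rule AE_ball_countable') (use weak_grad_level_set_direction[OF assms] in \<open>auto intro: countable_finite\<close>)
  then show ?thesis
    by eventually_elim (metis euclidean_all_zero_iff)
qed

lemma test_function_difference_quotient:
  assumes "test_function \<Omega> \<phi>"
  shows "(\<lambda>n. (\<phi> x - \<phi> (x - inverse (real (Suc n)) *\<^sub>R v)) / inverse (real (Suc n)))
    \<longlonglongrightarrow> frechet_derivative \<phi> (at x) v"
proof -
  have "((\<lambda>t. x - t *\<^sub>R v) has_derivative (\<lambda>s. - (s *\<^sub>R v))) (at 0)"
    by (auto intro!: derivative_eq_intros)
  moreover have "(\<phi> has_derivative frechet_derivative \<phi> (at x)) (at (x - 0 *\<^sub>R v))"
    using test_function_has_derivative[OF assms] by simp
  ultimately have d: "((\<lambda>t. \<phi> (x - t *\<^sub>R v)) has_derivative (\<lambda>s. frechet_derivative \<phi> (at x) (- (s *\<^sub>R v)))) (at 0)"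
    by (rule has_derivative_compose)
  have lin: "linear (frechet_derivative \<phi> (at x))"
    using test_function_has_derivative[OF assms] by (rule has_derivative_linear)
  then have "(\<lambda>s. frechet_derivative \<phi> (at x) (- (s *\<^sub>R v))) = (*) (- frechet_derivative \<phi> (at x) v)"
    by (auto simp: fun_eq_iff linear_neg linear_cmul)
  with d have "((\<lambda>t. \<phi> (x - t *\<^sub>R v)) has_real_derivative - frechet_derivative \<phi> (at x) v) (at 0)"
    by (simp add: has_field_derivative_def)
  then have "((\<lambda>t. (\<phi> (x - t *\<^sub>R v) - \<phi> x) / t) \<longlongrightarrow> - frechet_derivative \<phi> (at x) v) (at 0)"
    by (simp add: has_field_derivative_iff)
  moreover have "filterlim (\<lambda>n. inverse (real (Suc n))) (at 0) sequentially"
    using LIMSEQ_inverse_real_of_nat by (simp add: filterlim_at)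
  ultimately have "(\<lambda>n. (\<phi> (x - inverse (real (Suc n)) *\<^sub>R v) - \<phi> x) / inverse (real (Suc n)))
      \<longlonglongrightarrow> - frechet_derivative \<phi> (at x) v"
    by (rule filterlim_compose)
  from tendsto_minus[OF this] show ?thesis
    by (simp add: minus_divide_left del: of_nat_Suc)
qed

text \<open>The quotient is a mean of the directional derivative over a segment and inherits its
  bound.\<close>

lemma test_function_difference_quotient_bound:
  assumes \<phi>: "test_function \<Omega> \<phi>" and B: "\<And>x. \<bar>frechet_derivative \<phi> (at x) v\<bar> \<le> B" and "\<tau> \<noteq> 0"
  shows "\<bar>(\<phi> x - \<phi> (x - \<tau> *\<^sub>R v)) / \<tau>\<bar> \<le> B"
proof -
  have lin: "linear (frechet_derivative \<phi> (at y))" for y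
    using test_function_has_derivative[OF \<phi>] by (rule has_derivative_linear)
  let ?D = "\<lambda>t. frechet_derivative \<phi> (at (x - t *\<^sub>R \<tau> *\<^sub>R v)) v"
  have [measurable]: "(\<lambda>y. frechet_derivative \<phi> (at y) v) \<in> borel_measurable borel"
    by (rule test_function_derivative_measurable[OF \<phi>])
  have "\<phi> x - \<phi> (x - \<tau> *\<^sub>R v) = (\<integral>t. \<tau> * (indicator {0..1} t * ?D t) \<partial>lborel)"
    using integral_unit_interval_test_derivative[OF \<phi>, of x "\<tau> *\<^sub>R v"] lin
    by (simp add: linear_cmul mult.left_commute)
  then have "(\<phi> x - \<phi> (x - \<tau> *\<^sub>R v)) / \<tau> = (\<integral>t. indicator {0..1} t * ?D t \<partial>lborel)"
    using \<open>\<tau> \<noteq> 0\<close> by simp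
  also have "\<bar>\<dots>\<bar> \<le> (\<integral>t. indicator {0..1::real} t * B \<partial>lborel)"
  proof -
    have ind: "integrable lborel (indicator {0..1} :: real \<Rightarrow> real)" by simp
    have i: "integrable lborel (\<lambda>t. indicator {0..1::real} t * ?D t)"
      by (rule integrable_mult_bounded[OF ind _ B]) measurable
    have "norm (\<integral>t. indicator {0..1} t * ?D t \<partial>lborel) \<le> (\<integral>t. norm (indicator {0..1::real} t * ?D t) \<partial>lborel)"
      by (rule integral_norm_bound)
    also have "\<dots> \<le> (\<integral>t. indicator {0..1::real} t * B \<partial>lborel)"
    proof (rule integral_mono)
      show "norm (indicator {0..1::real} t * ?D t) \<le> indicator {0..1} t * B" for t
        using B[of "x - t *\<^sub>R \<tau> *\<^sub>R v"] by (auto simp: abs_mult split: split_indicator)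
    qed (use integrable_norm[OF i] in auto)
    finally show ?thesis by simp
  qed
  finally show ?thesis by simp
qed

lemma lipschitz_borel:
  fixes h :: "real \<Rightarrow> real"
  assumes "\<And>s t. \<bar>h s - h t\<bar> \<le> L * \<bar>s - t\<bar>"
  shows "h \<in> borel_measurable borel"
proof -
  have "0 \<le> L" using order_trans[OF abs_ge_zero assms[of 1 0]] by simp
  then have "L-lipschitz_on UNIV h"
    using assms by (auto simp: lipschitz_on_def dist_real_def)
  then show ?thesis
    by (intro borel_measurable_continuous_onI lipschitz_on_continuous_on)
qed

text \<open>The difference quotients of \<open>h (u x)\<close> are bounded by \<open>L\<close> times
  those of \<open>u\<close>, which along a subsequence converge almost everywhere under an
  integrable majorant. Points where \<open>h\<close> need not be differentiable are harmless, since
  \<open>G\<close> vanishes almost everywhere on each of the finitely many level sets with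
  \<open>u x \<in> Z\<close>.\<close>

lemma weak_grad_chain:
  fixes \<Omega> :: "'a::euclidean_space set" and h h' :: "real \<Rightarrow> real"
  assumes "open \<Omega>" "bounded \<Omega>" and wg: "weak_grad \<Omega> u G" and "finite Z"
    and lip: "\<And>s t. \<bar>h s - h t\<bar> \<le> L * \<bar>s - t\<bar>"
    and der: "\<And>s. s \<notin> Z \<Longrightarrow> (h has_real_derivative h' s) (at s)"
    and h'_bound: "\<And>s. \<bar>h' s\<bar> \<le> L" and [measurable]: "h' \<in> borel_measurable borel"
  shows "weak_grad \<Omega> (\<lambda>x. indicator \<Omega> x * h (u x)) (\<lambda>x. h' (u x) *\<^sub>R G x)"
proof -
  have u: "integrable lborel u" and G: "integrable lborel G"
    using wg by (auto simp: weak_grad_def)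
  then have [measurable]: "u \<in> borel_measurable borel" "G \<in> borel_measurable borel" by auto
  have [measurable]: "\<Omega> \<in> sets borel" using assms(1) by simp
  have [measurable]: "h \<in> borel_measurable borel" by (rule lipschitz_borel[OF lip])
  have "0 \<le> L" using h'_bound[of 0] by linarith
  have finO: "emeasure lborel \<Omega> < \<infinity>" by (rule emeasure_bounded_finite[OF assms(2)])
  define w where "w = (\<lambda>x. indicator \<Omega> x * h (u x))"
  have w: "integrable lborel w"
  proof (rule Bochner_Integration.integrable_bound)
    show "integrable lborel (\<lambda>x. L * \<bar>u x\<bar> + \<bar>h 0\<bar> * indicator \<Omega> x)"
      using u finO by (intro Bochner_Integration.integrable_add integrable_mult_right integrable_abs) auto
    show "AE x in lborel. norm (w x) \<le> norm (L * \<bar>u x\<bar> + \<bar>h 0\<bar> * indicator \<Omega> x)"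
    proof (rule AE_I2)
      fix x
      have "\<bar>h (u x)\<bar> \<le> L * \<bar>u x\<bar> + \<bar>h 0\<bar>" using lip[of "u x" 0] by simp
      moreover have "0 \<le> L * \<bar>u x\<bar>" using \<open>0 \<le> L\<close> by simp
      ultimately show "norm (w x) \<le> norm (L * \<bar>u x\<bar> + \<bar>h 0\<bar> * indicator \<Omega> x)"
        by (auto simp: w_def split: split_indicator)
    qed
  qed (simp add: w_def)
  have hG: "integrable lborel (\<lambda>x. h' (u x) *\<^sub>R G x)"
  proof (rule Bochner_Integration.integrable_bound)
    show "integrable lborel (\<lambda>x. L *\<^sub>R G x)" using G by simp
    show "AE x in lborel. norm (h' (u x) *\<^sub>R G x) \<le> norm (L *\<^sub>R G x)"
      using h'_bound \<open>0 \<le> L\<close> by (auto intro!: mult_right_mono)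
  qed simp
  have lev: "AE x in lborel. \<forall>c\<in>Z. x \<in> \<Omega> \<longrightarrow> u x = c \<longrightarrow> G x = 0"
    by (rule AE_ball_countable')
      (use weak_grad_level_set[OF assms(1-3)] \<open>finite Z\<close> in \<open>auto intro: countable_finite\<close>)
  have "(\<integral>x. w x * frechet_derivative \<phi> (at x) v \<partial>lborel) = - (\<integral>x. (h' (u x) *\<^sub>R G x \<bullet> v) * \<phi> x \<partial>lborel)"
    if \<phi>: "test_function \<Omega> \<phi>" for \<phi> v
  proof -
    define K where "K = closure {x. \<phi> x \<noteq> 0}"
    have K: "compact K" "K \<subseteq> \<Omega>" using \<phi> by (auto simp: test_function_def K_def)
    have \<phi>K: "\<phi> x = 0" if "x \<notin> K" for x
      using that closure_subset[of "{x. \<phi> x \<noteq> 0}"] by (auto simp: K_def)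
    have [measurable]: "K \<in> sets borel" using K(1) by (simp add: compact_imp_closed)
    obtain B where B: "0 \<le> B" "\<And>x. \<bar>\<phi> x\<bar> \<le> B" using test_function_bounded[OF \<phi>] by metis
    obtain B' where B': "0 \<le> B'" "\<And>x. \<bar>frechet_derivative \<phi> (at x) v\<bar> \<le> B'"
      using test_function_derivative_bounded[OF \<phi>, of v] by metis
    have [measurable]: "\<phi> \<in> borel_measurable borel" "(\<lambda>x. frechet_derivative \<phi> (at x) v) \<in> borel_measurable borel"
      using \<phi> by (auto intro: test_function_measurable test_function_derivative_measurable)
    define \<tau> where "\<tau> n = inverse (real (Suc n))" for n
    have \<tau>0: "0 < \<tau> n" for n by (simp add: \<tau>_def)
    have \<tau>lim: "\<tau> \<longlonglongrightarrow> 0" unfolding \<tau>_def by (rule LIMSEQ_inverse_real_of_nat)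
    define D where "D n x = (u (x + \<tau> n *\<^sub>R v) - u x) / \<tau> n" for n x
    define F where "F n x = indicator K x * \<bar>D n x - G x \<bullet> v\<bar>" for n x
    have iF: "integrable lborel (F n)" for n
    proof -
      have "integrable lborel (\<lambda>x. \<bar>D n x - G x \<bullet> v\<bar>)"
        unfolding D_def using u G integrable_lborel_shift[OF u] by auto
      from integrable_mult_indicator[OF _ this, of K] show ?thesis unfolding F_def by simp
    qed
    have limF: "(\<lambda>n. \<integral>x. F n x \<partial>lborel) \<longlonglongrightarrow> 0"
      unfolding D_def \<tau>_def F_def by (rule difference_quotient_L1_tendsto[OF assms(1) K wg])
    have nF: "0 \<le> F n x" for n x by (simp add: F_def)
    obtain r W where r: "strict_mono r" and W: "integrable lborel W"
      and lim: "AE x in lborel. (\<lambda>n. F (r n) x) \<longlonglongrightarrow> 0" and dom: "AE x in lborel. \<forall>n. F (r n) x \<le> W x"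
      by (rule L1_null_sequence_subsequence[OF iF nF limF])
    obtain d where d: "d > 0" "\<And>x y. x \<in> K \<Longrightarrow> norm y \<le> d \<Longrightarrow> x + y \<in> \<Omega>"
      using compact_shift_subset[OF K(1) assms(1) K(2)] by blast
    have "(\<lambda>n. \<tau> (r n) *\<^sub>R v) \<longlonglongrightarrow> 0 *\<^sub>R v"
      using LIMSEQ_subseq_LIMSEQ[OF \<tau>lim r] by (intro tendsto_intros) (simp add: o_def)
    then have "(\<lambda>n. \<tau> (r n) *\<^sub>R v) \<longlonglongrightarrow> 0" by simp
    \<comment> \<open>From \<open>N\<close> on, shifts of points of \<open>K\<close> stay in
      \<open>\<Omega>\<close>, where \<open>w\<close> is \<open>h (u x)\<close>; this accounts for
      the index \<open>n + N\<close> below.\<close>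
    from LIMSEQ_D[OF this d(1)] obtain N where N: "\<And>n. n \<ge> N \<Longrightarrow> norm (\<tau> (r n) *\<^sub>R v) < d" by auto
    define q where "q n x = (w (x + \<tau> n *\<^sub>R v) - w x) / \<tau> n * \<phi> x" for n x
    have q_bound: "\<bar>q (r n) x\<bar> \<le> L * \<bar>D (r n) x\<bar> * B * indicator K x" if "n \<ge> N" for n x
    proof (cases "x \<in> K")
      case True
      then have "x \<in> \<Omega>" "x + \<tau> (r n) *\<^sub>R v \<in> \<Omega>"
        using K d(2)[OF True] N[OF that] by auto
      then have "\<bar>q (r n) x\<bar> = \<bar>h (u (x + \<tau> (r n) *\<^sub>R v)) - h (u x)\<bar> / \<tau> (r n) * \<bar>\<phi> x\<bar>"
        using \<tau>0[of "r n"] by (simp add: q_def w_def abs_mult)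
      also have "\<dots> \<le> (L * \<bar>u (x + \<tau> (r n) *\<^sub>R v) - u x\<bar>) / \<tau> (r n) * B"
        using lip \<tau>0[of "r n"] B \<open>0 \<le> L\<close> by (intro mult_mono divide_right_mono) auto
      finally show ?thesis
        using True \<tau>0[of "r n"] by (simp add: D_def)
    qed (simp add: q_def \<phi>K)
    have lim_q: "(\<lambda>n. \<integral>x. q (r (n + N)) x \<partial>lborel) \<longlonglongrightarrow> (\<integral>x. (h' (u x) *\<^sub>R G x \<bullet> v) * \<phi> x \<partial>lborel)"
    proof (rule integral_dominated_convergence[where w = "\<lambda>x. L * B * (W x + \<bar>G x \<bullet> v\<bar>)"])
      show "integrable lborel (\<lambda>x. L * B * (W x + \<bar>G x \<bullet> v\<bar>))" using W G by auto
      show "AE x in lborel. norm (q (r (n + N)) x) \<le> L * B * (W x + \<bar>G x \<bullet> v\<bar>)" for n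
        using dom
      proof eventually_elim
        case (elim x)
        have "indicator K x * \<bar>D (r (n + N)) x\<bar> \<le> F (r (n + N)) x + \<bar>G x \<bullet> v\<bar>"
          by (auto simp: F_def split: split_indicator)
        also have "\<dots> \<le> W x + \<bar>G x \<bullet> v\<bar>" using elim by simp
        finally have "L * B * (indicator K x * \<bar>D (r (n + N)) x\<bar>) \<le> L * B * (W x + \<bar>G x \<bullet> v\<bar>)"
          using \<open>0 \<le> L\<close> B(1) by (intro mult_left_mono) auto
        then show ?case using q_bound[of "n + N" x] by (simp add: mult_ac)
      qed
      show "AE x in lborel. (\<lambda>n. q (r (n + N)) x) \<longlonglongrightarrow> (h' (u x) *\<^sub>R G x \<bullet> v) * \<phi> x"
        using lim lev
      proof eventually_elim
        case (elim x)
        show ?case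
        proof (cases "x \<in> K")
          case False
          then show ?thesis by (simp add: q_def \<phi>K)
        next
          case True
          then have "x \<in> \<Omega>" using K by auto
          have "(\<lambda>n. \<bar>D (r n) x - G x \<bullet> v\<bar>) \<longlonglongrightarrow> 0" using elim(1) True by (simp add: F_def)
          then have "(\<lambda>n. D (r n) x) \<longlonglongrightarrow> G x \<bullet> v"
            by (rule LIM_zero_cancel[OF tendsto_rabs_zero_cancel])
          then have Dlim: "(\<lambda>n. D (r (n + N)) x) \<longlonglongrightarrow> G x \<bullet> v"
            by (rule LIMSEQ_ignore_initial_segment)
          show ?thesis
          proof (cases "u x \<in> Z")
            case True
            then have G0: "G x = 0" using elim(2) \<open>x \<in> \<Omega>\<close> by blast
            have "(\<lambda>n. q (r (n + N)) x) \<longlonglongrightarrow> 0"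
            proof (rule Lim_null_comparison)
              show "\<forall>\<^sub>F n in sequentially. norm (q (r (n + N)) x) \<le> L * \<bar>D (r (n + N)) x\<bar> * B * indicator K x"
                using q_bound by simp
              have "(\<lambda>n. L * \<bar>D (r (n + N)) x\<bar> * B * indicator K x) \<longlonglongrightarrow> L * \<bar>G x \<bullet> v\<bar> * B * indicator K x"
                by (intro tendsto_intros Dlim)
              then show "(\<lambda>n. L * \<bar>D (r (n + N)) x\<bar> * B * indicator K x) \<longlonglongrightarrow> 0" using G0 by simp
            qed
            then show ?thesis using G0 by simp
          next
            case False
            define s where "s n = \<tau> (r (n + N))" for n
            define y where "y n = u (x + s n *\<^sub>R v)" for n
            \<comment> \<open>The difference quotient of \<open>h\<close> at \<open>u x\<close>,
              filled in continuously. It takes care of the indices with \<open>y n = u x\<close>,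
              where the plain quotient would divide by 0.\<close>
            define k where "k = (\<lambda>t. if t = u x then h' (u x) else (h t - h (u x)) / (t - u x))"
            have s0: "s n \<noteq> 0" for n using \<tau>0 less_irrefl s_def by metis
            have slim: "s \<longlonglongrightarrow> 0"
              unfolding s_def using LIMSEQ_ignore_initial_segment[OF LIMSEQ_subseq_LIMSEQ[OF \<tau>lim r], of N]
              by (simp add: o_def)
            have Dy: "D (r (n + N)) x = (y n - u x) / s n" for n
              by (simp add: D_def y_def s_def)
            have "(\<lambda>n. D (r (n + N)) x * s n + u x) \<longlonglongrightarrow> (G x \<bullet> v) * 0 + u x"
              by (intro tendsto_intros Dlim slim)
            moreover have "D (r (n + N)) x * s n + u x = y n" for n
              using s0 by (simp add: Dy)
            ultimately have ylim: "y \<longlonglongrightarrow> u x" by simp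
            have "isCont k (u x)"
            proof -
              have "((\<lambda>t. (h t - h (u x)) / (t - u x)) \<longlongrightarrow> h' (u x)) (at (u x))"
                using der[OF False] by (simp add: has_field_derivative_iff)
              then have "(k \<longlongrightarrow> h' (u x)) (at (u x))"
                by (rule Lim_transform_eventually) (auto simp: k_def eventually_at_filter)
              then show ?thesis by (simp add: isCont_def k_def)
            qed
            then have klim: "(\<lambda>n. k (y n)) \<longlonglongrightarrow> h' (u x)"
              using isCont_tendsto_compose[OF _ ylim, of k] by (simp add: k_def)
            have "(\<lambda>n. k (y n) * D (r (n + N)) x * \<phi> x) \<longlonglongrightarrow> h' (u x) * (G x \<bullet> v) * \<phi> x"
              by (intro tendsto_intros klim Dlim)
            moreover have "k (y n) * D (r (n + N)) x * \<phi> x = q (r (n + N)) x" for n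
            proof -
              have "x + s n *\<^sub>R v \<in> \<Omega>"
                unfolding s_def using d(2)[OF \<open>x \<in> K\<close>] N[of "n + N"] by auto
              then have "q (r (n + N)) x = (h (y n) - h (u x)) / s n * \<phi> x"
                using \<open>x \<in> \<Omega>\<close> by (simp add: q_def w_def y_def s_def)
              moreover have "k (y n) * (y n - u x) = h (y n) - h (u x)"
                by (simp add: k_def)
              ultimately show ?thesis by (simp add: Dy)
            qed
            ultimately show ?thesis by simp
          qed
        qed
      qed
      show "(\<lambda>x. q (r (n + N)) x) \<in> borel_measurable lborel" for n
        unfolding q_def w_def by measurable
    qed (use hG G in measurable)
    \<comment> \<open>Discrete integration by parts: a translation of the variable moves the
      difference quotient from \<open>w\<close> to \<open>\<phi>\<close>.\<close>
    have q_int: "(\<integral>x. q n x \<partial>lborel) = - (\<integral>x. w x * ((\<phi> x - \<phi> (x - \<tau> n *\<^sub>R v)) / \<tau> n) \<partial>lborel)" for n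
    proof -
      have i: "integrable lborel (\<lambda>x. w (x + \<tau> n *\<^sub>R v) * \<phi> x)" "integrable lborel (\<lambda>x. w x * \<phi> x)"
        "integrable lborel (\<lambda>x. w x * \<phi> (x - \<tau> n *\<^sub>R v))"
        using B by (auto intro!: integrable_mult_bounded[where B = B] integrable_lborel_shift w)
      have sh: "(\<integral>x. w (x + \<tau> n *\<^sub>R v) * \<phi> x \<partial>lborel) = (\<integral>x. w x * \<phi> (x - \<tau> n *\<^sub>R v) \<partial>lborel)"
        using integral_lborel_shift[of "\<lambda>x. w x * \<phi> (x - \<tau> n *\<^sub>R v)" "\<tau> n *\<^sub>R v"] w by simp
      have "(\<integral>x. q n x \<partial>lborel) = (\<integral>x. (w (x + \<tau> n *\<^sub>R v) * \<phi> x - w x * \<phi> x) / \<tau> n \<partial>lborel)"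
        by (simp add: q_def algebra_simps)
      also have "\<dots> = ((\<integral>x. w x * \<phi> (x - \<tau> n *\<^sub>R v) \<partial>lborel) - (\<integral>x. w x * \<phi> x \<partial>lborel)) / \<tau> n"
        using i sh by simp
      also have "\<dots> = - (\<integral>x. (w x * \<phi> x - w x * \<phi> (x - \<tau> n *\<^sub>R v)) / \<tau> n \<partial>lborel)"
        using i by (simp add: minus_divide_left)
      finally show ?thesis
        by (simp add: right_diff_distrib)
    qed
    have "(\<lambda>n. \<integral>x. w x * ((\<phi> x - \<phi> (x - \<tau> (r (n + N)) *\<^sub>R v)) / \<tau> (r (n + N))) \<partial>lborel) \<longlonglongrightarrow>
        (\<integral>x. w x * frechet_derivative \<phi> (at x) v \<partial>lborel)"
    proof (rule integral_dominated_convergence[where w = "\<lambda>x. \<bar>w x\<bar> * B'"])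
      show "integrable lborel (\<lambda>x. \<bar>w x\<bar> * B')" using w by simp
      show "AE x in lborel. norm (w x * ((\<phi> x - \<phi> (x - \<tau> (r (n + N)) *\<^sub>R v)) / \<tau> (r (n + N)))) \<le> \<bar>w x\<bar> * B'" for n
      proof (rule AE_I2)
        fix x
        have "\<bar>(\<phi> x - \<phi> (x - \<tau> (r (n + N)) *\<^sub>R v)) / \<tau> (r (n + N))\<bar> \<le> B'"
          by (rule test_function_difference_quotient_bound[OF \<phi> B'(2)]) (use \<tau>0[of "r (n + N)"] in simp)
        then show "norm (w x * ((\<phi> x - \<phi> (x - \<tau> (r (n + N)) *\<^sub>R v)) / \<tau> (r (n + N)))) \<le> \<bar>w x\<bar> * B'"
          unfolding real_norm_def abs_mult[of "w x"] by (intro mult_left_mono) auto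
      qed
      show "AE x in lborel. (\<lambda>n. w x * ((\<phi> x - \<phi> (x - \<tau> (r (n + N)) *\<^sub>R v)) / \<tau> (r (n + N)))) \<longlonglongrightarrow>
          w x * frechet_derivative \<phi> (at x) v"
      proof (intro AE_I2 tendsto_mult tendsto_const)
        fix x
        show "(\<lambda>n. (\<phi> x - \<phi> (x - \<tau> (r (n + N)) *\<^sub>R v)) / \<tau> (r (n + N))) \<longlonglongrightarrow> frechet_derivative \<phi> (at x) v"
          using LIMSEQ_ignore_initial_segment[OF LIMSEQ_subseq_LIMSEQ[OF
                test_function_difference_quotient[OF \<phi>, of x v] r], of N]
          by (simp add: \<tau>_def o_def del: of_nat_Suc)
      qed
    qed (use w in measurable)
    then have "(\<lambda>n. - (\<integral>x. q (r (n + N)) x \<partial>lborel)) \<longlonglongrightarrow>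
        (\<integral>x. w x * frechet_derivative \<phi> (at x) v \<partial>lborel)"
      by (simp add: q_int)
    then show ?thesis
      by (rule LIMSEQ_unique[OF _ tendsto_minus[OF lim_q]])
  qed
  then show ?thesis
    using w hG by (simp add: weak_grad_def w_def)
qed

subsection \<open>Borel versions\<close>

text \<open>Translations and Fubini are applied to Borel functions on the whole space, whereas the
  Sobolev classes consist of Lebesgue measurable functions on \<open>\<Omega>\<close>. Vanishing
  outside \<open>\<Omega>\<close> turns integrals over \<open>\<Omega>\<close> into integrals over
  the space.\<close>

definition borel_version :: "'a::euclidean_space set \<Rightarrow> ('a \<Rightarrow> 'b::euclidean_space) \<Rightarrow> ('a \<Rightarrow> 'b) \<Rightarrow> bool" where
  "borel_version \<Omega> g g' \<longleftrightarrow> g' \<in> borel_measurable borel \<and> (\<forall>x. x \<notin> \<Omega> \<longrightarrow> g' x = 0) \<and>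
     (AE x in lborel. x \<in> \<Omega> \<longrightarrow> g x = g' x)"

lemma AE_lebesgue_onI:
  assumes "open \<Omega>" and "AE x in lborel. x \<in> \<Omega> \<longrightarrow> P x"
  shows "AE x in lebesgue_on \<Omega>. P x"
  using assms by (subst AE_restrict_space_iff) (auto intro: AE_completion)

lemma ex_borel_version_real:
  fixes g :: "'a::euclidean_space \<Rightarrow> real"
  assumes "open \<Omega>" and g: "g \<in> borel_measurable (lebesgue_on \<Omega>)"
  shows "\<exists>g'. borel_version \<Omega> g g'"
proof -
  have [measurable]: "\<Omega> \<in> sets borel" using assms(1) by simp
  have "(\<lambda>x. indicator \<Omega> x *\<^sub>R g x) \<in> borel_measurable lebesgue"
    using g by (subst (asm) borel_measurable_restrict_space_iff) auto
  from completion_ex_borel_measurable_real[OF this]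
  obtain k where k: "k \<in> borel_measurable lborel" "AE x in lborel. indicator \<Omega> x *\<^sub>R g x = k x" by blast
  have "AE x in lborel. x \<in> \<Omega> \<longrightarrow> g x = indicator \<Omega> x * k x"
    using k(2) by eventually_elim auto
  moreover have "(\<lambda>x. indicator \<Omega> x * k x) \<in> borel_measurable borel" using k(1) by measurable
  ultimately show ?thesis
    unfolding borel_version_def by (intro exI[of _ "\<lambda>x. indicator \<Omega> x * k x"]) auto
qed

lemma ex_borel_version:
  fixes g :: "'a::euclidean_space \<Rightarrow> 'b::euclidean_space"
  assumes "open \<Omega>" and g: "g \<in> borel_measurable (lebesgue_on \<Omega>)"
  shows "\<exists>g'. borel_version \<Omega> g g'"
proof -
  have "\<forall>i. \<exists>k. borel_version \<Omega> (\<lambda>x. g x \<bullet> i) k"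
    using g by (intro allI ex_borel_version_real[OF assms(1)] borel_measurable_inner) auto
  then obtain k where k: "\<And>i. borel_version \<Omega> (\<lambda>x. g x \<bullet> i) (k i)" by metis
  have "AE x in lborel. \<forall>i\<in>Basis. x \<in> \<Omega> \<longrightarrow> g x \<bullet> i = k i x"
    by (rule AE_ball_countable') (use k in \<open>auto simp: borel_version_def intro: countable_finite\<close>)
  then have "AE x in lborel. x \<in> \<Omega> \<longrightarrow> g x = (\<Sum>i\<in>Basis. k i x *\<^sub>R i)"
    by eventually_elim (metis (no_types, lifting) euclidean_representation sum.cong)
  moreover have "(\<lambda>x. \<Sum>i\<in>Basis. k i x *\<^sub>R i) \<in> borel_measurable borel"
  proof -
    have [measurable]: "k i \<in> borel_measurable borel" for i
      using k by (simp add: borel_version_def)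
    show ?thesis by measurable
  qed
  ultimately show ?thesis
    using k unfolding borel_version_def
    by (intro exI[of _ "\<lambda>x. \<Sum>i\<in>Basis. k i x *\<^sub>R i"]) auto
qed

lemma borel_version_measurable:
  "borel_version \<Omega> g g' \<Longrightarrow> g' \<in> borel_measurable borel"
  by (simp add: borel_version_def)

lemma borel_version_AE: "open \<Omega> \<Longrightarrow> borel_version \<Omega> g g' \<Longrightarrow> AE x in lebesgue_on \<Omega>. g x = g' x"
  by (intro AE_lebesgue_onI) (auto simp: borel_version_def)

lemma measurable_lebesgue_on_if_borel:
  "f \<in> borel_measurable borel \<Longrightarrow> f \<in> borel_measurable (lebesgue_on \<Omega>)"
  by (intro measurable_restrict_space1 measurable_completion) simp

lemma indicator_borel_version:
  "borel_version \<Omega> g g' \<Longrightarrow> indicator \<Omega> x *\<^sub>R g' x = g' x"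
  by (auto simp: borel_version_def split: split_indicator)

lemma borel_version_integrable:
  fixes g :: "'a::euclidean_space \<Rightarrow> 'b::euclidean_space"
  assumes "open \<Omega>" "borel_version \<Omega> g g'" "g \<in> borel_measurable (lebesgue_on \<Omega>)"
  shows "integrable (lebesgue_on \<Omega>) g \<longleftrightarrow> integrable lborel g'"
proof -
  have m: "g' \<in> borel_measurable borel" by (rule borel_version_measurable[OF assms(2)])
  have "integrable (lebesgue_on \<Omega>) g \<longleftrightarrow> integrable (lebesgue_on \<Omega>) g'"
    by (rule integrable_cong_AE[OF assms(3) measurable_lebesgue_on_if_borel[OF m] borel_version_AE[OF assms(1,2)]])
  also have "\<dots> \<longleftrightarrow> integrable lebesgue g'"
    using assms(1) by (subst integrable_restrict_space) (auto simp: indicator_borel_version[OF assms(2)])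
  also have "\<dots> \<longleftrightarrow> integrable lborel g'"
    using m by (intro integrable_completion) simp
  finally show ?thesis .
qed

lemma borel_version_integral:
  fixes g :: "'a::euclidean_space \<Rightarrow> 'b::euclidean_space"
  assumes "open \<Omega>" "borel_version \<Omega> g g'" "g \<in> borel_measurable (lebesgue_on \<Omega>)"
  shows "(\<integral>x. g x \<partial>lebesgue_on \<Omega>) = (\<integral>x. g' x \<partial>lborel)"
proof -
  have m: "g' \<in> borel_measurable borel" by (rule borel_version_measurable[OF assms(2)])
  have "(\<integral>x. g x \<partial>lebesgue_on \<Omega>) = (\<integral>x. g' x \<partial>lebesgue_on \<Omega>)"
    by (rule integral_cong_AE[OF assms(3) measurable_lebesgue_on_if_borel[OF m] borel_version_AE[OF assms(1,2)]])
  also have "\<dots> = (\<integral>x. g' x \<partial>lebesgue)"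
    using assms(1) by (subst integral_restrict_space) (auto simp: indicator_borel_version[OF assms(2)])
  also have "\<dots> = (\<integral>x. g' x \<partial>lborel)"
    using m by (intro integral_completion) simp
  finally show ?thesis .
qed

lemma locally_integrable_if_integrable:
  fixes g :: "'a::euclidean_space \<Rightarrow> 'b::euclidean_space"
  assumes "open \<Omega>" "integrable (lebesgue_on \<Omega>) g"
  shows "locally_integrable \<Omega> g"
  unfolding locally_integrable_def
proof (intro allI impI)
  fix K assume K: "compact K \<and> K \<subseteq> \<Omega>"
  then have [measurable]: "K \<in> sets borel" by (simp add: compact_imp_closed)
  have "integrable lebesgue (\<lambda>x. indicator \<Omega> x *\<^sub>R g x)"
    using assms by (subst (asm) integrable_restrict_space) auto
  from integrable_mult_indicator[OF _ this, of K]
  have "integrable lebesgue (\<lambda>x. indicator K x *\<^sub>R indicator \<Omega> x *\<^sub>R g x)" by simp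
  moreover have "(\<lambda>x. indicator K x *\<^sub>R indicator \<Omega> x *\<^sub>R g x) = (\<lambda>x. indicator K x *\<^sub>R g x)"
    using K by (auto simp: fun_eq_iff split: split_indicator)
  ultimately have "integrable lebesgue (\<lambda>x. indicator K x *\<^sub>R g x)"
    by (simp only:)
  then show "integrable (lebesgue_on K) g"
    by (subst integrable_restrict_space) auto
qed

text \<open>Along a compact exhaustion of \<open>\<Omega>\<close> the functions cut off to the
  compact sets are measurable and converge pointwise.\<close>

lemma locally_integrable_measurable:
  fixes g :: "'a::euclidean_space \<Rightarrow> 'b::euclidean_space"
  assumes "open \<Omega>" "locally_integrable \<Omega> g"
  shows "g \<in> borel_measurable (lebesgue_on \<Omega>)"
proof -
  obtain C where C: "\<And>n. compact (C n)" "\<And>n. C n \<subseteq> \<Omega>" "\<And>n. C n \<subseteq> interior (C (Suc n))" "\<Union>(range C) = \<Omega>"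
    using open_Union_compact_subsets[OF assms(1)] by metis
  have mono: "m \<le> n \<Longrightarrow> C m \<subseteq> C n" for m n
    by (rule lift_Suc_mono_le[of C]) (use C(3) interior_subset in blast)+
  have "(\<lambda>x. indicator \<Omega> x *\<^sub>R g x) \<in> borel_measurable lebesgue"
  proof (rule borel_measurable_LIMSEQ_metric)
    fix n
    have "integrable (lebesgue_on (C n)) g"
      using assms(2) C by (auto simp: locally_integrable_def)
    then have "g \<in> borel_measurable (lebesgue_on (C n))" by auto
    then show "(\<lambda>x. indicator (C n) x *\<^sub>R g x) \<in> borel_measurable lebesgue"
      using C(1)[of n] by (subst (asm) borel_measurable_restrict_space_iff) (auto simp: compact_imp_closed)
  next
    fix x :: 'a
    show "(\<lambda>n. indicator (C n) x *\<^sub>R g x) \<longlonglongrightarrow> indicator \<Omega> x *\<^sub>R g x"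
    proof (cases "x \<in> \<Omega>")
      case True
      then obtain m where "x \<in> C m" using C(4) by auto
      then have "\<forall>\<^sub>F n in sequentially. indicator (C n) x *\<^sub>R g x = indicator \<Omega> x *\<^sub>R g x"
        using mono True by (intro eventually_sequentiallyI[of m]) (auto split: split_indicator)
      then show ?thesis by (rule tendsto_eventually)
    next
      case False
      then have "x \<notin> C n" for n using C(2) by auto
      with False show ?thesis by simp
    qed
  qed
  then show ?thesis
    using assms(1) by (subst borel_measurable_restrict_space_iff) auto
qed

text \<open>Each component of \<open>G - H\<close> annihilates all test functions. It is only
  locally integrable, so the hypothesis of the fundamental lemma is verified box by box on a Borel
  version.\<close>

lemma has_weak_gradient_unique:
  fixes \<Omega> :: "'a::euclidean_space set"
  assumes "open \<Omega>" and h1: "has_weak_gradient \<Omega> u G" and h2: "has_weak_gradient \<Omega> u H"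
  shows "AE x in lebesgue_on \<Omega>. G x = H x"
proof -
  have loc: "locally_integrable \<Omega> G" "locally_integrable \<Omega> H"
    using h1 h2 by (auto simp: has_weak_gradient_def)
  have G: "G \<in> borel_measurable (lebesgue_on \<Omega>)" and H: "H \<in> borel_measurable (lebesgue_on \<Omega>)"
    using loc locally_integrable_measurable[OF assms(1)] by auto
  have "AE x in lborel. x \<in> \<Omega> \<longrightarrow> (G x - H x) \<bullet> i = 0" if i: "i \<in> Basis" for i
  proof -
    define k where "k x = (G x - H x) \<bullet> i" for x
    have km: "k \<in> borel_measurable (lebesgue_on \<Omega>)" unfolding k_def using G H by simp
    then obtain k' where k': "borel_version \<Omega> k k'" using ex_borel_version[OF assms(1)] by blast
    have [measurable]: "k' \<in> borel_measurable borel" by (rule borel_version_measurable[OF k'])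
    have "AE x in lborel. x \<in> \<Omega> \<longrightarrow> k' x = 0"
    proof (rule fundamental_lemma[OF assms(1)])
      fix a d assume ad: "cbox a d \<subseteq> \<Omega>"
      have "integrable (lebesgue_on (cbox a d)) k"
        unfolding k_def using loc ad by (auto simp: locally_integrable_def)
      then have ik: "integrable lebesgue (\<lambda>x. indicator (cbox a d) x *\<^sub>R k x)"
        by (subst (asm) integrable_restrict_space) auto
      have "AE x in lebesgue. indicator (cbox a d) x *\<^sub>R k x = indicator (cbox a d) x * k' x"
      proof (rule AE_completion)
        have "AE x in lborel. x \<in> \<Omega> \<longrightarrow> k x = k' x" using k' by (simp add: borel_version_def)
        then show "AE x in lborel. indicator (cbox a d) x *\<^sub>R k x = indicator (cbox a d) x * k' x"
          by eventually_elim (use ad in \<open>auto split: split_indicator\<close>)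
      qed
      moreover have "(\<lambda>x. indicator (cbox a d) x * k' x) \<in> borel_measurable lborel" by measurable
      ultimately have "integrable lebesgue (\<lambda>x. indicator (cbox a d) x * k' x)"
        using ik by (subst (asm) integrable_cong_AE[OF borel_measurable_integrable[OF ik]])
            (auto intro: measurable_completion)
      then show "integrable lborel (\<lambda>x. indicator (cbox a d) x * k' x)"
        by (subst (asm) integrable_completion) auto
    next
      fix \<phi> assume \<phi>: "test_function \<Omega> \<phi>"
      define K where "K = closure {x. \<phi> x \<noteq> 0}"
      have K: "compact K" "K \<subseteq> \<Omega>" using \<phi> by (auto simp: test_function_def K_def)
      have \<phi>K: "\<phi> x = 0" if "x \<notin> K" for x
        using that closure_subset[of "{x. \<phi> x \<noteq> 0}"] by (auto simp: K_def)
      obtain B where B: "\<And>x. \<bar>\<phi> x\<bar> \<le> B" using test_function_bounded[OF \<phi>] by metis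
      have m\<phi>: "\<phi> \<in> borel_measurable (lebesgue_on S)" for S
        using \<phi> by (intro measurable_lebesgue_on_if_borel test_function_measurable)
      have int: "integrable (lebesgue_on \<Omega>) (\<lambda>x. (F x \<bullet> i) * \<phi> x)" if "locally_integrable \<Omega> F" for F
      proof -
        have "integrable (lebesgue_on K) F" using that K by (auto simp: locally_integrable_def)
        then have "integrable (lebesgue_on K) (\<lambda>x. (F x \<bullet> i) * \<phi> x)"
          by (intro integrable_mult_bounded[OF _ m\<phi> B]) auto
        then have "integrable lebesgue (\<lambda>x. indicator K x *\<^sub>R ((F x \<bullet> i) * \<phi> x))"
          using K(1) by (subst (asm) integrable_restrict_space) (auto simp: compact_imp_closed)
        also have "(\<lambda>x. indicator K x *\<^sub>R ((F x \<bullet> i) * \<phi> x)) = (\<lambda>x. indicator \<Omega> x *\<^sub>R ((F x \<bullet> i) * \<phi> x))"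
          using K(2) \<phi>K by (auto simp: fun_eq_iff split: split_indicator)
        finally show ?thesis
          using assms(1) by (subst integrable_restrict_space) auto
      qed
      have e1: "(\<integral>x. u x * frechet_derivative \<phi> (at x) i \<partial>lebesgue_on \<Omega>) =
          - (\<integral>x. (G x \<bullet> i) * \<phi> x \<partial>lebesgue_on \<Omega>)"
        using h1 \<phi> i unfolding has_weak_gradient_def by blast
      have e2: "(\<integral>x. u x * frechet_derivative \<phi> (at x) i \<partial>lebesgue_on \<Omega>) =
          - (\<integral>x. (H x \<bullet> i) * \<phi> x \<partial>lebesgue_on \<Omega>)"
        using h2 \<phi> i unfolding has_weak_gradient_def by blast
      have "(\<integral>x. (G x \<bullet> i) * \<phi> x \<partial>lebesgue_on \<Omega>) = (\<integral>x. (H x \<bullet> i) * \<phi> x \<partial>lebesgue_on \<Omega>)"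
        using e1 e2 by linarith
      then have k0: "(\<integral>x. k x * \<phi> x \<partial>lebesgue_on \<Omega>) = 0"
        using int loc by (simp add: k_def inner_diff_left left_diff_distrib)
      have "borel_version \<Omega> (\<lambda>x. k x * \<phi> x) (\<lambda>x. k' x * \<phi> x)"
        using k' test_function_measurable[OF \<phi>] by (auto simp: borel_version_def elim!: AE_mp)
      from borel_version_integral[OF assms(1) this borel_measurable_times[OF km m\<phi>]] k0
      show "(\<integral>x. k' x * \<phi> x \<partial>lborel) = 0" by simp
    qed
    moreover have "AE x in lborel. x \<in> \<Omega> \<longrightarrow> k x = k' x" using k' by (simp add: borel_version_def)
    ultimately show ?thesis by eventually_elim (simp add: k_def)
  qed
  then have "AE x in lborel. \<forall>i\<in>Basis. x \<in> \<Omega> \<longrightarrow> (G x - H x) \<bullet> i = 0"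
    by (intro AE_ball_countable') (auto intro: countable_finite)
  then have "AE x in lborel. x \<in> \<Omega> \<longrightarrow> G x = H x"
    by eventually_elim (metis euclidean_all_zero_iff right_minus_eq)
  then show ?thesis by (rule AE_lebesgue_onI[OF assms(1)])
qed

text \<open>The two notions differ in the directions tested, basis vectors on one side and all
  \<open>v\<close> on the other; linearity of the derivative and of the inner product closes this
  gap.\<close>

lemma has_weak_gradient_iff_weak_grad:
  fixes \<Omega> :: "'a::euclidean_space set"
  assumes "open \<Omega>" and u: "integrable (lebesgue_on \<Omega>) u" and G: "integrable (lebesgue_on \<Omega>) G"
    and vu: "borel_version \<Omega> u u'" and vG: "borel_version \<Omega> G G'"
  shows "has_weak_gradient \<Omega> u G \<longleftrightarrow> weak_grad \<Omega> u' G'"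
proof -
  have u': "integrable lborel u'" and G': "integrable lborel G'"
    using borel_version_integrable[OF assms(1) vu] borel_version_integrable[OF assms(1) vG] u G by auto
  have um: "u \<in> borel_measurable (lebesgue_on \<Omega>)" and Gm: "G \<in> borel_measurable (lebesgue_on \<Omega>)"
    using u G by auto
  have eq1: "(\<integral>x. u x * frechet_derivative \<phi> (at x) v \<partial>lebesgue_on \<Omega>) =
      (\<integral>x. u' x * frechet_derivative \<phi> (at x) v \<partial>lborel)" if \<phi>: "test_function \<Omega> \<phi>" for \<phi> v
  proof (rule borel_version_integral[OF assms(1)])
    show "borel_version \<Omega> (\<lambda>x. u x * frechet_derivative \<phi> (at x) v) (\<lambda>x. u' x * frechet_derivative \<phi> (at x) v)"
      using vu test_function_derivative_measurable[OF \<phi>, of v] by (auto simp: borel_version_def elim!: AE_mp)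
    show "(\<lambda>x. u x * frechet_derivative \<phi> (at x) v) \<in> borel_measurable (lebesgue_on \<Omega>)"
      using um measurable_lebesgue_on_if_borel[OF test_function_derivative_measurable[OF \<phi>, of v]] by simp
  qed
  have eq2: "(\<integral>x. (G x \<bullet> v) * \<phi> x \<partial>lebesgue_on \<Omega>) = (\<integral>x. (G' x \<bullet> v) * \<phi> x \<partial>lborel)"
    if \<phi>: "test_function \<Omega> \<phi>" for \<phi> v
  proof (rule borel_version_integral[OF assms(1)])
    show "borel_version \<Omega> (\<lambda>x. (G x \<bullet> v) * \<phi> x) (\<lambda>x. (G' x \<bullet> v) * \<phi> x)"
      using vG test_function_measurable[OF \<phi>] by (auto simp: borel_version_def elim!: AE_mp)
    show "(\<lambda>x. (G x \<bullet> v) * \<phi> x) \<in> borel_measurable (lebesgue_on \<Omega>)"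
      using Gm measurable_lebesgue_on_if_borel[OF test_function_measurable[OF \<phi>]] by simp
  qed
  show ?thesis
  proof
    assume wg: "weak_grad \<Omega> u' G'"
    then show "has_weak_gradient \<Omega> u G"
      using eq1 eq2 u G by (auto simp: has_weak_gradient_def weak_grad_def
          intro!: locally_integrable_if_integrable[OF assms(1)])
  next
    assume hw: "has_weak_gradient \<Omega> u G"
    show "weak_grad \<Omega> u' G'"
      unfolding weak_grad_def
    proof (intro conjI allI impI u' G')
      fix \<phi> :: "'a \<Rightarrow> real" and v assume \<phi>: "test_function \<Omega> \<phi>"
      obtain B where B: "\<And>x. \<bar>\<phi> x\<bar> \<le> B" using test_function_bounded[OF \<phi>] by metis
      have i1: "integrable lborel (\<lambda>x. u' x * frechet_derivative \<phi> (at x) i)" for i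
      proof -
        obtain B' where "\<And>x. \<bar>frechet_derivative \<phi> (at x) i\<bar> \<le> B'"
          using test_function_derivative_bounded[OF \<phi>, of i] by metis
        then show ?thesis
          using test_function_derivative_measurable[OF \<phi>, of i] by (intro integrable_mult_bounded[OF u']) auto
      qed
      have i2: "integrable lborel (\<lambda>x. (G' x \<bullet> i) * \<phi> x)" for i
        using G' B test_function_measurable[OF \<phi>] by (intro integrable_mult_bounded) auto
      have "(\<integral>x. u' x * frechet_derivative \<phi> (at x) v \<partial>lborel) =
          (\<integral>x. (\<Sum>i\<in>Basis. (v \<bullet> i) * (u' x * frechet_derivative \<phi> (at x) i)) \<partial>lborel)"
        by (subst test_function_derivative_sum[OF \<phi>]) (simp add: sum_distrib_left mult.left_commute)
      also have "\<dots> = (\<Sum>i\<in>Basis. (v \<bullet> i) * (\<integral>x. u' x * frechet_derivative \<phi> (at x) i \<partial>lborel))"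
        using i1 by (subst Bochner_Integration.integral_sum) auto
      also have "\<dots> = (\<Sum>i\<in>Basis. (v \<bullet> i) * - (\<integral>x. (G' x \<bullet> i) * \<phi> x \<partial>lborel))"
        using hw \<phi> eq1[OF \<phi>] eq2[OF \<phi>] by (intro sum.cong) (auto simp: has_weak_gradient_def)
      also have "\<dots> = - (\<integral>x. (\<Sum>i\<in>Basis. (v \<bullet> i) * ((G' x \<bullet> i) * \<phi> x)) \<partial>lborel)"
        using i2 by (subst Bochner_Integration.integral_sum) (auto simp: sum_negf)
      also have "(\<lambda>x. \<Sum>i\<in>Basis. (v \<bullet> i) * ((G' x \<bullet> i) * \<phi> x)) = (\<lambda>x. (G' x \<bullet> v) * \<phi> x)"
        by (simp add: euclidean_inner[of _ v] sum_distrib_left sum_distrib_right mult_ac fun_eq_iff)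
      finally show "(\<integral>x. u' x * frechet_derivative \<phi> (at x) v \<partial>lborel) = - (\<integral>x. (G' x \<bullet> v) * \<phi> x \<partial>lborel)" .
    qed
  qed
qed

subsection \<open>The variable exponent Sobolev space\<close>

lemma powr_add_le:
  fixes a b r P :: real
  assumes "0 \<le> r" "r \<le> P"
  shows "\<bar>a + b\<bar> powr r \<le> 2 powr P * (\<bar>a\<bar> powr r + \<bar>b\<bar> powr r)"
proof -
  let ?m = "max \<bar>a\<bar> \<bar>b\<bar>"
  have "\<bar>a + b\<bar> powr r \<le> (2 * ?m) powr r"
    using assms by (intro powr_mono2) auto
  also have "\<dots> = 2 powr r * ?m powr r" by (simp add: powr_mult)
  also have "\<dots> \<le> 2 powr P * (\<bar>a\<bar> powr r + \<bar>b\<bar> powr r)"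
    using assms by (intro mult_mono powr_mono) (auto simp: max_def)
  finally show ?thesis .
qed

lemma le_1_plus_powr: "\<bar>a\<bar> \<le> 1 + \<bar>a\<bar> powr r" if "1 \<le> r" for a r :: real
proof (cases "\<bar>a\<bar> \<le> 1")
  case False
  then have "\<bar>a\<bar> powr 1 \<le> \<bar>a\<bar> powr r" using that by (intro powr_mono) auto
  with False show ?thesis by simp
qed (simp add: add_increasing2)

text \<open>The exponent is handled through its measurability and two bounds: \<open>P\<close>
  supplies the constants for sums and multiples, \<open>p0 > 1\<close> supplies integrability and
  later uniform integrability.\<close>

locale var_exponent =
  fixes \<Omega> :: "'a::euclidean_space set" and p :: "'a \<Rightarrow> real" and p0 P :: real
  assumes open_dom: "open \<Omega>" and bounded_dom: "bounded \<Omega>"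
    and p_measurable [measurable]: "p \<in> borel_measurable (lebesgue_on \<Omega>)"
    and p0_gt_1: "1 < p0" and p_bounds: "\<And>x. x \<in> \<Omega> \<Longrightarrow> p0 \<le> p x \<and> p x \<le> P"
begin

abbreviation "M \<equiv> lebesgue_on \<Omega>"
abbreviation "W \<equiv> W1p_var \<Omega> p"
abbreviation "grad \<equiv> weak_gradient \<Omega>"

lemma finite_measure_M: "finite_measure M"
proof
  have "\<Omega> \<in> lmeasurable"
    using open_dom bounded_dom by (rule lmeasurable_open[rotated])
  then show "emeasure M (space M) \<noteq> \<infinity>"
    by (auto simp: emeasure_restrict_space fmeasurable_def)
qed

lemma integrable_M_const [simp]: "integrable M (\<lambda>x. c :: real)"
  using finite_measure.integrable_const[OF finite_measure_M] .

section \<open>Domination and linear structure of the variable exponent Lebesgue space\<close>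

lemma Lp_dominated:
  assumes v: "v \<in> Lp_var \<Omega> p" and [measurable]: "u \<in> borel_measurable M"
    and le: "AE x in M. \<bar>u x\<bar> \<le> \<bar>v x\<bar>"
  shows "u \<in> Lp_var \<Omega> p"
proof -
  have "integrable M (\<lambda>x. \<bar>u x\<bar> powr p x)"
  proof (rule Bochner_Integration.integrable_bound)
    show "integrable M (\<lambda>x. \<bar>v x\<bar> powr p x)" using v by (simp add: Lp_var_def)
    show "AE x in M. norm (\<bar>u x\<bar> powr p x) \<le> norm (\<bar>v x\<bar> powr p x)"
      using le AE_space
    proof eventually_elim
      case (elim x)
      then have "0 \<le> p x" using p_bounds[of x] p0_gt_1 by auto
      with elim show ?case by (auto intro!: powr_mono2)
    qed
  qed measurable
  then show ?thesis by (simp add: Lp_var_def)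
qed

lemma Lp_add:
  assumes "u \<in> Lp_var \<Omega> p" "v \<in> Lp_var \<Omega> p"
  shows "(\<lambda>x. u x + v x) \<in> Lp_var \<Omega> p"
proof -
  have [measurable]: "u \<in> borel_measurable M" "v \<in> borel_measurable M"
    using assms by (auto simp: Lp_var_def)
  have "integrable M (\<lambda>x. \<bar>u x + v x\<bar> powr p x)"
  proof (rule Bochner_Integration.integrable_bound)
    show "integrable M (\<lambda>x. 2 powr P * (\<bar>u x\<bar> powr p x + \<bar>v x\<bar> powr p x))"
      using assms by (simp add: Lp_var_def)
    show "AE x in M. norm (\<bar>u x + v x\<bar> powr p x) \<le> norm (2 powr P * (\<bar>u x\<bar> powr p x + \<bar>v x\<bar> powr p x))"
    proof (rule AE_I2)
      fix x assume "x \<in> space M"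
      then have "0 \<le> p x" "p x \<le> P" using p_bounds[of x] p0_gt_1 by auto
      then show "norm (\<bar>u x + v x\<bar> powr p x) \<le> norm (2 powr P * (\<bar>u x\<bar> powr p x + \<bar>v x\<bar> powr p x))"
        using powr_add_le[of "p x" P "u x" "v x"] by simp
    qed
  qed measurable
  then show ?thesis by (simp add: Lp_var_def)
qed

lemma Lp_cmult:
  assumes "u \<in> Lp_var \<Omega> p"
  shows "(\<lambda>x. c * u x) \<in> Lp_var \<Omega> p"
proof -
  have [measurable]: "u \<in> borel_measurable M"
    using assms by (auto simp: Lp_var_def)
  have "integrable M (\<lambda>x. \<bar>c * u x\<bar> powr p x)"
  proof (rule Bochner_Integration.integrable_bound)
    show "integrable M (\<lambda>x. (1 + \<bar>c\<bar>) powr P * \<bar>u x\<bar> powr p x)"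
      using assms by (simp add: Lp_var_def)
    show "AE x in M. norm (\<bar>c * u x\<bar> powr p x) \<le> norm ((1 + \<bar>c\<bar>) powr P * \<bar>u x\<bar> powr p x)"
    proof (rule AE_I2)
      fix x assume "x \<in> space M"
      then have px: "0 \<le> p x" "p x \<le> P" using p_bounds[of x] p0_gt_1 by auto
      have "\<bar>c * u x\<bar> powr p x = \<bar>c\<bar> powr p x * \<bar>u x\<bar> powr p x"
        by (simp add: abs_mult powr_mult)
      also have "\<bar>c\<bar> powr p x \<le> (1 + \<bar>c\<bar>) powr p x" using px by (intro powr_mono2) auto
      also have "\<dots> \<le> (1 + \<bar>c\<bar>) powr P" using px by (intro powr_mono) auto
      finally show "norm (\<bar>c * u x\<bar> powr p x) \<le> norm ((1 + \<bar>c\<bar>) powr P * \<bar>u x\<bar> powr p x)"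
        by (simp add: mult_right_mono)
    qed
  qed measurable
  then show ?thesis by (simp add: Lp_var_def)
qed

lemma Lp_const: "(\<lambda>x. c) \<in> Lp_var \<Omega> p"
proof -
  have "(\<lambda>x. 1) \<in> Lp_var \<Omega> p" by (simp add: Lp_var_def)
  from Lp_cmult[OF this, of c] show ?thesis by simp
qed

lemma Lp_integrable: "u \<in> Lp_var \<Omega> p \<Longrightarrow> integrable M u"
proof -
  assume u: "u \<in> Lp_var \<Omega> p"
  then have [measurable]: "u \<in> borel_measurable M" by (auto simp: Lp_var_def)
  show "integrable M u"
  proof (rule Bochner_Integration.integrable_bound)
    show "integrable M (\<lambda>x. 1 + \<bar>u x\<bar> powr p x)"
      using u by (simp add: Lp_var_def)
    show "AE x in M. norm (u x) \<le> norm (1 + \<bar>u x\<bar> powr p x)"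
    proof (rule AE_I2)
      fix x assume "x \<in> space M"
      then have "1 \<le> p x" using p_bounds[of x] p0_gt_1 by auto
      then show "norm (u x) \<le> norm (1 + \<bar>u x\<bar> powr p x)"
        using le_1_plus_powr[of "p x" "u x"] by (simp add: add_nonneg_nonneg)
    qed
  qed measurable
qed

lemma Lp_measurable: "u \<in> Lp_var \<Omega> p \<Longrightarrow> u \<in> borel_measurable M"
  by (simp add: Lp_var_def)

lemma W_Lp: "u \<in> W \<Longrightarrow> u \<in> Lp_var \<Omega> p"
  by (simp add: W1p_var_def)

lemma W_measurable: "u \<in> W \<Longrightarrow> u \<in> borel_measurable M"
  using W_Lp Lp_measurable by blast

lemma W_integrable: "u \<in> W \<Longrightarrow> integrable M u"
  using W_Lp Lp_integrable by blast

text \<open>\<open>weak_gradient\<close> is a choice of representative, so a concrete gradient is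
  recovered from it only almost everywhere, by uniqueness.\<close>

lemma W_I:
  assumes u: "u \<in> Lp_var \<Omega> p" and h: "has_weak_gradient \<Omega> u G" and G: "(\<lambda>x. norm (G x)) \<in> Lp_var \<Omega> p"
  shows "u \<in> W" "AE x in M. grad u x = G x"
proof -
  show "u \<in> W" using assms by (auto simp: W1p_var_def)
  have "has_weak_gradient \<Omega> u (grad u)"
    unfolding weak_gradient_def by (rule someI[of "has_weak_gradient \<Omega> u", OF h])
  then show "AE x in M. grad u x = G x"
    using h by (rule has_weak_gradient_unique[OF open_dom])
qed

section \<open>Gradients, linear combinations and truncations of Sobolev functions\<close>

lemma W_gradient:
  assumes "u \<in> W"
  shows "has_weak_gradient \<Omega> u (grad u)" "grad u \<in> borel_measurable M"
    "(\<lambda>x. norm (grad u x)) \<in> Lp_var \<Omega> p" "integrable M (grad u)"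
proof -
  obtain G where G: "has_weak_gradient \<Omega> u G" "(\<lambda>x. norm (G x)) \<in> Lp_var \<Omega> p"
    using assms by (auto simp: W1p_var_def)
  show h: "has_weak_gradient \<Omega> u (grad u)"
    unfolding weak_gradient_def by (rule someI[of "has_weak_gradient \<Omega> u", OF G(1)])
  then show m: "grad u \<in> borel_measurable M"
    by (intro locally_integrable_measurable[OF open_dom]) (simp add: has_weak_gradient_def)
  have "AE x in M. \<bar>norm (grad u x)\<bar> \<le> \<bar>norm (G x)\<bar>"
    using has_weak_gradient_unique[OF open_dom h G(1)] by eventually_elim simp
  then show n: "(\<lambda>x. norm (grad u x)) \<in> Lp_var \<Omega> p"
    using m by (intro Lp_dominated[OF G(2)]) simp_all
  show "integrable M (grad u)"
    using Lp_integrable[OF n] m by (simp add: integrable_norm_iff)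
qed

lemma W_borel:
  assumes "u \<in> W"
  obtains u' G' where "borel_version \<Omega> u u'" "borel_version \<Omega> (grad u) G'" "weak_grad \<Omega> u' G'"
proof -
  obtain u' where v1: "borel_version \<Omega> u u'"
    using ex_borel_version[OF open_dom W_measurable[OF assms]] by blast
  obtain G' where v2: "borel_version \<Omega> (grad u) G'"
    using ex_borel_version[OF open_dom W_gradient(2)[OF assms]] by blast
  have "weak_grad \<Omega> u' G'"
    using has_weak_gradient_iff_weak_grad[OF open_dom W_integrable[OF assms] W_gradient(4)[OF assms] v1 v2]
      W_gradient(1)[OF assms] by simp
  with v1 v2 show ?thesis by (rule that)
qed

lemma W_add_cmult:
  assumes u: "u \<in> W" and v: "v \<in> W"
  shows "(\<lambda>x. a * u x + b * v x) \<in> W"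
    "AE x in M. grad (\<lambda>x. a * u x + b * v x) x = a *\<^sub>R grad u x + b *\<^sub>R grad v x"
proof -
  have L: "(\<lambda>x. a * u x + b * v x) \<in> Lp_var \<Omega> p"
    using u v by (intro Lp_add Lp_cmult W_Lp)
  have G: "(\<lambda>x. norm (a *\<^sub>R grad u x + b *\<^sub>R grad v x)) \<in> Lp_var \<Omega> p"
  proof (rule Lp_dominated)
    show "(\<lambda>x. \<bar>a\<bar> * norm (grad u x) + \<bar>b\<bar> * norm (grad v x)) \<in> Lp_var \<Omega> p"
      using u v by (intro Lp_add Lp_cmult W_gradient)
    show "AE x in M. \<bar>norm (a *\<^sub>R grad u x + b *\<^sub>R grad v x)\<bar> \<le> \<bar>\<bar>a\<bar> * norm (grad u x) + \<bar>b\<bar> * norm (grad v x)\<bar>"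
    proof (rule AE_I2)
      fix x
      have "norm (a *\<^sub>R grad u x + b *\<^sub>R grad v x) \<le> \<bar>a\<bar> * norm (grad u x) + \<bar>b\<bar> * norm (grad v x)"
        using norm_triangle_ineq[of "a *\<^sub>R grad u x" "b *\<^sub>R grad v x"] by simp
      moreover have "0 \<le> \<bar>a\<bar> * norm (grad u x) + \<bar>b\<bar> * norm (grad v x)" by simp
      ultimately show "\<bar>norm (a *\<^sub>R grad u x + b *\<^sub>R grad v x)\<bar> \<le> \<bar>\<bar>a\<bar> * norm (grad u x) + \<bar>b\<bar> * norm (grad v x)\<bar>"
        by (simp only: abs_norm_cancel abs_of_nonneg)
    qed
  qed (use u v W_gradient in auto)
  have "has_weak_gradient \<Omega> (\<lambda>x. a * u x + b * v x) (\<lambda>x. a *\<^sub>R grad u x + b *\<^sub>R grad v x)"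
    unfolding has_weak_gradient_def
  proof (intro conjI allI impI ballI)
    show "locally_integrable \<Omega> (\<lambda>x. a * u x + b * v x)"
      by (rule locally_integrable_if_integrable[OF open_dom Lp_integrable[OF L]])
    show "locally_integrable \<Omega> (\<lambda>x. a *\<^sub>R grad u x + b *\<^sub>R grad v x)"
      using W_gradient(4)[OF u] W_gradient(4)[OF v] by (intro locally_integrable_if_integrable[OF open_dom]) simp
    fix \<phi> :: "'a \<Rightarrow> real" and i :: 'a assume \<phi>: "test_function \<Omega> \<phi>" and i: "i \<in> Basis"
    obtain B where B: "\<And>x. \<bar>\<phi> x\<bar> \<le> B" using test_function_bounded[OF \<phi>] by metis
    obtain B' where B': "\<And>x. \<bar>frechet_derivative \<phi> (at x) i\<bar> \<le> B'"
      using test_function_derivative_bounded[OF \<phi>, of i] by metis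
    have m: "(\<lambda>x. frechet_derivative \<phi> (at x) i) \<in> borel_measurable M" "\<phi> \<in> borel_measurable M"
      using test_function_derivative_measurable[OF \<phi>] test_function_measurable[OF \<phi>]
      by (auto intro: measurable_lebesgue_on_if_borel)
    have int: "integrable M (\<lambda>x. w x * frechet_derivative \<phi> (at x) i)" "integrable M (\<lambda>x. (grad w x \<bullet> i) * \<phi> x)"
      if "w \<in> W" for w
      using integrable_mult_bounded[OF W_integrable[OF that] m(1) B']
        integrable_mult_bounded[OF integrable_inner_left[OF W_gradient(4)[OF that]] m(2) B] by auto
    have "(\<integral>x. (a * u x + b * v x) * frechet_derivative \<phi> (at x) i \<partial>M) =
        (\<integral>x. a * (u x * frechet_derivative \<phi> (at x) i) + b * (v x * frechet_derivative \<phi> (at x) i) \<partial>M)"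
      by (simp add: algebra_simps)
    also have "\<dots> = a * (\<integral>x. u x * frechet_derivative \<phi> (at x) i \<partial>M) + b * (\<integral>x. v x * frechet_derivative \<phi> (at x) i \<partial>M)"
      using int[OF u] int[OF v] by simp
    also have "\<dots> = - (a * (\<integral>x. (grad u x \<bullet> i) * \<phi> x \<partial>M) + b * (\<integral>x. (grad v x \<bullet> i) * \<phi> x \<partial>M))"
      using W_gradient(1)[OF u] W_gradient(1)[OF v] \<phi> i by (simp add: has_weak_gradient_def)
    also have "\<dots> = - (\<integral>x. a * ((grad u x \<bullet> i) * \<phi> x) + b * ((grad v x \<bullet> i) * \<phi> x) \<partial>M)"
      using int[OF u] int[OF v] by simp
    finally show "(\<integral>x. (a * u x + b * v x) * frechet_derivative \<phi> (at x) i \<partial>M) =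
        - (\<integral>x. ((a *\<^sub>R grad u x + b *\<^sub>R grad v x) \<bullet> i) * \<phi> x \<partial>M)"
      by (simp add: inner_add_left algebra_simps)
  qed
  from W_I[OF L this G] show "(\<lambda>x. a * u x + b * v x) \<in> W"
    "AE x in M. grad (\<lambda>x. a * u x + b * v x) x = a *\<^sub>R grad u x + b *\<^sub>R grad v x" by auto
qed

text \<open>\<open>weak_grad_chain\<close> applied to Borel versions. The Lipschitz bound keeps
  \<open>h (u x)\<close> and its gradient in the variable exponent space, the boundedness of
  \<open>\<Omega>\<close> being used for the constant \<open>h 0\<close>.\<close>

lemma W_chain:
  assumes u: "u \<in> W" and "finite Z"
    and lip: "\<And>s t. \<bar>h s - h t\<bar> \<le> L * \<bar>s - t\<bar>"
    and der: "\<And>s. s \<notin> Z \<Longrightarrow> (h has_real_derivative h' s) (at s)"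
    and h'_bound: "\<And>s. \<bar>h' s\<bar> \<le> L" and [measurable]: "h' \<in> borel_measurable borel"
  shows "(\<lambda>x. h (u x)) \<in> W" "AE x in M. grad (\<lambda>x. h (u x)) x = h' (u x) *\<^sub>R grad u x"
proof -
  have [measurable]: "h \<in> borel_measurable borel" by (rule lipschitz_borel[OF lip])
  have [measurable]: "u \<in> borel_measurable M" "grad u \<in> borel_measurable M"
    using W_measurable[OF u] W_gradient(2)[OF u] by auto
  have [measurable]: "\<Omega> \<in> sets borel" using open_dom by simp
  have "0 \<le> L" using h'_bound[of 0] by linarith
  have hL: "(\<lambda>x. h (u x)) \<in> Lp_var \<Omega> p"
  proof (rule Lp_dominated)
    show "(\<lambda>x. L * \<bar>u x\<bar> + \<bar>h 0\<bar>) \<in> Lp_var \<Omega> p"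
    proof (intro Lp_add Lp_cmult Lp_const)
      show "(\<lambda>x. \<bar>u x\<bar>) \<in> Lp_var \<Omega> p" by (rule Lp_dominated[OF W_Lp[OF u]]) auto
    qed
    show "AE x in M. \<bar>h (u x)\<bar> \<le> \<bar>L * \<bar>u x\<bar> + \<bar>h 0\<bar>\<bar>"
    proof (rule AE_I2)
      fix x
      have "\<bar>h (u x)\<bar> \<le> L * \<bar>u x\<bar> + \<bar>h 0\<bar>" using lip[of "u x" 0] by simp
      then show "\<bar>h (u x)\<bar> \<le> \<bar>L * \<bar>u x\<bar> + \<bar>h 0\<bar>\<bar>" by linarith
    qed
  qed measurable
  have GL: "(\<lambda>x. norm (h' (u x) *\<^sub>R grad u x)) \<in> Lp_var \<Omega> p"
  proof (rule Lp_dominated)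
    show "(\<lambda>x. L * norm (grad u x)) \<in> Lp_var \<Omega> p" by (intro Lp_cmult W_gradient u)
    show "AE x in M. \<bar>norm (h' (u x) *\<^sub>R grad u x)\<bar> \<le> \<bar>L * norm (grad u x)\<bar>"
      using h'_bound \<open>0 \<le> L\<close> by (intro AE_I2) (auto simp: abs_mult intro!: mult_right_mono)
  qed measurable
  obtain u' G' where b: "borel_version \<Omega> u u'" "borel_version \<Omega> (grad u) G'" "weak_grad \<Omega> u' G'"
    using W_borel[OF u] .
  have wg: "weak_grad \<Omega> (\<lambda>x. indicator \<Omega> x * h (u' x)) (\<lambda>x. h' (u' x) *\<^sub>R G' x)"
    by (rule weak_grad_chain[OF open_dom bounded_dom b(3) assms(2) lip der h'_bound]) auto
  have [measurable]: "u' \<in> borel_measurable borel" "G' \<in> borel_measurable borel"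
    using b by (auto simp: borel_version_def)
  have v1: "borel_version \<Omega> (\<lambda>x. h (u x)) (\<lambda>x. indicator \<Omega> x * h (u' x))"
    using b(1) unfolding borel_version_def by (auto elim!: AE_mp)
  have v2: "borel_version \<Omega> (\<lambda>x. h' (u x) *\<^sub>R grad u x) (\<lambda>x. h' (u' x) *\<^sub>R G' x)"
    unfolding borel_version_def
  proof (intro conjI allI impI)
    have "AE x in lborel. x \<in> \<Omega> \<longrightarrow> u x = u' x" "AE x in lborel. x \<in> \<Omega> \<longrightarrow> grad u x = G' x"
      using b by (auto simp: borel_version_def)
    then show "AE x in lborel. x \<in> \<Omega> \<longrightarrow> h' (u x) *\<^sub>R grad u x = h' (u' x) *\<^sub>R G' x"
      by eventually_elim simp
  qed (use b(2) in \<open>auto simp: borel_version_def\<close>)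
  have "integrable M (\<lambda>x. norm (h' (u x) *\<^sub>R grad u x))" by (rule Lp_integrable[OF GL])
  moreover have "(\<lambda>x. h' (u x) *\<^sub>R grad u x) \<in> borel_measurable M" by measurable
  ultimately have "integrable M (\<lambda>x. h' (u x) *\<^sub>R grad u x)"
    using integrable_norm_iff by blast
  then have "has_weak_gradient \<Omega> (\<lambda>x. h (u x)) (\<lambda>x. h' (u x) *\<^sub>R grad u x)"
    using has_weak_gradient_iff_weak_grad[OF open_dom Lp_integrable[OF hL] _ v1 v2] wg by simp
  from W_I[OF hL this GL] show "(\<lambda>x. h (u x)) \<in> W" "AE x in M. grad (\<lambda>x. h (u x)) x = h' (u x) *\<^sub>R grad u x" by auto
qed

lemma W_level_set:
  assumes "u \<in> W"
  shows "AE x in M. u x = c \<longrightarrow> grad u x = 0"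
proof (rule AE_lebesgue_onI[OF open_dom])
  obtain u' G' where b: "borel_version \<Omega> u u'" "borel_version \<Omega> (grad u) G'" "weak_grad \<Omega> u' G'"
    using W_borel[OF assms] .
  have "AE x in lborel. x \<in> \<Omega> \<longrightarrow> u x = u' x" "AE x in lborel. x \<in> \<Omega> \<longrightarrow> grad u x = G' x"
    using b by (auto simp: borel_version_def)
  with weak_grad_level_set[OF open_dom bounded_dom b(3), of c]
  show "AE x in lborel. x \<in> \<Omega> \<longrightarrow> u x = c \<longrightarrow> grad u x = 0"
    by eventually_elim simp
qed

lemma W_const: "(\<lambda>x. c) \<in> W" "AE x in M. grad (\<lambda>x. c) x = 0"
proof -
  have "has_weak_gradient \<Omega> (\<lambda>x. 0) (\<lambda>x. 0)"
    by (simp add: has_weak_gradient_def locally_integrable_if_integrable[OF open_dom])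
  then have "(\<lambda>x. 0) \<in> W"
    using Lp_const[of 0] by (intro W_I(1)) auto
  \<comment> \<open>Constants arise from the zero function by the chain rule with a constant
    \<open>h\<close>.\<close>
  from W_chain[OF this, of "{}" "\<lambda>s. c" 0 "\<lambda>s. 0"]
  show "(\<lambda>x. c) \<in> W" "AE x in M. grad (\<lambda>x. c) x = 0" by auto
qed

lemma W_positive_part:
  assumes "u \<in> W"
  shows "(\<lambda>x. max 0 (u x)) \<in> W" "AE x in M. grad (\<lambda>x. max 0 (u x)) x = (if 0 < u x then grad u x else 0)"
proof -
  have der: "(max 0 has_real_derivative indicator {0<..} s) (at s)" if "s \<notin> {0}" for s :: real
  proof (cases "0 < s")
    case True
    have "((\<lambda>s. s) has_real_derivative 1) (at s)" by simp
    then have "(max 0 has_real_derivative 1) (at s)"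
      by (rule has_field_derivative_transform_within_open[where S = "{0<..}"]) (use True in auto)
    then show ?thesis using True by simp
  next
    case False
    have "((\<lambda>s. 0) has_real_derivative 0) (at s)" by simp
    then have "(max 0 has_real_derivative 0) (at s)"
      by (rule has_field_derivative_transform_within_open[where S = "{..<0}"]) (use False that in auto)
    then show ?thesis using False by simp
  qed
  note C = W_chain[OF assms, of "{0}" "max 0" 1 "indicator {0<..}"]
  show "(\<lambda>x. max 0 (u x)) \<in> W"
    by (rule C(1)) (use der in \<open>auto split: split_indicator\<close>)
  have "AE x in M. grad (\<lambda>x. max 0 (u x)) x = indicator {0<..} (u x) *\<^sub>R grad u x"
    by (rule C(2)) (use der in \<open>auto split: split_indicator\<close>)
  then show "AE x in M. grad (\<lambda>x. max 0 (u x)) x = (if 0 < u x then grad u x else 0)"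
    by eventually_elim (simp split: split_indicator)
qed

lemma W_clamp:
  assumes "u \<in> W" and "a \<le> b"
  shows "(\<lambda>x. max a (min b (u x))) \<in> W"
    "AE x in M. grad (\<lambda>x. max a (min b (u x))) x = (if a < u x \<and> u x < b then grad u x else 0)"
proof -
  let ?h = "\<lambda>s. max a (min b s)"
  have der: "(?h has_real_derivative indicator {a<..<b} s) (at s)" if "s \<notin> {a, b}" for s :: real
  proof -
    consider "s < a" | "a < s" "s < b" | "b < s" using \<open>s \<notin> {a, b}\<close> by fastforce
    then show ?thesis
    proof cases
      case 1
      have "((\<lambda>s. a) has_real_derivative 0) (at s)" by simp
      then have "(?h has_real_derivative 0) (at s)"
        by (rule has_field_derivative_transform_within_open[where S = "{..<a}"]) (use 1 assms(2) in auto)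
      then show ?thesis using 1 by simp
    next
      case 2
      have "((\<lambda>s. s) has_real_derivative 1) (at s)" by simp
      then have "(?h has_real_derivative 1) (at s)"
        by (rule has_field_derivative_transform_within_open[where S = "{a<..<b}"]) (use 2 in auto)
      then show ?thesis using 2 by simp
    next
      case 3
      have "((\<lambda>s. b) has_real_derivative 0) (at s)" by simp
      then have "(?h has_real_derivative 0) (at s)"
        by (rule has_field_derivative_transform_within_open[where S = "{b<..}"]) (use 3 assms(2) in auto)
      then show ?thesis using 3 by simp
    qed
  qed
  note C = W_chain[OF assms(1), of "{a, b}" ?h 1 "indicator {a<..<b}"]
  show "(\<lambda>x. ?h (u x)) \<in> W"
    by (rule C(1)) (use der in \<open>auto split: split_indicator\<close>)
  have "AE x in M. grad (\<lambda>x. ?h (u x)) x = indicator {a<..<b} (u x) *\<^sub>R grad u x"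
    by (rule C(2)) (use der in \<open>auto split: split_indicator\<close>)
  then show "AE x in M. grad (\<lambda>x. ?h (u x)) x = (if a < u x \<and> u x < b then grad u x else 0)"
    by eventually_elim (simp split: split_indicator)
qed

text \<open>Fatou keeps the limit in the space. Since \<open>p0 > 1\<close>, bounded modulars are
  uniformly integrable: where the difference exceeds \<open>R \<ge> 1\<close> it is at most
  \<open>R powr (1 - p0)\<close> times its own power \<open>p x\<close>, and the part cut at
  \<open>R\<close> converges by dominated convergence.\<close>

lemma L1_limit_if_Lp_bounded:
  fixes Y :: "nat \<Rightarrow> 'a \<Rightarrow> real"
  assumes Yn: "\<And>n. Y n \<in> Lp_var \<Omega> p" and C: "\<And>n. (\<integral>x. \<bar>Y n x\<bar> powr p x \<partial>M) \<le> C"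
    and lim: "AE x in M. (\<lambda>n. Y n x) \<longlonglongrightarrow> y x" and [measurable]: "y \<in> borel_measurable M"
  shows "y \<in> Lp_var \<Omega> p" "(\<lambda>n. \<integral>x. \<bar>Y n x - y x\<bar> \<partial>M) \<longlonglongrightarrow> 0"
proof -
  have [measurable]: "\<And>n. Y n \<in> borel_measurable M" using Yn by (simp add: Lp_measurable)
  have "0 \<le> C" using C[of 0] by (rule order_trans[rotated]) (simp add: Bochner_Integration.integral_nonneg)
  have nnY: "(\<integral>\<^sup>+x. ennreal (\<bar>Y n x\<bar> powr p x) \<partial>M) \<le> ennreal C" for n
    using Yn[of n] C[of n] by (subst nn_integral_eq_integral) (auto simp: Lp_var_def intro: ennreal_leI)
  have "(\<integral>\<^sup>+x. ennreal (\<bar>y x\<bar> powr p x) \<partial>M) \<le> (\<integral>\<^sup>+x. liminf (\<lambda>n. ennreal (\<bar>Y n x\<bar> powr p x)) \<partial>M)"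
  proof (rule nn_integral_mono_AE)
    show "AE x in M. ennreal (\<bar>y x\<bar> powr p x) \<le> liminf (\<lambda>n. ennreal (\<bar>Y n x\<bar> powr p x))"
      using lim AE_space
    proof eventually_elim
      case (elim x)
      then have "0 < p x" using p_bounds[of x] p0_gt_1 by auto
      with elim have "(\<lambda>n. ennreal (\<bar>Y n x\<bar> powr p x)) \<longlonglongrightarrow> ennreal (\<bar>y x\<bar> powr p x)"
        by (intro tendsto_ennrealI tendsto_powr' tendsto_intros) auto
      from lim_imp_Liminf[OF trivial_limit_sequentially this] show ?case by simp
    qed
  qed
  also have "\<dots> \<le> liminf (\<lambda>n. \<integral>\<^sup>+x. ennreal (\<bar>Y n x\<bar> powr p x) \<partial>M)"
    by (rule nn_integral_liminf) measurable
  also have "\<dots> \<le> ennreal C"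
    using nnY by (intro Liminf_le) (auto intro: always_eventually)
  finally have nny: "(\<integral>\<^sup>+x. ennreal (\<bar>y x\<bar> powr p x) \<partial>M) \<le> ennreal C" .
  then have iy: "integrable M (\<lambda>x. \<bar>y x\<bar> powr p x)"
    by (intro integrableI_bounded) (auto simp: le_less_trans)
  then show y: "y \<in> Lp_var \<Omega> p" by (simp add: Lp_var_def)
  have Cy: "(\<integral>x. \<bar>y x\<bar> powr p x \<partial>M) \<le> C"
    using nny iy \<open>0 \<le> C\<close> by (subst (asm) nn_integral_eq_integral) auto
  define D where "D n x = \<bar>Y n x - y x\<bar>" for n x
  have Dm[measurable]: "D n \<in> borel_measurable M" for n unfolding D_def by measurable
  define C' where "C' = 2 powr P * (C + C)"
  have iDp: "integrable M (\<lambda>x. D n x powr p x)" for n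
  proof -
    have "(\<lambda>x. Y n x + -1 * y x) \<in> Lp_var \<Omega> p" using Yn y by (intro Lp_add Lp_cmult)
    then show ?thesis by (simp add: Lp_var_def D_def)
  qed
  have DC: "(\<integral>x. D n x powr p x \<partial>M) \<le> C'" for n
  proof -
    have "(\<integral>x. D n x powr p x \<partial>M) \<le> (\<integral>x. 2 powr P * (\<bar>Y n x\<bar> powr p x + \<bar>y x\<bar> powr p x) \<partial>M)"
    proof (rule integral_mono[OF iDp])
      show "integrable M (\<lambda>x. 2 powr P * (\<bar>Y n x\<bar> powr p x + \<bar>y x\<bar> powr p x))"
        using Yn[of n] iy by (simp add: Lp_var_def)
      fix x assume "x \<in> space M"
      then have "0 \<le> p x" "p x \<le> P" using p_bounds[of x] p0_gt_1 by auto
      then show "D n x powr p x \<le> 2 powr P * (\<bar>Y n x\<bar> powr p x + \<bar>y x\<bar> powr p x)"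
        using powr_add_le[of "p x" P "Y n x" "- y x"] by (simp add: D_def)
    qed
    also have "\<dots> = 2 powr P * ((\<integral>x. \<bar>Y n x\<bar> powr p x \<partial>M) + (\<integral>x. \<bar>y x\<bar> powr p x \<partial>M))"
      using Yn[of n] iy by (simp add: Lp_var_def)
    also have "\<dots> \<le> C'"
      unfolding C'_def using C[of n] Cy by (intro mult_left_mono add_mono) auto
    finally show ?thesis .
  qed
  have iD: "integrable M (D n)" for n
    unfolding D_def using Lp_integrable[OF Yn] Lp_integrable[OF y]
    by (intro integrable_abs Bochner_Integration.integrable_diff)
  show "(\<lambda>n. \<integral>x. \<bar>Y n x - y x\<bar> \<partial>M) \<longlonglongrightarrow> 0"
  proof (rule LIMSEQ_I)
    fix e :: real assume "0 < e"
    have "((\<lambda>R. R powr (1 - p0) * C') \<longlongrightarrow> 0 * C') at_top"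
      using p0_gt_1 by (intro tendsto_mult tendsto_neg_powr filterlim_ident tendsto_const) auto
    then have "\<forall>\<^sub>F R in at_top. R powr (1 - p0) * C' < e / 2"
      using \<open>0 < e\<close> by (intro order_tendstoD(2)) auto
    then have "\<forall>\<^sub>F R in at_top. 1 \<le> R \<and> R powr (1 - p0) * C' < e / 2"
      using eventually_ge_at_top[of "1::real"] by eventually_elim simp
    then obtain R where R: "1 \<le> R" "R powr (1 - p0) * C' < e / 2"
      using eventually_happens'[OF trivial_limit_at_top_linorder] by blast
    have dom: "D n x \<le> min (D n x) R + R powr (1 - p0) * D n x powr p x" if "x \<in> space M" for n x
    proof (cases "D n x \<le> R")
      case True
      then show ?thesis by simp
    next
      case False
      have px: "p0 \<le> p x" using p_bounds[of x] that by auto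
      have "D n x = D n x powr (1 - p x) * D n x powr p x"
        using False R by (simp add: powr_add[symmetric])
      also have "\<dots> \<le> R powr (1 - p0) * D n x powr p x"
      proof (rule mult_right_mono)
        have "D n x powr (1 - p x) \<le> D n x powr (1 - p0)" using False R px by (intro powr_mono) auto
        also have "\<dots> \<le> R powr (1 - p0)" using False R p0_gt_1 by (intro powr_mono2') auto
        finally show "D n x powr (1 - p x) \<le> R powr (1 - p0)" .
      qed simp
      finally show ?thesis using False R by simp
    qed
    have "(\<lambda>n. \<integral>x. min (D n x) R \<partial>M) \<longlonglongrightarrow> (\<integral>x. 0 \<partial>M)"
    proof (rule integral_dominated_convergence[where w = "\<lambda>x. R"])
      show "AE x in M. (\<lambda>n. min (D n x) R) \<longlonglongrightarrow> 0"
        using lim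
      proof eventually_elim
        case (elim x)
        then have "(\<lambda>n. D n x) \<longlonglongrightarrow> 0"
          unfolding D_def by (intro tendsto_rabs_zero LIM_zero)
        then have "(\<lambda>n. min (D n x) R) \<longlonglongrightarrow> min 0 R" by (intro tendsto_intros)
        then show ?case using R by simp
      qed
      show "AE x in M. norm (min (D n x) R) \<le> R" for n
        using R by (intro AE_I2) (auto simp: D_def min_def)
    qed auto
    then have "\<forall>\<^sub>F n in sequentially. (\<integral>x. min (D n x) R \<partial>M) < e / 2"
      using \<open>0 < e\<close> by (intro order_tendstoD(2)) auto
    then obtain N where N: "\<And>n. n \<ge> N \<Longrightarrow> (\<integral>x. min (D n x) R \<partial>M) < e / 2"
      by (auto simp: eventually_sequentially)
    show "\<exists>no. \<forall>n\<ge>no. norm ((\<integral>x. \<bar>Y n x - y x\<bar> \<partial>M) - 0) < e"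
    proof (intro exI allI impI)
      fix n assume "N \<le> n"
      have im: "integrable M (\<lambda>x. min (D n x) R)"
        by (rule Bochner_Integration.integrable_bound[OF iD[of n]]) (use R in \<open>auto simp: D_def\<close>)
      have "(\<integral>x. D n x \<partial>M) \<le> (\<integral>x. min (D n x) R + R powr (1 - p0) * D n x powr p x \<partial>M)"
        using iD im iDp dom by (intro integral_mono) auto
      also have "\<dots> = (\<integral>x. min (D n x) R \<partial>M) + R powr (1 - p0) * (\<integral>x. D n x powr p x \<partial>M)"
        using im iDp by simp
      also have "\<dots> < e / 2 + e / 2"
        using N[OF \<open>N \<le> n\<close>] R(2) mult_left_mono[OF DC[of n], of "R powr (1 - p0)"] by simp
      finally have "(\<integral>x. D n x \<partial>M) < e" by simp
      moreover have "0 \<le> (\<integral>x. D n x \<partial>M)" by (simp add: Bochner_Integration.integral_nonneg D_def)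
      ultimately show "norm ((\<integral>x. \<bar>Y n x - y x\<bar> \<partial>M) - 0) < e" by (simp add: D_def)
    qed
  qed
qed

text \<open>The values converge boundedly and the gradients, componentwise, in L1 by
  \<open>L1_limit_if_Lp_bounded\<close>, so both sides of the weak gradient relation pass to the
  limit. Almost everywhere convergence of the gradients stands in for weak convergence.\<close>

lemma W_closed:
  assumes V: "\<And>n. V n \<in> W" and bound: "\<And>n. AE x in M. \<bar>V n x\<bar> \<le> B"
    and C: "\<And>n. (\<integral>x. norm (grad (V n) x) powr p x \<partial>M) \<le> C"
    and limV: "AE x in M. (\<lambda>n. V n x) \<longlonglongrightarrow> v x" and limG: "AE x in M. (\<lambda>n. grad (V n) x) \<longlonglongrightarrow> G x"
    and [measurable]: "v \<in> borel_measurable M" "G \<in> borel_measurable M"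
  shows "v \<in> W" "AE x in M. grad v x = G x"
proof -
  have vm[measurable]: "\<And>n. V n \<in> borel_measurable M" "\<And>n. grad (V n) \<in> borel_measurable M"
    using V W_measurable W_gradient(2) by auto
  have allB: "AE x in M. \<forall>n. \<bar>V n x\<bar> \<le> B" using bound by (simp add: AE_all_countable)
  have vB: "AE x in M. \<bar>v x\<bar> \<le> B"
    using allB limV
  proof eventually_elim
    case (elim x)
    from tendsto_rabs[OF elim(2)] show ?case
      by (rule tendsto_upperbound) (use elim(1) in auto)
  qed
  have vL: "v \<in> Lp_var \<Omega> p"
    by (rule Lp_dominated[OF Lp_const[of B]]) (use vB in \<open>auto elim!: AE_mp\<close>)
  have GL: "(\<lambda>x. norm (G x)) \<in> Lp_var \<Omega> p"
  proof (rule L1_limit_if_Lp_bounded(1))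
    show "(\<lambda>x. norm (grad (V n) x)) \<in> Lp_var \<Omega> p" for n by (rule W_gradient(3)[OF V])
    show "AE x in M. (\<lambda>n. norm (grad (V n) x)) \<longlonglongrightarrow> norm (G x)"
      using limG by eventually_elim (rule tendsto_norm)
  qed (use C in auto)
  have GI: "integrable M G" using Lp_integrable[OF GL] by (simp add: integrable_norm_iff)
  have "has_weak_gradient \<Omega> v G"
    unfolding has_weak_gradient_def
  proof (intro conjI allI impI ballI)
    show "locally_integrable \<Omega> v" by (rule locally_integrable_if_integrable[OF open_dom Lp_integrable[OF vL]])
    show "locally_integrable \<Omega> G" by (rule locally_integrable_if_integrable[OF open_dom GI])
    fix \<phi> :: "'a \<Rightarrow> real" and i :: 'a assume \<phi>: "test_function \<Omega> \<phi>" and i: "i \<in> Basis"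
    obtain B1 where B1: "0 \<le> B1" "\<And>x. \<bar>\<phi> x\<bar> \<le> B1" using test_function_bounded[OF \<phi>] by metis
    let ?d = "\<lambda>x. frechet_derivative \<phi> (at x) i"
    obtain B2 where B2: "0 \<le> B2" "\<And>x. \<bar>?d x\<bar> \<le> B2"
      using test_function_derivative_bounded[OF \<phi>, of i] by metis
    have m[measurable]: "?d \<in> borel_measurable M" "\<phi> \<in> borel_measurable M"
      using test_function_derivative_measurable[OF \<phi>] test_function_measurable[OF \<phi>]
      by (auto intro: measurable_lebesgue_on_if_borel)
    have lim1: "(\<lambda>n. \<integral>x. V n x * ?d x \<partial>M) \<longlonglongrightarrow> (\<integral>x. v x * ?d x \<partial>M)"
    proof (rule integral_dominated_convergence[where w = "\<lambda>x. B * B2"])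
      show "AE x in M. (\<lambda>n. V n x * ?d x) \<longlonglongrightarrow> v x * ?d x"
        using limV by eventually_elim (intro tendsto_intros)
      show "AE x in M. norm (V n x * ?d x) \<le> B * B2" for n
        using bound[of n]
      proof eventually_elim
        case (elim x)
        then show ?case using B2(2)[of x] B2(1) by (auto simp: abs_mult intro!: mult_mono)
      qed
    qed auto
    have "(\<lambda>n. \<integral>x. \<bar>grad (V n) x \<bullet> i - G x \<bullet> i\<bar> \<partial>M) \<longlonglongrightarrow> 0"
    proof (rule L1_limit_if_Lp_bounded(2))
      fix n
      have le: "\<bar>grad (V n) x \<bullet> i\<bar> \<le> norm (grad (V n) x)" for x
        using i by (rule Basis_le_norm)
      show L: "(\<lambda>x. grad (V n) x \<bullet> i) \<in> Lp_var \<Omega> p"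
        by (rule Lp_dominated[OF W_gradient(3)[OF V]]) (use le in auto)
      have "(\<integral>x. \<bar>grad (V n) x \<bullet> i\<bar> powr p x \<partial>M) \<le> (\<integral>x. norm (grad (V n) x) powr p x \<partial>M)"
      proof (rule integral_mono)
        show "\<bar>grad (V n) x \<bullet> i\<bar> powr p x \<le> norm (grad (V n) x) powr p x" if "x \<in> space M" for x
          using le[of x] p_bounds[of x] that p0_gt_1 by (intro powr_mono2) auto
      qed (use L W_gradient(3)[OF V, of n] in \<open>auto simp: Lp_var_def\<close>)
      then show "(\<integral>x. \<bar>grad (V n) x \<bullet> i\<bar> powr p x \<partial>M) \<le> C" using C[of n] by linarith
    next
      show "AE x in M. (\<lambda>n. grad (V n) x \<bullet> i) \<longlonglongrightarrow> G x \<bullet> i"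
        using limG by eventually_elim (intro tendsto_intros)
    qed auto
    then have lim0: "(\<lambda>n. B1 * (\<integral>x. \<bar>grad (V n) x \<bullet> i - G x \<bullet> i\<bar> \<partial>M)) \<longlonglongrightarrow> 0"
      by (rule tendsto_mult_right_zero)
    have int: "integrable M (\<lambda>x. (grad (V n) x \<bullet> i) * \<phi> x)" "integrable M (\<lambda>x. (G x \<bullet> i) * \<phi> x)" for n
      using integrable_mult_bounded[OF integrable_inner_left[OF W_gradient(4)[OF V]] m(2) B1(2)]
        integrable_mult_bounded[OF integrable_inner_left[OF GI] m(2) B1(2)] by auto
    have lim2: "(\<lambda>n. \<integral>x. (grad (V n) x \<bullet> i) * \<phi> x \<partial>M) \<longlonglongrightarrow> (\<integral>x. (G x \<bullet> i) * \<phi> x \<partial>M)"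
    proof (rule LIM_zero_cancel, rule Lim_null_comparison[OF _ lim0], rule always_eventually, rule allI)
      fix n
      have "norm ((\<integral>x. (grad (V n) x \<bullet> i) * \<phi> x \<partial>M) - (\<integral>x. (G x \<bullet> i) * \<phi> x \<partial>M)) =
          norm (\<integral>x. (grad (V n) x \<bullet> i - G x \<bullet> i) * \<phi> x \<partial>M)"
        using int by (simp add: left_diff_distrib)
      also have "\<dots> \<le> (\<integral>x. norm ((grad (V n) x \<bullet> i - G x \<bullet> i) * \<phi> x) \<partial>M)"
        by (rule integral_norm_bound)
      also have "\<dots> \<le> (\<integral>x. B1 * \<bar>grad (V n) x \<bullet> i - G x \<bullet> i\<bar> \<partial>M)"
      proof (rule integral_mono)
        have "integrable M (\<lambda>x. (grad (V n) x \<bullet> i - G x \<bullet> i) * \<phi> x)"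
          unfolding left_diff_distrib by (intro Bochner_Integration.integrable_diff int)
        then show "integrable M (\<lambda>x. norm ((grad (V n) x \<bullet> i - G x \<bullet> i) * \<phi> x))"
          by (rule integrable_norm)
        show "integrable M (\<lambda>x. B1 * \<bar>grad (V n) x \<bullet> i - G x \<bullet> i\<bar>)"
          using W_gradient(4)[OF V, of n] GI by simp
        show "norm ((grad (V n) x \<bullet> i - G x \<bullet> i) * \<phi> x) \<le> B1 * \<bar>grad (V n) x \<bullet> i - G x \<bullet> i\<bar>" for x
          using B1(2)[of x] by (simp add: abs_mult mult.commute[of B1] mult_left_mono)
      qed
      finally show "norm ((\<integral>x. (grad (V n) x \<bullet> i) * \<phi> x \<partial>M) - (\<integral>x. (G x \<bullet> i) * \<phi> x \<partial>M))
          \<le> B1 * (\<integral>x. \<bar>grad (V n) x \<bullet> i - G x \<bullet> i\<bar> \<partial>M)" by simp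
    qed
    have "(\<integral>x. V n x * ?d x \<partial>M) = - (\<integral>x. (grad (V n) x \<bullet> i) * \<phi> x \<partial>M)" for n
      using W_gradient(1)[OF V, of n] \<phi> i unfolding has_weak_gradient_def by blast
    with lim1 have "(\<lambda>n. - (\<integral>x. (grad (V n) x \<bullet> i) * \<phi> x \<partial>M)) \<longlonglongrightarrow> (\<integral>x. v x * ?d x \<partial>M)"
      by simp
    then show "(\<integral>x. v x * ?d x \<partial>M) = - (\<integral>x. (G x \<bullet> i) * \<phi> x \<partial>M)"
      by (rule LIMSEQ_unique[OF _ tendsto_minus[OF lim2]])
  qed
  from W_I[OF vL this GL] show "v \<in> W" "AE x in M. grad v x = G x" by auto
qed

end

subsection \<open>The Gagliardo inequality\<close>

text \<open>Powers with real exponents on the extended half-line. Exponent 0 gives 1 even at 0 and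
  at infinity, so that factors of weight 0 drop out of Holder products.\<close>

definition epow :: "ennreal \<Rightarrow> real \<Rightarrow> ennreal" where
  "epow x \<theta> = (if \<theta> = 0 then 1 else if x = top then top else ennreal (enn2real x powr \<theta>))"

lemma epow_0 [simp]: "epow x 0 = 1"
  by (simp add: epow_def)

lemma epow_ennreal: "0 \<le> r \<Longrightarrow> \<theta> \<noteq> 0 \<Longrightarrow> epow (ennreal r) \<theta> = ennreal (r powr \<theta>)"
  by (simp add: epow_def)

lemma epow_top [simp]: "\<theta> \<noteq> 0 \<Longrightarrow> epow top \<theta> = top"
  by (simp add: epow_def)

lemma epow_zero [simp]: "\<theta> \<noteq> 0 \<Longrightarrow> epow 0 \<theta> = 0"
  by (simp add: epow_def)

lemma epow_eq_0_iff: "\<theta> \<noteq> 0 \<Longrightarrow> epow x \<theta> = 0 \<longleftrightarrow> x = 0"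
  by (cases x) (auto simp: epow_ennreal)

lemma epow_less_top: "x < top \<Longrightarrow> epow x \<theta> < top"
  by (simp add: epow_def)

lemma epow_mono: "0 \<le> \<theta> \<Longrightarrow> x \<le> y \<Longrightarrow> epow x \<theta> \<le> epow y \<theta>"
  by (cases x; cases y; cases "\<theta> = 0") (auto simp: epow_ennreal powr_mono2 top_unique)

lemma epow_add: "0 \<le> a \<Longrightarrow> 0 \<le> b \<Longrightarrow> epow x (a + b) = epow x a * epow x b"
  by (cases x; cases "a = 0"; cases "b = 0")
    (auto simp: epow_ennreal powr_add ennreal_mult' ennreal_top_mult)

lemma epow_mult: "0 < \<theta> \<Longrightarrow> epow (x * y) \<theta> = epow x \<theta> * epow y \<theta>"
  by (cases x; cases y; cases "x = 0"; cases "y = 0")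
    (auto simp: epow_ennreal powr_mult ennreal_mult'[symmetric] ennreal_top_mult ennreal_mult_top)

lemma epow_measurable [measurable]:
  assumes [measurable]: "f \<in> borel_measurable M"
  shows "(\<lambda>x. epow (f x) \<theta>) \<in> borel_measurable M"
  unfolding epow_def by measurable

text \<open>With \<open>A\<close> the weighted mean, the inequalities
  \<open>ln (x i / A) \<le> x i / A - 1\<close> are summed against the weights; the right sides add
  up to 0.\<close>

lemma weighted_AM_GM:
  fixes x \<theta> :: "'i \<Rightarrow> real"
  assumes "finite I" and \<theta>: "\<And>i. i \<in> I \<Longrightarrow> 0 < \<theta> i" "(\<Sum>i\<in>I. \<theta> i) = 1"
    and x: "\<And>i. i \<in> I \<Longrightarrow> 0 \<le> x i"
  shows "(\<Prod>i\<in>I. x i powr \<theta> i) \<le> (\<Sum>i\<in>I. \<theta> i * x i)"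
proof (cases "\<exists>i\<in>I. x i = 0")
  case True
  then have "(\<Prod>i\<in>I. x i powr \<theta> i) = 0" using assms(1) by auto
  moreover have "0 \<le> (\<Sum>i\<in>I. \<theta> i * x i)" using \<theta>(1) x by (intro sum_nonneg mult_nonneg_nonneg) (auto intro: less_imp_le)
  ultimately show ?thesis by simp
next
  case False
  then have x': "\<And>i. i \<in> I \<Longrightarrow> 0 < x i" using x by (metis less_eq_real_def)
  have "I \<noteq> {}" using \<theta>(2) by auto
  define A where "A = (\<Sum>i\<in>I. \<theta> i * x i)"
  have "0 < A" unfolding A_def using assms(1) \<open>I \<noteq> {}\<close> \<theta> x' by (intro sum_pos) auto
  have "(\<Sum>i\<in>I. \<theta> i * (ln (x i) - ln A)) \<le> (\<Sum>i\<in>I. \<theta> i * (x i / A - 1))"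
  proof (intro sum_mono mult_left_mono)
    fix i assume i: "i \<in> I"
    have "ln (x i / A) \<le> x i / A - 1" using x'[OF i] \<open>0 < A\<close> by (intro ln_le_minus_one) simp
    then show "ln (x i) - ln A \<le> x i / A - 1" using x'[OF i] \<open>0 < A\<close> by (simp add: ln_div)
  qed (use \<theta> in \<open>auto intro: less_imp_le\<close>)
  also have "\<dots> = (\<Sum>i\<in>I. \<theta> i * x i) / A - (\<Sum>i\<in>I. \<theta> i)"
    by (simp add: right_diff_distrib sum_subtractf sum_divide_distrib)
  also have "\<dots> = 0" using \<theta>(2) \<open>0 < A\<close> by (simp add: A_def)
  finally have "(\<Sum>i\<in>I. \<theta> i * ln (x i)) \<le> ln A"
    using \<theta>(2) by (simp add: right_diff_distrib sum_subtractf sum_distrib_right[symmetric])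
  then have "exp (\<Sum>i\<in>I. \<theta> i * ln (x i)) \<le> A" using \<open>0 < A\<close> by (simp add: ln_ge_iff)
  moreover have "exp (\<Sum>i\<in>I. \<theta> i * ln (x i)) = (\<Prod>i\<in>I. x i powr \<theta> i)"
    using assms(1) x' by (force simp: exp_sum powr_def intro!: prod.cong)
  ultimately show ?thesis by (simp add: A_def)
qed

lemma prod_ennreal_pos_top:
  fixes f :: "'i \<Rightarrow> ennreal"
  assumes "finite I" "j \<in> I" "f j = top" "\<And>i. i \<in> I \<Longrightarrow> f i \<noteq> 0"
  shows "(\<Prod>i\<in>I. f i) = top"
proof -
  have "(\<Prod>i\<in>I. f i) = f j * (\<Prod>i\<in>I - {j}. f i)" using assms by (intro prod.remove)
  moreover have "(\<Prod>i\<in>I - {j}. f i) \<noteq> 0" using assms by auto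
  ultimately show ?thesis using assms(3) by (simp add: ennreal_top_mult)
qed

text \<open>Each function is divided by its integral and the pointwise arithmetic-geometric mean
  inequality is integrated. The extreme cases are separate: a vanishing integral makes the left side
  0, and otherwise an infinite one makes the right side infinite.\<close>

lemma Holder_positive_weights:
  fixes f :: "'i \<Rightarrow> 'a \<Rightarrow> ennreal"
  assumes I: "finite I" and \<theta>: "\<And>i. i \<in> I \<Longrightarrow> 0 < \<theta> i" "(\<Sum>i\<in>I. \<theta> i) = 1"
    and f[measurable]: "\<And>i. i \<in> I \<Longrightarrow> f i \<in> borel_measurable M"
  shows "(\<integral>\<^sup>+x. (\<Prod>i\<in>I. epow (f i x) (\<theta> i)) \<partial>M) \<le> (\<Prod>i\<in>I. epow (\<integral>\<^sup>+x. f i x \<partial>M) (\<theta> i))"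
proof -
  define a where "a i = (\<integral>\<^sup>+x. f i x \<partial>M)" for i
  have \<theta>0: "i \<in> I \<Longrightarrow> \<theta> i \<noteq> 0" for i using \<theta>(1) by (metis less_irrefl)
  show ?thesis
  proof (cases "\<exists>j\<in>I. a j = 0")
    case True
    then obtain j where j: "j \<in> I" "a j = 0" by blast
    have "AE x in M. f j x = 0"
      using j f[OF j(1)] by (simp add: a_def nn_integral_0_iff_AE)
    then have "AE x in M. (\<Prod>i\<in>I. epow (f i x) (\<theta> i)) = 0"
    proof eventually_elim
      case (elim x)
      then have "epow (f j x) (\<theta> j) = 0" using \<theta>0[OF j(1)] by simp
      then show ?case using I j(1) by (meson prod_zero)
    qed
    then have "(\<integral>\<^sup>+x. (\<Prod>i\<in>I. epow (f i x) (\<theta> i)) \<partial>M) = (\<integral>\<^sup>+x. 0 \<partial>M)"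
      by (rule nn_integral_cong_AE)
    then show ?thesis by simp
  next
    case False
    then have a0: "\<And>i. i \<in> I \<Longrightarrow> a i \<noteq> 0" by blast
    show ?thesis
    proof (cases "\<exists>j\<in>I. a j = top")
      case True
      then obtain j where j: "j \<in> I" "a j = top" by blast
      have "(\<Prod>i\<in>I. epow (a i) (\<theta> i)) = top"
        by (rule prod_ennreal_pos_top[OF I j(1)]) (use j \<theta>0 a0 in \<open>auto simp: epow_eq_0_iff\<close>)
      then show ?thesis by (simp add: a_def)
    next
      case False
      define r where "r i = enn2real (a i)" for i
      have r: "a i = ennreal (r i)" "0 < r i" if "i \<in> I" for i
      proof -
        have "a i < top" "a i \<noteq> 0" using False a0 that by (auto simp: less_top)
        then show "a i = ennreal (r i)" "0 < r i"
          by (auto simp: r_def enn2real_positive_iff zero_less_iff_neq_zero)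
      qed
      define C where "C = (\<Prod>i\<in>I. epow (a i) (\<theta> i))"
      have C: "C = ennreal (\<Prod>i\<in>I. r i powr \<theta> i)"
        unfolding C_def using r \<theta>0 by (simp add: epow_ennreal less_imp_le prod_ennreal[symmetric])
      have "0 < (\<Prod>i\<in>I. r i powr \<theta> i)" using r(2) by (intro prod_pos) force
      then have C0: "C \<noteq> 0" unfolding C by (simp add: ennreal_eq_0_iff)
      have pw: "(\<Prod>i\<in>I. epow (f i x) (\<theta> i)) \<le> C * (\<Sum>i\<in>I. ennreal (\<theta> i / r i) * f i x)" for x
      proof (cases "\<exists>j\<in>I. f j x = top")
        case True
        then obtain j where j: "j \<in> I" "f j x = top" by blast
        have "ennreal (\<theta> j / r j) * f j x = top"
          using j r(2)[OF j(1)] \<theta>(1)[OF j(1)] by (simp add: ennreal_mult_top)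
        then have "(\<Sum>i\<in>I. ennreal (\<theta> i / r i) * f i x) = top"
          using sum.remove[OF I j(1), of "\<lambda>i. ennreal (\<theta> i / r i) * f i x"] by simp
        then show ?thesis using C0 by (simp add: ennreal_mult_top)
      next
        case False
        define t where "t i = enn2real (f i x)" for i
        have t: "f i x = ennreal (t i)" "0 \<le> t i" if "i \<in> I" for i
          using False that by (auto simp: t_def less_top)
        have "(\<Prod>i\<in>I. (t i / r i) powr \<theta> i) \<le> (\<Sum>i\<in>I. \<theta> i * (t i / r i))"
          by (rule weighted_AM_GM[OF I \<theta>]) (use t r in \<open>auto intro!: divide_nonneg_pos\<close>)
        moreover have "(\<Prod>i\<in>I. (t i / r i) powr \<theta> i) = (\<Prod>i\<in>I. t i powr \<theta> i) / (\<Prod>i\<in>I. r i powr \<theta> i)"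
          using t r by (simp add: powr_divide less_imp_le prod_dividef cong: prod.cong)
        ultimately have "(\<Prod>i\<in>I. t i powr \<theta> i) \<le> (\<Prod>i\<in>I. r i powr \<theta> i) * (\<Sum>i\<in>I. \<theta> i * (t i / r i))"
          using \<open>0 < (\<Prod>i\<in>I. r i powr \<theta> i)\<close> by (simp add: pos_divide_le_eq mult.commute)
        then have "ennreal (\<Prod>i\<in>I. t i powr \<theta> i) \<le> ennreal ((\<Prod>i\<in>I. r i powr \<theta> i) * (\<Sum>i\<in>I. \<theta> i * (t i / r i)))"
          by (rule ennreal_leI)
        also have "\<dots> = C * ennreal (\<Sum>i\<in>I. \<theta> i * (t i / r i))"
          unfolding C using \<open>0 < (\<Prod>i\<in>I. r i powr \<theta> i)\<close> by (intro ennreal_mult') simp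
        also have "ennreal (\<Sum>i\<in>I. \<theta> i * (t i / r i)) = (\<Sum>i\<in>I. ennreal (\<theta> i * (t i / r i)))"
        proof (rule sum_ennreal[symmetric])
          show "0 \<le> \<theta> i * (t i / r i)" if "i \<in> I" for i
            using t(2)[OF that] r(2)[OF that] \<theta>(1)[OF that] by simp
        qed
        also have "\<dots> = (\<Sum>i\<in>I. ennreal (\<theta> i / r i) * f i x)"
          using t r \<theta> by (intro sum.cong refl) (auto simp: ennreal_mult'[symmetric] less_imp_le)
        also have "ennreal (\<Prod>i\<in>I. t i powr \<theta> i) = (\<Prod>i\<in>I. epow (f i x) (\<theta> i))"
          using t \<theta>0 by (simp add: epow_ennreal prod_ennreal[symmetric] cong: prod.cong)
        finally show ?thesis .
      qed
      have "(\<integral>\<^sup>+x. (\<Prod>i\<in>I. epow (f i x) (\<theta> i)) \<partial>M) \<le> (\<integral>\<^sup>+x. C * (\<Sum>i\<in>I. ennreal (\<theta> i / r i) * f i x) \<partial>M)"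
        by (intro nn_integral_mono pw)
      also have "\<dots> = C * (\<Sum>i\<in>I. ennreal (\<theta> i / r i) * a i)"
        by (simp add: nn_integral_cmult nn_integral_sum a_def cong: sum.cong)
      also have "(\<Sum>i\<in>I. ennreal (\<theta> i / r i) * a i) = (\<Sum>i\<in>I. ennreal (\<theta> i))"
      proof (intro sum.cong refl)
        fix i assume i: "i \<in> I"
        have "ennreal (\<theta> i / r i) * a i = ennreal (\<theta> i / r i * r i)"
          unfolding r(1)[OF i] using r(2)[OF i] by (intro ennreal_mult''[symmetric]) simp
        then show "ennreal (\<theta> i / r i) * a i = ennreal (\<theta> i)" using r(2)[OF i] by simp
      qed
      also have "\<dots> = 1" using \<theta> by (subst sum_ennreal) (auto intro: less_imp_le)
      finally show ?thesis by (simp add: C_def a_def)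
    qed
  qed
qed

lemma Holder:
  fixes f :: "'i \<Rightarrow> 'a \<Rightarrow> ennreal"
  assumes I: "finite I" and \<theta>: "\<And>i. i \<in> I \<Longrightarrow> 0 \<le> \<theta> i" "(\<Sum>i\<in>I. \<theta> i) = 1"
    and f: "\<And>i. i \<in> I \<Longrightarrow> f i \<in> borel_measurable M"
  shows "(\<integral>\<^sup>+x. (\<Prod>i\<in>I. epow (f i x) (\<theta> i)) \<partial>M) \<le> (\<Prod>i\<in>I. epow (\<integral>\<^sup>+x. f i x \<partial>M) (\<theta> i))"
proof -
  let ?J = "{i \<in> I. \<theta> i \<noteq> 0}"
  have eq: "(\<Prod>i\<in>I. epow (F i) (\<theta> i)) = (\<Prod>i\<in>?J. epow (F i) (\<theta> i))" for F :: "'i \<Rightarrow> ennreal"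
    using I by (intro prod.mono_neutral_right) auto
  have "(\<Sum>i\<in>?J. \<theta> i) = 1"
    using I \<theta>(2) by (subst sum.mono_neutral_left[of I]) auto
  then show ?thesis
    unfolding eq using I \<theta>(1) f by (intro Holder_positive_weights) (auto simp: less_le)
qed

section \<open>Iterated integrals along lines\<close>

definition line_int :: "'a::euclidean_space \<Rightarrow> ('a \<Rightarrow> ennreal) \<Rightarrow> 'a \<Rightarrow> ennreal" where
  "line_int v g x = (\<integral>\<^sup>+t. g (x + t *\<^sub>R v) \<partial>lborel)"

lemma line_int_measurable [measurable]:
  assumes [measurable]: "g \<in> borel_measurable borel"
  shows "line_int v g \<in> borel_measurable borel"
  unfolding line_int_def by measurable

lemma line_int_mono: "(\<And>x. g x \<le> h x) \<Longrightarrow> line_int v g x \<le> line_int v h x"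
  unfolding line_int_def by (intro nn_integral_mono)

lemma line_int_shift: "line_int v (\<lambda>x. g (x + y)) x = line_int v g (x + y)"
  by (simp add: line_int_def algebra_simps)

lemma line_int_invariant:
  assumes [measurable]: "g \<in> borel_measurable borel"
  shows "line_int v g (x + s *\<^sub>R v) = line_int v g x"
proof -
  have "line_int v g (x + s *\<^sub>R v) = (\<integral>\<^sup>+t. g (x + (t + s) *\<^sub>R v) \<partial>lborel)"
    by (simp add: line_int_def algebra_simps)
  also have "\<dots> = line_int v g x"
    unfolding line_int_def by (rule nn_integral_lborel_shift) measurable
  finally show ?thesis .
qed

lemma line_int_commute:
  fixes v w :: "'a::euclidean_space"
  assumes [measurable]: "g \<in> borel_measurable borel"
  shows "line_int v (line_int w g) = line_int w (line_int v g)"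
proof
  fix x
  have "(\<integral>\<^sup>+t. (\<integral>\<^sup>+s. g (x + t *\<^sub>R v + s *\<^sub>R w) \<partial>lborel) \<partial>lborel) =
      (\<integral>\<^sup>+s. (\<integral>\<^sup>+t. g (x + t *\<^sub>R v + s *\<^sub>R w) \<partial>lborel) \<partial>lborel)"
    by (rule pair_sigma_finite.Fubini'[OF lborel_pair_sigma_finite]) measurable
  then show "line_int v (line_int w g) x = line_int w (line_int v g) x"
    by (simp add: line_int_def algebra_simps)
qed

text \<open>For spanning directions the value does not depend on the base point, so evaluation at 0
  is a translation invariant functional. Uniqueness of such functionals relates it to the Lebesgue
  integral without computing the determinant of a linear change of variables.\<close>

fun line_ints :: "'a::euclidean_space list \<Rightarrow> ('a \<Rightarrow> ennreal) \<Rightarrow> 'a \<Rightarrow> ennreal" where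
  "line_ints [] g = g"
| "line_ints (v # vs) g = line_ints vs (line_int v g)"

lemma line_ints_mono: "(\<And>x. g x \<le> h x) \<Longrightarrow> line_ints vs g x \<le> line_ints vs h x"
proof (induction vs arbitrary: g h)
  case (Cons v vs)
  show ?case unfolding line_ints.simps by (rule Cons.IH) (rule line_int_mono[OF Cons.prems])
qed simp

lemma line_ints_shift: "line_ints vs (\<lambda>x. g (x + y)) x = line_ints vs g (x + y)"
proof (induction vs arbitrary: g)
  case (Cons v vs)
  have "line_int v (\<lambda>x. g (x + y)) = (\<lambda>x. line_int v g (x + y))"
    by (simp add: line_int_shift fun_eq_iff)
  then show ?case using Cons.IH[of "line_int v g"] by simp
qed simp

lemma line_ints_invariant:
  assumes g: "g \<in> borel_measurable borel" and "w \<in> set vs"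
  shows "line_ints vs g (x + s *\<^sub>R w) = line_ints vs g x"
  using assms
proof (induction vs arbitrary: g)
  case (Cons v vs)
  show ?case
  proof (cases "w = v")
    case True
    have "(\<lambda>x. line_int v g (x + s *\<^sub>R v)) = line_int v g"
      by (simp add: line_int_invariant[OF Cons.prems(1)] fun_eq_iff)
    then show ?thesis
      using line_ints_shift[of vs "line_int v g" "s *\<^sub>R v" x] True by simp
  next
    case False
    then show ?thesis
      using Cons.IH[of "line_int v g"] Cons.prems by simp
  qed
qed simp

lemma line_ints_const:
  assumes g: "g \<in> borel_measurable borel" and sp: "span (set vs) = UNIV"
  shows "line_ints vs g x = line_ints vs g 0"
proof -
  have "\<forall>z. line_ints vs g (z + y) = line_ints vs g z" if "y \<in> span (set vs)" for y
    using that
  proof (induction y rule: span_induct_alt)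
    case (step c w y)
    show ?case
    proof
      fix z
      have "line_ints vs g (z + (c *\<^sub>R w + y)) = line_ints vs g ((z + c *\<^sub>R w) + y)"
        by (simp add: add.assoc)
      also have "\<dots> = line_ints vs g z"
        using step line_ints_invariant[OF g, of w vs z c] by simp
      finally show "line_ints vs g (z + (c *\<^sub>R w + y)) = line_ints vs g z" .
    qed
  qed simp
  from this[of x] have "line_ints vs g (0 + x) = line_ints vs g 0" using sp by blast
  then show ?thesis by simp
qed

text \<open>Tonelli, one direction at a time. The scalar \<open>s\<close> allows both signs of the
  convolution variable, as the Haar argument needs 1 and -1.\<close>

lemma nn_integral_line_ints:
  fixes k h :: "'a::euclidean_space \<Rightarrow> ennreal"
  assumes [measurable]: "k \<in> borel_measurable borel" and "h \<in> borel_measurable borel"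
  shows "(\<integral>\<^sup>+x. k x * line_ints vs h (z + s *\<^sub>R x) \<partial>lborel) =
    line_ints vs (\<lambda>y. \<integral>\<^sup>+x. k x * h (y + s *\<^sub>R x) \<partial>lborel) z"
  using assms(2)
proof (induction vs arbitrary: h)
  case (Cons v vs)
  note [measurable] = Cons.prems
  have "(\<lambda>y. \<integral>\<^sup>+x. k x * line_int v h (y + s *\<^sub>R x) \<partial>lborel) =
      line_int v (\<lambda>y. \<integral>\<^sup>+x. k x * h (y + s *\<^sub>R x) \<partial>lborel)"
  proof
    fix y
    have "(\<integral>\<^sup>+x. k x * line_int v h (y + s *\<^sub>R x) \<partial>lborel) =
        (\<integral>\<^sup>+x. (\<integral>\<^sup>+t. k x * h (y + s *\<^sub>R x + t *\<^sub>R v) \<partial>lborel) \<partial>lborel)"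
      unfolding line_int_def by (subst nn_integral_cmult) auto
    also have "\<dots> = (\<integral>\<^sup>+t. (\<integral>\<^sup>+x. k x * h (y + s *\<^sub>R x + t *\<^sub>R v) \<partial>lborel) \<partial>lborel)"
      by (rule pair_sigma_finite.Fubini'[OF lborel_pair_sigma_finite]) measurable
    also have "\<dots> = line_int v (\<lambda>y. \<integral>\<^sup>+x. k x * h (y + s *\<^sub>R x) \<partial>lborel) y"
      by (simp add: line_int_def algebra_simps)
    finally show "(\<integral>\<^sup>+x. k x * line_int v h (y + s *\<^sub>R x) \<partial>lborel) =
        line_int v (\<lambda>y. \<integral>\<^sup>+x. k x * h (y + s *\<^sub>R x) \<partial>lborel) y" .
  qed
  then show ?case
    using Cons.IH[of "line_int v h"] by simp
qed simp

text \<open>Uniqueness of Haar measure, for the two translation invariant integrals \<open>line_ints vs _ 0\<close>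
  and Lebesgue: both sides equal the double integral of \<open>h x * k (x - y)\<close>.\<close>

lemma line_ints_Haar:
  fixes h k :: "'a::euclidean_space \<Rightarrow> ennreal"
  assumes [measurable]: "h \<in> borel_measurable borel" "k \<in> borel_measurable borel"
    and even: "\<And>x. k (- x) = k x" and sp: "span (set vs) = UNIV"
  shows "line_ints vs h 0 * (\<integral>\<^sup>+x. k x \<partial>lborel) = line_ints vs k 0 * (\<integral>\<^sup>+x. h x \<partial>lborel)"
proof -
  have "line_ints vs h 0 * (\<integral>\<^sup>+x. k x \<partial>lborel) = (\<integral>\<^sup>+x. k x * line_ints vs h (0 + 1 *\<^sub>R x) \<partial>lborel)"
  proof -
    have "(\<lambda>x. k x * line_ints vs h (0 + 1 *\<^sub>R x)) = (\<lambda>x. line_ints vs h 0 * k x)"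
      by (rule ext, subst line_ints_const[OF assms(1) sp]) (rule mult.commute)
    then show ?thesis by (simp only:) (simp add: nn_integral_cmult)
  qed
  also have "\<dots> = line_ints vs (\<lambda>y. \<integral>\<^sup>+x. k x * h (y + 1 *\<^sub>R x) \<partial>lborel) 0"
    by (rule nn_integral_line_ints) auto
  also have "(\<lambda>y. \<integral>\<^sup>+x. k x * h (y + 1 *\<^sub>R x) \<partial>lborel) = (\<lambda>y. \<integral>\<^sup>+x. h x * k (y + (- 1) *\<^sub>R x) \<partial>lborel)"
  proof
    fix y
    have "(\<integral>\<^sup>+x. k x * h (y + 1 *\<^sub>R x) \<partial>lborel) = (\<integral>\<^sup>+x. k (x + y - y) * h (x + y) \<partial>lborel)"
      by (simp add: add.commute)
    also have "\<dots> = (\<integral>\<^sup>+x. k (x - y) * h x \<partial>lborel)"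
      by (rule nn_integral_lborel_shift[of "\<lambda>x. k (x - y) * h x"]) measurable
    also have "\<dots> = (\<integral>\<^sup>+x. h x * k (y + (- 1) *\<^sub>R x) \<partial>lborel)"
      using even by (intro nn_integral_cong) (simp add: mult.commute, metis minus_diff_eq)
    finally show "(\<integral>\<^sup>+x. k x * h (y + 1 *\<^sub>R x) \<partial>lborel) = (\<integral>\<^sup>+x. h x * k (y + (- 1) *\<^sub>R x) \<partial>lborel)" .
  qed
  also have "line_ints vs (\<lambda>y. \<integral>\<^sup>+x. h x * k (y + (- 1) *\<^sub>R x) \<partial>lborel) 0 =
      (\<integral>\<^sup>+x. h x * line_ints vs k (0 + (- 1) *\<^sub>R x) \<partial>lborel)"
    by (rule nn_integral_line_ints[symmetric]) auto
  also have "\<dots> = line_ints vs k 0 * (\<integral>\<^sup>+x. h x \<partial>lborel)"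
  proof -
    have "(\<lambda>x. h x * line_ints vs k (0 + (- 1) *\<^sub>R x)) = (\<lambda>x. line_ints vs k 0 * h x)"
      by (rule ext, subst line_ints_const[OF assms(2) sp]) (rule mult.commute)
    then show ?thesis by (simp only:) (simp add: nn_integral_cmult)
  qed
  finally show ?thesis .
qed

text \<open>Induction over the directions still to be integrated; \<open>m\<close> counts those
  already done, each of which has left a factor of exponent \<open>1 / (n - 1)\<close> in the
  current \<open>G\<close>. Along the head direction its own line integral is constant and leaves
  the integral. The exponents of all other factors then add up to 1, so Holder applies and the count
  rises to \<open>Suc m\<close>.\<close>

lemma Gagliardo_list:
  fixes G :: "'a::euclidean_space \<Rightarrow> ennreal"
  assumes "G \<in> borel_measurable borel" and n: "m + length vs = n" "2 \<le> n"
  shows "line_ints vs (\<lambda>x. epow (G x) (real m / (real n - 1)) *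
      (\<Prod>i<length vs. epow (line_int (vs ! i) G x) (1 / (real n - 1)))) x
    \<le> epow (line_ints vs G x) (real n / (real n - 1))"
  using assms(1) n(1)
proof (induction vs arbitrary: G m)
  case (Cons v vs)
  let ?\<theta> = "1 / (real n - 1)"
  note [measurable] = Cons.prems(1)
  have n1: "0 < real n - 1" using n(2) by simp
  \<comment> \<open>Index 0 is the current \<open>G\<close>, a positive index stands for one of the
    remaining directions; hence the shift in \<open>vs ! (i - 1)\<close>.\<close>
  define f where "f i = (if i = 0 then G else line_int (vs ! (i - 1)) G)" for i :: nat
  define \<theta> where "\<theta> i = (if i = 0 then real m / (real n - 1) else ?\<theta>)" for i :: nat
  have fm: "f i \<in> borel_measurable borel" for i unfolding f_def by simp
  have H: "line_int v (\<lambda>x. epow (G x) (real m / (real n - 1)) *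
        (\<Prod>i<length (v # vs). epow (line_int ((v # vs) ! i) G x) ?\<theta>)) x \<le>
      epow (line_int v G x) (real (Suc m) / (real n - 1)) *
        (\<Prod>i<length vs. epow (line_int (vs ! i) (line_int v G) x) ?\<theta>)" for x
  proof -
    have "line_int v (\<lambda>x. epow (G x) (real m / (real n - 1)) *
        (\<Prod>i<length (v # vs). epow (line_int ((v # vs) ! i) G x) ?\<theta>)) x =
        (\<integral>\<^sup>+t. epow (line_int v G x) ?\<theta> * (\<Prod>i<Suc (length vs). epow (f i (x + t *\<^sub>R v)) (\<theta> i)) \<partial>lborel)"
      unfolding line_int_def[of v "\<lambda>x. epow (G x) (real m / (real n - 1)) * _ x"]
      by (intro nn_integral_cong)
        (simp add: prod.lessThan_Suc_shift line_int_invariant[OF Cons.prems(1)] f_def \<theta>_def mult_ac del: prod.lessThan_Suc)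
    also have "\<dots> = epow (line_int v G x) ?\<theta> * (\<integral>\<^sup>+t. (\<Prod>i<Suc (length vs). epow (f i (x + t *\<^sub>R v)) (\<theta> i)) \<partial>lborel)"
    proof (rule nn_integral_cmult)
      have [measurable]: "(\<lambda>t. f i (x + t *\<^sub>R v)) \<in> borel_measurable lborel" for i
        by (rule measurable_compose[OF _ fm[of i]]) measurable
      show "(\<lambda>t. \<Prod>i<Suc (length vs). epow (f i (x + t *\<^sub>R v)) (\<theta> i)) \<in> borel_measurable lborel"
        by measurable
    qed
    also have "(\<integral>\<^sup>+t. (\<Prod>i<Suc (length vs). epow (f i (x + t *\<^sub>R v)) (\<theta> i)) \<partial>lborel) \<le>
        (\<Prod>i<Suc (length vs). epow (\<integral>\<^sup>+t. f i (x + t *\<^sub>R v) \<partial>lborel) (\<theta> i))"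
    proof (rule Holder)
      have "(\<Sum>i<Suc (length vs). \<theta> i) = real m / (real n - 1) + real (length vs) / (real n - 1)"
        by (simp add: sum.lessThan_Suc_shift \<theta>_def del: sum.lessThan_Suc)
      also have "\<dots> = 1"
        using n1 Cons.prems(2) by (simp add: add_divide_distrib[symmetric])
      finally show "(\<Sum>i<Suc (length vs). \<theta> i) = 1" .
      show "(\<lambda>t. f i (x + t *\<^sub>R v)) \<in> borel_measurable lborel" for i
        by (rule measurable_compose[OF _ fm[of i]]) measurable
    qed (use n1 in \<open>auto simp: \<theta>_def\<close>)
    also have "\<dots> = epow (line_int v G x) (real m / (real n - 1)) *
        (\<Prod>i<length vs. epow (line_int v (line_int (vs ! i) G) x) ?\<theta>)"
      by (simp add: prod.lessThan_Suc_shift f_def \<theta>_def line_int_def[of v] del: prod.lessThan_Suc)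
    finally have "line_int v (\<lambda>x. epow (G x) (real m / (real n - 1)) *
        (\<Prod>i<length (v # vs). epow (line_int ((v # vs) ! i) G x) ?\<theta>)) x \<le>
        epow (line_int v G x) ?\<theta> * (epow (line_int v G x) (real m / (real n - 1)) *
        (\<Prod>i<length vs. epow (line_int v (line_int (vs ! i) G) x) ?\<theta>))"
      by (simp add: mult_left_mono)
    also have "\<dots> = epow (line_int v G x) (?\<theta> + real m / (real n - 1)) *
        (\<Prod>i<length vs. epow (line_int (vs ! i) (line_int v G) x) ?\<theta>)"
      using n1 by (simp add: epow_add mult.assoc line_int_commute[OF Cons.prems(1), of v])
    also have "?\<theta> + real m / (real n - 1) = real (Suc m) / (real n - 1)"
      by (simp add: add_divide_distrib)
    finally show ?thesis .
  qed
  have "line_ints (v # vs) (\<lambda>x. epow (G x) (real m / (real n - 1)) *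
        (\<Prod>i<length (v # vs). epow (line_int ((v # vs) ! i) G x) ?\<theta>)) x \<le>
      line_ints vs (\<lambda>x. epow (line_int v G x) (real (Suc m) / (real n - 1)) *
        (\<Prod>i<length vs. epow (line_int (vs ! i) (line_int v G) x) ?\<theta>)) x"
    unfolding line_ints.simps by (rule line_ints_mono) (rule H)
  also have "\<dots> \<le> epow (line_ints vs (line_int v G) x) (real n / (real n - 1))"
    by (rule Cons.IH) (use Cons.prems in auto)
  finally show ?case by simp
qed simp

text \<open>The parallelepiped spanned by the \<open>v b\<close>, written in dual coordinates, is
  the set on which iterated integration is normalised. It serves to show that the constant comparing
  iterated and Lebesgue integrals is neither 0 nor infinite.\<close>

lemma line_ints_dual_basis:
  fixes v :: "'a::euclidean_space \<Rightarrow> 'a" and l :: "'a \<Rightarrow> 'a \<Rightarrow> real"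
  assumes "distinct bs" and lin: "\<And>b. linear (l b)"
    and dual: "\<And>b c. b \<in> set bs \<Longrightarrow> c \<in> set bs \<Longrightarrow> l b (v c) = (if b = c then 1 else 0)"
  shows "line_ints (map v bs) (\<lambda>x. \<Prod>b\<in>set bs. indicator {0..1} (l b x)) x = 1"
  using assms(1) dual
proof (induction bs)
  case (Cons b bs)
  have "line_int (v b) (\<lambda>x. \<Prod>c\<in>set (b # bs). indicator {0..1} (l c x)) x =
      (\<Prod>c\<in>set bs. indicator {0..1} (l c x))" for x
  proof -
    have e1: "l b (x + t *\<^sub>R v b) = l b x + t" for t
      using lin[of b] Cons.prems(2)[of b b] by (simp add: linear_add linear_cmul)
    have e2: "l c (x + t *\<^sub>R v b) = l c x" if "c \<in> set bs" for c t
      using lin[of c] Cons.prems(2)[of c b] Cons.prems(1) that by (auto simp: linear_add linear_cmul)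
    have "line_int (v b) (\<lambda>x. \<Prod>c\<in>set (b # bs). indicator {0..1} (l c x)) x =
        (\<integral>\<^sup>+t. (\<Prod>c\<in>set bs. indicator {0..1} (l c x)) * indicator {0..1} (t + l b x) \<partial>lborel)"
      unfolding line_int_def using Cons.prems(1)
      by (intro nn_integral_cong) (simp add: e1 e2 mult.commute add.commute cong: prod.cong)
    also have "\<dots> = (\<Prod>c\<in>set bs. indicator {0..1} (l c x)) * (\<integral>\<^sup>+t. indicator {0..1} (t + l b x) \<partial>lborel)"
      by (intro nn_integral_cmult) measurable
    also have "(\<integral>\<^sup>+t. indicator {0..1} (t + l b x) \<partial>lborel) = (\<integral>\<^sup>+t. indicator {0..1::real} t \<partial>lborel)"
      by (rule nn_integral_lborel_shift[of "indicator {0..1}"]) measurable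
    finally show ?thesis by simp
  qed
  then have eq: "line_int (v b) (\<lambda>x. \<Prod>c\<in>set (b # bs). indicator {0..1} (l c x)) =
      (\<lambda>x. \<Prod>c\<in>set bs. indicator {0..1} (l c x))" by (rule ext)
  show ?case
    unfolding list.map line_ints.simps eq using Cons by auto
qed simp

text \<open>The iterated integral is \<open>K / V\<close> times the Lebesgue integral. The constant
  \<open>C\<close> collects the conversion \<open>V / K\<close> of the left side and the power of
  \<open>K / V\<close> arising on the right side.\<close>

lemma Gagliardo_directions:
  fixes v :: "'a::euclidean_space \<Rightarrow> 'a" and l :: "'a \<Rightarrow> 'a \<Rightarrow> real"
  assumes lin: "\<And>b. linear (l b)"
    and dual: "\<And>b c. b \<in> Basis \<Longrightarrow> c \<in> Basis \<Longrightarrow> l b (v c) = (if b = c then 1 else 0)"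
    and repr: "\<And>x. x = (\<Sum>b\<in>Basis. l b x *\<^sub>R v b)"
    and dim: "2 \<le> DIM('a)"
  obtains C where "C < top" and "\<And>g. g \<in> borel_measurable borel \<Longrightarrow>
    (\<integral>\<^sup>+x. (\<Prod>b\<in>Basis. epow (line_int (v b) g x) (1 / (real DIM('a) - 1))) \<partial>lborel) \<le>
      C * epow (\<integral>\<^sup>+x. g x \<partial>lborel) (real DIM('a) / (real DIM('a) - 1))"
proof -
  obtain bs where bs: "set bs = (Basis :: 'a set)" "distinct bs"
    using finite_distinct_list[OF finite_Basis] by blast
  define vs where "vs = map v bs"
  have len: "length vs = DIM('a)"
    using distinct_card[OF bs(2)] by (simp add: vs_def bs(1))
  have sp: "span (set vs) = UNIV"
  proof -
    have "(\<Sum>b\<in>Basis. l b x *\<^sub>R v b) \<in> span (set vs)" for x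
      by (intro span_sum span_scale span_base) (auto simp: vs_def bs(1))
    then show ?thesis using repr by (metis UNIV_eq_I)
  qed
  \<comment> \<open>The uniqueness argument compares with an even function, and its integral
    \<open>V\<close> is divided out, so it must be positive and finite.\<close>
  define k :: "'a \<Rightarrow> ennreal" where "k = indicator (ball 0 1)"
  have km[measurable]: "k \<in> borel_measurable borel" unfolding k_def by (intro borel_measurable_indicator) auto
  define V where "V = (\<integral>\<^sup>+x. k x \<partial>(lborel :: 'a measure))"
  have V: "V = emeasure lborel (ball (0::'a) 1)" by (simp add: V_def k_def)
  have "V < top" unfolding V using emeasure_bounded_finite[of "ball (0::'a) 1"] by (simp add: less_top)
  have "V \<noteq> 0"
  proof
    assume "V = 0"
    then have "ball (0::'a) 1 \<in> null_sets lborel" unfolding V by (simp add: null_sets_def)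
    then have "negligible (ball (0::'a) 1)"
      by (metis negligible_iff_null_sets null_sets_completionI)
    then show False using open_not_negligible[of "ball (0::'a) 1"] by simp
  qed
  define K where "K = line_ints vs k 0"
  have Haar: "line_ints vs h 0 * V = K * (\<integral>\<^sup>+x. h x \<partial>lborel)" if "h \<in> borel_measurable borel" for h
    unfolding V_def K_def by (rule line_ints_Haar[OF that km _ sp]) (simp add: k_def split: split_indicator)
  have [measurable]: "l b \<in> borel_measurable borel" for b
    using lin[of b] by (intro borel_measurable_continuous_onI linear_continuous_on linear_conv_bounded_linear[THEN iffD1])
  have "line_ints vs (\<lambda>x. \<Prod>b\<in>Basis. indicator {0..1} (l b x)) 0 = 1"
    using line_ints_dual_basis[OF bs(2) lin, where v = v and x = 0] dual by (simp add: vs_def bs(1))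
  with Haar[of "\<lambda>x. \<Prod>b\<in>Basis. indicator {0..1} (l b x)"]
  have "V = K * (\<integral>\<^sup>+x. (\<Prod>b\<in>Basis. indicator {0..1} (l b x)) \<partial>lborel)" by simp
  with \<open>V < top\<close> \<open>V \<noteq> 0\<close> have "K \<noteq> 0" "K \<noteq> top"
    by (auto simp: ennreal_top_mult split: if_splits)
  define \<nu> where "\<nu> = real DIM('a) / (real DIM('a) - 1)"
  have "0 < \<nu>" using dim by (simp add: \<nu>_def)
  define C where "C = V / K * epow (K / V) \<nu>"
  have "V \<noteq> top" using \<open>V < top\<close> by simp
  have "V / K \<noteq> top" "K / V \<noteq> top"
    using \<open>V \<noteq> top\<close> \<open>V \<noteq> 0\<close> \<open>K \<noteq> 0\<close> \<open>K \<noteq> top\<close> by (simp_all add: ennreal_divide_eq_top_iff)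
  then have "V / K < top" "K / V < top" by (simp_all only: less_top)
  then have "C < top" unfolding C_def by (intro ennreal_mult_less_top[THEN iffD2]) (simp add: epow_less_top)
  moreover have "(\<integral>\<^sup>+x. (\<Prod>b\<in>Basis. epow (line_int (v b) g x) (1 / (real DIM('a) - 1))) \<partial>lborel) \<le>
      C * epow (\<integral>\<^sup>+x. g x \<partial>lborel) \<nu>" if g[measurable]: "g \<in> borel_measurable borel" for g
  proof -
    let ?F = "\<lambda>x. \<Prod>b\<in>Basis. epow (line_int (v b) g x) (1 / (real DIM('a) - 1))"
    let ?I = "\<integral>\<^sup>+x. g x \<partial>lborel"
    have [measurable]: "?F \<in> borel_measurable borel" by measurable
    have prod: "(\<Prod>i<length vs. epow (line_int (vs ! i) g x) \<theta>) = (\<Prod>b\<in>Basis. epow (line_int (v b) g x) \<theta>)" for x \<theta>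
    proof -
      have "(\<Prod>b\<in>Basis. epow (line_int (v b) g x) \<theta>) = (\<Prod>i<length bs. epow (line_int (v (bs ! i)) g x) \<theta>)"
        using bij_betw_nth[OF bs(2) refl bs(1)[symmetric]] by (rule prod.reindex_bij_betw[symmetric])
      then show ?thesis by (simp add: vs_def)
    qed
    have eq: "line_ints vs g 0 = K / V * ?I"
    proof -
      have "line_ints vs g 0 = line_ints vs g 0 * V / V"
        using \<open>V \<noteq> 0\<close> \<open>V \<noteq> top\<close> by (simp add: ennreal_mult_divide_eq)
      also have "\<dots> = K * ?I / V" by (simp only: Haar[OF g])
      also have "\<dots> = K / V * ?I" by (simp add: divide_ennreal_def mult_ac)
      finally show ?thesis .
    qed
    have "line_ints vs ?F 0 \<le> epow (line_ints vs g 0) \<nu>"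
      using Gagliardo_list[OF g, of 0 vs "DIM('a)" 0] len dim by (simp add: prod[unfolded len] \<nu>_def)
    then have "line_ints vs ?F 0 * V \<le> epow (K / V * ?I) \<nu> * V"
      unfolding eq by (rule mult_right_mono) simp
    then have "K * (\<integral>\<^sup>+x. ?F x \<partial>lborel) \<le> epow (K / V) \<nu> * epow ?I \<nu> * V"
      using Haar[of ?F] \<open>0 < \<nu>\<close> by (simp add: epow_mult)
    then have "K * (\<integral>\<^sup>+x. ?F x \<partial>lborel) / K \<le> epow (K / V) \<nu> * epow ?I \<nu> * V / K"
      by (rule divide_right_mono_ennreal)
    moreover have "K * (\<integral>\<^sup>+x. ?F x \<partial>lborel) / K = (\<integral>\<^sup>+x. ?F x \<partial>lborel)"
      using \<open>K \<noteq> 0\<close> \<open>K \<noteq> top\<close> by (simp add: ennreal_mult_divide_eq mult.commute[of K])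
    moreover have "epow (K / V) \<nu> * epow ?I \<nu> * V / K = C * epow ?I \<nu>"
      by (simp add: C_def divide_ennreal_def mult_ac)
    ultimately show ?thesis by (simp only:)
  qed
  ultimately show ?thesis using that unfolding \<nu>_def by blast
qed

subsection \<open>The Sobolev embedding on Lipschitz domains\<close>

text \<open>Linearly independent directions \<open>v b\<close>, with dual functionals, along which a neighbourhood of a
  point can be moved inside \<open>\<Omega>\<close>.\<close>

definition interior_directions :: "'a::euclidean_space set \<Rightarrow> 'a set \<Rightarrow> ('a \<Rightarrow> 'a) \<Rightarrow> ('a \<Rightarrow> 'a \<Rightarrow> real) \<Rightarrow> bool" where
  "interior_directions \<Omega> S v l \<longleftrightarrow> (\<forall>b. linear (l b)) \<and>
     (\<forall>b\<in>Basis. \<forall>c\<in>Basis. l b (v c) = (if b = c then 1 else 0)) \<and>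
     (\<forall>x. x = (\<Sum>b\<in>Basis. l b x *\<^sub>R v b)) \<and>
     (\<forall>x\<in>S. \<forall>b\<in>Basis. \<forall>t\<in>{0..1}. x + t *\<^sub>R v b \<in> \<Omega>)"

text \<open>The vectors \<open>e + \<eta> *\<^sub>R b\<close> form a rank-one perturbation of a
  multiple of the identity. For \<open>\<eta> \<noteq> 0\<close> it is invertible because the
  coordinate sum of \<open>e\<close> plus \<open>\<eta>\<close> is nonzero. The functional
  \<open>\<sigma>\<close> reads off the coefficient of \<open>e\<close>, and \<open>l\<close> is the
  resulting Sherman-Morrison inverse.\<close>

lemma cone_directions:
  fixes e :: "'a::euclidean_space"
  assumes "\<tau> \<noteq> 0" "\<eta> \<noteq> 0" "(\<Sum>c\<in>Basis. e \<bullet> c) + \<eta> \<noteq> 0"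
    and "\<And>x b t. x \<in> S \<Longrightarrow> b \<in> Basis \<Longrightarrow> 0 \<le> t \<Longrightarrow> t \<le> 1 \<Longrightarrow> x + t *\<^sub>R (\<tau> *\<^sub>R (e + \<eta> *\<^sub>R b)) \<in> \<Omega>"
  shows "\<exists>v l. interior_directions \<Omega> S v l"
proof -
  define s0 where "s0 = (\<Sum>c\<in>Basis. e \<bullet> c) + \<eta>"
  define \<sigma> where "\<sigma> x = (\<Sum>c\<in>Basis. x \<bullet> c) / s0" for x :: 'a
  define v where "v b = \<tau> *\<^sub>R (e + \<eta> *\<^sub>R b)" for b :: 'a
  define l where "l b x = (x \<bullet> b - \<sigma> x * (e \<bullet> b)) / (\<eta> * \<tau>)" for b x :: 'a
  have s0: "s0 \<noteq> 0" using assms(3) by (simp add: s0_def)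
  have lin\<sigma>: "\<sigma> (x + y) = \<sigma> x + \<sigma> y" "\<sigma> (c *\<^sub>R x) = c * \<sigma> x" for x y c
    by (simp_all add: \<sigma>_def inner_add_left sum.distrib add_divide_distrib sum_distrib_left[symmetric])
  have "linear (l b)" for b
    by (rule linearI) (simp_all add: l_def lin\<sigma> inner_add_left add_divide_distrib diff_divide_distrib algebra_simps)
  moreover have "l b (v c) = (if b = c then 1 else 0)" if "b \<in> Basis" "c \<in> Basis" for b c
  proof -
    have "(\<Sum>d\<in>Basis. c \<bullet> d) = 1"
      using that(2) by (simp add: inner_Basis)
    then have "\<sigma> (e + \<eta> *\<^sub>R c) = 1"
      using s0 by (simp add: \<sigma>_def s0_def inner_add_left sum.distrib sum_distrib_left[symmetric])
    then have "\<sigma> (v c) = \<tau>" by (simp add: v_def lin\<sigma>)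
    then show ?thesis
      using assms(1,2) that by (simp add: l_def v_def inner_add_left inner_Basis field_simps)
  qed
  moreover have "x = (\<Sum>b\<in>Basis. l b x *\<^sub>R v b)" for x
  proof -
    have "(\<Sum>b\<in>Basis. x \<bullet> b) - \<sigma> x * (\<Sum>b\<in>Basis. e \<bullet> b) = \<sigma> x * \<eta>"
      using s0 by (simp add: \<sigma>_def s0_def field_simps)
    then have 1: "(\<Sum>b\<in>Basis. x \<bullet> b - \<sigma> x * (e \<bullet> b)) / \<eta> = \<sigma> x"
      using assms(2) by (simp add: sum_subtractf sum_distrib_left)
    have "(\<Sum>b\<in>Basis. l b x *\<^sub>R v b) = (\<Sum>b\<in>Basis. ((x \<bullet> b - \<sigma> x * (e \<bullet> b)) / \<eta>) *\<^sub>R e + (x \<bullet> b - \<sigma> x * (e \<bullet> b)) *\<^sub>R b)"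
      using assms(1,2) by (intro sum.cong refl) (simp add: l_def v_def scaleR_add_right)
    also have "\<dots> = ((\<Sum>b\<in>Basis. x \<bullet> b - \<sigma> x * (e \<bullet> b)) / \<eta>) *\<^sub>R e +
        ((\<Sum>b\<in>Basis. (x \<bullet> b) *\<^sub>R b) - \<sigma> x *\<^sub>R (\<Sum>b\<in>Basis. (e \<bullet> b) *\<^sub>R b))"
    proof -
      have "((\<Sum>b\<in>Basis. x \<bullet> b - \<sigma> x * (e \<bullet> b)) / \<eta>) *\<^sub>R e = (\<Sum>b\<in>Basis. ((x \<bullet> b - \<sigma> x * (e \<bullet> b)) / \<eta>) *\<^sub>R e)"
        by (simp only: sum_divide_distrib scaleR_sum_left)
      then show ?thesis
        by (simp add: sum.distrib scaleR_diff_left sum_subtractf scaleR_sum_right)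
    qed
    also have "\<dots> = x"
      unfolding 1 by (simp add: euclidean_representation)
    finally show ?thesis by simp
  qed
  moreover have "x + t *\<^sub>R v b \<in> \<Omega>" if "x \<in> S" "b \<in> Basis" "t \<in> {0..1}" for x b t
    using assms(4)[OF that(1,2), of t] that(3) by (simp add: v_def)
  ultimately show ?thesis
    unfolding interior_directions_def by blast
qed

text \<open>Near an interior point all short directions work. Near a boundary point the inward
  direction \<open>e\<close> is tilted slightly along each basis vector: the tilted directions still
  lie in the cone above the Lipschitz graph, and they are linearly independent.\<close>

lemma lipschitz_domain_directions:
  fixes \<Omega> :: "'a::euclidean_space set"
  assumes lip: "lipschitz_domain \<Omega>" and z: "z \<in> closure \<Omega>"
  shows "\<exists>\<rho>>0. \<exists>v l. interior_directions \<Omega> (\<Omega> \<inter> ball z \<rho>) v l"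
proof -
  have "open \<Omega>" using lip by (simp add: lipschitz_domain_def)
  show ?thesis
  proof (cases "z \<in> \<Omega>")
    case True
    then obtain r where r: "0 < r" "ball z r \<subseteq> \<Omega>"
      using \<open>open \<Omega>\<close> by (meson open_contains_ball)
    have "\<exists>v l. interior_directions \<Omega> (\<Omega> \<inter> ball z (r / 2)) v l"
    proof (rule cone_directions[where e = 0 and \<eta> = 1 and \<tau> = "r / 2"])
      fix x b :: 'a and t :: real
      assume "x \<in> \<Omega> \<inter> ball z (r / 2)" "b \<in> Basis" "0 \<le> t" "t \<le> 1"
      then have "norm (x - z) < r / 2" "norm (t *\<^sub>R ((r / 2) *\<^sub>R (0 + 1 *\<^sub>R b))) \<le> r / 2"
        using r(1) by (auto simp: dist_norm norm_minus_commute mult_left_le_one_le)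
      then have "norm ((x - z) + t *\<^sub>R ((r / 2) *\<^sub>R (0 + 1 *\<^sub>R b))) < r"
        using norm_triangle_ineq[of "x - z" "t *\<^sub>R ((r / 2) *\<^sub>R (0 + 1 *\<^sub>R b))"] by linarith
      then have "x + t *\<^sub>R ((r / 2) *\<^sub>R (0 + 1 *\<^sub>R b)) \<in> ball z r"
        by (simp add: dist_norm norm_minus_commute algebra_simps)
      with r(2) show "x + t *\<^sub>R ((r / 2) *\<^sub>R (0 + 1 *\<^sub>R b)) \<in> \<Omega>" by blast
    qed (use r in auto)
    then show ?thesis using r(1) by (intro exI[of _ "r / 2"]) auto
  next
    case False
    then have "z \<in> frontier \<Omega>" using z \<open>open \<Omega>\<close> by (simp add: frontier_def interior_open)
    then obtain e r L and \<gamma> :: "'a \<Rightarrow> real" where e: "norm e = 1" and r: "0 < r"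
      and L: "L-lipschitz_on {y. y \<bullet> e = 0} \<gamma>"
      and graph: "\<Omega> \<inter> ball z r = {x \<in> ball z r. \<gamma> (x - (x \<bullet> e) *\<^sub>R e) < x \<bullet> e}"
      using lip unfolding lipschitz_domain_def lipschitz_boundary_def by blast
    have "0 \<le> L" using L by (rule lipschitz_on_nonneg)
    have ee: "e \<bullet> e = 1" using e by (simp add: norm_eq_1)
    \<comment> \<open>Solves \<open>2 * L * \<eta>0 = 1 - \<eta>0\<close>. The tangential part of
      the tilted direction has norm at most \<open>2 * \<eta>0\<close> and its component along
      \<open>e\<close> is at least \<open>1 - \<eta>0\<close>, so the graph cannot catch up with the
      shifted point.\<close>
    define \<eta>0 where "\<eta>0 = 1 / (2 * L + 1)"
    have \<eta>0: "0 < \<eta>0" "2 * L * \<eta>0 + \<eta>0 = 1" "\<eta>0 \<le> 1"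
      using \<open>0 \<le> L\<close> by (auto simp: \<eta>0_def field_simps)
    \<comment> \<open>The sign avoids the degenerate case: if the coordinate sum of \<open>e\<close>
      is \<open>- \<eta>0\<close>, adding \<open>\<eta>\<close> gives
      \<open>- 2 * \<eta>0\<close>.\<close>
    define \<eta> where "\<eta> = (if (\<Sum>c\<in>Basis. e \<bullet> c) + \<eta>0 = 0 then - \<eta>0 else \<eta>0)"
    have \<eta>: "\<bar>\<eta>\<bar> = \<eta>0" "\<eta> \<noteq> 0" "(\<Sum>c\<in>Basis. e \<bullet> c) + \<eta> \<noteq> 0"
      using \<eta>0 by (auto simp: \<eta>_def)
    have "\<exists>v l. interior_directions \<Omega> (\<Omega> \<inter> ball z (r / 2)) v l"
    \<comment> \<open>The tilted direction has norm at most 2, so the scale \<open>r / 4\<close>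
      keeps shifts of points of the half ball inside \<open>ball z r\<close>, where the graph
      description holds.\<close>
    proof (rule cone_directions[where e = e and \<eta> = \<eta> and \<tau> = "r / 4"])
      fix x b :: 'a and t :: real
      assume x: "x \<in> \<Omega> \<inter> ball z (r / 2)" and b: "b \<in> Basis" and t: "0 \<le> t" "t \<le> 1"
      define w where "w = e + \<eta> *\<^sub>R b"
      define s where "s = t * (r / 4)"
      define P where "P y = y - (y \<bullet> e) *\<^sub>R e" for y :: 'a
      have "0 \<le> s" "s \<le> r / 4" using t r by (auto simp: s_def mult_left_le_one_le)
      have Pe: "P y \<bullet> e = 0" for y by (simp add: P_def inner_diff_left ee)
      have Padd: "P (x + s *\<^sub>R w) = P x + s *\<^sub>R P w"
        by (simp add: P_def inner_add_left algebra_simps)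
      have be: "\<bar>b \<bullet> e\<bar> \<le> 1" using Cauchy_Schwarz_ineq2[of b e] e b by simp
      have "norm w \<le> 2"
        using norm_triangle_ineq[of e "\<eta> *\<^sub>R b"] e b \<eta>(1) \<eta>0(3) by (simp add: w_def)
      have we: "w \<bullet> e \<ge> 1 - \<eta>0"
      proof -
        have "\<bar>\<eta> * (b \<bullet> e)\<bar> \<le> \<eta>0 * 1" unfolding abs_mult \<eta>(1) using be \<eta>0(1) by (intro mult_left_mono) auto
        then show ?thesis by (simp add: w_def inner_add_left ee)
      qed
      have "norm (P w) \<le> 2 * \<eta>0"
      proof -
        have "P w = \<eta> *\<^sub>R (b - (b \<bullet> e) *\<^sub>R e)" by (simp add: P_def w_def inner_add_left ee algebra_simps)
        moreover have "norm (b - (b \<bullet> e) *\<^sub>R e) \<le> 2"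
          using norm_triangle_ineq4[of b "(b \<bullet> e) *\<^sub>R e"] be b e by simp
        ultimately show ?thesis using \<eta>(1) \<eta>0(1) by (simp add: mult.commute mult_left_mono)
      qed
      then have "L * norm (P w) \<le> w \<bullet> e"
        using mult_left_mono[of "norm (P w)" "2 * \<eta>0" L] \<open>0 \<le> L\<close> we \<eta>0(2) by (simp add: algebra_simps)
      have "norm (x - z) < r / 2" using x by (simp add: dist_norm norm_minus_commute)
      moreover have "norm (s *\<^sub>R w) \<le> (r / 4) * 2"
        using mult_mono[OF \<open>s \<le> r / 4\<close> \<open>norm w \<le> 2\<close>] \<open>0 \<le> s\<close> r by simp
      ultimately have "norm ((x - z) + s *\<^sub>R w) < r"
        using norm_triangle_ineq[of "x - z" "s *\<^sub>R w"] by linarith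
      then have in_ball: "x + s *\<^sub>R w \<in> ball z r"
        by (simp add: dist_norm norm_minus_commute algebra_simps)
      have "x \<in> \<Omega> \<inter> ball z r" using x r by auto
      then have gx: "\<gamma> (P x) < x \<bullet> e" using graph by (simp add: P_def)
      have "dist (\<gamma> (P (x + s *\<^sub>R w))) (\<gamma> (P x)) \<le> L * dist (P (x + s *\<^sub>R w)) (P x)"
        using L Pe by (intro lipschitz_onD) auto
      also have "dist (P (x + s *\<^sub>R w)) (P x) = s * norm (P w)"
        using \<open>0 \<le> s\<close> by (simp add: Padd dist_norm)
      finally have "\<gamma> (P (x + s *\<^sub>R w)) \<le> \<gamma> (P x) + s * (L * norm (P w))"
        by (simp add: dist_real_def abs_le_iff mult.left_commute)
      also have "\<dots> \<le> \<gamma> (P x) + s * (w \<bullet> e)"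
        using \<open>L * norm (P w) \<le> w \<bullet> e\<close> \<open>0 \<le> s\<close> by (intro add_left_mono mult_left_mono)
      also have "\<dots> < (x + s *\<^sub>R w) \<bullet> e" using gx by (simp add: inner_add_left)
      finally have "x + s *\<^sub>R w \<in> \<Omega> \<inter> ball z r"
        unfolding graph using in_ball by (simp add: P_def)
      then show "x + t *\<^sub>R ((r / 4) *\<^sub>R (e + \<eta> *\<^sub>R b)) \<in> \<Omega>" by (simp add: w_def s_def)
    qed (use r \<eta> in auto)
    then show ?thesis using r by (intro exI[of _ "r / 2"]) auto
  qed
qed

text \<open>Also valid when \<open>f\<close> is not integrable, because its integral is then 0 by
  convention.\<close>

lemma norm_integral_le_nn_integral:
  fixes f :: "'a \<Rightarrow> 'b::{banach, second_countable_topology}"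
  shows "ennreal (norm (\<integral>x. f x \<partial>M)) \<le> (\<integral>\<^sup>+x. ennreal (norm (f x)) \<partial>M)"
  by (cases "integrable M f") (auto simp: not_integrable_integral_eq intro: integral_norm_bound_ennreal)

text \<open>No cut-off function is used: \<open>u x\<close> is compared with the value at every
  point \<open>x + \<tau> *\<^sub>R v\<close> of the segment and the result is averaged over
  \<open>\<tau>\<close>. This is the origin of the term \<open>\<bar>u y\<bar>\<close> in the
  integrand.\<close>

lemma weak_grad_line_bound:
  fixes v :: "'a::euclidean_space"
  assumes "open \<Omega>" and wg: "weak_grad \<Omega> u G" and [measurable]: "S \<in> sets borel"
    and S: "\<And>x t. x \<in> S \<Longrightarrow> 0 \<le> t \<Longrightarrow> t \<le> 1 \<Longrightarrow> x + t *\<^sub>R v \<in> \<Omega>"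
    and c: "norm v \<le> c"
  shows "AE x in lborel. x \<in> S \<longrightarrow>
    ennreal \<bar>u x\<bar> \<le> line_int v (\<lambda>y. indicator \<Omega> y * ennreal (\<bar>u y\<bar> + c * norm (G y))) x"
proof -
  have [measurable]: "u \<in> borel_measurable borel" "G \<in> borel_measurable borel" "\<Omega> \<in> sets borel"
    using wg assms(1) by (auto simp: weak_grad_def)
  define k where "k x = (\<integral>\<^sup>+s. indicator {0..1} s * ennreal (norm (G (x + s *\<^sub>R v)) * norm v) \<partial>lborel)" for x
  have [measurable]: "k \<in> borel_measurable borel" unfolding k_def by measurable
  have step: "AE x in lborel. \<tau> \<in> {0..1} \<longrightarrow> x \<in> S \<longrightarrow> ennreal \<bar>u x\<bar> \<le> ennreal \<bar>u (x + \<tau> *\<^sub>R v)\<bar> + k x"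
    for \<tau> :: real
  proof (cases "0 < \<tau> \<and> \<tau> \<le> 1")
    case True
    from weak_grad_segment[OF assms(1) wg, of "\<tau> *\<^sub>R v"]
    show ?thesis
    proof (eventually_elim, intro impI)
      fix x assume x: "x \<in> S" and "(\<forall>t\<in>{0..1}. x + t *\<^sub>R \<tau> *\<^sub>R v \<in> \<Omega>) \<longrightarrow> u (x + \<tau> *\<^sub>R v) - u x =
          (\<integral>t. indicator {0..1} t * (G (x + t *\<^sub>R \<tau> *\<^sub>R v) \<bullet> \<tau> *\<^sub>R v) \<partial>lborel)"
      moreover have "\<forall>t\<in>{0..1}. x + t *\<^sub>R \<tau> *\<^sub>R v \<in> \<Omega>"
        using S[OF x, of "t * \<tau>" for t] True by (auto simp: mult_le_one)
      ultimately have eq: "u (x + \<tau> *\<^sub>R v) - u x =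
          (\<integral>t. indicator {0..1} t * (G (x + t *\<^sub>R \<tau> *\<^sub>R v) \<bullet> \<tau> *\<^sub>R v) \<partial>lborel)" by blast
      have "ennreal \<bar>u (x + \<tau> *\<^sub>R v) - u x\<bar> \<le>
          (\<integral>\<^sup>+t. ennreal (norm (indicator {0..1} t * (G (x + t *\<^sub>R \<tau> *\<^sub>R v) \<bullet> \<tau> *\<^sub>R v))) \<partial>lborel)"
        unfolding eq real_norm_def[symmetric] by (rule norm_integral_le_nn_integral)
      also have "\<dots> \<le> (\<integral>\<^sup>+t. ennreal \<tau> * (indicator {0..\<tau>} (0 + \<tau> * t) *
          ennreal (norm (G (x + (0 + \<tau> * t) *\<^sub>R v)) * norm v)) \<partial>lborel)"
      proof (rule nn_integral_mono)
        fix t :: real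
        have "\<bar>G (x + (t * \<tau>) *\<^sub>R v) \<bullet> v\<bar> \<le> norm (G (x + (t * \<tau>) *\<^sub>R v)) * norm v"
          by (rule Cauchy_Schwarz_ineq2)
        then have "ennreal (\<tau> * \<bar>G (x + (t * \<tau>) *\<^sub>R v) \<bullet> v\<bar>) \<le> ennreal (\<tau> * (norm (G (x + (t * \<tau>) *\<^sub>R v)) * norm v))"
          using True by (intro ennreal_leI mult_left_mono) auto
        also have "\<dots> = ennreal \<tau> * ennreal (norm (G (x + (t * \<tau>) *\<^sub>R v)) * norm v)"
          using True by (intro ennreal_mult') auto
        finally show "ennreal (norm (indicator {0..1} t * (G (x + t *\<^sub>R \<tau> *\<^sub>R v) \<bullet> \<tau> *\<^sub>R v))) \<le>
            ennreal \<tau> * (indicator {0..\<tau>} (0 + \<tau> * t) * ennreal (norm (G (x + (0 + \<tau> * t) *\<^sub>R v)) * norm v))"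
          using True by (cases "t \<in> {0..1}") (auto simp: abs_mult mult.commute)
      qed
      also have "\<dots> = (\<integral>\<^sup>+s. indicator {0..\<tau>} s * ennreal (norm (G (x + s *\<^sub>R v)) * norm v) \<partial>lborel)"
        using True by (subst nn_integral_real_affine[where c = \<tau> and t = 0]) (auto simp: nn_integral_cmult)
      also have "\<dots> \<le> k x"
        unfolding k_def using True by (intro nn_integral_mono) (auto split: split_indicator)
      finally have "ennreal \<bar>u (x + \<tau> *\<^sub>R v) - u x\<bar> \<le> k x" .
      have "ennreal \<bar>u x\<bar> \<le> ennreal (\<bar>u (x + \<tau> *\<^sub>R v)\<bar> + \<bar>u (x + \<tau> *\<^sub>R v) - u x\<bar>)"
        by (intro ennreal_leI) simp
      also have "\<dots> = ennreal \<bar>u (x + \<tau> *\<^sub>R v)\<bar> + ennreal \<bar>u (x + \<tau> *\<^sub>R v) - u x\<bar>" by simp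
      also have "\<dots> \<le> ennreal \<bar>u (x + \<tau> *\<^sub>R v)\<bar> + k x"
        using \<open>ennreal \<bar>u (x + \<tau> *\<^sub>R v) - u x\<bar> \<le> k x\<close> by (intro add_left_mono)
      finally show "ennreal \<bar>u x\<bar> \<le> ennreal \<bar>u (x + \<tau> *\<^sub>R v)\<bar> + k x" .
    qed
  next
    case False
    then have "\<tau> \<notin> {0..1} \<or> \<tau> = 0" by auto
    then show ?thesis
    proof
      assume "\<tau> = 0"
      then show ?thesis by (intro AE_I2 impI) simp
    qed (intro AE_I2 impI, simp)
  qed
  \<comment> \<open>Each \<open>\<tau>\<close> has its own null set. Fubini exchanges the two
    quantifiers, so that for almost every fixed \<open>x\<close> the inequality can be integrated in
    \<open>\<tau>\<close>.\<close>
  have "AE x in lborel. AE \<tau> in lborel. \<tau> \<in> {0..1::real} \<longrightarrow> x \<in> S \<longrightarrow> ennreal \<bar>u x\<bar> \<le> ennreal \<bar>u (x + \<tau> *\<^sub>R v)\<bar> + k x"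
  proof (rule iffD1[OF pair_sigma_finite.AE_commute[OF lborel_pair_sigma_finite]])
    show "AE \<tau> in lborel. AE x in lborel. \<tau> \<in> {0..1::real} \<longrightarrow> x \<in> S \<longrightarrow> ennreal \<bar>u x\<bar> \<le> ennreal \<bar>u (x + \<tau> *\<^sub>R v)\<bar> + k x"
      by (rule AE_I2) (rule step)
  qed measurable
  then show ?thesis
  proof (eventually_elim, intro impI)
    fix x assume AE: "AE \<tau> in lborel. \<tau> \<in> {0..1::real} \<longrightarrow> x \<in> S \<longrightarrow> ennreal \<bar>u x\<bar> \<le> ennreal \<bar>u (x + \<tau> *\<^sub>R v)\<bar> + k x"
      and x: "x \<in> S"
    have "ennreal \<bar>u x\<bar> = (\<integral>\<^sup>+\<tau>. ennreal \<bar>u x\<bar> * indicator {0..1::real} \<tau> \<partial>lborel)"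
      by (subst nn_integral_cmult_indicator) auto
    also have "\<dots> \<le> (\<integral>\<^sup>+\<tau>. indicator {0..1::real} \<tau> * ennreal \<bar>u (x + \<tau> *\<^sub>R v)\<bar> + k x * indicator {0..1} \<tau> \<partial>lborel)"
      using AE by (intro nn_integral_mono_AE, eventually_elim) (use x in \<open>auto split: split_indicator\<close>)
    also have "\<dots> = (\<integral>\<^sup>+\<tau>. indicator {0..1::real} \<tau> * ennreal \<bar>u (x + \<tau> *\<^sub>R v)\<bar> \<partial>lborel) +
        (\<integral>\<^sup>+\<tau>. k x * indicator {0..1::real} \<tau> \<partial>lborel)"
      by (rule nn_integral_add) measurable
    also have "(\<integral>\<^sup>+\<tau>. k x * indicator {0..1::real} \<tau> \<partial>lborel) = k x"
      by (subst nn_integral_cmult_indicator) auto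
    also have "(\<integral>\<^sup>+\<tau>. indicator {0..1::real} \<tau> * ennreal \<bar>u (x + \<tau> *\<^sub>R v)\<bar> \<partial>lborel) + k x =
        (\<integral>\<^sup>+\<tau>. indicator {0..1::real} \<tau> * ennreal \<bar>u (x + \<tau> *\<^sub>R v)\<bar> +
          indicator {0..1} \<tau> * ennreal (norm (G (x + \<tau> *\<^sub>R v)) * norm v) \<partial>lborel)"
      unfolding k_def by (rule nn_integral_add[symmetric]) measurable
    also have "\<dots> \<le> line_int v (\<lambda>y. indicator \<Omega> y * ennreal (\<bar>u y\<bar> + c * norm (G y))) x"
      unfolding line_int_def
    proof (rule nn_integral_mono)
      fix \<tau> :: real
      show "indicator {0..1::real} \<tau> * ennreal \<bar>u (x + \<tau> *\<^sub>R v)\<bar> +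
          indicator {0..1} \<tau> * ennreal (norm (G (x + \<tau> *\<^sub>R v)) * norm v) \<le>
          indicator \<Omega> (x + \<tau> *\<^sub>R v) * ennreal (\<bar>u (x + \<tau> *\<^sub>R v)\<bar> + c * norm (G (x + \<tau> *\<^sub>R v)))"
      proof (cases "\<tau> \<in> {0..1}")
        case True
        have "norm (G (x + \<tau> *\<^sub>R v)) * norm v \<le> c * norm (G (x + \<tau> *\<^sub>R v))"
          using c by (subst mult.commute) (intro mult_right_mono, auto)
        then have "ennreal (\<bar>u (x + \<tau> *\<^sub>R v)\<bar> + norm (G (x + \<tau> *\<^sub>R v)) * norm v) \<le>
            ennreal (\<bar>u (x + \<tau> *\<^sub>R v)\<bar> + c * norm (G (x + \<tau> *\<^sub>R v)))"
          by (intro ennreal_leI) simp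
        then show ?thesis using True S[OF x, of \<tau>] by simp
      qed simp
    qed
    finally show "ennreal \<bar>u x\<bar> \<le> line_int v (\<lambda>y. indicator \<Omega> y * ennreal (\<bar>u y\<bar> + c * norm (G y))) x" .
  qed
qed

lemma epow_prod_const:
  "finite I \<Longrightarrow> 0 \<le> \<theta> \<Longrightarrow> (\<Prod>i\<in>I. epow x \<theta>) = epow x (real (card I) * \<theta>)"
proof (induction I rule: finite_induct)
  case (insert i I)
  then have "(\<Prod>i\<in>insert i I. epow x \<theta>) = epow x \<theta> * epow x (real (card I) * \<theta>)" by simp
  also have "\<dots> = epow x (\<theta> + real (card I) * \<theta>)"
    using insert.prems by (intro epow_add[symmetric]) auto
  finally show ?case using insert by (simp add: algebra_simps)
qed simp

text \<open>The power \<open>N / (N - 1)\<close> of \<open>\<bar>u x\<bar>\<close>, with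
  \<open>N\<close> the dimension, is a product of \<open>N\<close> equal factors. Each is bounded by
  the line integral in one of the interior directions, and the Gagliardo inequality applies to the
  product.\<close>

lemma Sobolev_local:
  fixes \<Omega> :: "'a::euclidean_space set"
  assumes "open \<Omega>" and dim: "2 \<le> DIM('a)" and [measurable]: "S \<in> sets borel"
    and dir: "interior_directions \<Omega> S v l"
  shows "\<exists>C c. C < top \<and> 0 \<le> c \<and> (\<forall>u G. weak_grad \<Omega> u G \<longrightarrow>
    (\<integral>\<^sup>+x. indicator S x * epow (ennreal \<bar>u x\<bar>) (real DIM('a) / (real DIM('a) - 1)) \<partial>lborel) \<le>
    C * epow (\<integral>\<^sup>+x. indicator \<Omega> x * ennreal (\<bar>u x\<bar> + c * norm (G x)) \<partial>lborel) (real DIM('a) / (real DIM('a) - 1)))"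
proof -
  let ?\<theta> = "1 / (real DIM('a) - 1)"
  let ?\<nu> = "real DIM('a) / (real DIM('a) - 1)"
  have [measurable]: "\<Omega> \<in> sets borel" using assms(1) by simp
  obtain C where C: "C < top" "\<And>g. g \<in> borel_measurable borel \<Longrightarrow>
    (\<integral>\<^sup>+x. (\<Prod>b\<in>Basis. epow (line_int (v b) g x) ?\<theta>) \<partial>lborel) \<le> C * epow (\<integral>\<^sup>+x. g x \<partial>lborel) ?\<nu>"
  proof (rule Gagliardo_directions[of l v, OF _ _ _ dim])
    show "linear (l b)" for b using dir by (simp add: interior_directions_def)
    show "l b (v c) = (if b = c then 1 else 0)" if "b \<in> Basis" "c \<in> Basis" for b c
      using dir that by (simp add: interior_directions_def)
    show "x = (\<Sum>b\<in>Basis. l b x *\<^sub>R v b)" for x using dir unfolding interior_directions_def by blast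
  qed (rule that)
  define c where "c = (\<Sum>b\<in>Basis. norm (v b))"
  have "0 \<le> c" by (simp add: c_def sum_nonneg)
  have cb: "norm (v b) \<le> c" if "b \<in> Basis" for b
    unfolding c_def using that by (intro member_le_sum) auto
  have "(\<integral>\<^sup>+x. indicator S x * epow (ennreal \<bar>u x\<bar>) ?\<nu> \<partial>lborel) \<le>
      C * epow (\<integral>\<^sup>+x. indicator \<Omega> x * ennreal (\<bar>u x\<bar> + c * norm (G x)) \<partial>lborel) ?\<nu>" if wg: "weak_grad \<Omega> u G" for u G
  proof -
    have [measurable]: "u \<in> borel_measurable borel" "G \<in> borel_measurable borel"
      using wg by (auto simp: weak_grad_def)
    let ?g = "\<lambda>y. indicator \<Omega> y * ennreal (\<bar>u y\<bar> + c * norm (G y))"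
    have [measurable]: "?g \<in> borel_measurable borel" by measurable
    have "AE x in lborel. \<forall>b\<in>Basis. x \<in> S \<longrightarrow> ennreal \<bar>u x\<bar> \<le> line_int (v b) ?g x"
    proof (rule AE_ball_countable')
      fix b :: 'a assume b: "b \<in> Basis"
      show "AE x in lborel. x \<in> S \<longrightarrow> ennreal \<bar>u x\<bar> \<le> line_int (v b) ?g x"
        using dir b by (intro weak_grad_line_bound[OF assms(1) wg _ _ cb[OF b]]) (auto simp: interior_directions_def)
    qed (simp add: countable_finite)
    then have "AE x in lborel. indicator S x * epow (ennreal \<bar>u x\<bar>) ?\<nu> \<le> (\<Prod>b\<in>Basis. epow (line_int (v b) ?g x) ?\<theta>)"
    proof eventually_elim
      case (elim x)
      show ?case
      proof (cases "x \<in> S")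
        case True
        have "epow (ennreal \<bar>u x\<bar>) ?\<nu> = (\<Prod>b\<in>(Basis::'a set). epow (ennreal \<bar>u x\<bar>) ?\<theta>)"
          using dim by (subst epow_prod_const) auto
        also have "\<dots> \<le> (\<Prod>b\<in>Basis. epow (line_int (v b) ?g x) ?\<theta>)"
          using elim True dim by (intro prod_mono_ennreal epow_mono) auto
        finally show ?thesis using True by simp
      qed simp
    qed
    then have "(\<integral>\<^sup>+x. indicator S x * epow (ennreal \<bar>u x\<bar>) ?\<nu> \<partial>lborel) \<le> (\<integral>\<^sup>+x. (\<Prod>b\<in>Basis. epow (line_int (v b) ?g x) ?\<theta>) \<partial>lborel)"
      by (rule nn_integral_mono_AE)
    also have "\<dots> \<le> C * epow (\<integral>\<^sup>+x. ?g x \<partial>lborel) ?\<nu>" by (rule C(2)) measurable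
    finally show ?thesis .
  qed
  then show ?thesis using C(1) \<open>0 \<le> c\<close> by blast
qed

text \<open>Finitely many neighbourhoods cover the compact closure. Every local estimate already has
  the integral over all of \<open>\<Omega>\<close> on its right side, so the estimates simply add
  up.\<close>

lemma Sobolev_W11:
  fixes \<Omega> :: "'a::euclidean_space set"
  assumes lip: "lipschitz_domain \<Omega>" and dim: "2 \<le> DIM('a)"
  obtains C c where "C < top" "0 \<le> c" "\<And>u G. weak_grad \<Omega> u G \<Longrightarrow>
    (\<integral>\<^sup>+x. indicator \<Omega> x * epow (ennreal \<bar>u x\<bar>) (real DIM('a) / (real DIM('a) - 1)) \<partial>lborel) \<le>
    C * epow (\<integral>\<^sup>+x. indicator \<Omega> x * ennreal (\<bar>u x\<bar> + c * norm (G x)) \<partial>lborel) (real DIM('a) / (real DIM('a) - 1))"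
proof -
  let ?\<nu> = "real DIM('a) / (real DIM('a) - 1)"
  have "open \<Omega>" "bounded \<Omega>" using lip by (auto simp: lipschitz_domain_def)
  then have [measurable]: "\<Omega> \<in> sets borel" by simp
  have "compact (closure \<Omega>)" using \<open>bounded \<Omega>\<close> by simp
  have "\<forall>z\<in>closure \<Omega>. \<exists>\<rho>>0. \<exists>v l. interior_directions \<Omega> (\<Omega> \<inter> ball z \<rho>) v l"
    using lipschitz_domain_directions[OF lip] by blast
  then obtain \<rho> where \<rho>: "\<And>z. z \<in> closure \<Omega> \<Longrightarrow> 0 < \<rho> z"
    "\<And>z. z \<in> closure \<Omega> \<Longrightarrow> \<exists>v l. interior_directions \<Omega> (\<Omega> \<inter> ball z (\<rho> z)) v l" by metis
  obtain Z where Z: "Z \<subseteq> closure \<Omega>" "finite Z" "closure \<Omega> \<subseteq> (\<Union>z\<in>Z. ball z (\<rho> z))"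
    by (rule compactE_image[OF \<open>compact (closure \<Omega>)\<close>, of "closure \<Omega>" "\<lambda>z. ball z (\<rho> z)"])
      (use \<rho>(1) in force)+
  let ?S = "\<lambda>z. \<Omega> \<inter> ball z (\<rho> z)"
  define Q where "Q z C c \<longleftrightarrow> C < top \<and> 0 \<le> c \<and> (\<forall>u G. weak_grad \<Omega> u G \<longrightarrow>
    (\<integral>\<^sup>+x. indicator (?S z) x * epow (ennreal \<bar>u x\<bar>) ?\<nu> \<partial>lborel) \<le>
    C * epow (\<integral>\<^sup>+x. indicator \<Omega> x * ennreal (\<bar>u x\<bar> + c * norm (G x)) \<partial>lborel) ?\<nu>)" for z C c
  have "\<forall>z\<in>Z. \<exists>C c. Q z C c"
  proof
    fix z assume "z \<in> Z"
    then obtain v l where "interior_directions \<Omega> (?S z) v l" using \<rho>(2) Z(1) by blast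
    then show "\<exists>C c. Q z C c"
      unfolding Q_def by (intro Sobolev_local[OF \<open>open \<Omega>\<close> dim]) auto
  qed
  then obtain C c where Qz: "\<forall>z\<in>Z. Q z (C z) (c z)" by metis
  then have Cc: "\<And>z. z \<in> Z \<Longrightarrow> C z < top" "\<And>z. z \<in> Z \<Longrightarrow> 0 \<le> c z"
    "\<And>z u G. z \<in> Z \<Longrightarrow> weak_grad \<Omega> u G \<Longrightarrow> (\<integral>\<^sup>+x. indicator (?S z) x * epow (ennreal \<bar>u x\<bar>) ?\<nu> \<partial>lborel) \<le>
    C z * epow (\<integral>\<^sup>+x. indicator \<Omega> x * ennreal (\<bar>u x\<bar> + c z * norm (G x)) \<partial>lborel) ?\<nu>"
    unfolding Q_def by blast+
  define c' where "c' = (\<Sum>z\<in>Z. c z)"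
  have c': "0 \<le> c'" "\<And>z. z \<in> Z \<Longrightarrow> c z \<le> c'"
    using Cc(2) Z(2) by (auto simp: c'_def intro: sum_nonneg member_le_sum)
  show ?thesis
  proof (rule that[of "\<Sum>z\<in>Z. C z" c'])
    show "(\<Sum>z\<in>Z. C z) < top" using Cc(1) Z(2) by simp
    fix u G assume wg: "weak_grad \<Omega> u G"
    have [measurable]: "u \<in> borel_measurable borel" "G \<in> borel_measurable borel"
      using wg by (auto simp: weak_grad_def)
    let ?E = "epow (\<integral>\<^sup>+x. indicator \<Omega> x * ennreal (\<bar>u x\<bar> + c' * norm (G x)) \<partial>lborel) ?\<nu>"
    have "(\<integral>\<^sup>+x. indicator \<Omega> x * epow (ennreal \<bar>u x\<bar>) ?\<nu> \<partial>lborel) \<le>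
        (\<integral>\<^sup>+x. (\<Sum>z\<in>Z. indicator (?S z) x * epow (ennreal \<bar>u x\<bar>) ?\<nu>) \<partial>lborel)"
    proof (rule nn_integral_mono)
      fix x
      show "indicator \<Omega> x * epow (ennreal \<bar>u x\<bar>) ?\<nu> \<le> (\<Sum>z\<in>Z. indicator (?S z) x * epow (ennreal \<bar>u x\<bar>) ?\<nu>)"
      proof (cases "x \<in> \<Omega>")
        case True
        then obtain z where z: "z \<in> Z" "x \<in> ?S z" using Z(3) closure_subset by blast
        have "indicator (?S z) x * epow (ennreal \<bar>u x\<bar>) ?\<nu> \<le> (\<Sum>z\<in>Z. indicator (?S z) x * epow (ennreal \<bar>u x\<bar>) ?\<nu>)"
          using z(1) Z(2) by (intro member_le_sum) auto
        then show ?thesis using z(2) True by simp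
      qed simp
    qed
    also have "\<dots> = (\<Sum>z\<in>Z. \<integral>\<^sup>+x. indicator (?S z) x * epow (ennreal \<bar>u x\<bar>) ?\<nu> \<partial>lborel)"
    proof (rule nn_integral_sum)
      fix z
      have [measurable]: "ball z (\<rho> z) \<in> sets borel" by simp
      show "(\<lambda>x. indicator (?S z) x * epow (ennreal \<bar>u x\<bar>) ?\<nu>) \<in> borel_measurable lborel"
        by measurable
    qed
    also have "\<dots> \<le> (\<Sum>z\<in>Z. C z * ?E)"
    proof (rule sum_mono)
      fix z assume z: "z \<in> Z"
      have "epow (\<integral>\<^sup>+x. indicator \<Omega> x * ennreal (\<bar>u x\<bar> + c z * norm (G x)) \<partial>lborel) ?\<nu> \<le> ?E"
        using dim c'(2)[OF z] by (intro epow_mono nn_integral_mono mult_left_mono ennreal_leI add_left_mono mult_right_mono) auto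
      then show "(\<integral>\<^sup>+x. indicator (?S z) x * epow (ennreal \<bar>u x\<bar>) ?\<nu> \<partial>lborel) \<le> C z * ?E"
        using Cc(3)[OF z wg] by (meson mult_left_mono order_trans zero_le)
    qed
    also have "\<dots> = (\<Sum>z\<in>Z. C z) * ?E" by (simp add: sum_distrib_right)
    finally show "(\<integral>\<^sup>+x. indicator \<Omega> x * epow (ennreal \<bar>u x\<bar>) ?\<nu> \<partial>lborel) \<le> (\<Sum>z\<in>Z. C z) * ?E" .
  qed (rule c'(1))
qed

section \<open>From the inequality for \<open>W^{1,1}\<close> to square integrability\<close>

lemma powr_lipschitz:
  fixes a b k \<gamma> :: real
  assumes "1 \<le> \<gamma>" "0 \<le> b" "b \<le> a" "a \<le> k"
  shows "a powr \<gamma> - b powr \<gamma> \<le> \<gamma> * k powr (\<gamma> - 1) * (a - b)"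
proof (cases "a = b")
  case False
  then have "b < a" using assms by simp
  have "continuous_on {b..a} (\<lambda>s. s powr \<gamma>)"
    using assms by (intro continuous_on_powr') (auto intro!: continuous_intros)
  moreover have d: "((\<lambda>s. s powr \<gamma>) has_real_derivative \<gamma> * z powr (\<gamma> - 1)) (at z)" if "b < z" for z
    using that assms by (intro has_real_derivative_powr) auto
  ultimately obtain l z where z: "b < z" "z < a" "((\<lambda>s. s powr \<gamma>) has_real_derivative l) (at z)"
    "a powr \<gamma> - b powr \<gamma> = (a - b) * l"
    using MVT[OF \<open>b < a\<close>, of "\<lambda>s. s powr \<gamma>"] real_differentiable_def by blast
  have "l = \<gamma> * z powr (\<gamma> - 1)" using DERIV_unique[OF z(3) d[OF z(1)]] .
  also have "\<dots> \<le> \<gamma> * k powr (\<gamma> - 1)"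
    using assms z by (intro mult_left_mono powr_mono2) auto
  finally show ?thesis using z(4) \<open>b < a\<close> by (simp add: mult.commute mult_left_mono)
qed simp

text \<open>If \<open>X > 1\<close>, the total exponent on the right may be raised to 1/2, and
  finiteness of \<open>X\<close> allows division by its square root: \<open>sqrt X \<le> A\<close>.
  The resulting bound no longer involves \<open>X\<close>.\<close>

lemma ennreal_self_bound:
  assumes le: "X \<le> A * epow (epow X \<theta>) \<nu>" and fin: "X < top" "A < top"
    and \<kappa>: "0 \<le> \<theta>" "0 < \<nu>" "\<theta> * \<nu> \<le> 1 / 2"
  shows "X \<le> 1 + A * A"
proof (cases "X \<le> 1")
  case True
  then show ?thesis by (simp add: add_increasing2)
next
  case False
  obtain r a where r: "X = ennreal r" "0 \<le> r" and a: "A = ennreal a" "0 \<le> a"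
    using fin by (metis ennreal_cases less_irrefl)
  have "1 < r" using False r by (simp add: ennreal_le_1 not_le)
  have "epow (epow X \<theta>) \<nu> = ennreal (r powr (\<theta> * \<nu>))"
    using \<open>1 < r\<close> \<kappa> by (cases "\<theta> = 0") (auto simp: r epow_ennreal powr_powr epow_def)
  with le have "ennreal r \<le> ennreal (a * r powr (\<theta> * \<nu>))"
    using a by (simp add: r ennreal_mult')
  then have "r \<le> a * r powr (\<theta> * \<nu>)" using a \<open>1 < r\<close> by (subst (asm) ennreal_le_iff) auto
  also have "\<dots> \<le> a * r powr (1 / 2)"
    using a \<open>1 < r\<close> \<kappa> by (intro mult_left_mono powr_mono) auto
  finally have "sqrt r * sqrt r \<le> a * sqrt r" using \<open>1 < r\<close> by (simp add: powr_half_sqrt)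
  then have "sqrt r \<le> a" by (rule mult_right_le_imp_le) (use \<open>1 < r\<close> in simp)
  then have "sqrt r * sqrt r \<le> a * a" using \<open>1 < r\<close> a(2) by (intro mult_mono) auto
  then have "r \<le> 1 + a * a" using \<open>1 < r\<close> by simp
  then show ?thesis
    using a by (simp add: r ennreal_mult'[symmetric] ennreal_leI flip: ennreal_1 ennreal_plus)
qed

text \<open>\<open>Sobolev_W11\<close> for the truncations of \<open>\<bar>u\<bar> powr \<gamma>\<close> and Holder's inequality for \<open>\<bar>u\<bar> powr (\<gamma> - 1)\<close> times
  the gradient bound the integral \<open>X\<close> of the truncated \<open>u\<^sup>2\<close> by a constant times \<open>X powr (\<theta>2 * \<nu>)\<close>,
  and \<open>\<theta>2 * \<nu> \<le> 1/2\<close>.\<close>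

lemma (in var_exponent) W_square_integrable:
  assumes lip: "lipschitz_domain \<Omega>" and dim: "2 \<le> DIM('a)"
    and q: "2 * real DIM('a) / (real DIM('a) + 2) \<le> p0" and u: "u \<in> W"
  shows "integrable M (\<lambda>x. (u x)\<^sup>2)"
proof -
  define n where "n = real DIM('a)"
  have n: "2 \<le> n" using dim by (simp add: n_def)
  \<comment> \<open>The exponents are tied together: \<open>\<gamma> * \<nu> = 2\<close> makes the
    Sobolev power of \<open>\<bar>u\<bar> powr \<gamma>\<close> a square,
    \<open>1 / \<theta>1\<close> is the integrability exponent \<open>q\<close> of the gradient, and
    \<open>2 * \<theta>2 = \<gamma> - 1\<close> matches the factor from differentiating the
    power.\<close>
  define \<gamma> where "\<gamma> = 2 * (n - 1) / n"
  define \<nu> where "\<nu> = n / (n - 1)"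
  define \<theta>1 where "\<theta>1 = (n + 2) / (2 * n)"
  define \<theta>2 where "\<theta>2 = (n - 2) / (2 * n)"
  define q where "q = 2 * n / (n + 2)"
  have exps: "1 \<le> \<gamma>" "0 < \<nu>" "\<gamma> * \<nu> = 2" "0 < \<theta>1" "0 \<le> \<theta>2" "\<theta>1 + \<theta>2 = 1" "q * \<theta>1 = 1" "2 * \<theta>2 = \<gamma> - 1"
    "\<theta>2 * \<nu> \<le> 1 / 2" "1 \<le> q" "q \<le> p0"
    using n assms(3) unfolding n_def[symmetric]
    by (auto simp: \<gamma>_def \<nu>_def \<theta>1_def \<theta>2_def q_def divide_simps)
  obtain u' G' where b: "borel_version \<Omega> u u'" "borel_version \<Omega> (grad u) G'" "weak_grad \<Omega> u' G'"
    using W_borel[OF u] .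
  have [measurable]: "u' \<in> borel_measurable borel" "G' \<in> borel_measurable borel" "\<Omega> \<in> sets borel"
    using b open_dom by (auto simp: borel_version_def)
  obtain C c where C: "C < top" "0 \<le> c" "\<And>u G. weak_grad \<Omega> u G \<Longrightarrow>
    (\<integral>\<^sup>+x. indicator \<Omega> x * epow (ennreal \<bar>u x\<bar>) \<nu> \<partial>lborel) \<le>
    C * epow (\<integral>\<^sup>+x. indicator \<Omega> x * ennreal (\<bar>u x\<bar> + c * norm (G x)) \<partial>lborel) \<nu>"
    by (rule Sobolev_W11[OF lip dim, folded n_def, folded \<nu>_def]) (rule that)
  define D where "D x = \<bar>u' x\<bar> + c * \<gamma> * norm (G' x)" for x
  have D0: "0 \<le> D x" for x using C(2) exps(1) by (simp add: D_def)
  have [measurable]: "D \<in> borel_measurable borel" unfolding D_def by measurable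
  define E where "E = epow (\<integral>\<^sup>+x. indicator \<Omega> x * ennreal (D x powr q) \<partial>lborel) \<theta>1"
  have "E < top"
  proof -
    define d where "d x = \<bar>u x\<bar> + c * \<gamma> * norm (grad u x)" for x
    have um[measurable]: "u \<in> borel_measurable M" "grad u \<in> borel_measurable M"
      using W_measurable[OF u] W_gradient(2)[OF u] by auto
    have [measurable]: "d \<in> borel_measurable M" unfolding d_def by measurable
    have dL: "d \<in> Lp_var \<Omega> p"
      unfolding d_def
    proof (intro Lp_add Lp_cmult W_gradient u)
      show "(\<lambda>x. \<bar>u x\<bar>) \<in> Lp_var \<Omega> p" by (rule Lp_dominated[OF W_Lp[OF u]]) auto
    qed
    have d0: "0 \<le> d x" for x using C(2) exps(1) by (simp add: d_def)
    have "integrable M (\<lambda>x. d x powr q)"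
    proof (rule Bochner_Integration.integrable_bound)
      show "integrable M (\<lambda>x. 1 + \<bar>d x\<bar> powr p x)" using dL by (simp add: Lp_var_def)
      show "AE x in M. norm (d x powr q) \<le> norm (1 + \<bar>d x\<bar> powr p x)"
      proof (rule AE_I2)
        fix x assume "x \<in> space M"
        then have "q \<le> p x" using p_bounds[of x] exps(11) by auto
        have "d x powr q \<le> 1 + d x powr p x"
        proof (cases "d x \<le> 1")
          case True
          then have "d x powr q \<le> 1" using d0 exps(10) by (intro powr_le1) auto
          then show ?thesis by (simp add: add_increasing2)
        next
          case False
          then have "d x powr q \<le> d x powr p x" using \<open>q \<le> p x\<close> by (intro powr_mono) auto
          then show ?thesis by simp
        qed
        then show "norm (d x powr q) \<le> norm (1 + \<bar>d x\<bar> powr p x)" using d0[of x] by simp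
      qed
    qed measurable
    moreover have "borel_version \<Omega> (\<lambda>x. d x powr q) (\<lambda>x. indicator \<Omega> x * D x powr q)"
      unfolding borel_version_def
    proof (intro conjI allI impI)
      have "AE x in lborel. x \<in> \<Omega> \<longrightarrow> u x = u' x" "AE x in lborel. x \<in> \<Omega> \<longrightarrow> grad u x = G' x"
        using b by (auto simp: borel_version_def)
      then show "AE x in lborel. x \<in> \<Omega> \<longrightarrow> d x powr q = indicator \<Omega> x * D x powr q"
        by eventually_elim (simp add: d_def D_def)
    qed auto
    ultimately have "integrable lborel (\<lambda>x. indicator \<Omega> x * D x powr q)"
      using borel_version_integrable[OF open_dom, of "\<lambda>x. d x powr q"] by simp
    then have "(\<integral>\<^sup>+x. ennreal (indicator \<Omega> x * D x powr q) \<partial>lborel) < top"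
      by (subst nn_integral_eq_integral) auto
    moreover have "(\<lambda>x. ennreal (indicator \<Omega> x * D x powr q)) = (\<lambda>x. indicator \<Omega> x * ennreal (D x powr q))"
      by (auto simp: fun_eq_iff split: split_indicator)
    ultimately show ?thesis unfolding E_def by (simp add: epow_less_top)
  qed
  define A where "A = C * epow E \<nu>"
  have "A < top" unfolding A_def using C(1) \<open>E < top\<close> by (intro ennreal_mult_less_top[THEN iffD2]) (simp add: epow_less_top)
  \<comment> \<open>Truncation makes the power Lipschitz, so that the chain rule applies, and makes
    \<open>X k\<close> finite, so that it can be absorbed. The bound obtained is uniform in
    \<open>k\<close>.\<close>
  define m where "m k x = min \<bar>u' x\<bar> (real (Suc k))" for k x
  have [measurable]: "m k \<in> borel_measurable borel" for k unfolding m_def by measurable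
  have m0: "0 \<le> m k x" for k x by (simp add: m_def)
  define X where "X k = (\<integral>\<^sup>+x. indicator \<Omega> x * ennreal ((m k x)\<^sup>2) \<partial>lborel)" for k
  have X_le: "X k \<le> 1 + A * A" for k
  proof (rule ennreal_self_bound)
    have "X k \<le> (\<integral>\<^sup>+x. ennreal ((real (Suc k))\<^sup>2) * indicator \<Omega> x \<partial>lborel)"
      unfolding X_def
    proof (rule nn_integral_mono)
      fix x
      have "(m k x)\<^sup>2 \<le> (real (Suc k))\<^sup>2" using m0[of k x] by (intro power_mono) (auto simp: m_def)
      then show "indicator \<Omega> x * ennreal ((m k x)\<^sup>2) \<le> ennreal ((real (Suc k))\<^sup>2) * indicator \<Omega> x"
        by (auto intro: ennreal_leI split: split_indicator)
    qed
    also have "\<dots> = ennreal ((real (Suc k))\<^sup>2) * emeasure lborel \<Omega>"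
      by (rule nn_integral_cmult_indicator) simp
    also have "\<dots> < top"
      using emeasure_bounded_finite[OF bounded_dom] by (intro ennreal_mult_less_top[THEN iffD2]) auto
    finally show "X k < top" .
    define K where "K = real (Suc k)"
    have "0 < K" by (simp add: K_def)
    define h where "h s = min \<bar>s\<bar> K powr \<gamma>" for s
    define h' where "h' s = (if 0 < \<bar>s\<bar> \<and> \<bar>s\<bar> < K then \<gamma> * \<bar>s\<bar> powr (\<gamma> - 1) * sgn s else 0)" for s
    have h'_abs: "\<bar>h' s\<bar> \<le> \<gamma> * min \<bar>s\<bar> K powr (\<gamma> - 1)" for s
      using exps(1) by (auto simp: h'_def abs_mult abs_sgn_eq)
    have wg: "weak_grad \<Omega> (\<lambda>x. indicator \<Omega> x * h (u' x)) (\<lambda>x. h' (u' x) *\<^sub>R G' x)"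
    proof (rule weak_grad_chain[OF open_dom bounded_dom b(3), where Z = "{0, K, - K}" and L = "\<gamma> * K powr (\<gamma> - 1)"])
      fix s t :: real
      have *: "\<bar>h s - h t\<bar> \<le> \<gamma> * K powr (\<gamma> - 1) * \<bar>s - t\<bar>" if "\<bar>t\<bar> \<le> \<bar>s\<bar>" for s t
      proof -
        let ?a = "min \<bar>s\<bar> K" and ?b = "min \<bar>t\<bar> K"
        have "?b \<le> ?a" using that by auto
        have "?b powr \<gamma> \<le> ?a powr \<gamma>" using \<open>?b \<le> ?a\<close> \<open>0 < K\<close> exps(1) by (intro powr_mono2) auto
        moreover have "?a powr \<gamma> - ?b powr \<gamma> \<le> \<gamma> * K powr (\<gamma> - 1) * (?a - ?b)"
          using \<open>?b \<le> ?a\<close> \<open>0 < K\<close> exps(1) by (intro powr_lipschitz) auto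
        moreover have "\<gamma> * K powr (\<gamma> - 1) * (?a - ?b) \<le> \<gamma> * K powr (\<gamma> - 1) * \<bar>s - t\<bar>"
          using exps(1) by (intro mult_left_mono) auto
        ultimately show ?thesis by (simp add: h_def)
      qed
      show "\<bar>h s - h t\<bar> \<le> \<gamma> * K powr (\<gamma> - 1) * \<bar>s - t\<bar>"
        using *[of s t] *[of t s] by (cases "\<bar>t\<bar> \<le> \<bar>s\<bar>") (auto simp: abs_minus_commute)
    next
      fix s assume "s \<notin> {0, K, - K}"
      then consider "0 < s" "s < K" | "s < 0" "- K < s" | "K < \<bar>s\<bar>" by fastforce
      then show "(h has_real_derivative h' s) (at s)"
      proof cases
        case 1
        have "((\<lambda>s. s powr \<gamma>) has_real_derivative h' s) (at s)"
          using 1 by (auto simp: h'_def intro!: has_real_derivative_powr)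
        then show ?thesis
          by (rule has_field_derivative_transform_within_open[where S = "{0<..<K}"]) (use 1 in \<open>auto simp: h_def\<close>)
      next
        case 2
        have "((\<lambda>s. (- s) powr \<gamma>) has_real_derivative \<gamma> * (- s) powr (\<gamma> - 1) * (- 1)) (at s)"
          using 2 by (intro DERIV_chain2[where f = "\<lambda>s. s powr \<gamma>" and g = uminus] has_real_derivative_powr)
            (auto intro!: derivative_eq_intros)
        then have "((\<lambda>s. (- s) powr \<gamma>) has_real_derivative h' s) (at s)"
          using 2 by (simp add: h'_def)
        then show ?thesis
          by (rule has_field_derivative_transform_within_open[where S = "{- K<..<0}"]) (use 2 in \<open>auto simp: h_def\<close>)
      next
        case 3
        have "((\<lambda>s. K powr \<gamma>) has_real_derivative h' s) (at s)" using 3 by (simp add: h'_def)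
        then show ?thesis
          by (rule has_field_derivative_transform_within_open[where S = "- {- K..K}"])
            (use 3 in \<open>auto simp: h_def\<close>)
      qed
    next
      fix s
      have "\<bar>h' s\<bar> \<le> \<gamma> * min \<bar>s\<bar> K powr (\<gamma> - 1)" by (rule h'_abs)
      also have "\<dots> \<le> \<gamma> * K powr (\<gamma> - 1)"
        using exps(1) \<open>0 < K\<close> by (intro mult_left_mono powr_mono2) auto
      finally show "\<bar>h' s\<bar> \<le> \<gamma> * K powr (\<gamma> - 1)" .
    next
      show "h' \<in> borel_measurable borel" unfolding h'_def by measurable
    qed simp
    have "X k = (\<integral>\<^sup>+x. indicator \<Omega> x * epow (ennreal \<bar>indicator \<Omega> x * h (u' x)\<bar>) \<nu> \<partial>lborel)"
      unfolding X_def
    proof (rule nn_integral_cong)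
      fix x
      have "(m k x powr \<gamma>) powr \<nu> = (m k x)\<^sup>2"
        using m0[of k x] exps(3) by (cases "m k x = 0") (auto simp: powr_powr)
      then show "indicator \<Omega> x * ennreal ((m k x)\<^sup>2) =
          indicator \<Omega> x * epow (ennreal \<bar>indicator \<Omega> x * h (u' x)\<bar>) \<nu>"
        using exps(2) by (auto simp: h_def m_def K_def epow_ennreal split: split_indicator)
    qed
    also have "\<dots> \<le> C * epow (\<integral>\<^sup>+x. indicator \<Omega> x * ennreal (\<bar>indicator \<Omega> x * h (u' x)\<bar> + c * norm (h' (u' x) *\<^sub>R G' x)) \<partial>lborel) \<nu>"
      by (rule C(3)[OF wg])
    also have "\<dots> \<le> C * epow (epow (X k) \<theta>2 * E) \<nu>"
    proof (intro mult_left_mono epow_mono)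
      \<comment> \<open>Holder for two factors, indexed by booleans.\<close>
      define F where "F i x = (if i then indicator \<Omega> x * ennreal ((m k x)\<^sup>2) else indicator \<Omega> x * ennreal (D x powr q))"
        for i :: bool and x
      define \<theta> where "\<theta> i = (if i then \<theta>2 else \<theta>1)" for i :: bool
      have "(\<integral>\<^sup>+x. indicator \<Omega> x * ennreal (\<bar>indicator \<Omega> x * h (u' x)\<bar> + c * norm (h' (u' x) *\<^sub>R G' x)) \<partial>lborel) \<le>
          (\<integral>\<^sup>+x. (\<Prod>i\<in>UNIV. epow (F i x) (\<theta> i)) \<partial>lborel)"
      proof (rule nn_integral_mono)
        fix x
        show "indicator \<Omega> x * ennreal (\<bar>indicator \<Omega> x * h (u' x)\<bar> + c * norm (h' (u' x) *\<^sub>R G' x)) \<le>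
            (\<Prod>i\<in>UNIV. epow (F i x) (\<theta> i))"
        proof (cases "x \<in> \<Omega>")
          case True
          \<comment> \<open>The factor \<open>m k x powr (\<gamma> - 1)\<close> is taken out of both
            terms, which explains why \<open>D\<close> contains \<open>\<bar>u' x\<bar>\<close>
            beside the gradient.\<close>
          have "h (u' x) \<le> m k x powr (\<gamma> - 1) * \<bar>u' x\<bar>"
          proof -
            have "h (u' x) = m k x powr ((\<gamma> - 1) + 1)" by (simp add: h_def m_def K_def)
            also have "\<dots> = m k x powr (\<gamma> - 1) * m k x powr 1" by (rule powr_add)
            also have "\<dots> \<le> m k x powr (\<gamma> - 1) * \<bar>u' x\<bar>"
              using m0[of k x] by (intro mult_left_mono) (auto simp: m_def)
            finally show ?thesis .
          qed
          moreover have "c * norm (h' (u' x) *\<^sub>R G' x) \<le> m k x powr (\<gamma> - 1) * (c * \<gamma> * norm (G' x))"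
          proof -
            have "\<bar>h' (u' x)\<bar> * norm (G' x) \<le> (\<gamma> * m k x powr (\<gamma> - 1)) * norm (G' x)"
              using h'_abs[of "u' x"] by (intro mult_right_mono) (auto simp: m_def K_def)
            then have "c * (\<bar>h' (u' x)\<bar> * norm (G' x)) \<le> c * ((\<gamma> * m k x powr (\<gamma> - 1)) * norm (G' x))"
              using C(2) by (rule mult_left_mono)
            then show ?thesis by (simp add: mult_ac)
          qed
          moreover have "0 \<le> h (u' x)" by (simp add: h_def)
          ultimately have "\<bar>h (u' x)\<bar> + c * norm (h' (u' x) *\<^sub>R G' x) \<le> m k x powr (\<gamma> - 1) * D x"
            unfolding D_def distrib_left by linarith
          then have "ennreal (\<bar>h (u' x)\<bar> + c * norm (h' (u' x) *\<^sub>R G' x)) \<le> ennreal (m k x powr (\<gamma> - 1) * D x)"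
            by (rule ennreal_leI)
          also have "\<dots> = ennreal (m k x powr (\<gamma> - 1)) * ennreal (D x)"
            by (rule ennreal_mult') simp
          also have "ennreal (m k x powr (\<gamma> - 1)) \<le> epow (ennreal ((m k x)\<^sup>2)) \<theta>2"
          proof (cases "\<theta>2 = 0")
            case True
            then have "\<gamma> = 1" using exps(8) by simp
            then show ?thesis using True by (cases "m k x = 0") auto
          next
            case False
            have "((m k x)\<^sup>2) powr \<theta>2 = m k x powr (\<gamma> - 1)"
            proof (cases "m k x = 0")
              case False
              then have "(m k x)\<^sup>2 = m k x powr 2" using m0[of k x] by simp
              then show ?thesis by (simp only: powr_powr exps(8))
            qed simp
            then show ?thesis using False by (simp add: epow_ennreal)
          qed
          also have "ennreal (D x) = epow (ennreal (D x powr q)) \<theta>1"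
            using exps(4,7) D0[of x] by (cases "D x = 0") (simp_all add: epow_ennreal powr_powr)
          finally show ?thesis
            using True by (simp add: F_def \<theta>_def UNIV_bool mult_right_mono mult.commute)
        qed simp
      qed
      also have "\<dots> \<le> (\<Prod>i\<in>UNIV. epow (\<integral>\<^sup>+x. F i x \<partial>lborel) (\<theta> i))"
      proof (rule Holder)
        show "F i \<in> borel_measurable lborel" for i unfolding F_def by (cases i) simp_all
      qed (use exps in \<open>auto simp: \<theta>_def UNIV_bool\<close>)
      also have "\<dots> = epow (X k) \<theta>2 * E"
        by (simp add: F_def \<theta>_def UNIV_bool X_def E_def mult.commute)
      finally show "(\<integral>\<^sup>+x. indicator \<Omega> x * ennreal (\<bar>indicator \<Omega> x * h (u' x)\<bar> + c * norm (h' (u' x) *\<^sub>R G' x)) \<partial>lborel)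
          \<le> epow (X k) \<theta>2 * E" .
    qed (use exps in auto)
    also have "\<dots> = A * epow (epow (X k) \<theta>2) \<nu>"
      using exps(2) by (simp add: A_def epow_mult mult_ac)
    finally show "X k \<le> A * epow (epow (X k) \<theta>2) \<nu>" .
  qed (use exps \<open>A < top\<close> in auto)
  have "(\<integral>\<^sup>+x. indicator \<Omega> x * ennreal ((u' x)\<^sup>2) \<partial>lborel) \<le>
      (\<integral>\<^sup>+x. liminf (\<lambda>k. indicator \<Omega> x * ennreal ((m k x)\<^sup>2)) \<partial>lborel)"
  proof (rule nn_integral_mono)
    fix x
    obtain k0 where k0: "\<bar>u' x\<bar> \<le> real k0" using real_arch_simple by blast
    have "\<forall>\<^sub>F k in sequentially. indicator \<Omega> x * ennreal ((m k x)\<^sup>2) = indicator \<Omega> x * ennreal ((u' x)\<^sup>2)"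
      using k0 by (intro eventually_sequentiallyI[of k0]) (auto simp: m_def min_def)
    then have "(\<lambda>k. indicator \<Omega> x * ennreal ((m k x)\<^sup>2)) \<longlonglongrightarrow> indicator \<Omega> x * ennreal ((u' x)\<^sup>2)"
      by (rule tendsto_eventually)
    from lim_imp_Liminf[OF trivial_limit_sequentially this]
    show "indicator \<Omega> x * ennreal ((u' x)\<^sup>2) \<le> liminf (\<lambda>k. indicator \<Omega> x * ennreal ((m k x)\<^sup>2))" by simp
  qed
  also have "\<dots> \<le> liminf X"
    unfolding X_def by (rule nn_integral_liminf) measurable
  also have "\<dots> \<le> 1 + A * A"
    using X_le by (intro Liminf_le) (auto intro: always_eventually)
  also have "\<dots> < top" using \<open>A < top\<close> by (simp add: ennreal_mult_less_top)
  finally have fin: "(\<integral>\<^sup>+x. indicator \<Omega> x * ennreal ((u' x)\<^sup>2) \<partial>lborel) < top" .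
  have u'0: "u' x = 0" if "x \<notin> \<Omega>" for x using b(1) that by (simp add: borel_version_def)
  have "(\<lambda>x. indicator \<Omega> x * ennreal ((u' x)\<^sup>2)) = (\<lambda>x. ennreal ((u' x)\<^sup>2))"
    using u'0 by (auto simp: fun_eq_iff split: split_indicator)
  with fin have "integrable lborel (\<lambda>x. (u' x)\<^sup>2)"
    by (intro integrableI_bounded) auto
  moreover have "borel_version \<Omega> (\<lambda>x. (u x)\<^sup>2) (\<lambda>x. (u' x)\<^sup>2)"
    using b(1) by (auto simp: borel_version_def elim!: AE_mp)
  ultimately show ?thesis
    using borel_version_integrable[OF open_dom, of "\<lambda>x. (u x)\<^sup>2"] W_measurable[OF u] by simp
qed

subsection \<open>The elliptic problem\<close>

text \<open>Subgradient inequalities of a convex primitive. They cover both orders of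
  \<open>s\<close> and \<open>t\<close>, so the two points may be interchanged.\<close>

lemma monotone_primitive_bounds:
  fixes h :: "real \<Rightarrow> real"
  assumes cont: "continuous_on {a..c} h"
    and mono: "\<And>s t. a \<le> s \<Longrightarrow> s \<le> t \<Longrightarrow> t \<le> c \<Longrightarrow> h s \<le> h t"
    and s: "a \<le> s" "s \<le> c" and t: "a \<le> t" "t \<le> c"
  shows "h s * (t - s) \<le> integral {a..t} h - integral {a..s} h"
    "integral {a..t} h - integral {a..s} h \<le> h t * (t - s)"
proof -
  have *: "h s * (t - s) \<le> integral {a..t} h - integral {a..s} h \<and>
      integral {a..t} h - integral {a..s} h \<le> h t * (t - s)"
    if st: "a \<le> s" "s \<le> t" "t \<le> c" for s t
  proof -
    have i: "h integrable_on {a..t}" "h integrable_on {s..t}"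
      using st by (auto intro!: integrable_continuous_real continuous_on_subset[OF cont])
    have eq: "integral {a..s} h + integral {s..t} h = integral {a..t} h"
      using st i(1) by (intro Henstock_Kurzweil_Integration.integral_combine) auto
    have "integral {s..t} (\<lambda>r. h s) \<le> integral {s..t} h"
      by (rule integral_le) (use st mono i(2) in auto)
    moreover have "integral {s..t} h \<le> integral {s..t} (\<lambda>r. h t)"
      by (rule integral_le) (use st mono i(2) in auto)
    ultimately show ?thesis using eq st by (simp add: mult.commute)
  qed
  have "h s * (t - s) \<le> integral {a..t} h - integral {a..s} h \<and>
      integral {a..t} h - integral {a..s} h \<le> h t * (t - s)"
  proof (cases "s \<le> t")
    case True
    then show ?thesis using * s t by blast
  next
    case False
    then have "h t * (s - t) \<le> integral {a..s} h - integral {a..t} h \<and>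
      integral {a..s} h - integral {a..t} h \<le> h s * (s - t)" using *[of t s] s t by simp
    then show ?thesis by (simp add: algebra_simps)
  qed
  then show "h s * (t - s) \<le> integral {a..t} h - integral {a..s} h"
    "integral {a..t} h - integral {a..s} h \<le> h t * (t - s)" by auto
qed

text \<open>For a monotone integrand the upper and lower sums differ by a telescoping amount of
  order \<open>1 / n\<close>. The purpose is to exhibit \<open>A_pot\<close> and \<open>B\<close> as
  limits of measurable functions of \<open>x\<close>.\<close>

lemma Riemann_sums_monotone:
  fixes h :: "real \<Rightarrow> real"
  assumes cont: "continuous_on {a..c} h" and "a \<le> c"
    and mono: "\<And>s t. a \<le> s \<Longrightarrow> s \<le> t \<Longrightarrow> t \<le> c \<Longrightarrow> h s \<le> h t"
  shows "(\<lambda>n. \<Sum>k<Suc n. (c - a) / real (Suc n) * h (a + real k / real (Suc n) * (c - a))) \<longlonglongrightarrow> integral {a..c} h"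
proof -
  define H where "H t = integral {a..t} h" for t
  have bound: "\<bar>(\<Sum>k<Suc n. (c - a) / real (Suc n) * h (a + real k / real (Suc n) * (c - a))) - H c\<bar>
      \<le> (c - a) * (h c - h a) * inverse (real (Suc n))" for n
  proof -
    define d where "d = (c - a) / real (Suc n)"
    define s where "s k = a + real k / real (Suc n) * (c - a)" for k
    have d: "0 \<le> d" using assms(2) by (simp add: d_def)
    have sk: "a \<le> s k" "s k \<le> c" if "k \<le> Suc n" for k
    proof -
      have "real k / real (Suc n) \<le> 1" using that by simp
      then have "real k / real (Suc n) * (c - a) \<le> 1 * (c - a)" using assms(2) by (intro mult_right_mono) auto
      then show "a \<le> s k" "s k \<le> c" using assms(2) by (auto simp: s_def)
    qed
    have step: "s (Suc k) - s k = d" for k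
    proof -
      have "s (Suc k) - s k = (real (Suc k) / real (Suc n) - real k / real (Suc n)) * (c - a)"
        unfolding s_def left_diff_distrib by simp
      also have "real (Suc k) / real (Suc n) - real k / real (Suc n) = 1 / real (Suc n)"
        by (simp add: diff_divide_distrib[symmetric])
      finally show ?thesis by (simp add: d_def)
    qed
    have "real (Suc n) / real (Suc n) = 1" by (rule divide_self) simp
    then have s0: "s 0 = a" "s (Suc n) = c" by (simp_all only: s_def) simp_all
    have tel: "(\<Sum>k<Suc n. H (s (Suc k)) - H (s k)) = H c"
      using sum_lessThan_telescope[of "\<lambda>k. H (s k)" "Suc n"] by (simp add: s0 H_def del: sum.lessThan_Suc)
    have "d * h (s k) \<le> H (s (Suc k)) - H (s k)" "H (s (Suc k)) - H (s k) \<le> d * h (s (Suc k))" if "k < Suc n" for k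
      using monotone_primitive_bounds[OF cont mono, of "s k" "s (Suc k)"] sk[of k] sk[of "Suc k"] that
      unfolding H_def step by (auto simp: mult.commute)
    then have "(\<Sum>k<Suc n. d * h (s k)) \<le> H c" "H c \<le> (\<Sum>k<Suc n. d * h (s (Suc k)))"
      unfolding tel[symmetric] by (auto intro!: sum_mono simp del: sum.lessThan_Suc)
    moreover have "(\<Sum>k<Suc n. d * h (s (Suc k))) - (\<Sum>k<Suc n. d * h (s k)) = d * (h c - h a)"
      using sum_lessThan_telescope[of "\<lambda>k. h (s k)" "Suc n"]
      by (simp add: s0 sum_subtractf[symmetric] right_diff_distrib[symmetric] sum_distrib_left[symmetric]
          del: sum.lessThan_Suc)
    ultimately have "\<bar>(\<Sum>k<Suc n. d * h (s k)) - H c\<bar> \<le> d * (h c - h a)" by linarith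
    then show ?thesis by (simp add: d_def s_def divide_inverse mult_ac del: sum.lessThan_Suc of_nat_Suc)
  qed
  have "(\<lambda>n. (c - a) * (h c - h a) * inverse (real (Suc n))) \<longlonglongrightarrow> (c - a) * (h c - h a) * 0"
    by (intro tendsto_intros LIMSEQ_inverse_real_of_nat)
  then have lim0: "(\<lambda>n. (c - a) * (h c - h a) * inverse (real (Suc n))) \<longlonglongrightarrow> 0" by simp
  show ?thesis
    unfolding H_def[symmetric]
    by (rule LIM_zero_cancel, rule Lim_null_comparison[OF _ lim0])
      (intro always_eventually allI, unfold real_norm_def, rule bound)
qed

lemma Young_le_sum:
  fixes a b r :: real
  assumes "1 < r"
  shows "\<bar>a\<bar> * \<bar>b\<bar> \<le> \<bar>a\<bar> powr (r / (r - 1)) + \<bar>b\<bar> powr r"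
proof -
  have "\<bar>a\<bar> * \<bar>b\<bar> \<le> \<bar>a\<bar> powr (r / (r - 1)) / (r / (r - 1)) + \<bar>b\<bar> powr r / r"
    using assms by (intro Youngs_inequality) (auto simp: field_simps)
  moreover have "\<bar>a\<bar> powr (r / (r - 1)) / (r / (r - 1)) \<le> \<bar>a\<bar> powr (r / (r - 1)) / 1"
    using assms by (intro divide_left_mono) (auto simp: field_simps)
  moreover have "\<bar>b\<bar> powr r / r \<le> \<bar>b\<bar> powr r / 1"
    using assms by (intro divide_left_mono) auto
  ultimately show ?thesis by simp
qed

lemma integrable_mult_if_square_integrable:
  fixes u v :: "'a \<Rightarrow> real"
  assumes [measurable]: "u \<in> borel_measurable M" "v \<in> borel_measurable M"
    and "integrable M (\<lambda>x. (u x)\<^sup>2)" "integrable M (\<lambda>x. (v x)\<^sup>2)"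
  shows "integrable M (\<lambda>x. u x * v x)"
proof (rule Bochner_Integration.integrable_bound)
  show "integrable M (\<lambda>x. (u x)\<^sup>2 + (v x)\<^sup>2)" using assms by simp
  show "AE x in M. norm (u x * v x) \<le> norm ((u x)\<^sup>2 + (v x)\<^sup>2)"
  proof (rule AE_I2)
    fix x
    have "2 * (\<bar>u x\<bar> * \<bar>v x\<bar>) \<le> (u x)\<^sup>2 + (v x)\<^sup>2"
      using sum_squares_bound[of "\<bar>u x\<bar>" "\<bar>v x\<bar>"] by simp
    moreover have "0 \<le> \<bar>u x\<bar> * \<bar>v x\<bar>" by simp
    ultimately show "norm (u x * v x) \<le> norm ((u x)\<^sup>2 + (v x)\<^sup>2)"
      unfolding real_norm_def abs_mult by linarith
  qed
qed measurable

text \<open>Completeness of Lebesgue measure: changing a function on a null set preserves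
  measurability.\<close>

lemma (in var_exponent) measurable_AE:
  fixes g :: "'a \<Rightarrow> 'c::euclidean_space"
  assumes "g \<in> borel_measurable M" "AE x in M. g x = h x"
  shows "h \<in> borel_measurable M"
proof -
  have "(\<lambda>x. indicator \<Omega> x *\<^sub>R h x) \<in> borel_measurable lebesgue"
  proof (rule Equivalence_Measurable_On_Borel.borel_measurable_AE)
    show "(\<lambda>x. indicator \<Omega> x *\<^sub>R g x) \<in> borel_measurable lebesgue"
      using assms(1) open_dom by (subst (asm) borel_measurable_restrict_space_iff) auto
    have "AE x in lebesgue. x \<in> \<Omega> \<longrightarrow> g x = h x"
      using assms(2) open_dom by (subst (asm) AE_restrict_space_iff) auto
    then show "AE x in lebesgue. indicator \<Omega> x *\<^sub>R g x = indicator \<Omega> x *\<^sub>R h x"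
      by eventually_elim (auto split: split_indicator)
  qed
  then show ?thesis
    using open_dom by (subst borel_measurable_restrict_space_iff) auto
qed

lemma (in var_exponent) measurable_AE_limit:
  fixes g :: "nat \<Rightarrow> 'a \<Rightarrow> 'c::euclidean_space"
  assumes "\<And>n. g n \<in> borel_measurable M" "AE x in M. (\<lambda>n. g n x) \<longlonglongrightarrow> h x"
  shows "h \<in> borel_measurable M"
proof (rule measurable_AE)
  show "(\<lambda>x. lim (\<lambda>n. g n x)) \<in> borel_measurable M" using assms(1) by measurable
  show "AE x in M. lim (\<lambda>n. g n x) = h x" using assms(2) by eventually_elim (rule limI)
qed

text \<open>\<open>V\<close> is rounded down to a grid of mesh \<open>1 / (n + 1)\<close> and
  clamped to the interval. The rounded function has countably many values, so that only sections of
  \<open>g\<close> at fixed \<open>s\<close> are involved; continuity in \<open>s\<close> gives the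
  limit.\<close>

lemma (in var_exponent) caratheodory_compose_measurable:
  fixes g :: "'a \<Rightarrow> real \<Rightarrow> real"
  assumes meas: "\<And>s. a \<le> s \<Longrightarrow> s \<le> c \<Longrightarrow> (\<lambda>x. g x s) \<in> borel_measurable M"
    and cont: "AE x in M. continuous_on {a..c} (g x)"
    and V: "V \<in> borel_measurable M" "AE x in M. a \<le> V x \<and> V x \<le> c" and "a \<le> c"
  shows "(\<lambda>x. g x (V x)) \<in> borel_measurable M"
proof (rule measurable_AE_limit)
  define s where "s n i = max a (min c (real_of_int i / real (Suc n)))" for n :: nat and i :: int
  have s: "a \<le> s n i" "s n i \<le> c" for n i using \<open>a \<le> c\<close> by (auto simp: s_def)
  fix n :: nat
  show "(\<lambda>x. g x (s n \<lfloor>real (Suc n) * V x\<rfloor>)) \<in> borel_measurable M"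
  proof (rule measurable_compose_countable[of "\<lambda>i x. g x (s n i)"])
    show "(\<lambda>x. \<lfloor>real (Suc n) * V x\<rfloor>) \<in> measurable M (count_space UNIV)"
      using V(1) by measurable
  qed (use meas s in auto)
next
  define s where "s n i = max a (min c (real_of_int i / real (Suc n)))" for n :: nat and i :: int
  show "AE x in M. (\<lambda>n. g x (s n \<lfloor>real (Suc n) * V x\<rfloor>)) \<longlonglongrightarrow> g x (V x)"
    using cont V(2)
  proof eventually_elim
    case (elim x)
    have lim: "(\<lambda>n. real_of_int \<lfloor>real (Suc n) * V x\<rfloor> / real (Suc n)) \<longlonglongrightarrow> V x"
    proof (rule LIM_zero_cancel, rule Lim_null_comparison[OF _ LIMSEQ_inverse_real_of_nat])
      show "\<forall>\<^sub>F n in sequentially. norm (real_of_int \<lfloor>real (Suc n) * V x\<rfloor> / real (Suc n) - V x) \<le> inverse (real (Suc n))"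
      proof (intro always_eventually allI)
        fix n
        have "\<bar>real_of_int \<lfloor>real (Suc n) * V x\<rfloor> - real (Suc n) * V x\<bar> \<le> 1" by linarith
        then have "\<bar>real_of_int \<lfloor>real (Suc n) * V x\<rfloor> - real (Suc n) * V x\<bar> / real (Suc n) \<le> 1 / real (Suc n)"
          by (intro divide_right_mono) auto
        moreover have "real_of_int \<lfloor>real (Suc n) * V x\<rfloor> / real (Suc n) - V x =
            (real_of_int \<lfloor>real (Suc n) * V x\<rfloor> - real (Suc n) * V x) / real (Suc n)"
          by (simp add: diff_divide_distrib del: of_nat_Suc)
        ultimately show "norm (real_of_int \<lfloor>real (Suc n) * V x\<rfloor> / real (Suc n) - V x) \<le> inverse (real (Suc n))"
          by (simp add: inverse_eq_divide del: of_nat_Suc)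
      qed
    qed
    have "(\<lambda>n. max a (min c (real_of_int \<lfloor>real (Suc n) * V x\<rfloor> / real (Suc n)))) \<longlonglongrightarrow> max a (min c (V x))"
      by (intro tendsto_intros lim)
    then have "(\<lambda>n. s n \<lfloor>real (Suc n) * V x\<rfloor>) \<longlonglongrightarrow> V x"
      using elim(2) by (simp add: s_def)
    moreover have "\<forall>\<^sub>F n in sequentially. s n \<lfloor>real (Suc n) * V x\<rfloor> \<in> {a..c}"
      using \<open>a \<le> c\<close> by (auto simp: s_def)
    ultimately show ?case
      using elim by (intro continuous_on_tendsto_compose[OF elim(1)]) auto
  qed
qed

text \<open>The embedding in L^2 enters as the assumption \<open>W_L2\<close>, which separates the
  variational part from the geometry of the boundary. Monotonicity of
  \<open>f x s + lam * b x s\<close> orders the sources; strict monotonicity of \<open>b\<close>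
  gives comparison and uniqueness.\<close>

locale elliptic = var_exponent \<Omega> p p0 P
  for \<Omega> :: "'a::euclidean_space set" and p :: "'a \<Rightarrow> real" and p0 P :: real +
  fixes \<Psi> b f :: "'a \<Rightarrow> real \<Rightarrow> real" and \<epsilon> \<delta> lam :: real
  assumes W_L2: "\<And>u. u \<in> W1p_var \<Omega> p \<Longrightarrow> integrable (lebesgue_on \<Omega>) (\<lambda>x. (u x)\<^sup>2)"
    and Phi_Lp: "\<And>v. v \<in> Lp_var \<Omega> p \<Longrightarrow> (\<lambda>x. Phi \<Psi> x (v x)) \<in> Lp_var \<Omega> (conj_exponent p)"
    and Phi_AE: "AE x in lebesgue_on \<Omega>. continuous_on {0..} (Phi \<Psi> x) \<and>
      (\<forall>s t. 0 \<le> s \<and> s \<le> t \<longrightarrow> Phi \<Psi> x s \<le> Phi \<Psi> x t)"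
    and coercive: "\<And>V :: nat \<Rightarrow> 'a \<Rightarrow> real. (\<And>n. V n \<in> W1p_var \<Omega> p) \<Longrightarrow>
      filterlim (\<lambda>n. LINT x|lebesgue_on \<Omega>. norm (weak_gradient \<Omega> (V n) x) powr p x) at_top sequentially \<Longrightarrow>
      filterlim (\<lambda>n. LINT x|lebesgue_on \<Omega>. A_pot \<Psi> x (weak_gradient \<Omega> (V n) x)) at_top sequentially"
    and eps_le_delta: "\<epsilon> \<le> \<delta>" and lam_pos: "0 < lam"
    and b_meas: "\<And>s. \<epsilon> \<le> s \<Longrightarrow> s \<le> \<delta> \<Longrightarrow> (\<lambda>x. b x s) \<in> borel_measurable (lebesgue_on \<Omega>)"
    and f_meas: "\<And>s. \<epsilon> \<le> s \<Longrightarrow> s \<le> \<delta> \<Longrightarrow> (\<lambda>x. f x s) \<in> borel_measurable (lebesgue_on \<Omega>)"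
    and bf_AE: "AE x in lebesgue_on \<Omega>. continuous_on {\<epsilon>..\<delta>} (b x) \<and> strict_mono_on {\<epsilon>..\<delta>} (b x) \<and>
      continuous_on {\<epsilon>..\<delta>} (f x) \<and>
      (\<forall>s t. \<epsilon> \<le> s \<and> s \<le> t \<and> t \<le> \<delta> \<longrightarrow> f x s + lam * b x s \<le> f x t + lam * b x t) \<and>
      0 \<le> b x \<epsilon> \<and> 0 \<le> f x \<epsilon> \<and> f x \<delta> \<le> 0"
    and b_L2: "integrable (lebesgue_on \<Omega>) (\<lambda>x. (b x \<delta>)\<^sup>2)"
begin

section \<open>The monotone field and its potential\<close>

definition Phi_regular :: "'a \<Rightarrow> bool" where
  "Phi_regular x \<longleftrightarrow> continuous_on {0..} (Phi \<Psi> x) \<and> (\<forall>s t. 0 \<le> s \<and> s \<le> t \<longrightarrow> Phi \<Psi> x s \<le> Phi \<Psi> x t)"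

lemma AE_Phi_regular: "AE x in M. Phi_regular x"
  using Phi_AE by (simp add: Phi_regular_def)

lemma Phi_0 [simp]: "Phi \<Psi> x 0 = 0"
  by (simp add: Phi_def)

lemma Phi_nonneg: "Phi_regular x \<Longrightarrow> 0 \<le> s \<Longrightarrow> 0 \<le> Phi \<Psi> x s"
  unfolding Phi_regular_def by (metis Phi_0 order_refl)

lemma Phi_mono: "Phi_regular x \<Longrightarrow> 0 \<le> s \<Longrightarrow> s \<le> t \<Longrightarrow> Phi \<Psi> x s \<le> Phi \<Psi> x t"
  by (simp add: Phi_regular_def)

lemma a_field_eq: "a_field \<Psi> x \<xi> = (Phi \<Psi> x (norm \<xi>) / norm \<xi>) *\<^sub>R \<xi>"
  by (simp add: a_field_def Phi_def)

lemma norm_a_field: "Phi_regular x \<Longrightarrow> norm (a_field \<Psi> x \<xi>) = Phi \<Psi> x (norm \<xi>)"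
  using Phi_nonneg[of x "norm \<xi>"] by (simp add: a_field_eq)

lemma a_field_inner_self: "a_field \<Psi> x \<xi> \<bullet> \<xi> = Phi \<Psi> x (norm \<xi>) * norm \<xi>"
  by (simp add: a_field_eq dot_square_norm power2_eq_square)

lemma a_field_inner_le: "Phi_regular x \<Longrightarrow> \<bar>a_field \<Psi> x \<xi> \<bullet> \<eta>\<bar> \<le> Phi \<Psi> x (norm \<xi>) * norm \<eta>"
  using Cauchy_Schwarz_ineq2[of "a_field \<Psi> x \<xi>" \<eta>] by (simp add: norm_a_field)

text \<open>\<open>a_field\<close> is a subgradient of the convex radial potential
  \<open>A_pot\<close>: the one-dimensional inequalities for the norms become vectorial by
  Cauchy-Schwarz, which is an equality when \<open>\<xi>\<close> is paired with its own
  field.\<close>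

lemma A_pot_bounds:
  assumes "Phi_regular x"
  shows "a_field \<Psi> x \<xi> \<bullet> (\<eta> - \<xi>) \<le> A_pot \<Psi> x \<eta> - A_pot \<Psi> x \<xi>"
    "A_pot \<Psi> x \<eta> - A_pot \<Psi> x \<xi> \<le> a_field \<Psi> x \<eta> \<bullet> (\<eta> - \<xi>)"
proof -
  let ?c = "max (norm \<xi>) (norm \<eta>)"
  have c: "continuous_on {0..?c} (Phi \<Psi> x)"
    using assms by (auto simp: Phi_regular_def elim: continuous_on_subset)
  have m: "Phi \<Psi> x s \<le> Phi \<Psi> x t" if "0 \<le> s" "s \<le> t" "t \<le> ?c" for s t
    using Phi_mono[OF assms] that by blast
  have 1: "Phi \<Psi> x (norm \<xi>) * (norm \<eta> - norm \<xi>) \<le> A_pot \<Psi> x \<eta> - A_pot \<Psi> x \<xi>"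
    "A_pot \<Psi> x \<eta> - A_pot \<Psi> x \<xi> \<le> Phi \<Psi> x (norm \<eta>) * (norm \<eta> - norm \<xi>)"
    unfolding A_pot_def by (rule monotone_primitive_bounds[OF c m]; simp)+
  have "a_field \<Psi> x \<xi> \<bullet> (\<eta> - \<xi>) \<le> Phi \<Psi> x (norm \<xi>) * (norm \<eta> - norm \<xi>)"
    using a_field_inner_le[OF assms, of \<xi> \<eta>] by (simp add: inner_diff_right a_field_inner_self right_diff_distrib)
  with 1(1) show "a_field \<Psi> x \<xi> \<bullet> (\<eta> - \<xi>) \<le> A_pot \<Psi> x \<eta> - A_pot \<Psi> x \<xi>" by linarith
  have "Phi \<Psi> x (norm \<eta>) * (norm \<eta> - norm \<xi>) \<le> a_field \<Psi> x \<eta> \<bullet> (\<eta> - \<xi>)"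
    using a_field_inner_le[OF assms, of \<eta> \<xi>] by (simp add: inner_diff_right a_field_inner_self right_diff_distrib)
  with 1(2) show "A_pot \<Psi> x \<eta> - A_pot \<Psi> x \<xi> \<le> a_field \<Psi> x \<eta> \<bullet> (\<eta> - \<xi>)" by linarith
qed

lemma A_pot_0 [simp]: "A_pot \<Psi> x 0 = 0"
  by (simp add: A_pot_def)

lemma A_pot_nonneg: "Phi_regular x \<Longrightarrow> 0 \<le> A_pot \<Psi> x \<xi>"
  using A_pot_bounds(1)[of x 0 \<xi>] by (simp add: a_field_eq)

lemma A_pot_le: "Phi_regular x \<Longrightarrow> A_pot \<Psi> x \<xi> \<le> Phi \<Psi> x (norm \<xi>) * norm \<xi>"
  using A_pot_bounds(2)[of x \<xi> 0] by (simp add: a_field_inner_self)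

lemma a_field_monotone: "Phi_regular x \<Longrightarrow> 0 \<le> (a_field \<Psi> x \<xi> - a_field \<Psi> x \<eta>) \<bullet> (\<xi> - \<eta>)"
  using A_pot_bounds(1)[of x \<xi> \<eta>] A_pot_bounds(1)[of x \<eta> \<xi>]
  by (simp add: inner_diff_left inner_diff_right)

lemma A_pot_midpoint:
  assumes "Phi_regular x"
  shows "2 * A_pot \<Psi> x ((1/2) *\<^sub>R \<xi> + (1/2) *\<^sub>R \<eta>) \<le> A_pot \<Psi> x \<xi> + A_pot \<Psi> x \<eta>"
proof -
  let ?m = "(1/2) *\<^sub>R \<xi> + (1/2) *\<^sub>R \<eta>"
  have "\<xi> - ?m + (\<eta> - ?m) = \<xi> + \<eta> - (?m + ?m)" by simp
  also have "?m + ?m = \<xi> + \<eta>" by (simp add: algebra_simps flip: scaleR_add_left)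
  finally have "a_field \<Psi> x ?m \<bullet> (\<xi> - ?m) + a_field \<Psi> x ?m \<bullet> (\<eta> - ?m) = 0"
    unfolding inner_add_right[symmetric] by simp
  with A_pot_bounds(1)[OF assms, of ?m \<xi>] A_pot_bounds(1)[OF assms, of ?m \<eta>] show ?thesis by linarith
qed

lemma Phi_tendsto:
  assumes "Phi_regular x" "(s \<longlongrightarrow> r) F" "\<And>n. 0 \<le> s n" "0 \<le> r"
  shows "((\<lambda>n. Phi \<Psi> x (s n)) \<longlongrightarrow> Phi \<Psi> x r) F"
proof -
  have "continuous_on {0..} (Phi \<Psi> x)" using assms(1) by (simp add: Phi_regular_def)
  then show ?thesis
    by (rule continuous_on_tendsto_compose) (use assms in auto)
qed

text \<open>At \<open>\<xi> = 0\<close> the quotient form of the field gives no information; there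
  the norm of the field equals \<open>Phi\<close>, which tends to 0.\<close>

lemma a_field_tendsto:
  fixes \<zeta> :: "nat \<Rightarrow> 'a"
  assumes "Phi_regular x" "\<zeta> \<longlonglongrightarrow> \<xi>"
  shows "(\<lambda>n. a_field \<Psi> x (\<zeta> n)) \<longlonglongrightarrow> a_field \<Psi> x \<xi>"
proof -
  have P: "(\<lambda>n. Phi \<Psi> x (norm (\<zeta> n))) \<longlonglongrightarrow> Phi \<Psi> x (norm \<xi>)"
    by (rule Phi_tendsto[OF assms(1) tendsto_norm[OF assms(2)]]) auto
  show ?thesis
  proof (cases "\<xi> = 0")
    case True
    then have "(\<lambda>n. norm (a_field \<Psi> x (\<zeta> n))) \<longlonglongrightarrow> 0" using P by (simp add: norm_a_field[OF assms(1)])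
    from tendsto_norm_zero_cancel[OF this] show ?thesis using True by (simp add: a_field_def)
  next
    case False
    then show ?thesis unfolding a_field_eq by (intro tendsto_intros P assms(2)) simp
  qed
qed

lemma A_pot_tendsto:
  fixes \<zeta> :: "nat \<Rightarrow> 'a"
  assumes "Phi_regular x" "\<zeta> \<longlonglongrightarrow> \<xi>"
  shows "(\<lambda>n. A_pot \<Psi> x (\<zeta> n)) \<longlonglongrightarrow> A_pot \<Psi> x \<xi>"
proof (rule LIM_zero_cancel, rule tendsto_sandwich)
  have z: "(\<lambda>n. \<zeta> n - \<xi>) \<longlonglongrightarrow> 0" using assms(2) by (rule LIM_zero)
  show "(\<lambda>n. a_field \<Psi> x \<xi> \<bullet> (\<zeta> n - \<xi>)) \<longlonglongrightarrow> 0"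
    using tendsto_inner[OF tendsto_const z] by simp
  show "(\<lambda>n. a_field \<Psi> x (\<zeta> n) \<bullet> (\<zeta> n - \<xi>)) \<longlonglongrightarrow> 0"
    using tendsto_inner[OF a_field_tendsto[OF assms] z] by simp
qed (use A_pot_bounds[OF assms(1)] in auto)

lemma Phi_measurable: "v \<in> Lp_var \<Omega> p \<Longrightarrow> (\<lambda>x. Phi \<Psi> x (v x)) \<in> borel_measurable M"
  using Phi_Lp by (auto simp: Lp_var_def)

text \<open>Young's inequality pairs the conjugate exponents pointwise and so turns the growth
  assumption into integrability of products.\<close>

lemma Phi_mult_integrable:
  assumes v: "v \<in> Lp_var \<Omega> p" and w: "w \<in> Lp_var \<Omega> p"
  shows "integrable M (\<lambda>x. Phi \<Psi> x (v x) * w x)"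
proof (rule Bochner_Integration.integrable_bound)
  show "integrable M (\<lambda>x. \<bar>Phi \<Psi> x (v x)\<bar> powr conj_exponent p x + \<bar>w x\<bar> powr p x)"
    using Phi_Lp[OF v] w by (simp add: Lp_var_def)
  show "(\<lambda>x. Phi \<Psi> x (v x) * w x) \<in> borel_measurable M"
    using Phi_measurable[OF v] Lp_measurable[OF w] by simp
  show "AE x in M. norm (Phi \<Psi> x (v x) * w x) \<le> norm (\<bar>Phi \<Psi> x (v x)\<bar> powr conj_exponent p x + \<bar>w x\<bar> powr p x)"
  proof (rule AE_I2)
    fix x assume "x \<in> space M"
    then have "1 < p x" using p_bounds[of x] p0_gt_1 by auto
    from Young_le_sum[OF this, of "Phi \<Psi> x (v x)" "w x"]
    have "\<bar>Phi \<Psi> x (v x)\<bar> * \<bar>w x\<bar> \<le> \<bar>Phi \<Psi> x (v x)\<bar> powr conj_exponent p x + \<bar>w x\<bar> powr p x"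
      by (simp add: conj_exponent_def)
    then show "norm (Phi \<Psi> x (v x) * w x) \<le> norm (\<bar>Phi \<Psi> x (v x)\<bar> powr conj_exponent p x + \<bar>w x\<bar> powr p x)"
      by (simp add: abs_mult)
  qed
qed

lemma a_field_measurable: "U \<in> W \<Longrightarrow> (\<lambda>x. a_field \<Psi> x (grad U x)) \<in> borel_measurable M"
  unfolding a_field_eq using Phi_measurable[OF W_gradient(3)] W_gradient(2) by simp

lemma a_field_integrable:
  assumes U: "U \<in> W" and \<phi>: "\<phi> \<in> W"
  shows "integrable M (\<lambda>x. a_field \<Psi> x (grad U x) \<bullet> grad \<phi> x)"
proof (rule Bochner_Integration.integrable_bound)
  show "integrable M (\<lambda>x. Phi \<Psi> x (norm (grad U x)) * norm (grad \<phi> x))"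
    using U \<phi> by (intro Phi_mult_integrable W_gradient)
  show "AE x in M. norm (a_field \<Psi> x (grad U x) \<bullet> grad \<phi> x) \<le> norm (Phi \<Psi> x (norm (grad U x)) * norm (grad \<phi> x))"
    using AE_Phi_regular
  proof eventually_elim
    case (elim x)
    show ?case
      using a_field_inner_le[OF elim, of "grad U x" "grad \<phi> x"] Phi_nonneg[OF elim] by (simp add: abs_mult)
  qed
qed (use a_field_measurable[OF U] W_gradient(2)[OF \<phi>] in simp)

lemma A_pot_measurable:
  assumes U: "U \<in> W"
  shows "(\<lambda>x. A_pot \<Psi> x (grad U x)) \<in> borel_measurable M"
proof (rule measurable_AE_limit)
  let ?g = "\<lambda>x. norm (grad U x)"
  note gm = W_gradient(2,3)[OF U]
  fix n
  have "(\<lambda>x. Phi \<Psi> x (real k / real (Suc n) * ?g x)) \<in> borel_measurable M" for k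
    by (intro Phi_measurable Lp_cmult gm)
  then show "(\<lambda>x. \<Sum>k<Suc n. (?g x - 0) / real (Suc n) * Phi \<Psi> x (0 + real k / real (Suc n) * (?g x - 0))) \<in> borel_measurable M"
    using gm(1) by (intro borel_measurable_sum borel_measurable_times borel_measurable_divide) auto
next
  let ?g = "\<lambda>x. norm (grad U x)"
  show "AE x in M. (\<lambda>n. \<Sum>k<Suc n. (?g x - 0) / real (Suc n) * Phi \<Psi> x (0 + real k / real (Suc n) * (?g x - 0)))
      \<longlonglongrightarrow> A_pot \<Psi> x (grad U x)"
    using AE_Phi_regular
  proof eventually_elim
    case (elim x)
    then show ?case
      unfolding A_pot_def
      by (intro Riemann_sums_monotone) (auto simp: Phi_regular_def elim: continuous_on_subset)
  qed
qed

lemma A_pot_integrable: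
  assumes U: "U \<in> W"
  shows "integrable M (\<lambda>x. A_pot \<Psi> x (grad U x))"
proof (rule Bochner_Integration.integrable_bound)
  show "integrable M (\<lambda>x. Phi \<Psi> x (norm (grad U x)) * norm (grad U x))"
    using U by (intro Phi_mult_integrable W_gradient)
  show "AE x in M. norm (A_pot \<Psi> x (grad U x)) \<le> norm (Phi \<Psi> x (norm (grad U x)) * norm (grad U x))"
    using AE_Phi_regular
  proof eventually_elim
    case (elim x)
    then show ?case using A_pot_nonneg[OF elim, of "grad U x"] A_pot_le[OF elim, of "grad U x"] by simp
  qed
qed (rule A_pot_measurable[OF U])

section \<open>Lower order terms on the constraint set\<close>

definition K :: "('a \<Rightarrow> real) set" where
  "K = {V \<in> W. AE x in M. \<epsilon> \<le> V x \<and> V x \<le> \<delta>}"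

definition bf_regular :: "'a \<Rightarrow> bool" where
  "bf_regular x \<longleftrightarrow> continuous_on {\<epsilon>..\<delta>} (b x) \<and> strict_mono_on {\<epsilon>..\<delta>} (b x) \<and>
      continuous_on {\<epsilon>..\<delta>} (f x) \<and>
      (\<forall>s t. \<epsilon> \<le> s \<and> s \<le> t \<and> t \<le> \<delta> \<longrightarrow> f x s + lam * b x s \<le> f x t + lam * b x t) \<and>
      0 \<le> b x \<epsilon> \<and> 0 \<le> f x \<epsilon> \<and> f x \<delta> \<le> 0"

lemma AE_bf_regular: "AE x in M. bf_regular x"
  using bf_AE by (simp add: bf_regular_def)

lemma b_mono: "bf_regular x \<Longrightarrow> \<epsilon> \<le> s \<Longrightarrow> s \<le> t \<Longrightarrow> t \<le> \<delta> \<Longrightarrow> b x s \<le> b x t"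
  by (cases "s = t") (auto simp: bf_regular_def dest!: strict_mono_onD[of _ _ s t])

lemma b_strict_mono: "bf_regular x \<Longrightarrow> \<epsilon> \<le> s \<Longrightarrow> s < t \<Longrightarrow> t \<le> \<delta> \<Longrightarrow> b x s < b x t"
  by (auto simp: bf_regular_def dest!: strict_mono_onD[of _ _ s t])

lemma b_bounds: "bf_regular x \<Longrightarrow> \<epsilon> \<le> s \<Longrightarrow> s \<le> \<delta> \<Longrightarrow> 0 \<le> b x s \<and> b x s \<le> b x \<delta>"
  using b_mono[of x \<epsilon> s] b_mono[of x s \<delta>] by (auto simp: bf_regular_def)

lemma b_tendsto:
  "bf_regular x \<Longrightarrow> (s \<longlongrightarrow> r) F \<Longrightarrow> (\<And>n. \<epsilon> \<le> s n \<and> s n \<le> \<delta>) \<Longrightarrow> \<epsilon> \<le> r \<Longrightarrow> r \<le> \<delta> \<Longrightarrow>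
    ((\<lambda>n. b x (s n)) \<longlongrightarrow> b x r) F"
  by (rule continuous_on_tendsto_compose[of "{\<epsilon>..\<delta>}" "b x"]) (auto simp: bf_regular_def)

lemma b_delta_measurable: "(\<lambda>x. b x \<delta>) \<in> borel_measurable M"
  using b_meas eps_le_delta by auto

lemma b_delta_integrable: "integrable M (\<lambda>x. b x \<delta>)"
  using integrable_mult_if_square_integrable[OF b_delta_measurable _ b_L2, of "\<lambda>x. 1"] by simp

lemma b_compose_measurable:
  assumes "V \<in> borel_measurable M" "AE x in M. \<epsilon> \<le> V x \<and> V x \<le> \<delta>"
  shows "(\<lambda>x. b x (V x)) \<in> borel_measurable M"
  by (rule caratheodory_compose_measurable[OF b_meas _ assms eps_le_delta])
    (use AE_bf_regular in \<open>auto simp: bf_regular_def elim!: AE_mp\<close>)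

lemma f_compose_measurable:
  assumes "V \<in> borel_measurable M" "AE x in M. \<epsilon> \<le> V x \<and> V x \<le> \<delta>"
  shows "(\<lambda>x. f x (V x)) \<in> borel_measurable M"
  by (rule caratheodory_compose_measurable[OF f_meas _ assms eps_le_delta])
    (use AE_bf_regular in \<open>auto simp: bf_regular_def elim!: AE_mp\<close>)

definition B :: "'a \<Rightarrow> real \<Rightarrow> real" where
  "B x s = integral {\<epsilon>..s} (b x)"

lemma B_bounds:
  assumes "bf_regular x" "\<epsilon> \<le> s" "s \<le> \<delta>" "\<epsilon> \<le> t" "t \<le> \<delta>"
  shows "b x s * (t - s) \<le> B x t - B x s" "B x t - B x s \<le> b x t * (t - s)"
  unfolding B_def
  by (rule monotone_primitive_bounds[of \<epsilon> \<delta> "b x"]; use assms b_mono[OF assms(1)] in \<open>simp add: bf_regular_def\<close>)+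

lemma B_eps [simp]: "B x \<epsilon> = 0"
  by (simp add: B_def)

lemma B_nonneg: "bf_regular x \<Longrightarrow> \<epsilon> \<le> s \<Longrightarrow> s \<le> \<delta> \<Longrightarrow> 0 \<le> B x s"
proof -
  assume x: "bf_regular x" and s: "\<epsilon> \<le> s" "s \<le> \<delta>"
  have "0 \<le> b x \<epsilon> * (s - \<epsilon>)"
    using b_bounds[OF x, of \<epsilon>] s by (intro mult_nonneg_nonneg) auto
  then show ?thesis using B_bounds(1)[OF x, of \<epsilon> s] s by simp
qed

lemma B_le:
  assumes x: "bf_regular x" and s: "\<epsilon> \<le> s" "s \<le> \<delta>"
  shows "B x s \<le> b x \<delta> * (\<delta> - \<epsilon>)"
proof -
  have "B x s \<le> b x s * (s - \<epsilon>)" using B_bounds(2)[OF x, of \<epsilon> s] s by simp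
  also have "\<dots> \<le> b x \<delta> * (\<delta> - \<epsilon>)"
    using b_bounds[OF x s] s by (intro mult_mono) auto
  finally show ?thesis .
qed

lemma B_midpoint:
  assumes x: "bf_regular x" and s: "\<epsilon> \<le> s" "s \<le> \<delta>" and t: "\<epsilon> \<le> t" "t \<le> \<delta>"
  shows "2 * B x ((s + t) / 2) \<le> B x s + B x t"
    "s \<noteq> t \<Longrightarrow> 2 * B x ((s + t) / 2) < B x s + B x t"
proof -
  let ?m = "(s + t) / 2"
  have m: "\<epsilon> \<le> ?m" "?m \<le> \<delta>" using s t by auto
  have "b x ?m * (s - ?m) \<le> B x s - B x ?m" "b x ?m * (t - ?m) \<le> B x t - B x ?m"
    using B_bounds(1)[OF x m] s t by auto
  moreover have "b x ?m * (s - ?m) + b x ?m * (t - ?m) = 0" by (simp add: field_simps)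
  ultimately show "2 * B x ?m \<le> B x s + B x t" by linarith
  assume "s \<noteq> t"
  have *: "2 * B x ((s + t) / 2) < B x s + B x t" if st: "\<epsilon> \<le> s" "s < t" "t \<le> \<delta>" for s t
  proof -
    \<comment> \<open>The extra point \<open>?n\<close> halves the interval from \<open>?m\<close>
      to \<open>t\<close>. At \<open>?n\<close> the value of \<open>b\<close> strictly exceeds
      \<open>b x ?m\<close>, and this makes the convexity inequality strict.\<close>
    let ?m = "(s + t) / 2" and ?n = "(s + 3 * t) / 4"
    have "b x s * (?m - s) \<le> B x ?m - B x s \<and> B x ?m - B x s \<le> b x ?m * (?m - s)"
      using B_bounds[OF x, of s ?m] st by auto
    moreover have "b x ?m * (?n - ?m) \<le> B x ?n - B x ?m"
      using B_bounds(1)[OF x, of ?m ?n] st by auto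
    moreover have "b x ?n * (t - ?n) \<le> B x t - B x ?n"
      using B_bounds(1)[OF x, of ?n t] st by auto
    moreover have "b x ?m * (t - ?n) < b x ?n * (t - ?n)"
      using b_strict_mono[OF x, of ?m ?n] st by (intro mult_strict_right_mono) auto
    moreover have "b x ?m * (?m - s) = b x ?m * (?n - ?m) + b x ?m * (t - ?n)" by (simp add: field_simps)
    ultimately show ?thesis by linarith
  qed
  show "2 * B x ?m < B x s + B x t"
    using \<open>s \<noteq> t\<close> *[of s t] *[of t s] s t by (cases "s < t") (auto simp: add.commute)
qed

lemma B_tendsto:
  assumes x: "bf_regular x" and lim: "s \<longlonglongrightarrow> r" and s: "\<And>n::nat. \<epsilon> \<le> s n \<and> s n \<le> \<delta>"
  shows "(\<lambda>n. B x (s n)) \<longlonglongrightarrow> B x r"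
proof -
  have r: "\<epsilon> \<le> r" "r \<le> \<delta>"
    using s by (auto intro: LIMSEQ_le_const[OF lim] LIMSEQ_le_const2[OF lim])
  have z: "(\<lambda>n. s n - r) \<longlonglongrightarrow> 0" using lim by (rule LIM_zero)
  show ?thesis
  proof (rule LIM_zero_cancel, rule tendsto_sandwich)
    show "(\<lambda>n. b x r * (s n - r)) \<longlonglongrightarrow> 0" using tendsto_mult_right_zero[OF z] .
    show "(\<lambda>n. b x (s n) * (s n - r)) \<longlonglongrightarrow> 0"
      using tendsto_mult[OF b_tendsto[OF x lim s r] z] by simp
  qed (use B_bounds[OF x] r s in auto)
qed

lemma B_measurable:
  assumes V: "V \<in> borel_measurable M" "AE x in M. \<epsilon> \<le> V x \<and> V x \<le> \<delta>"
  shows "(\<lambda>x. B x (V x)) \<in> borel_measurable M"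
proof (rule measurable_AE_limit)
  fix n
  have "(\<lambda>x. b x (\<epsilon> + real k / real (Suc n) * (V x - \<epsilon>))) \<in> borel_measurable M" if "k < Suc n" for k
  proof (rule b_compose_measurable)
    show "AE x in M. \<epsilon> \<le> \<epsilon> + real k / real (Suc n) * (V x - \<epsilon>) \<and> \<epsilon> + real k / real (Suc n) * (V x - \<epsilon>) \<le> \<delta>"
      using V(2)
    proof eventually_elim
      case (elim x)
      have "real k / real (Suc n) * (V x - \<epsilon>) \<le> 1 * (V x - \<epsilon>)"
        using elim that by (intro mult_right_mono) auto
      moreover have "0 \<le> real k / real (Suc n) * (V x - \<epsilon>)" using elim by (intro mult_nonneg_nonneg) auto
      moreover have "e \<le> e + t \<and> e + t \<le> d" if "t \<le> 1 * (v - e)" "0 \<le> t" "v \<le> d" for t v e d :: real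
        using that by auto
      ultimately show ?case using elim by blast
    qed
  qed (use V(1) in simp)
  then show "(\<lambda>x. \<Sum>k<Suc n. (V x - \<epsilon>) / real (Suc n) * b x (\<epsilon> + real k / real (Suc n) * (V x - \<epsilon>))) \<in> borel_measurable M"
    using V(1) by (intro borel_measurable_sum borel_measurable_times borel_measurable_divide) auto
next
  show "AE x in M. (\<lambda>n. \<Sum>k<Suc n. (V x - \<epsilon>) / real (Suc n) * b x (\<epsilon> + real k / real (Suc n) * (V x - \<epsilon>)))
      \<longlonglongrightarrow> B x (V x)"
    using AE_bf_regular V(2)
  proof eventually_elim
    case (elim x)
    then show ?case
      unfolding B_def using b_mono[OF elim(1)]
      by (intro Riemann_sums_monotone) (auto simp: bf_regular_def elim: continuous_on_subset)
  qed
qed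

end

context elliptic
begin

text \<open>The bounds say that the constants \<open>\<epsilon>\<close> and \<open>\<delta>\<close>
  are a sub- and a supersolution for the source \<open>g\<close>. They also dominate
  \<open>g\<close> by a multiple of the square integrable function
  \<open>b x \<delta>\<close>.\<close>

definition sources :: "('a \<Rightarrow> real) set" where
  "sources = {g \<in> borel_measurable M. AE x in M. lam * b x \<epsilon> \<le> g x \<and> g x \<le> lam * b x \<delta>}"

definition J :: "('a \<Rightarrow> real) \<Rightarrow> ('a \<Rightarrow> real) \<Rightarrow> real" where
  "J g V = (\<integral>x. A_pot \<Psi> x (grad V x) \<partial>M) + (\<integral>x. lam * B x (V x) - g x * V x \<partial>M)"

text \<open>Solutions lie in \<open>K\<close> but are tested with all of \<open>W\<close>: this is
  an equation, not a variational inequality over \<open>K\<close>.\<close>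

definition solves :: "('a \<Rightarrow> real) \<Rightarrow> ('a \<Rightarrow> real) \<Rightarrow> bool" where
  "solves g V \<longleftrightarrow> V \<in> K \<and> (\<forall>\<phi>\<in>W. (\<integral>x. a_field \<Psi> x (grad V x) \<bullet> grad \<phi> x \<partial>M) =
     (\<integral>x. (g x - lam * b x (V x)) * \<phi> x \<partial>M))"

lemma K_W: "V \<in> K \<Longrightarrow> V \<in> W"
  by (simp add: K_def)

lemma K_AE: "V \<in> K \<Longrightarrow> AE x in M. \<epsilon> \<le> V x \<and> V x \<le> \<delta>"
  by (simp add: K_def)

lemma K_measurable: "V \<in> K \<Longrightarrow> V \<in> borel_measurable M"
  by (intro W_measurable K_W)

lemma const_K: "\<epsilon> \<le> c \<Longrightarrow> c \<le> \<delta> \<Longrightarrow> (\<lambda>x. c) \<in> K"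
  by (simp add: K_def W_const)

lemma clamp_K: "u \<in> W \<Longrightarrow> (\<lambda>x. max \<epsilon> (min \<delta> (u x))) \<in> K"
  using W_clamp(1)[OF _ eps_le_delta] eps_le_delta by (auto simp: K_def)

lemma K_midpoint: "U \<in> K \<Longrightarrow> V \<in> K \<Longrightarrow> (\<lambda>x. 1/2 * U x + 1/2 * V x) \<in> K"
  using W_add_cmult(1)[of U V "1/2" "1/2"] by (auto simp: K_def elim!: AE_mp)

lemma sources_measurable: "g \<in> sources \<Longrightarrow> g \<in> borel_measurable M"
  by (simp add: sources_def)

lemma sources_bounds: "g \<in> sources \<Longrightarrow> AE x in M. lam * b x \<epsilon> \<le> g x \<and> g x \<le> lam * b x \<delta>"
  by (simp add: sources_def)

lemma sources_AE: "g \<in> sources \<Longrightarrow> AE x in M. \<bar>g x\<bar> \<le> lam * b x \<delta>"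
proof -
  assume "g \<in> sources"
  then have "AE x in M. lam * b x \<epsilon> \<le> g x \<and> g x \<le> lam * b x \<delta>" by (simp add: sources_def)
  then show ?thesis
    using AE_bf_regular
  proof eventually_elim
    case (elim x)
    have "0 \<le> lam * b x \<epsilon>" using elim(2) lam_pos by (simp add: bf_regular_def)
    with elim(1) show ?case by linarith
  qed
qed

text \<open>The L2 embedding makes the pairing with test functions finite:
  \<open>b x \<delta>\<close> and \<open>\<phi>\<close> are both square integrable.\<close>

lemma dominated_mult_integrable:
  assumes h: "h \<in> borel_measurable M" "AE x in M. \<bar>h x\<bar> \<le> c * b x \<delta>" and \<phi>: "\<phi> \<in> W"
  shows "integrable M (\<lambda>x. h x * \<phi> x)"
proof (rule Bochner_Integration.integrable_bound)
  show "integrable M (\<lambda>x. c * (b x \<delta> * \<phi> x))"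
    using integrable_mult_if_square_integrable[OF b_delta_measurable W_measurable[OF \<phi>] b_L2 W_L2[OF \<phi>]] by simp
  show "AE x in M. norm (h x * \<phi> x) \<le> norm (c * (b x \<delta> * \<phi> x))"
    using h(2)
  proof eventually_elim
    case (elim x)
    then have "\<bar>h x\<bar> * \<bar>\<phi> x\<bar> \<le> \<bar>c * b x \<delta>\<bar> * \<bar>\<phi> x\<bar>" by (intro mult_right_mono) auto
    then show ?case by (simp add: abs_mult mult.assoc)
  qed
qed (use h(1) W_measurable[OF \<phi>] in simp)

lemma source_mult_integrable: "g \<in> sources \<Longrightarrow> \<phi> \<in> W \<Longrightarrow> integrable M (\<lambda>x. g x * \<phi> x)"
  using dominated_mult_integrable[OF sources_measurable sources_AE] .

lemma b_K_measurable: "V \<in> K \<Longrightarrow> (\<lambda>x. b x (V x)) \<in> borel_measurable M"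
  by (intro b_compose_measurable K_measurable K_AE)

lemma b_K_AE: "V \<in> K \<Longrightarrow> AE x in M. \<bar>b x (V x)\<bar> \<le> 1 * b x \<delta>"
proof -
  assume V: "V \<in> K"
  show ?thesis
    using AE_bf_regular K_AE[OF V]
  proof eventually_elim
    case (elim x)
    then show ?case using b_bounds[OF elim(1), of "V x"] by auto
  qed
qed

lemma b_mult_integrable: "V \<in> K \<Longrightarrow> \<phi> \<in> W \<Longrightarrow> integrable M (\<lambda>x. b x (V x) * \<phi> x)"
  using dominated_mult_integrable[OF b_K_measurable b_K_AE] .

lemma rhs_integrable:
  assumes "g \<in> sources" "V \<in> K" "\<phi> \<in> W"
  shows "integrable M (\<lambda>x. (g x - lam * b x (V x)) * \<phi> x)"
  using source_mult_integrable[OF assms(1,3)] b_mult_integrable[OF assms(2,3)]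
  by (simp add: left_diff_distrib mult.assoc)

lemma B_K_measurable: "V \<in> K \<Longrightarrow> (\<lambda>x. B x (V x)) \<in> borel_measurable M"
  by (intro B_measurable K_measurable K_AE)

lemma B_K_AE: "V \<in> K \<Longrightarrow> AE x in M. 0 \<le> B x (V x) \<and> B x (V x) \<le> b x \<delta> * (\<delta> - \<epsilon>)"
proof -
  assume V: "V \<in> K"
  show ?thesis
    using AE_bf_regular K_AE[OF V]
  proof eventually_elim
    case (elim x)
    then show ?case using B_nonneg[OF elim(1), of "V x"] B_le[OF elim(1), of "V x"] by auto
  qed
qed

lemma B_integrable: "V \<in> K \<Longrightarrow> integrable M (\<lambda>x. B x (V x))"
proof (rule Bochner_Integration.integrable_bound)
  assume V: "V \<in> K"
  show "integrable M (\<lambda>x. b x \<delta> * (\<delta> - \<epsilon>))" using b_delta_integrable by simp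
  show "AE x in M. norm (B x (V x)) \<le> norm (b x \<delta> * (\<delta> - \<epsilon>))"
    using B_K_AE[OF V] by eventually_elim auto
qed (rule B_K_measurable)

lemma lower_order_integrable:
  "g \<in> sources \<Longrightarrow> V \<in> K \<Longrightarrow> integrable M (\<lambda>x. lam * B x (V x) - g x * V x)"
  by (intro Bochner_Integration.integrable_diff integrable_mult_right B_integrable source_mult_integrable K_W)

lemma K_abs: "V \<in> K \<Longrightarrow> AE x in M. \<bar>V x\<bar> \<le> \<bar>\<epsilon>\<bar> + \<bar>\<delta>\<bar>"
proof -
  assume "V \<in> K"
  then have "AE x in M. \<epsilon> \<le> V x \<and> V x \<le> \<delta>" by (rule K_AE)
  then show ?thesis by eventually_elim auto
qed

lemma lower_order_dominated:
  assumes g: "g \<in> sources" and V: "V \<in> K"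
  shows "AE x in M. \<bar>lam * B x (V x) - g x * V x\<bar> \<le> lam * (\<delta> - \<epsilon> + \<bar>\<epsilon>\<bar> + \<bar>\<delta>\<bar>) * b x \<delta>"
  using sources_AE[OF g] B_K_AE[OF V] K_abs[OF V]
proof eventually_elim
  case (elim x)
  have "\<bar>g x * V x\<bar> \<le> (lam * b x \<delta>) * (\<bar>\<epsilon>\<bar> + \<bar>\<delta>\<bar>)"
    unfolding abs_mult using elim by (intro mult_mono) auto
  moreover have "0 \<le> lam * B x (V x)" "lam * B x (V x) \<le> lam * (b x \<delta> * (\<delta> - \<epsilon>))"
    using elim lam_pos by auto
  moreover have "lam * (\<delta> - \<epsilon> + \<bar>\<epsilon>\<bar> + \<bar>\<delta>\<bar>) * b x \<delta> = (lam * b x \<delta>) * (\<bar>\<epsilon>\<bar> + \<bar>\<delta>\<bar>) + lam * (b x \<delta> * (\<delta> - \<epsilon>))"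
    by (simp add: algebra_simps)
  ultimately show ?case by linarith
qed

lemma lower_order_tendsto:
  assumes g: "g \<in> sources" and V: "\<And>n::nat. V n \<in> K" and U: "U \<in> borel_measurable M"
    and lim: "AE x in M. (\<lambda>n. V n x) \<longlonglongrightarrow> U x"
  shows "(\<lambda>n. \<integral>x. lam * B x (V n x) - g x * V n x \<partial>M) \<longlonglongrightarrow> (\<integral>x. lam * B x (U x) - g x * U x \<partial>M)"
proof (rule integral_dominated_convergence[where w = "\<lambda>x. lam * (\<delta> - \<epsilon> + \<bar>\<epsilon>\<bar> + \<bar>\<delta>\<bar>) * b x \<delta>"])
  have allK: "AE x in M. \<forall>n. \<epsilon> \<le> V n x \<and> V n x \<le> \<delta>"
    using K_AE[OF V] by (simp add: AE_all_countable)
  have UK: "AE x in M. \<epsilon> \<le> U x \<and> U x \<le> \<delta>"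
    using allK lim
    by eventually_elim (auto intro: LIMSEQ_le_const LIMSEQ_le_const2)
  show "integrable M (\<lambda>x. lam * (\<delta> - \<epsilon> + \<bar>\<epsilon>\<bar> + \<bar>\<delta>\<bar>) * b x \<delta>)" using b_delta_integrable by simp
  show "AE x in M. (\<lambda>n. lam * B x (V n x) - g x * V n x) \<longlonglongrightarrow> lam * B x (U x) - g x * U x"
    using lim allK AE_bf_regular
  proof eventually_elim
    case (elim x)
    then show ?case by (intro tendsto_intros B_tendsto) auto
  qed
  show "AE x in M. norm (lam * B x (V n x) - g x * V n x) \<le> lam * (\<delta> - \<epsilon> + \<bar>\<epsilon>\<bar> + \<bar>\<delta>\<bar>) * b x \<delta>" for n
    using lower_order_dominated[OF g V] by simp
  show "(\<lambda>x. lam * B x (U x) - g x * U x) \<in> borel_measurable M"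
    using B_measurable[OF U UK] sources_measurable[OF g] U by simp
  show "(\<lambda>x. lam * B x (V n x) - g x * V n x) \<in> borel_measurable M" for n
    using lower_order_integrable[OF g V] by (rule borel_measurable_integrable)
qed

text \<open>Comparing \<open>V\<close> with the truncation of \<open>V + t * \<phi>\<close> to \<open>[\<epsilon>, \<delta>]\<close>. By convexity the difference
  quotients are bounded by integrands converging to those of the weak formulation; where the truncation
  is active, the signs of \<open>lam * b x \<epsilon> - g x\<close> and \<open>lam * b x \<delta> - g x\<close> help, and \<open>grad V\<close> vanishes
  on \<open>{V = \<epsilon>}\<close> and \<open>{V = \<delta>}\<close>.\<close>

lemma minimizer_inequality:
  assumes g: "g \<in> sources" and V: "V \<in> K" and min: "\<And>U. U \<in> K \<Longrightarrow> J g V \<le> J g U" and \<phi>: "\<phi> \<in> W"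
  shows "(\<integral>x. (g x - lam * b x (V x)) * \<phi> x \<partial>M) \<le> (\<integral>x. a_field \<Psi> x (grad V x) \<bullet> grad \<phi> x \<partial>M)"
proof -
  define t where "t n = inverse (real (Suc n))" for n
  have t: "0 < t n" "t n \<le> 1" for n by (simp_all add: t_def inverse_le_1_iff)
  have tlim: "t \<longlonglongrightarrow> 0" unfolding t_def by (rule LIMSEQ_inverse_real_of_nat)
  define V' where "V' n x = V x + t n * \<phi> x" for n x
  define U where "U n x = max \<epsilon> (min \<delta> (V' n x))" for n x
  define \<xi> where "\<xi> n x = grad V x + t n *\<^sub>R grad \<phi> x" for n x
  define I where "I n x \<longleftrightarrow> \<epsilon> < V' n x \<and> V' n x < \<delta>" for n x
  have V'W: "V' n \<in> W" and gV': "AE x in M. grad (V' n) x = \<xi> n x" for n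
    using W_add_cmult[OF K_W[OF V] \<phi>, of 1 "t n"] by (simp_all add: V'_def[abs_def] \<xi>_def)
  have UK: "U n \<in> K" for n
    unfolding U_def using clamp_K[OF V'W] .
  have gU: "AE x in M. grad (U n) x = (if I n x then \<xi> n x else 0)" for n
  proof -
    have "AE x in M. grad (U n) x = (if I n x then grad (V' n) x else 0)"
      using W_clamp(2)[OF V'W eps_le_delta, of n] by (simp add: U_def[abs_def] I_def)
    with gV'[of n] show ?thesis by eventually_elim auto
  qed
  define D where "D n x = (if I n x then a_field \<Psi> x (\<xi> n x) \<bullet> grad \<phi> x else 0)
    + (lam * b x (U n x) - g x) * \<phi> x" for n x
  note Vm[measurable] = K_measurable[OF V] W_gradient(2)[OF K_W[OF V]]
    and \<phi>m[measurable] = W_measurable[OF \<phi>] W_gradient(2)[OF \<phi>]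
    and gm[measurable] = sources_measurable[OF g]
  have am: "(\<lambda>x. a_field \<Psi> x (\<xi> n x)) \<in> borel_measurable M" for n
    by (rule measurable_AE[OF a_field_measurable[OF V'W[of n]]]) (rule eventually_mono[OF gV'[of n]], simp)
  have V'm[measurable]: "V' n \<in> borel_measurable M" for n by (rule W_measurable[OF V'W])
  have Dm[measurable]: "D n \<in> borel_measurable M" for n
    unfolding D_def I_def using am[of n] b_K_measurable[OF UK[of n]] by measurable
  \<comment> \<open>As \<open>t n \<le> 1\<close>, the norm of \<open>\<xi> n x\<close> is at most
    the sum of both gradient norms, which belongs to the variable exponent space. Monotonicity of
    \<open>Phi\<close> then yields a majorant without any growth rate.\<close>
  define w1 where "w1 x = Phi \<Psi> x (norm (grad V x) + norm (grad \<phi> x)) * norm (grad \<phi> x)" for x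
  define w2 where "w2 x = 2 * lam * (b x \<delta> * \<bar>\<phi> x\<bar>)" for x
  have "integrable M w1"
    unfolding w1_def by (intro Phi_mult_integrable Lp_add W_gradient K_W[OF V] \<phi>)
  moreover have "integrable M w2"
  proof -
    have "integrable M (\<lambda>x. \<bar>b x \<delta> * \<phi> x\<bar>)"
      using integrable_mult_if_square_integrable[OF b_delta_measurable \<phi>m(1) b_L2 W_L2[OF \<phi>]] by (rule integrable_abs)
    moreover have "AE x in M. \<bar>b x \<delta> * \<phi> x\<bar> = b x \<delta> * \<bar>\<phi> x\<bar>"
      using AE_bf_regular by eventually_elim (use b_bounds[of _ \<delta>] eps_le_delta in \<open>simp add: abs_mult\<close>)
    ultimately have "integrable M (\<lambda>x. b x \<delta> * \<bar>\<phi> x\<bar>)"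
      using b_delta_measurable by (subst (asm) integrable_cong_AE) auto
    then show ?thesis unfolding w2_def by simp
  qed
  ultimately have iw: "integrable M (\<lambda>x. w1 x + w2 x)" by simp
  have Dw: "AE x in M. norm (D n x) \<le> w1 x + w2 x" for n
    using AE_Phi_regular AE_bf_regular sources_AE[OF g] K_AE[OF UK[of n]]
  proof eventually_elim
    case (elim x)
    have "\<bar>if I n x then a_field \<Psi> x (\<xi> n x) \<bullet> grad \<phi> x else 0\<bar> \<le> w1 x"
    proof -
      have "norm (\<xi> n x) \<le> norm (grad V x) + norm (grad \<phi> x)"
        using norm_triangle_ineq[of "grad V x" "t n *\<^sub>R grad \<phi> x"] t[of n]
          mult_left_le_one_le[of "norm (grad \<phi> x)" "t n"] by (simp add: \<xi>_def)
      then have "Phi \<Psi> x (norm (\<xi> n x)) * norm (grad \<phi> x) \<le> w1 x"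
        unfolding w1_def by (intro mult_right_mono Phi_mono[OF elim(1)]) auto
      moreover have "0 \<le> w1 x" unfolding w1_def using Phi_nonneg[OF elim(1)] by simp
      ultimately show ?thesis using a_field_inner_le[OF elim(1), of "\<xi> n x" "grad \<phi> x"] by auto
    qed
    moreover have "\<bar>(lam * b x (U n x) - g x) * \<phi> x\<bar> \<le> w2 x"
    proof -
      have "0 \<le> b x (U n x)" "b x (U n x) \<le> b x \<delta>" using b_bounds[OF elim(2)] elim(4) by auto
      then have "0 \<le> lam * b x (U n x)" "lam * b x (U n x) \<le> lam * b x \<delta>" using lam_pos by auto
      then have "\<bar>lam * b x (U n x) - g x\<bar> \<le> 2 * lam * b x \<delta>" using elim(3) by linarith
      then have "\<bar>lam * b x (U n x) - g x\<bar> * \<bar>\<phi> x\<bar> \<le> 2 * lam * b x \<delta> * \<bar>\<phi> x\<bar>" by (intro mult_right_mono) auto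
      then show ?thesis by (simp add: w2_def abs_mult mult.assoc)
    qed
    ultimately show ?case unfolding D_def real_norm_def by linarith
  qed
  have iD: "integrable M (D n)" for n
  proof (rule Bochner_Integration.integrable_bound[OF iw Dm])
    show "AE x in M. norm (D n x) \<le> norm (w1 x + w2 x)" using Dw[of n] by eventually_elim auto
  qed
  have D_nonneg: "0 \<le> (\<integral>x. D n x \<partial>M)" for n
  proof -
    have i: "integrable M (\<lambda>x. A_pot \<Psi> x (grad (U n) x) - A_pot \<Psi> x (grad V x))"
      "integrable M (\<lambda>x. (lam * B x (U n x) - g x * U n x) - (lam * B x (V x) - g x * V x))"
      by (intro Bochner_Integration.integrable_diff A_pot_integrable lower_order_integrable g UK V K_W)+
    have "0 \<le> J g (U n) - J g V" using min[OF UK] by simp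
    also have "\<dots> = (\<integral>x. (A_pot \<Psi> x (grad (U n) x) - A_pot \<Psi> x (grad V x)) +
        ((lam * B x (U n x) - g x * U n x) - (lam * B x (V x) - g x * V x)) \<partial>M)"
      unfolding J_def
      by (subst Bochner_Integration.integral_add[OF i])
        (simp add: Bochner_Integration.integral_diff A_pot_integrable[OF K_W] lower_order_integrable[OF g] UK V)
    also have "\<dots> \<le> (\<integral>x. t n * D n x \<partial>M)"
    proof (rule integral_mono_AE)
      show "AE x in M. (A_pot \<Psi> x (grad (U n) x) - A_pot \<Psi> x (grad V x)) +
        ((lam * B x (U n x) - g x * U n x) - (lam * B x (V x) - g x * V x)) \<le> t n * D n x"
        using AE_Phi_regular AE_bf_regular gU[of n] K_AE[OF V] K_AE[OF UK[of n]]
          sources_bounds[OF g]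
      proof eventually_elim
        case (elim x)
        have "A_pot \<Psi> x (grad (U n) x) - A_pot \<Psi> x (grad V x) \<le>
            t n * (if I n x then a_field \<Psi> x (\<xi> n x) \<bullet> grad \<phi> x else 0)"
        proof (cases "I n x")
          case True
          have "A_pot \<Psi> x (\<xi> n x) - A_pot \<Psi> x (grad V x) \<le> a_field \<Psi> x (\<xi> n x) \<bullet> (\<xi> n x - grad V x)"
            by (rule A_pot_bounds(2)[OF elim(1)])
          then show ?thesis using True elim(3) by (simp add: \<xi>_def)
        next
          \<comment> \<open>Where the truncation is active the gradient of \<open>U n\<close> is 0,
            so the energy density can only drop.\<close>
          case False
          then show ?thesis using elim(3) A_pot_nonneg[OF elim(1)] by simp
        qed
        moreover have "(lam * B x (U n x) - g x * U n x) - (lam * B x (V x) - g x * V x) \<le>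
            (lam * b x (U n x) - g x) * (U n x - V x)"
        proof -
          have "lam * (B x (U n x) - B x (V x)) \<le> lam * (b x (U n x) * (U n x - V x))"
            using B_bounds(2)[OF elim(2), of "V x" "U n x"] elim lam_pos by (intro mult_left_mono) auto
          then show ?thesis by (simp add: algebra_simps)
        qed
        moreover have "(lam * b x (U n x) - g x) * (U n x - V x) \<le> (lam * b x (U n x) - g x) * (t n * \<phi> x)"
        proof -
          consider "U n x = V' n x" | "U n x = \<delta>" "\<delta> \<le> V' n x" | "U n x = \<epsilon>" "V' n x \<le> \<epsilon>"
            using eps_le_delta unfolding U_def by (cases "V' n x \<le> \<epsilon>"; cases "\<delta> \<le> V' n x") auto
          then show ?thesis
          proof cases
            case 1
            then show ?thesis by (simp add: V'_def)
          next
            case 2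
            then have "0 \<le> lam * b x (U n x) - g x" "U n x - V x \<le> t n * \<phi> x"
              using elim(6) by (auto simp: V'_def)
            then show ?thesis by (rule mult_left_mono[rotated])
          next
            case 3
            have "lam * b x (U n x) - g x \<le> 0"
              unfolding 3(1) using elim(6) by simp
            moreover have "t n * \<phi> x \<le> U n x - V x"
              using 3 by (simp add: V'_def)
            ultimately show ?thesis by (rule mult_left_mono_neg[rotated])
          qed
        qed
        ultimately show ?case by (simp add: D_def algebra_simps)
      qed
    qed (use i iD in auto)
    also have "\<dots> = t n * (\<integral>x. D n x \<partial>M)" by simp
    finally show ?thesis using t(1)[of n] by (simp add: zero_le_mult_iff)
  qed
  have "(\<lambda>n. \<integral>x. D n x \<partial>M) \<longlonglongrightarrow>
      (\<integral>x. a_field \<Psi> x (grad V x) \<bullet> grad \<phi> x + (lam * b x (V x) - g x) * \<phi> x \<partial>M)"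
  proof (rule integral_dominated_convergence[where w = "\<lambda>x. w1 x + w2 x"])
    show "AE x in M. (\<lambda>n. D n x) \<longlonglongrightarrow> a_field \<Psi> x (grad V x) \<bullet> grad \<phi> x + (lam * b x (V x) - g x) * \<phi> x"
      using AE_Phi_regular AE_bf_regular K_AE[OF V] W_level_set[OF K_W[OF V], of \<epsilon>] W_level_set[OF K_W[OF V], of \<delta>]
    proof eventually_elim
      case (elim x)
      have "(\<lambda>n. V x + t n * \<phi> x) \<longlonglongrightarrow> V x + 0 * \<phi> x" by (intro tendsto_intros tlim)
      then have V'lim: "(\<lambda>n. V' n x) \<longlonglongrightarrow> V x" by (simp add: V'_def)
      have "(\<lambda>n. max \<epsilon> (min \<delta> (V' n x))) \<longlonglongrightarrow> max \<epsilon> (min \<delta> (V x))" by (intro tendsto_intros V'lim)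
      then have Ulim: "(\<lambda>n. U n x) \<longlonglongrightarrow> V x" using elim(3) by (simp add: U_def)
      have "(\<lambda>n. grad V x + t n *\<^sub>R grad \<phi> x) \<longlonglongrightarrow> grad V x + 0 *\<^sub>R grad \<phi> x" by (intro tendsto_intros tlim)
      then have \<xi>lim: "(\<lambda>n. \<xi> n x) \<longlonglongrightarrow> grad V x" by (simp add: \<xi>_def)
      have alim: "(\<lambda>n. a_field \<Psi> x (\<xi> n x)) \<longlonglongrightarrow> a_field \<Psi> x (grad V x)"
        by (rule a_field_tendsto[OF elim(1) \<xi>lim])
      have "(\<lambda>n. if I n x then a_field \<Psi> x (\<xi> n x) \<bullet> grad \<phi> x else 0) \<longlonglongrightarrow> a_field \<Psi> x (grad V x) \<bullet> grad \<phi> x"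
      proof (cases "\<epsilon> < V x \<and> V x < \<delta>")
        case True
        then have "\<forall>\<^sub>F n in sequentially. \<epsilon> < V' n x" "\<forall>\<^sub>F n in sequentially. V' n x < \<delta>"
          using order_tendstoD[OF V'lim] by auto
        then have "\<forall>\<^sub>F n in sequentially. a_field \<Psi> x (\<xi> n x) \<bullet> grad \<phi> x =
            (if I n x then a_field \<Psi> x (\<xi> n x) \<bullet> grad \<phi> x else 0)"
          by eventually_elim (simp add: I_def)
        with tendsto_inner[OF alim tendsto_const[of "grad \<phi> x"]] show ?thesis
          by (rule Lim_transform_eventually)
      next
        case False
        then have "grad V x = 0" using elim(3-5) by auto
        then have a0: "a_field \<Psi> x (grad V x) = 0" by (simp add: a_field_def)
        have "(\<lambda>n. a_field \<Psi> x (\<xi> n x) \<bullet> grad \<phi> x) \<longlonglongrightarrow> 0"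
          using tendsto_inner[OF alim tendsto_const[of "grad \<phi> x"]] a0 by simp
        then have "(\<lambda>n. \<bar>a_field \<Psi> x (\<xi> n x) \<bullet> grad \<phi> x\<bar>) \<longlonglongrightarrow> 0" by (rule tendsto_rabs_zero)
        then have "(\<lambda>n. if I n x then a_field \<Psi> x (\<xi> n x) \<bullet> grad \<phi> x else 0) \<longlonglongrightarrow> 0"
          by (rule Lim_null_comparison[rotated]) simp
        then show ?thesis using a0 by simp
      qed
      moreover have "(\<lambda>n. b x (U n x)) \<longlonglongrightarrow> b x (V x)"
        by (rule b_tendsto[OF elim(2) Ulim]) (use elim(3) eps_le_delta in \<open>auto simp: U_def\<close>)
      ultimately show ?case unfolding D_def by (intro tendsto_intros)
    qed
  qed (use iw Dw a_field_integrable[OF K_W[OF V] \<phi>] b_K_measurable[OF V] in auto)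
  then have "0 \<le> (\<integral>x. a_field \<Psi> x (grad V x) \<bullet> grad \<phi> x + (lam * b x (V x) - g x) * \<phi> x \<partial>M)"
    using D_nonneg by (intro LIMSEQ_le_const) auto
  also have "\<dots> = (\<integral>x. a_field \<Psi> x (grad V x) \<bullet> grad \<phi> x - (g x - lam * b x (V x)) * \<phi> x \<partial>M)"
    by (simp add: algebra_simps)
  also have "\<dots> = (\<integral>x. a_field \<Psi> x (grad V x) \<bullet> grad \<phi> x \<partial>M) - (\<integral>x. (g x - lam * b x (V x)) * \<phi> x \<partial>M)"
    by (intro Bochner_Integration.integral_diff a_field_integrable rhs_integrable K_W V \<phi> g)
  finally show ?thesis by simp
qed

text \<open>The one-sided inequality is linear in the test function, so using it for
  \<open>\<phi>\<close> and for its negative gives equality.\<close>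

lemma minimizer_solves:
  assumes g: "g \<in> sources" and V: "V \<in> K" and min: "\<And>U. U \<in> K \<Longrightarrow> J g V \<le> J g U"
  shows "solves g V"
  unfolding solves_def
proof (intro conjI ballI V)
  fix \<phi> assume \<phi>: "\<phi> \<in> W"
  have m: "(\<lambda>x. - \<phi> x) \<in> W" and gm: "AE x in M. grad (\<lambda>x. - \<phi> x) x = - grad \<phi> x"
    using W_add_cmult[OF \<phi> \<phi>, of "-1" 0] by simp_all
  have "(\<integral>x. a_field \<Psi> x (grad V x) \<bullet> grad (\<lambda>x. - \<phi> x) x \<partial>M) = (\<integral>x. - (a_field \<Psi> x (grad V x) \<bullet> grad \<phi> x) \<partial>M)"
    by (rule integral_cong_AE)
      (use a_field_integrable[OF K_W[OF V] m] a_field_integrable[OF K_W[OF V] \<phi>] gm in \<open>auto elim!: AE_mp\<close>)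
  with minimizer_inequality[OF g V min m] minimizer_inequality[OF g V min \<phi>]
  show "(\<integral>x. a_field \<Psi> x (grad V x) \<bullet> grad \<phi> x \<partial>M) = (\<integral>x. (g x - lam * b x (V x)) * \<phi> x \<partial>M)"
    by simp
qed

text \<open>The left sides differ by a nonnegative amount, while the integrand \<open>R\<close> on
  the right is nonpositive and strictly negative where \<open>V1 x > V2 x\<close>; hence that set is
  null. The strictness comes from \<open>b\<close>, because gradients cannot detect a constant
  difference.\<close>

lemma comparison:
  assumes s1: "solves g1 V1" and s2: "solves g2 V2" and g: "g1 \<in> sources" "g2 \<in> sources"
    and le: "AE x in M. g1 x \<le> g2 x"
  shows "AE x in M. V1 x \<le> V2 x"
proof -
  have V: "V1 \<in> K" "V2 \<in> K" using s1 s2 by (auto simp: solves_def)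
  define u where "u x = V1 x - V2 x" for x
  have uW: "u \<in> W" and gu: "AE x in M. grad u x = grad V1 x - grad V2 x"
    using W_add_cmult[OF K_W[OF V(1)] K_W[OF V(2)], of 1 "-1"] by (simp_all add: u_def[abs_def])
  define \<phi> where "\<phi> x = max 0 (u x)" for x
  have \<phi>: "\<phi> \<in> W" and g\<phi>: "AE x in M. grad \<phi> x = (if 0 < u x then grad u x else 0)"
    using W_positive_part[OF uW] by (simp_all add: \<phi>_def[abs_def])
  define R where "R x = (g1 x - lam * b x (V1 x)) * \<phi> x - (g2 x - lam * b x (V2 x)) * \<phi> x" for x
  have iR: "integrable M R"
    unfolding R_def by (intro Bochner_Integration.integrable_diff rhs_integrable g V \<phi>)
  have "0 \<le> (\<integral>x. a_field \<Psi> x (grad V1 x) \<bullet> grad \<phi> x - a_field \<Psi> x (grad V2 x) \<bullet> grad \<phi> x \<partial>M)"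
  proof (rule integral_nonneg_AE)
    show "AE x in M. 0 \<le> a_field \<Psi> x (grad V1 x) \<bullet> grad \<phi> x - a_field \<Psi> x (grad V2 x) \<bullet> grad \<phi> x"
      using AE_Phi_regular gu g\<phi>
      by eventually_elim (use a_field_monotone in \<open>auto simp: inner_diff_left\<close>)
  qed
  also have "\<dots> = (\<integral>x. R x \<partial>M)"
    unfolding R_def using s1 s2 \<phi>
    by (simp add: Bochner_Integration.integral_diff a_field_integrable K_W V rhs_integrable g solves_def)
  finally have "0 \<le> (\<integral>x. R x \<partial>M)" .
  have R_le: "AE x in M. R x \<le> 0 \<and> (R x = 0 \<longrightarrow> V1 x \<le> V2 x)"
    using le AE_bf_regular K_AE[OF V(1)] K_AE[OF V(2)]
  proof eventually_elim
    case (elim x)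
    show ?case
    proof (cases "V2 x < V1 x")
      case True
      then have "lam * b x (V2 x) < lam * b x (V1 x)"
        using b_strict_mono[OF elim(2), of "V2 x" "V1 x"] elim lam_pos by simp
      then have "(g1 x - lam * b x (V1 x)) - (g2 x - lam * b x (V2 x)) < 0" using elim(1) by linarith
      moreover have "0 < \<phi> x" using True by (simp add: \<phi>_def u_def)
      ultimately have "((g1 x - lam * b x (V1 x)) - (g2 x - lam * b x (V2 x))) * \<phi> x < 0"
        by (rule mult_neg_pos)
      then have "R x < 0" by (simp add: R_def left_diff_distrib)
      then show ?thesis by simp
    next
      case False
      then show ?thesis by (simp add: R_def \<phi>_def u_def)
    qed
  qed
  have "AE x in M. 0 \<le> - R x" using R_le by eventually_elim simp
  moreover have "(\<integral>x. - R x \<partial>M) = 0"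
    using \<open>0 \<le> (\<integral>x. R x \<partial>M)\<close> integral_nonneg_AE[OF \<open>AE x in M. 0 \<le> - R x\<close>] by simp
  ultimately have "AE x in M. - R x = 0"
    using integral_nonneg_eq_0_iff_AE[of M "\<lambda>x. - R x"] iR by simp
  with R_le show ?thesis by eventually_elim simp
qed

text \<open>Of the convexity of \<open>J g\<close>, only the part due to \<open>B\<close> is kept
  exactly, since it detects differences of the functions themselves; for \<open>A_pot\<close> the
  midpoint inequality is enough.\<close>

lemma J_midpoint:
  assumes g: "g \<in> sources" and U: "U \<in> K" and V: "V \<in> K"
  defines "m \<equiv> \<lambda>x. 1/2 * U x + 1/2 * V x"
  shows "2 * J g m + (\<integral>x. lam * (B x (U x) + B x (V x) - 2 * B x ((U x + V x) / 2)) \<partial>M) \<le> J g U + J g V"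
proof -
  have m: "m \<in> K" unfolding m_def by (rule K_midpoint[OF U V])
  have gm: "AE x in M. grad m x = (1/2) *\<^sub>R grad U x + (1/2) *\<^sub>R grad V x"
    unfolding m_def by (rule W_add_cmult(2)[OF K_W[OF U] K_W[OF V]])
  have iA: "integrable M (\<lambda>x. A_pot \<Psi> x (grad w x))" if "w \<in> K" for w
    by (rule A_pot_integrable[OF K_W[OF that]])
  have "2 * (\<integral>x. A_pot \<Psi> x (grad m x) \<partial>M) = (\<integral>x. 2 * A_pot \<Psi> x (grad m x) \<partial>M)" by simp
  also have "\<dots> \<le> (\<integral>x. A_pot \<Psi> x (grad U x) + A_pot \<Psi> x (grad V x) \<partial>M)"
  proof (rule integral_mono_AE)
    show "AE x in M. 2 * A_pot \<Psi> x (grad m x) \<le> A_pot \<Psi> x (grad U x) + A_pot \<Psi> x (grad V x)"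
      using gm AE_Phi_regular by eventually_elim (use A_pot_midpoint in simp)
  qed (use iA U V m in auto)
  also have "\<dots> = (\<integral>x. A_pot \<Psi> x (grad U x) \<partial>M) + (\<integral>x. A_pot \<Psi> x (grad V x) \<partial>M)"
    using iA U V by simp
  finally have 1: "2 * (\<integral>x. A_pot \<Psi> x (grad m x) \<partial>M) \<le> \<dots>" .
  have iB: "integrable M (\<lambda>x. B x ((U x + V x) / 2))"
    using B_integrable[OF m] by (simp add: m_def add_divide_distrib)
  note iL = lower_order_integrable[OF g]
  have "2 * (\<integral>x. lam * B x (m x) - g x * m x \<partial>M) +
      (\<integral>x. lam * (B x (U x) + B x (V x) - 2 * B x ((U x + V x) / 2)) \<partial>M) =
      (\<integral>x. 2 * (lam * B x (m x) - g x * m x) + lam * (B x (U x) + B x (V x) - 2 * B x ((U x + V x) / 2)) \<partial>M)"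
  proof -
    have "integrable M (\<lambda>x. 2 * (lam * B x (m x) - g x * m x))"
      by (intro integrable_mult_right iL m)
    moreover have "integrable M (\<lambda>x. lam * (B x (U x) + B x (V x) - 2 * B x ((U x + V x) / 2)))"
      using iB B_integrable[OF U] B_integrable[OF V] by simp
    ultimately show ?thesis
      by (subst Bochner_Integration.integral_add) (simp_all only: integral_mult_right_zero)
  qed
  also have "\<dots> = (\<integral>x. (lam * B x (U x) - g x * U x) + (lam * B x (V x) - g x * V x) \<partial>M)"
    by (intro Bochner_Integration.integral_cong refl) (simp add: m_def algebra_simps add_divide_distrib)
  also have "\<dots> = (\<integral>x. lam * B x (U x) - g x * U x \<partial>M) + (\<integral>x. lam * B x (V x) - g x * V x \<partial>M)"
    using iL U V by simp
  finally have 2: "2 * (\<integral>x. lam * B x (m x) - g x * m x \<partial>M) +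
      (\<integral>x. lam * (B x (U x) + B x (V x) - 2 * B x ((U x + V x) / 2)) \<partial>M) = \<dots>" .
  have "2 * (a + l) + d \<le> (aU + lU) + (aV + lV)" if "2 * a \<le> aU + aV" "2 * l + d = lU + lV"
    for a l d aU aV lU lV :: real
    using that by (simp add: distrib_left)
  from this[OF 1 2] show ?thesis unfolding J_def .
qed

lemma B_defect_nonneg:
  assumes "U \<in> K" "V \<in> K"
  shows "AE x in M. 0 \<le> lam * (B x (U x) + B x (V x) - 2 * B x ((U x + V x) / 2))"
  using AE_bf_regular K_AE[OF assms(1)] K_AE[OF assms(2)]
  by eventually_elim (use B_midpoint(1) lam_pos in \<open>auto intro!: mult_nonneg_nonneg\<close>)

text \<open>The midpoint defect of \<open>B\<close> between \<open>Us n\<close> and \<open>V\<close>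
  is bounded in the mean by \<open>J g (Us n) - J g V\<close>, hence vanishes in the limit, and
  strict convexity of \<open>B\<close> identifies \<open>U\<close> with \<open>V\<close>. The
  argument uses no convergence of gradients.\<close>

lemma minimizing_limit_unique:
  assumes g: "g \<in> sources" and V: "V \<in> K" and min: "\<And>U. U \<in> K \<Longrightarrow> J g V \<le> J g U"
    and Us: "\<And>n::nat. Us n \<in> K" and Jlim: "(\<lambda>n. J g (Us n)) \<longlonglongrightarrow> J g V"
    and lim: "AE x in M. (\<lambda>n. Us n x) \<longlonglongrightarrow> U x"
  shows "AE x in M. U x = V x"
proof -
  define d where "d n x = lam * (B x (Us n x) + B x (V x) - 2 * B x ((Us n x + V x) / 2))" for n x
  have id: "integrable M (d n)" for n
  proof -
    have "integrable M (\<lambda>x. B x ((Us n x + V x) / 2))"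
      using B_integrable[OF K_midpoint[OF Us V]] by (simp add: add_divide_distrib)
    then show ?thesis unfolding d_def using B_integrable[OF Us] B_integrable[OF V] by simp
  qed
  have d0: "AE x in M. 0 \<le> d n x" for n unfolding d_def by (rule B_defect_nonneg[OF Us V])
  have d_le: "(\<integral>x. d n x \<partial>M) \<le> J g (Us n) - J g V" for n
    using J_midpoint[OF g Us V, of n] min[OF K_midpoint[OF Us V], of n] unfolding d_def by linarith
  have "(\<lambda>n. J g (Us n) - J g V) \<longlonglongrightarrow> 0" using Jlim by (rule LIM_zero)
  then have dlim: "(\<lambda>n. \<integral>x. d n x \<partial>M) \<longlonglongrightarrow> 0"
    by (rule Lim_null_comparison[rotated]) (use d_le integral_nonneg_AE[OF d0] in auto)
  have UB: "AE x in M. \<forall>n. \<epsilon> \<le> Us n x \<and> Us n x \<le> \<delta>"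
    using K_AE[OF Us] by (simp add: AE_all_countable)
  define D where "D x = lam * (B x (U x) + B x (V x) - 2 * B x ((U x + V x) / 2))" for x
  have dD: "AE x in M. (\<lambda>n. d n x) \<longlonglongrightarrow> D x"
    using AE_bf_regular UB K_AE[OF V] lim
  proof eventually_elim
    case (elim x)
    have "(\<lambda>n. B x ((Us n x + V x) / 2)) \<longlonglongrightarrow> B x ((U x + V x) / 2)"
    proof (rule B_tendsto[OF elim(1)])
      show "(\<lambda>n. (Us n x + V x) / 2) \<longlonglongrightarrow> (U x + V x) / 2" by (intro tendsto_intros elim(4)) simp
      show "\<epsilon> \<le> (Us n x + V x) / 2 \<and> (Us n x + V x) / 2 \<le> \<delta>" for n using elim(3) spec[OF elim(2), of n] by auto
    qed
    moreover have "(\<lambda>n. B x (Us n x)) \<longlonglongrightarrow> B x (U x)" using elim by (intro B_tendsto) auto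
    ultimately show ?case unfolding d_def D_def by (intro tendsto_intros)
  qed
  have "AE x in M. D x = 0"
  proof -
    obtain r w where r: "strict_mono r" and r0: "AE x in M. (\<lambda>n. \<bar>d (r n) x\<bar>) \<longlonglongrightarrow> 0"
    proof (rule L1_null_sequence_subsequence[of M "\<lambda>n x. \<bar>d n x\<bar>"])
      have "(\<integral>x. \<bar>d n x\<bar> \<partial>M) = (\<integral>x. d n x \<partial>M)" for n
        by (rule integral_cong_AE) (use id d0[of n] in \<open>auto elim!: AE_mp\<close>)
      then show "(\<lambda>n. \<integral>x. \<bar>d n x\<bar> \<partial>M) \<longlonglongrightarrow> 0" using dlim by simp
    qed (use id that in auto)
    show ?thesis
      using r0 dD
    proof eventually_elim
      case (elim x)
      have "(\<lambda>n. d (r n) x) \<longlonglongrightarrow> D x" using LIMSEQ_subseq_LIMSEQ[OF elim(2) r] by (simp add: o_def)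
      from tendsto_rabs[OF this] have "\<bar>D x\<bar> = 0" using elim(1) by (rule LIMSEQ_unique)
      then show ?case by simp
    qed
  qed
  then show ?thesis
    using AE_bf_regular UB K_AE[OF V] lim
  proof eventually_elim
    case (elim x)
    have "\<epsilon> \<le> U x" "U x \<le> \<delta>"
      using elim(3) by (auto intro: LIMSEQ_le_const[OF elim(5)] LIMSEQ_le_const2[OF elim(5)])
    then show ?case
      using B_midpoint(2)[OF elim(2), of "U x" "V x"] elim(1,4) lam_pos by (auto simp: D_def)
  qed
qed

end

subsection \<open>Existence of minimisers\<close>

text \<open>With norms \<open>a\<close>, \<open>b\<close> and \<open>s\<close> of \<open>X\<close>,
  \<open>Y\<close> and \<open>X + Y\<close>, the left side is
  \<open>((a + b)\<^sup>2 - s\<^sup>2) / (a * b)\<close>. Factoring the difference of squares leaves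
  at most \<open>2 * (a + b) / (a * b)\<close> as coefficient, and this is at most 4 because
  \<open>a\<close> and \<open>b\<close> are at least 1.\<close>

lemma normalized_difference_defect:
  fixes X Y :: "'a::real_inner"
  assumes "1 \<le> norm X" "1 \<le> norm Y"
  shows "(norm (X /\<^sub>R norm X - Y /\<^sub>R norm Y))\<^sup>2 \<le> 4 * (norm X + norm Y - norm (X + Y))"
proof -
  define a b s where "a = norm X" and "b = norm Y" and "s = norm (X + Y)"
  have ab: "1 \<le> a" "1 \<le> b" using assms by (auto simp: a_def b_def)
  have s: "0 \<le> s" "s \<le> a + b" by (auto simp: s_def a_def b_def norm_triangle_ineq)
  have s2: "s\<^sup>2 = a\<^sup>2 + 2 * (X \<bullet> Y) + b\<^sup>2"
    by (simp add: s_def a_def b_def power2_norm_eq_inner inner_add_left inner_add_right inner_commute)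
  have "X \<bullet> X = a\<^sup>2" "Y \<bullet> Y = b\<^sup>2" by (simp_all add: a_def b_def power2_norm_eq_inner)
  then have n: "(norm (X /\<^sub>R a - Y /\<^sub>R b))\<^sup>2 = 2 - 2 * (X \<bullet> Y) / (a * b)"
    using ab by (simp add: power2_norm_eq_inner inner_diff_left inner_diff_right inner_commute[of Y X])
      (simp add: field_simps power2_eq_square)
  have "a + b \<le> 2 * (a * b)"
  proof -
    have "0 \<le> (a - 1) * b + (b - 1) * a" using ab by (intro add_nonneg_nonneg mult_nonneg_nonneg) auto
    then show ?thesis by (simp add: algebra_simps)
  qed
  have "(a + b)\<^sup>2 - s\<^sup>2 = (a + b - s) * (a + b + s)" by (simp add: power2_eq_square algebra_simps)
  also have "\<dots> \<le> (a + b - s) * (2 * (a + b))" using s by (intro mult_left_mono) auto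
  also have "\<dots> \<le> (a + b - s) * (4 * (a * b))"
    using s \<open>a + b \<le> 2 * (a * b)\<close> by (intro mult_left_mono) auto
  also have "\<dots> = 4 * (a + b - s) * (a * b)" by (simp only: ac_simps)
  finally have "(a + b)\<^sup>2 - s\<^sup>2 \<le> 4 * (a + b - s) * (a * b)" .
  moreover have "2 * (a * b) - 2 * (X \<bullet> Y) = (a + b)\<^sup>2 - s\<^sup>2"
    using s2 by (simp add: power2_eq_square algebra_simps)
  ultimately have "2 * (a * b) - 2 * (X \<bullet> Y) \<le> 4 * (a + b - s) * (a * b)" by simp
  moreover have "0 < a * b" using ab by (intro mult_pos_pos) auto
  ultimately have "(2 * (a * b) - 2 * (X \<bullet> Y)) / (a * b) \<le> 4 * (a + b - s)"
    by (simp add: pos_divide_le_eq)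
  moreover have "(2 * (a * b) - 2 * (X \<bullet> Y)) / (a * b) = 2 - 2 * (X \<bullet> Y) / (a * b)"
    using ab by (simp add: diff_divide_distrib)
  ultimately show ?thesis using n by (simp add: a_def b_def s_def)
qed

context elliptic
begin

text \<open>The component \<open>1\<close> keeps the jet away from \<open>0\<close>, so that it can be normalised. The norm is strictly
  convex across directions, hence the defect of \<open>Q\<close> at a midpoint controls the distance of the
  normalised jets.\<close>

definition jet :: "('a \<Rightarrow> real) \<Rightarrow> 'a \<Rightarrow> real \<times> real \<times> 'a" where
  "jet V x = (1, V x, grad V x)"

definition Q :: "('a \<Rightarrow> real) \<Rightarrow> real" where
  "Q V = (\<integral>x. norm (jet V x) \<partial>M)"

lemma jet_measurable: "V \<in> W \<Longrightarrow> jet V \<in> borel_measurable M"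
  unfolding jet_def[abs_def] using W_measurable W_gradient(2) by (intro borel_measurable_Pair) auto

lemma norm_jet_ge_1: "1 \<le> norm (jet V x)"
  using norm_fst_le[of "1 :: real" "(V x, grad V x)"] by (simp add: jet_def)

lemma norm_jet_le: "norm (jet V x) \<le> 1 + \<bar>V x\<bar> + norm (grad V x)"
  using norm_Pair_le[of "1 :: real" "(V x, grad V x)"] norm_Pair_le[of "V x" "grad V x"]
  by (simp add: jet_def)

lemma jet_integrable: "V \<in> W \<Longrightarrow> integrable M (\<lambda>x. norm (jet V x))"
proof (rule Bochner_Integration.integrable_bound)
  assume V: "V \<in> W"
  show "integrable M (\<lambda>x. 1 + \<bar>V x\<bar> + norm (grad V x))"
    using W_integrable[OF V] W_gradient(4)[OF V] by simp
  show "AE x in M. norm (norm (jet V x)) \<le> norm (1 + \<bar>V x\<bar> + norm (grad V x))"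
    using norm_jet_le by (intro AE_I2) (simp add: add_nonneg_nonneg)
qed (use jet_measurable in measurable)

lemma AE_jet_midpoint:
  assumes "U \<in> W" "V \<in> W"
  shows "AE x in M. 2 * norm (jet (\<lambda>x. 1/2 * U x + 1/2 * V x) x) = norm (jet U x + jet V x)"
  using W_add_cmult(2)[OF assms, of "1/2" "1/2"]
proof eventually_elim
  case (elim x)
  have "jet U x + jet V x = 2 *\<^sub>R jet (\<lambda>x. 1/2 * U x + 1/2 * V x) x"
    using elim by (simp add: jet_def scaleR_add_right)
  then show ?case by simp
qed

text \<open>The jet of a midpoint is almost everywhere the midpoint of the jets, the constant
  component included, so the pointwise defect integrates to the defect of \<open>Q\<close>.\<close>

lemma Q_defect:
  assumes U: "U \<in> W" and V: "V \<in> W"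
  shows "(\<integral>x. (norm (jet U x /\<^sub>R norm (jet U x) - jet V x /\<^sub>R norm (jet V x)))\<^sup>2 \<partial>M) \<le>
    4 * (Q U + Q V - 2 * Q (\<lambda>x. 1/2 * U x + 1/2 * V x))"
proof -
  let ?m = "\<lambda>x. 1/2 * U x + 1/2 * V x"
  have m: "?m \<in> W" by (rule W_add_cmult(1)[OF U V])
  let ?e = "\<lambda>x. (norm (jet U x /\<^sub>R norm (jet U x) - jet V x /\<^sub>R norm (jet V x)))\<^sup>2"
  let ?d = "\<lambda>x. 4 * (norm (jet U x) + norm (jet V x) - 2 * norm (jet ?m x))"
  have id: "integrable M ?d" using jet_integrable[OF U] jet_integrable[OF V] jet_integrable[OF m] by simp
  have le: "AE x in M. ?e x \<le> ?d x"
    using AE_jet_midpoint[OF U V]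
    by eventually_elim (use normalized_difference_defect[OF norm_jet_ge_1 norm_jet_ge_1, of U _ V] in simp)
  have [measurable]: "jet U \<in> borel_measurable M" "jet V \<in> borel_measurable M"
    using jet_measurable U V by auto
  have ie: "integrable M ?e"
  proof (rule Bochner_Integration.integrable_bound[OF id])
    show "AE x in M. norm (?e x) \<le> norm (?d x)" using le by eventually_elim simp
  qed measurable
  have "(\<integral>x. ?e x \<partial>M) \<le> (\<integral>x. ?d x \<partial>M)" by (rule integral_mono_AE[OF ie id le])
  also have "\<dots> = 4 * (Q U + Q V - 2 * Q ?m)"
    using jet_integrable[OF U] jet_integrable[OF V] jet_integrable[OF m] by (simp add: Q_def)
  finally show ?thesis .
qed

text \<open>The lower order part of \<open>J g\<close> is bounded on \<open>K\<close>, because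
  values in \<open>K\<close> are bounded and \<open>b x \<delta>\<close> is integrable.\<close>

lemma J_lower_bound:
  assumes g: "g \<in> sources"
  obtains c where "0 \<le> c" "\<And>V. V \<in> K \<Longrightarrow> (\<integral>x. A_pot \<Psi> x (grad V x) \<partial>M) \<le> J g V + c"
    "\<And>V. V \<in> K \<Longrightarrow> 0 \<le> (\<integral>x. A_pot \<Psi> x (grad V x) \<partial>M)"
proof -
  define w where "w x = lam * (\<delta> - \<epsilon> + \<bar>\<epsilon>\<bar> + \<bar>\<delta>\<bar>) * b x \<delta>" for x
  have iw: "integrable M w" unfolding w_def using b_delta_integrable by simp
  have w0: "AE x in M. 0 \<le> w x"
    using AE_bf_regular
  proof eventually_elim
    case (elim x)
    have "0 \<le> b x \<delta>" using b_bounds[OF elim, of \<delta>] eps_le_delta by auto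
    then show ?case unfolding w_def using lam_pos eps_le_delta by (intro mult_nonneg_nonneg) auto
  qed
  show ?thesis
  proof (rule that[of "\<integral>x. w x \<partial>M"])
    show "0 \<le> (\<integral>x. w x \<partial>M)" by (rule integral_nonneg_AE[OF w0])
    fix V assume V: "V \<in> K"
    have "- (\<integral>x. w x \<partial>M) = (\<integral>x. - w x \<partial>M)" by simp
    also have "\<dots> \<le> (\<integral>x. lam * B x (V x) - g x * V x \<partial>M)"
    proof (rule integral_mono_AE)
      show "AE x in M. - w x \<le> lam * B x (V x) - g x * V x"
        using lower_order_dominated[OF g V] unfolding w_def by eventually_elim linarith
    qed (use iw lower_order_integrable[OF g V] in auto)
    finally show "(\<integral>x. A_pot \<Psi> x (grad V x) \<partial>M) \<le> J g V + (\<integral>x. w x \<partial>M)" unfolding J_def by simp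
    show "0 \<le> (\<integral>x. A_pot \<Psi> x (grad V x) \<partial>M)"
      by (rule integral_nonneg_AE) (use AE_Phi_regular A_pot_nonneg in \<open>auto elim!: AE_mp\<close>)
  qed
qed

text \<open>Coercivity is stated for sequences whose modulars tend to infinity; a sublevel set with
  unbounded modulars would contain such a sequence with bounded energy.\<close>

lemma sublevel_gradient_bound:
  assumes g: "g \<in> sources"
  obtains R where "\<And>V. V \<in> K \<Longrightarrow> J g V \<le> c \<Longrightarrow> (\<integral>x. norm (grad V x) powr p x \<partial>M) \<le> R"
proof -
  have "\<exists>R. \<forall>V. V \<in> K \<longrightarrow> J g V \<le> c \<longrightarrow> (\<integral>x. norm (grad V x) powr p x \<partial>M) \<le> R"
  proof (rule ccontr)
    assume "\<not> ?thesis"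
    then have "\<forall>n::nat. \<exists>V. V \<in> K \<and> J g V \<le> c \<and> real n < (\<integral>x. norm (grad V x) powr p x \<partial>M)"
      by (metis not_le)
    then obtain V where V: "\<And>n::nat. V n \<in> K" "\<And>n. J g (V n) \<le> c"
      "\<And>n. real n < (\<integral>x. norm (grad (V n) x) powr p x \<partial>M)" by metis
    have "filterlim (\<lambda>n. \<integral>x. norm (grad (V n) x) powr p x \<partial>M) at_top sequentially"
      by (rule filterlim_at_top_mono[OF filterlim_real_sequentially])
        (use V(3) less_imp_le in \<open>auto intro!: always_eventually\<close>)
    then have "filterlim (\<lambda>n. \<integral>x. A_pot \<Psi> x (grad (V n) x) \<partial>M) at_top sequentially"
      using coercive[of V] K_W[OF V(1)] by blast
    then have top: "\<forall>\<^sub>F n in sequentially. Z < (\<integral>x. A_pot \<Psi> x (grad (V n) x) \<partial>M)" for Z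
      by (simp add: filterlim_at_top_dense)
    obtain k where k: "\<And>V. V \<in> K \<Longrightarrow> (\<integral>x. A_pot \<Psi> x (grad V x) \<partial>M) \<le> J g V + k"
      using J_lower_bound[OF g] by metis
    from eventually_happens'[OF sequentially_bot top[of "c + k"]]
    obtain n where "c + k < (\<integral>x. A_pot \<Psi> x (grad (V n) x) \<partial>M)" by blast
    with k[OF V(1), of n] V(2)[of n] show False by linarith
  qed
  then show ?thesis using that by blast
qed

text \<open>For every \<open>t > 0\<close> a nonnegative \<open>d\<close> satisfies
  \<open>d \<le> t + d\<^sup>2 / t\<close>. On the finite measure \<open>M\<close> the constant
  \<open>t\<close> can be chosen to cost less than half of \<open>\<eta>\<close>.\<close>

lemma L1_Cauchy_if_L2_Cauchy:
  fixes e :: "nat \<Rightarrow> 'a \<Rightarrow> 'c::euclidean_space"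
  assumes i: "\<And>n. integrable M (e n)" "\<And>n m. integrable M (\<lambda>x. (norm (e n x - e m x))\<^sup>2)"
    and C: "\<And>\<eta>. 0 < \<eta> \<Longrightarrow> \<exists>N. \<forall>n\<ge>N. \<forall>m\<ge>N. (\<integral>x. (norm (e n x - e m x))\<^sup>2 \<partial>M) < \<eta>"
    and "0 < \<eta>"
  shows "\<exists>N. \<forall>n\<ge>N. \<forall>m\<ge>N. (\<integral>x. norm (e n x - e m x) \<partial>M) < \<eta>"
proof -
  define vol where "vol = (\<integral>x. (1 :: real) \<partial>M)"
  have "0 \<le> vol" unfolding vol_def by (rule Bochner_Integration.integral_nonneg) simp
  define t where "t = \<eta> / (2 * (vol + 1))"
  have "0 < t" using \<open>0 < \<eta>\<close> \<open>0 \<le> vol\<close> by (simp add: t_def)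
  have "t * vol < \<eta> / 2"
  proof -
    have "t * vol < t * (vol + 1)" using \<open>0 < t\<close> by simp
    also have "\<dots> = \<eta> / 2" using \<open>0 \<le> vol\<close> unfolding t_def by (simp add: field_simps)
    finally show ?thesis .
  qed
  obtain N where N: "\<And>n m. N \<le> n \<Longrightarrow> N \<le> m \<Longrightarrow> (\<integral>x. (norm (e n x - e m x))\<^sup>2 \<partial>M) < t * (\<eta> / 2)"
    using C[of "t * (\<eta> / 2)"] \<open>0 < t\<close> \<open>0 < \<eta>\<close> by auto
  have "(\<integral>x. norm (e n x - e m x) \<partial>M) < \<eta>" if "N \<le> n" "N \<le> m" for n m
  proof -
    have "(\<integral>x. norm (e n x - e m x) \<partial>M) \<le> (\<integral>x. t * 1 + (norm (e n x - e m x))\<^sup>2 / t \<partial>M)"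
    proof (rule integral_mono)
      fix x
      let ?d = "norm (e n x - e m x)"
      show "?d \<le> t * 1 + ?d\<^sup>2 / t"
      proof (cases "?d \<le> t")
        case False
        then have "t * ?d \<le> ?d * ?d" using \<open>0 < t\<close> by (intro mult_right_mono) auto
        then have "?d \<le> ?d\<^sup>2 / t" using \<open>0 < t\<close> by (simp add: pos_le_divide_eq power2_eq_square mult.commute)
        then show ?thesis using \<open>0 < t\<close> by simp
      qed (use \<open>0 < t\<close> in \<open>simp add: add_increasing2\<close>)
    qed (use i in auto)
    also have "\<dots> = t * vol + (\<integral>x. (norm (e n x - e m x))\<^sup>2 \<partial>M) / t"
      using i(2) by (simp add: vol_def)
    also have "(\<integral>x. (norm (e n x - e m x))\<^sup>2 \<partial>M) / t < \<eta> / 2"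
      using N[OF that] \<open>0 < t\<close> by (simp add: pos_divide_less_eq mult.commute)
    finally show ?thesis using \<open>t * vol < \<eta> / 2\<close> by simp
  qed
  then show ?thesis by blast
qed

text \<open>Bounded sequences in \<open>W\<close> that almost minimise \<open>Q\<close> over a decreasing family of midpoint convex sets
  have convergent subsequences: this replaces weak compactness of the variable exponent space.\<close>

lemma almost_minimizers_converge:
  assumes C: "\<And>n::nat. C n \<subseteq> W" "\<And>n. C (Suc n) \<subseteq> C n" "\<And>n. C n \<noteq> {}"
    and mid: "\<And>n U V. U \<in> C n \<Longrightarrow> V \<in> C n \<Longrightarrow> (\<lambda>x. 1/2 * U x + 1/2 * V x) \<in> C n"
    and bound: "\<And>V. V \<in> C 0 \<Longrightarrow> Q V \<le> R"
  obtains V v G where "\<And>n. V n \<in> C n" "AE x in M. (\<lambda>n. V n x) \<longlonglongrightarrow> v x"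
    "AE x in M. (\<lambda>n. grad (V n) x) \<longlonglongrightarrow> G x" "v \<in> borel_measurable M" "G \<in> borel_measurable M"
proof -
  have mono: "m \<le> n \<Longrightarrow> C n \<subseteq> C m" for m n
    by (rule lift_Suc_antimono_le[of C]) (rule C(2))
  have Q0: "0 \<le> Q V" for V unfolding Q_def by (rule Bochner_Integration.integral_nonneg) simp
  \<comment> \<open>Infima over shrinking sets increase and stay below \<open>R\<close>, so they
    form a Cauchy sequence; their differences enter the bound on the midpoint defect.\<close>
  define q where "q n = (INF V\<in>C n. Q V)" for n
  have bdd: "bdd_below (Q ` S)" for S using Q0 by (intro bdd_belowI[of _ 0]) auto
  have q_le: "q n \<le> Q V" if "V \<in> C n" for n V
    unfolding q_def using that by (intro cINF_lower bdd)
  have q_mono: "q m \<le> q n" if "m \<le> n" for m n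
    unfolding q_def using mono[OF that] C(3) by (intro cINF_superset_mono bdd) auto
  have "q n \<le> R" for n
  proof -
    obtain V where "V \<in> C n" using C(3) by blast
    then have "q n \<le> Q V" "Q V \<le> R" using q_le bound mono[of 0 n] by auto
    then show ?thesis by simp
  qed
  then have "norm (q n) \<le> \<bar>q 0\<bar> + \<bar>R\<bar>" for n using q_mono[of 0 n] by (auto simp: abs_le_iff) (smt (verit) \<open>\<And>n. q n \<le> R\<close>)+
  then have "Bseq q" by (rule BseqI')
  then have "convergent q" using q_mono by (intro Bseq_monoseq_convergent) (auto simp: monoseq_def)
  then have Cq: "Cauchy q" by (rule convergent_Cauchy)
  have "\<exists>V\<in>C n. Q V < q n + inverse (real (Suc n))" for n
  proof -
    have "q n < q n + inverse (real (Suc n))" by simp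
    then show ?thesis unfolding q_def using C(3)[of n] bdd by (subst (asm) cINF_less_iff) auto
  qed
  then obtain V where V: "\<And>n. V n \<in> C n" "\<And>n. Q (V n) < q n + inverse (real (Suc n))" by metis
  have VW: "V n \<in> W" for n using V(1) C(1) by blast
  define e where "e n x = jet (V n) x /\<^sub>R norm (jet (V n) x)" for n x
  have jm[measurable]: "jet (V n) \<in> borel_measurable M" for n by (rule jet_measurable[OF VW])
  have em[measurable]: "e n \<in> borel_measurable M" for n unfolding e_def by measurable
  have ne: "norm (e n x) = 1" for n x
    using norm_jet_ge_1[of "V n" x] by (simp add: e_def) (metis left_inverse not_one_le_zero norm_zero)
  have ie: "integrable M (e n)" for n
    by (rule Bochner_Integration.integrable_bound[OF integrable_M_const[of 1]]) (auto simp: ne)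
  have ie2: "integrable M (\<lambda>x. (norm (e n x - e m x))\<^sup>2)" for n m
  proof (rule Bochner_Integration.integrable_bound[OF integrable_M_const[of 4]])
    show "AE x in M. norm ((norm (e n x - e m x))\<^sup>2) \<le> norm (4 :: real)"
    proof (rule AE_I2)
      fix x
      have "norm (e n x - e m x) \<le> 2" using norm_triangle_ineq4[of "e n x" "e m x"] by (simp add: ne)
      then have "(norm (e n x - e m x))\<^sup>2 \<le> 2\<^sup>2" by (intro power_mono) auto
      then show "norm ((norm (e n x - e m x))\<^sup>2) \<le> norm (4 :: real)" by simp
    qed
  qed measurable
  have defect: "(\<integral>x. (norm (e n x - e m x))\<^sup>2 \<partial>M) \<le> 4 * (\<bar>q n - q m\<bar> + 2 * inverse (real (Suc N)))"
    if "N \<le> n" "N \<le> m" for n m N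
  proof -
    \<comment> \<open>Both functions and hence their midpoint lie in the larger of the two sets, the
      one of smaller index; its infimum bounds \<open>Q\<close> of the midpoint from below.\<close>
    let ?k = "min n m"
    have "V n \<in> C ?k" "V m \<in> C ?k" using V(1) mono by (meson min.cobounded1 min.cobounded2 subsetD)+
    then have "q ?k \<le> Q (\<lambda>x. 1/2 * V n x + 1/2 * V m x)" by (intro q_le mid)
    moreover have "inverse (real (Suc n)) \<le> inverse (real (Suc N))" "inverse (real (Suc m)) \<le> inverse (real (Suc N))"
      using that by (auto intro!: le_imp_inverse_le)
    moreover have "q n + q m - 2 * q ?k \<le> \<bar>q n - q m\<bar>" by (auto simp: min_def)
    ultimately have "Q (V n) + Q (V m) - 2 * Q (\<lambda>x. 1/2 * V n x + 1/2 * V m x) \<le> \<bar>q n - q m\<bar> + 2 * inverse (real (Suc N))"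
      using V(2)[of n] V(2)[of m] by linarith
    then have "4 * (Q (V n) + Q (V m) - 2 * Q (\<lambda>x. 1/2 * V n x + 1/2 * V m x)) \<le> 4 * (\<bar>q n - q m\<bar> + 2 * inverse (real (Suc N)))"
      by (rule mult_left_mono) simp
    with Q_defect[OF VW[of n] VW[of m]] show ?thesis
      unfolding e_def by (rule order_trans)
  qed
  have "\<exists>N. \<forall>n\<ge>N. \<forall>m\<ge>N. (\<integral>x. (norm (e n x - e m x))\<^sup>2 \<partial>M) < \<eta>" if "0 < \<eta>" for \<eta>
  proof -
    have "\<exists>N. \<forall>n\<ge>N. \<forall>m\<ge>N. dist (q n) (q m) < \<eta> / 8"
      using \<open>0 < \<eta>\<close> by (intro metric_CauchyD[OF Cq]) simp
    then obtain N1 where N1: "\<And>n m. N1 \<le> n \<Longrightarrow> N1 \<le> m \<Longrightarrow> \<bar>q n - q m\<bar> < \<eta> / 8"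
      unfolding dist_real_def by blast
    obtain N2 where N2: "inverse (real (Suc N2)) < \<eta> / 16"
      using reals_Archimedean[of "\<eta> / 16"] \<open>0 < \<eta>\<close> by auto
    have "(\<integral>x. (norm (e n x - e m x))\<^sup>2 \<partial>M) < \<eta>" if "max N1 N2 \<le> n" "max N1 N2 \<le> m" for n m
      using defect[of N2 n m] N1[of n m] N2 that by (auto simp del: of_nat_Suc)
    then show ?thesis by blast
  qed
  then have L1: "\<exists>N. \<forall>n\<ge>N. \<forall>m\<ge>N. (\<integral>x. norm (e n x - e m x) \<partial>M) < \<eta>" if "0 < \<eta>" for \<eta>
    using that by (intro L1_Cauchy_if_L2_Cauchy[OF ie ie2])
  obtain r where r: "strict_mono r" and rC: "AE x in M. Cauchy (\<lambda>n. e (r n) x)"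
    by (rule cauchy_L1_AE_cauchy_subseq[OF ie L1])
  have rn: "n \<le> r n" for n using r by (rule seq_suble)
  \<comment> \<open>The normalised jets converge, but the jets themselves might escape to infinity;
    Fatou excludes this at almost every point.\<close>
  have "(\<integral>\<^sup>+x. liminf (\<lambda>n. ennreal (norm (jet (V (r n)) x))) \<partial>M) \<le> liminf (\<lambda>n. \<integral>\<^sup>+x. ennreal (norm (jet (V (r n)) x)) \<partial>M)"
    by (rule nn_integral_liminf) measurable
  also have "\<dots> \<le> liminf (\<lambda>n::nat. ennreal R)"
  proof (rule Liminf_mono, rule always_eventually, rule allI)
    fix n
    have "V (r n) \<in> C 0" using V(1) mono[of 0 "r n"] by blast
    then have "Q (V (r n)) \<le> R" by (rule bound)
    then show "(\<integral>\<^sup>+x. ennreal (norm (jet (V (r n)) x)) \<partial>M) \<le> ennreal R"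
      using jet_integrable[OF VW] by (subst nn_integral_eq_integral) (auto simp: Q_def intro: ennreal_leI)
  qed
  also have "\<dots> < \<infinity>" by (simp add: Liminf_const)
  finally have "(\<integral>\<^sup>+x. liminf (\<lambda>n. ennreal (norm (jet (V (r n)) x))) \<partial>M) \<noteq> \<infinity>" by simp
  then have fin: "AE x in M. liminf (\<lambda>n. ennreal (norm (jet (V (r n)) x))) \<noteq> \<infinity>"
    by (intro nn_integral_PInf_AE) measurable
  have conv: "AE x in M. convergent (\<lambda>n. jet (V (r n)) x)"
    using rC fin
  proof eventually_elim
    case (elim x)
    obtain z where z: "(\<lambda>n. e (r n) x) \<longlonglongrightarrow> z" using elim(1) Cauchy_convergent convergent_def by blast
    define s where "s n = norm (jet (V (r n)) x)" for n
    have s1: "1 \<le> s n" for n unfolding s_def by (rule norm_jet_ge_1)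
    have fs: "fst (e (r n) x) = inverse (s n)" for n by (simp add: e_def jet_def s_def)
    have zl: "(\<lambda>n. inverse (s n)) \<longlonglongrightarrow> fst z" using tendsto_fst[OF z] by (simp add: fs)
    have "0 \<le> fst z"
      by (rule LIMSEQ_le_const[OF zl]) (use s1 in \<open>auto intro!: exI[of _ 0] order_trans[OF zero_le_one]\<close>)
    \<comment> \<open>The first component of the normalised jet is the reciprocal of the norm of the
      jet. If it tended to 0, the norms would tend to infinity along the whole sequence, against the
      finite lower limit.\<close>
    have "fst z \<noteq> 0"
    proof
      assume "fst z = 0"
      then have "filterlim (\<lambda>n. inverse (s n)) (at_right 0) sequentially"
        using zl less_le_trans[OF zero_less_one s1] by (auto simp: filterlim_at intro!: always_eventually) (metis less_irrefl)
      then have "filterlim s at_top sequentially"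
        using filterlim_compose[OF filterlim_inverse_at_top_right, of "\<lambda>n. inverse (s n)"] by simp
      then have "(\<lambda>n. ennreal (s n)) \<longlonglongrightarrow> top" by (simp add: ennreal_tendsto_top_eq_at_top)
      from lim_imp_Liminf[OF trivial_limit_sequentially this] elim(2) show False
        by (simp add: s_def)
    qed
    have "s \<longlonglongrightarrow> inverse (fst z)" using tendsto_inverse[OF zl \<open>fst z \<noteq> 0\<close>] by simp
    from tendsto_scaleR[OF this z]
    have "(\<lambda>n. s n *\<^sub>R e (r n) x) \<longlonglongrightarrow> inverse (fst z) *\<^sub>R z" .
    moreover have "s n *\<^sub>R e (r n) x = jet (V (r n)) x" for n
    proof -
      have "s n \<noteq> 0" using s1[of n] by auto
      then show ?thesis by (simp add: e_def s_def[symmetric])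
    qed
    ultimately have "(\<lambda>n. jet (V (r n)) x) \<longlonglongrightarrow> inverse (fst z) *\<^sub>R z" by simp
    then show ?case by (rule convergentI)
  qed
  define L where "L x = lim (\<lambda>n. jet (V (r n)) x)" for x
  have Lm: "L \<in> borel_measurable M" unfolding L_def by measurable
  have Llim: "AE x in M. (\<lambda>n. jet (V (r n)) x) \<longlonglongrightarrow> L x"
    using conv by eventually_elim (simp add: L_def convergent_LIMSEQ_iff)
  show ?thesis
  proof (rule that[of "\<lambda>n. V (r n)" "\<lambda>x. fst (snd (L x))" "\<lambda>x. snd (snd (L x))"])
    show "V (r n) \<in> C n" for n using V(1) mono[OF rn] by blast
    show "AE x in M. (\<lambda>n. V (r n) x) \<longlonglongrightarrow> fst (snd (L x))"
      using Llim by eventually_elim (drule tendsto_snd, drule tendsto_fst, simp add: jet_def)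
    show "AE x in M. (\<lambda>n. grad (V (r n)) x) \<longlonglongrightarrow> snd (snd (L x))"
      using Llim by eventually_elim (drule tendsto_snd, drule tendsto_snd, simp add: jet_def)
    show "(\<lambda>x. fst (snd (L x))) \<in> borel_measurable M"
      by (rule measurable_compose[OF Lm, of "\<lambda>z. fst (snd z)"], rule borel_measurable_continuous_onI)
        (intro continuous_intros)
    show "(\<lambda>x. snd (snd (L x))) \<in> borel_measurable M"
      by (rule measurable_compose[OF Lm, of "\<lambda>z. snd (snd z)"], rule borel_measurable_continuous_onI)
        (intro continuous_intros)
  qed
qed

text \<open>Fatou for the nonnegative energy densities, convergence for the lower order terms. The
  bound with an error \<open>s n\<close> makes it unnecessary to know a limit of
  \<open>J g (V n)\<close>.\<close>

lemma J_lower_semicontinuous: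
  assumes g: "g \<in> sources" and V: "\<And>n::nat. V n \<in> K" and v: "v \<in> K"
    and limV: "AE x in M. (\<lambda>n. V n x) \<longlonglongrightarrow> v x" and limG: "AE x in M. (\<lambda>n. grad (V n) x) \<longlonglongrightarrow> grad v x"
    and Jlim: "\<And>n. J g (V n) \<le> m + s n" and "s \<longlonglongrightarrow> 0"
  shows "J g v \<le> m"
proof -
  let ?A = "\<lambda>u x. A_pot \<Psi> x (grad u x)"
  let ?L = "\<lambda>u. \<integral>x. lam * B x (u x) - g x * u x \<partial>M"
  have limL: "(\<lambda>n. ?L (V n)) \<longlonglongrightarrow> ?L v" by (rule lower_order_tendsto[OF g V K_measurable[OF v] limV])
  have A0: "AE x in M. 0 \<le> ?A u x" for u using AE_Phi_regular by eventually_elim (rule A_pot_nonneg)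
  have nnA: "(\<integral>\<^sup>+x. ennreal (?A u x) \<partial>M) = ennreal (\<integral>x. ?A u x \<partial>M)" if "u \<in> K" for u
    by (rule nn_integral_eq_integral[OF A_pot_integrable[OF K_W[OF that]] A0])
  have am[measurable]: "?A (V n) \<in> borel_measurable M" for n by (rule A_pot_measurable[OF K_W[OF V]])
  have "ennreal (\<integral>x. ?A v x \<partial>M) = (\<integral>\<^sup>+x. ennreal (?A v x) \<partial>M)" using nnA[OF v] by simp
  also have "\<dots> \<le> (\<integral>\<^sup>+x. liminf (\<lambda>n. ennreal (?A (V n) x)) \<partial>M)"
  proof (rule nn_integral_mono_AE)
    show "AE x in M. ennreal (?A v x) \<le> liminf (\<lambda>n. ennreal (?A (V n) x))"
      using limG AE_Phi_regular
    proof eventually_elim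
      case (elim x)
      from tendsto_ennrealI[OF A_pot_tendsto[OF elim(2,1)]]
      show ?case using lim_imp_Liminf[OF trivial_limit_sequentially] by fastforce
    qed
  qed
  also have "\<dots> \<le> liminf (\<lambda>n. \<integral>\<^sup>+x. ennreal (?A (V n) x) \<partial>M)"
    by (rule nn_integral_liminf) measurable
  also have "\<dots> \<le> liminf (\<lambda>n. ennreal (m + s n - ?L (V n)))"
  proof (rule Liminf_mono, rule always_eventually, rule allI)
    fix n
    show "(\<integral>\<^sup>+x. ennreal (?A (V n) x) \<partial>M) \<le> ennreal (m + s n - ?L (V n))"
      unfolding nnA[OF V] using Jlim[of n] unfolding J_def by (intro ennreal_leI) simp
  qed
  also have "liminf (\<lambda>n. ennreal (m + s n - ?L (V n))) = ennreal (m + 0 - ?L v)"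
    by (intro lim_imp_Liminf trivial_limit_sequentially tendsto_ennrealI tendsto_intros limL assms(7))
  finally have le: "ennreal (\<integral>x. ?A v x \<partial>M) \<le> ennreal (m - ?L v)" by simp
  have "0 \<le> m - ?L v"
  proof (rule LIMSEQ_le_const)
    show "(\<lambda>n. m + s n - ?L (V n)) \<longlonglongrightarrow> m - ?L v"
      using tendsto_diff[OF tendsto_add[OF tendsto_const[of m] assms(7)] limL] by simp
    show "\<exists>N. \<forall>n\<ge>N. 0 \<le> m + s n - ?L (V n)"
    proof (intro exI allI impI)
      fix n
      have "0 \<le> (\<integral>x. ?A (V n) x \<partial>M)" by (rule integral_nonneg_AE[OF A0])
      then show "0 \<le> m + s n - ?L (V n)" using Jlim[of n] unfolding J_def by simp
    qed
  qed
  with le have "(\<integral>x. ?A v x \<partial>M) \<le> m - ?L v" by (subst (asm) ennreal_le_iff) auto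
  then show ?thesis unfolding J_def by simp
qed

lemma minimizer_exists:
  assumes g: "g \<in> sources"
  obtains v where "v \<in> K" "\<And>U. U \<in> K \<Longrightarrow> J g v \<le> J g U"
proof -
  obtain c where c: "\<And>V. V \<in> K \<Longrightarrow> (\<integral>x. A_pot \<Psi> x (grad V x) \<partial>M) \<le> J g V + c"
    "\<And>V. V \<in> K \<Longrightarrow> 0 \<le> (\<integral>x. A_pot \<Psi> x (grad V x) \<partial>M)"
    using J_lower_bound[OF g] by metis
  have lb: "- c \<le> J g V" if "V \<in> K" for V using c(1)[OF that] c(2)[OF that] by linarith
  have Kne: "K \<noteq> {}" using const_K[of \<epsilon>] eps_le_delta by auto
  define m where "m = (INF V\<in>K. J g V)"
  have bdd: "bdd_below (J g ` K)" using lb by (intro bdd_belowI[of _ "- c"]) auto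
  have m_le: "m \<le> J g V" if "V \<in> K" for V unfolding m_def using that by (intro cINF_lower bdd)
  define C where "C n = {V \<in> K. J g V \<le> m + inverse (real (Suc n))}" for n
  obtain R where R: "\<And>V. V \<in> K \<Longrightarrow> J g V \<le> m + 1 \<Longrightarrow> (\<integral>x. norm (grad V x) powr p x \<partial>M) \<le> R"
    using sublevel_gradient_bound[OF g, of "m + 1"] by metis
  have C_le: "J g V \<le> m + 1" if "V \<in> C n" for V n
    using that inverse_le_1_iff[of "real (Suc n)"] by (auto simp: C_def simp del: of_nat_Suc)
  obtain V v G where V: "\<And>n. V n \<in> C n" and limV: "AE x in M. (\<lambda>n. V n x) \<longlonglongrightarrow> v x"
    and limG: "AE x in M. (\<lambda>n. grad (V n) x) \<longlonglongrightarrow> G x"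
    and meas: "v \<in> borel_measurable M" "G \<in> borel_measurable M"
  \<comment> \<open>The norm of the jet is at most
    \<open>1 + \<bar>V x\<bar> + norm (grad V x)\<close>, and the last term is at most 1 plus its
    power \<open>p x\<close>; this is the origin of the constant 2.\<close>
  proof (rule almost_minimizers_converge[of C "(\<integral>x. 2 + \<bar>\<epsilon>\<bar> + \<bar>\<delta>\<bar> \<partial>M) + R"])
    show "C n \<subseteq> W" for n using K_W by (auto simp: C_def)
    show "C (Suc n) \<subseteq> C n" for n
    proof -
      have "inverse (real (Suc (Suc n))) \<le> inverse (real (Suc n))" by (intro le_imp_inverse_le) auto
      then have "J g V \<le> m + inverse (real (Suc n))" if "J g V \<le> m + inverse (real (Suc (Suc n)))" for V
        using that by linarith
      then show ?thesis by (auto simp: C_def simp del: of_nat_Suc)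
    qed
    show "C n \<noteq> {}" for n
    proof -
      have "m < m + inverse (real (Suc n))" by simp
      then obtain V where "V \<in> K" "J g V < m + inverse (real (Suc n))"
        unfolding m_def using Kne bdd by (subst (asm) cINF_less_iff) auto
      then show ?thesis by (auto simp: C_def)
    qed
    show "(\<lambda>x. 1/2 * U x + 1/2 * V x) \<in> C n" if "U \<in> C n" "V \<in> C n" for U V n
    proof -
      have UV: "U \<in> K" "V \<in> K" "J g U \<le> m + inverse (real (Suc n))" "J g V \<le> m + inverse (real (Suc n))"
        using that by (auto simp: C_def)
      have "0 \<le> (\<integral>x. lam * (B x (U x) + B x (V x) - 2 * B x ((U x + V x) / 2)) \<partial>M)"
        by (rule integral_nonneg_AE[OF B_defect_nonneg[OF UV(1,2)]])
      then have "2 * J g (\<lambda>x. 1/2 * U x + 1/2 * V x) \<le> J g U + J g V"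
        using J_midpoint[OF g UV(1,2)] by linarith
      then have "J g (\<lambda>x. 1/2 * U x + 1/2 * V x) \<le> m + inverse (real (Suc n))" using UV(3,4) by linarith
      then show ?thesis using K_midpoint[OF UV(1,2)] by (simp add: C_def)
    qed
    show "Q V \<le> (\<integral>x. 2 + \<bar>\<epsilon>\<bar> + \<bar>\<delta>\<bar> \<partial>M) + R" if "V \<in> C 0" for V
    proof -
      have VK: "V \<in> K" using that by (simp add: C_def)
      have ip: "integrable M (\<lambda>x. norm (grad V x) powr p x)"
        using W_gradient(3)[OF K_W[OF VK]] by (simp add: Lp_var_def)
      have "Q V \<le> (\<integral>x. (2 + \<bar>\<epsilon>\<bar> + \<bar>\<delta>\<bar>) + norm (grad V x) powr p x \<partial>M)"
        unfolding Q_def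
      proof (rule integral_mono_AE)
        show "AE x in M. norm (jet V x) \<le> (2 + \<bar>\<epsilon>\<bar> + \<bar>\<delta>\<bar>) + norm (grad V x) powr p x"
          using K_abs[OF VK] AE_space
        proof eventually_elim
          case (elim x)
          then have "1 \<le> p x" using p_bounds[of x] p0_gt_1 by auto
          from le_1_plus_powr[OF this, of "norm (grad V x)"] elim(1) norm_jet_le[of V x] show ?case by simp
        qed
      qed (use jet_integrable[OF K_W[OF VK]] ip in auto)
      also have "\<dots> = (\<integral>x. 2 + \<bar>\<epsilon>\<bar> + \<bar>\<delta>\<bar> \<partial>M) + (\<integral>x. norm (grad V x) powr p x \<partial>M)"
        using ip by (intro Bochner_Integration.integral_add) auto
      also have "\<dots> \<le> (\<integral>x. 2 + \<bar>\<epsilon>\<bar> + \<bar>\<delta>\<bar> \<partial>M) + R" using R[OF VK C_le[OF that]] by simp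
      finally show ?thesis .
    qed
  qed (rule that)
  have VK: "V n \<in> K" and VJ: "J g (V n) \<le> m + inverse (real (Suc n))" for n using V[of n] by (auto simp: C_def)
  have vW: "v \<in> W" and gv: "AE x in M. grad v x = G x"
    using W_closed[OF K_W[OF VK] K_abs[OF VK] R[OF VK C_le[OF V]] limV limG meas] by auto
  have "AE x in M. \<forall>n. \<epsilon> \<le> V n x \<and> V n x \<le> \<delta>" using K_AE[OF VK] by (simp add: AE_all_countable)
  then have "AE x in M. \<epsilon> \<le> v x \<and> v x \<le> \<delta>"
    using limV by eventually_elim (auto intro: LIMSEQ_le_const LIMSEQ_le_const2)
  with vW have vK: "v \<in> K" by (simp add: K_def)
  have "J g v \<le> m"
  proof (rule J_lower_semicontinuous[OF g VK vK limV _ VJ LIMSEQ_inverse_real_of_nat])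
    show "AE x in M. (\<lambda>n. grad (V n) x) \<longlonglongrightarrow> grad v x" using limG gv by eventually_elim simp
  qed
  then show ?thesis using vK m_le that order_trans by blast
qed

end

context elliptic
begin

subsection \<open>Monotone iteration\<close>

definition F :: "('a \<Rightarrow> real) \<Rightarrow> 'a \<Rightarrow> real" where
  "F w x = f x (w x) + lam * b x (w x)"

text \<open>Here the signs of \<open>f\<close> at \<open>\<epsilon>\<close> and
  \<open>\<delta>\<close> enter: together with monotonicity in the value they place
  \<open>F w x\<close> between the two barriers.\<close>

lemma F_sources:
  assumes w: "w \<in> borel_measurable M" "AE x in M. \<epsilon> \<le> w x \<and> w x \<le> \<delta>"
  shows "F w \<in> sources"
  unfolding sources_def
proof (intro CollectI conjI)
  show "F w \<in> borel_measurable M"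
    unfolding F_def[abs_def] using f_compose_measurable[OF w] b_compose_measurable[OF w] by simp
  show "AE x in M. lam * b x \<epsilon> \<le> F w x \<and> F w x \<le> lam * b x \<delta>"
    using AE_bf_regular w(2)
  proof eventually_elim
    case (elim x)
    have m: "\<epsilon> \<le> s \<Longrightarrow> s \<le> t \<Longrightarrow> t \<le> \<delta> \<Longrightarrow> f x s + lam * b x s \<le> f x t + lam * b x t" for s t
      using elim(1) by (simp add: bf_regular_def)
    have "0 \<le> f x \<epsilon>" "f x \<delta> \<le> 0" using elim(1) by (auto simp: bf_regular_def)
    then show ?case using m[of \<epsilon> "w x"] m[of "w x" \<delta>] elim(2) by (auto simp: F_def)
  qed
qed

lemma F_K: "w \<in> K \<Longrightarrow> F w \<in> sources"
  by (intro F_sources K_measurable K_AE)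

lemma F_mono:
  assumes "v \<in> K" "w \<in> K" "AE x in M. v x \<le> w x"
  shows "AE x in M. F v x \<le> F w x"
  using AE_bf_regular K_AE[OF assms(1)] K_AE[OF assms(2)] assms(3)
proof eventually_elim
  case (elim x)
  then show ?case by (auto simp: F_def bf_regular_def)
qed

text \<open>The multiples of \<open>b\<close> cancel: \<open>F U x - lam * b x (U x)\<close> is
  \<open>f x (U x)\<close>.\<close>

lemma solves_F_iff: "solves (F U) U \<longleftrightarrow> weak_solution \<Omega> p \<Psi> f \<epsilon> \<delta> U"
  by (auto simp: solves_def weak_solution_def K_def F_def)

lemma solves_cong:
  assumes s: "solves g V" and g: "g \<in> sources" "h \<in> sources" and eq: "AE x in M. g x = h x"
  shows "solves h V"
  unfolding solves_def
proof (intro conjI ballI)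
  show V: "V \<in> K" using s by (simp add: solves_def)
  fix \<phi> assume \<phi>: "\<phi> \<in> W"
  have "(\<integral>x. (g x - lam * b x (V x)) * \<phi> x \<partial>M) = (\<integral>x. (h x - lam * b x (V x)) * \<phi> x \<partial>M)"
  proof (rule integral_cong_AE)
    show "AE x in M. (g x - lam * b x (V x)) * \<phi> x = (h x - lam * b x (V x)) * \<phi> x"
      using eq by eventually_elim simp
  qed (use rhs_integrable[OF g(1) V \<phi>] rhs_integrable[OF g(2) V \<phi>] in auto)
  then show "(\<integral>x. a_field \<Psi> x (grad V x) \<bullet> grad \<phi> x \<partial>M) = (\<integral>x. (h x - lam * b x (V x)) * \<phi> x \<partial>M)"
    using s \<phi> by (simp add: solves_def)
qed

text \<open>Functions in \<open>K\<close> share a bound, so \<open>J\<close> is Lipschitz in the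
  source for the L1 distance, uniformly on \<open>K\<close>.\<close>

lemma J_source_change:
  assumes g: "g \<in> sources" and h: "h \<in> sources" and V: "V \<in> K"
  shows "J g V \<le> J h V + (\<bar>\<epsilon>\<bar> + \<bar>\<delta>\<bar>) * (\<integral>x. \<bar>h x - g x\<bar> \<partial>M)"
proof -
  have one: "(\<lambda>x. 1) \<in> W" by (rule W_const)
  have ig: "integrable M g" "integrable M h"
    using source_mult_integrable[OF g one] source_mult_integrable[OF h one] by simp_all
  have igV: "integrable M (\<lambda>x. g x * V x)" "integrable M (\<lambda>x. h x * V x)"
    using source_mult_integrable[OF g K_W[OF V]] source_mult_integrable[OF h K_W[OF V]] by simp_all
  have iB: "integrable M (\<lambda>x. lam * B x (V x))" using B_integrable[OF V] by simp
  have "J g V - J h V = (\<integral>x. h x * V x \<partial>M) - (\<integral>x. g x * V x \<partial>M)"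
    using Bochner_Integration.integral_diff[OF iB igV(1)] Bochner_Integration.integral_diff[OF iB igV(2)]
    by (simp add: J_def)
  also have "\<dots> = (\<integral>x. h x * V x - g x * V x \<partial>M)"
    by (rule Bochner_Integration.integral_diff[symmetric, OF igV(2,1)])
  also have "\<dots> \<le> (\<integral>x. (\<bar>\<epsilon>\<bar> + \<bar>\<delta>\<bar>) * \<bar>h x - g x\<bar> \<partial>M)"
  proof (rule integral_mono_AE)
    show "AE x in M. h x * V x - g x * V x \<le> (\<bar>\<epsilon>\<bar> + \<bar>\<delta>\<bar>) * \<bar>h x - g x\<bar>"
      using K_abs[OF V]
    proof eventually_elim
      case (elim x)
      have "h x * V x - g x * V x = (h x - g x) * V x" by (simp add: left_diff_distrib)
      also have "\<dots> \<le> \<bar>h x - g x\<bar> * \<bar>V x\<bar>" using abs_ge_self[of "(h x - g x) * V x"] by (simp add: abs_mult)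
      also have "\<dots> \<le> \<bar>h x - g x\<bar> * (\<bar>\<epsilon>\<bar> + \<bar>\<delta>\<bar>)" using elim by (intro mult_left_mono) auto
      finally show ?case by (simp add: mult.commute)
    qed
  qed (use ig igV in auto)
  also have "\<dots> = (\<bar>\<epsilon>\<bar> + \<bar>\<delta>\<bar>) * (\<integral>x. \<bar>h x - g x\<bar> \<partial>M)" by simp
  finally show ?thesis by simp
qed

text \<open>Continuity in the value gives pointwise convergence, and the common barriers for sources
  give the majorant \<open>2 * lam * b x \<delta>\<close>.\<close>

lemma F_tendsto:
  assumes V: "\<And>n::nat. V n \<in> K" and U: "U \<in> borel_measurable M" "AE x in M. \<epsilon> \<le> U x \<and> U x \<le> \<delta>"
    and lim: "AE x in M. (\<lambda>n. V n x) \<longlonglongrightarrow> U x"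
  shows "(\<lambda>n. \<integral>x. \<bar>F (V n) x - F U x\<bar> \<partial>M) \<longlonglongrightarrow> 0"
proof -
  have g: "F (V n) \<in> sources" "F U \<in> sources" for n by (rule F_K[OF V], rule F_sources[OF U])
  have [measurable]: "F (V n) \<in> borel_measurable M" "F U \<in> borel_measurable M" for n
    using g by (auto simp: sources_measurable)
  have "(\<lambda>n. \<integral>x. \<bar>F (V n) x - F U x\<bar> \<partial>M) \<longlonglongrightarrow> (\<integral>x. 0 \<partial>M)"
  proof (rule integral_dominated_convergence[where w = "\<lambda>x. 2 * lam * b x \<delta>"])
    show "integrable M (\<lambda>x. 2 * lam * b x \<delta>)" using b_delta_integrable by simp
    have "AE x in M. \<forall>n. \<epsilon> \<le> V n x \<and> V n x \<le> \<delta>" using K_AE[OF V] by (simp add: AE_all_countable)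
    then show "AE x in M. (\<lambda>n. \<bar>F (V n) x - F U x\<bar>) \<longlonglongrightarrow> 0"
      using AE_bf_regular lim U(2)
    proof eventually_elim
      case (elim x)
      have "(\<lambda>n. f x (V n x)) \<longlonglongrightarrow> f x (U x)"
        by (rule continuous_on_tendsto_compose[of "{\<epsilon>..\<delta>}" "f x"]) (use elim in \<open>auto simp: bf_regular_def\<close>)
      moreover have "(\<lambda>n. b x (V n x)) \<longlonglongrightarrow> b x (U x)"
        by (rule b_tendsto) (use elim in auto)
      ultimately have "(\<lambda>n. F (V n) x) \<longlonglongrightarrow> F U x"
        unfolding F_def by (intro tendsto_intros)
      then show ?case by (intro tendsto_rabs_zero LIM_zero)
    qed
    show "AE x in M. norm \<bar>F (V n) x - F U x\<bar> \<le> 2 * lam * b x \<delta>" for n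
      using sources_AE[OF g(1)[of n]] sources_AE[OF g(2)] by eventually_elim auto
  qed measurable
  then show ?thesis by simp
qed

text \<open>The limit \<open>U\<close> is at this point merely measurable with values in the
  obstacle interval; that it has a gradient in the right class is learned from its agreement with
  the minimiser \<open>V\<close> for the source \<open>F U\<close>.\<close>

lemma iteration_limit:
  assumes Us: "\<And>n. Us n \<in> K" and min: "\<And>n U. U \<in> K \<Longrightarrow> J (F (Us n)) (Us (Suc n)) \<le> J (F (Us n)) U"
    and conv: "AE x in M. convergent (\<lambda>n. Us n x)"
  obtains V where "weak_solution \<Omega> p \<Psi> f \<epsilon> \<delta> V" "AE x in M. (\<lambda>n. Us n x) \<longlonglongrightarrow> V x"
proof -
  define U where "U x = lim (\<lambda>n. Us n x)" for x
  have [measurable]: "Us n \<in> borel_measurable M" for n by (rule K_measurable[OF Us])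
  have Um: "U \<in> borel_measurable M" unfolding U_def by measurable
  have lim: "AE x in M. (\<lambda>n. Us n x) \<longlonglongrightarrow> U x"
    using conv by eventually_elim (simp add: U_def convergent_LIMSEQ_iff)
  have "AE x in M. \<forall>n. \<epsilon> \<le> Us n x \<and> Us n x \<le> \<delta>" using K_AE[OF Us] by (simp add: AE_all_countable)
  then have Ub: "AE x in M. \<epsilon> \<le> U x \<and> U x \<le> \<delta>"
    using lim by eventually_elim (auto intro: LIMSEQ_le_const LIMSEQ_le_const2)
  have g: "F U \<in> sources" by (rule F_sources[OF Um Ub])
  obtain V where V: "V \<in> K" and Vmin: "\<And>w. w \<in> K \<Longrightarrow> J (F U) V \<le> J (F U) w"
    by (rule minimizer_exists[OF g]) (rule that)
  define e where "e n = (\<bar>\<epsilon>\<bar> + \<bar>\<delta>\<bar>) * (\<integral>x. \<bar>F (Us n) x - F U x\<bar> \<partial>M)" for n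
  have e: "e \<longlonglongrightarrow> 0" unfolding e_def using tendsto_mult_right_zero[OF F_tendsto[OF Us Um Ub lim]] .
  \<comment> \<open>The source is exchanged twice, once for the iterate and once for
    \<open>V\<close>, hence the factor 2.\<close>
  have up: "J (F U) (Us (Suc n)) \<le> J (F U) V + 2 * e n" for n
  proof -
    have "J (F U) (Us (Suc n)) \<le> J (F (Us n)) (Us (Suc n)) + e n"
      unfolding e_def by (rule J_source_change[OF g F_K[OF Us] Us])
    also have "J (F (Us n)) (Us (Suc n)) \<le> J (F (Us n)) V" by (rule min[OF V])
    also have "J (F (Us n)) V \<le> J (F U) V + e n"
      using J_source_change[OF F_K[OF Us] g V, of n] by (simp add: e_def abs_minus_commute)
    finally show ?thesis by simp
  qed
  have Jlim: "(\<lambda>n. J (F U) (Us (Suc n))) \<longlonglongrightarrow> J (F U) V"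
  proof (rule tendsto_sandwich[of "\<lambda>_. J (F U) V" _ _ "\<lambda>n. J (F U) V + 2 * e n"])
    show "(\<lambda>n. J (F U) V + 2 * e n) \<longlonglongrightarrow> J (F U) V"
      using tendsto_add[OF tendsto_const tendsto_mult_right_zero[OF e, of 2], of "J (F U) V"] by simp
  qed (use up Vmin[OF Us] in auto)
  have UV: "AE x in M. U x = V x"
  proof (rule minimizing_limit_unique[OF g V Vmin Us Jlim])
    show "AE x in M. (\<lambda>n. Us (Suc n) x) \<longlonglongrightarrow> U x"
      using lim by eventually_elim (rule LIMSEQ_Suc)
  qed
  have "solves (F V) V"
  proof (rule solves_cong[OF minimizer_solves[OF g V Vmin] g F_K[OF V]])
    show "AE x in M. F U x = F V x" using UV by eventually_elim (simp add: F_def)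
  qed
  then have "weak_solution \<Omega> p \<Psi> f \<epsilon> \<delta> V" by (simp add: solves_F_iff)
  moreover have "AE x in M. (\<lambda>n. Us n x) \<longlonglongrightarrow> V x" using lim UV by eventually_elim simp
  ultimately show ?thesis by (rule that)
qed

section \<open>Iteration from the two constants\<close>

definition T :: "('a \<Rightarrow> real) \<Rightarrow> 'a \<Rightarrow> real" where
  "T w = (SOME v. v \<in> K \<and> (\<forall>U\<in>K. J (F w) v \<le> J (F w) U))"

lemma T_minimizer:
  assumes "w \<in> K"
  shows "T w \<in> K" "\<And>U. U \<in> K \<Longrightarrow> J (F w) (T w) \<le> J (F w) U"
proof -
  obtain v where "v \<in> K" "\<And>U. U \<in> K \<Longrightarrow> J (F w) v \<le> J (F w) U"
    by (rule minimizer_exists[OF F_K[OF assms]]) (rule that)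
  then have "\<exists>v. v \<in> K \<and> (\<forall>U\<in>K. J (F w) v \<le> J (F w) U)" by auto
  from someI_ex[OF this] show "T w \<in> K" "\<And>U. U \<in> K \<Longrightarrow> J (F w) (T w) \<le> J (F w) U"
    unfolding T_def by auto
qed

lemma T_solves: "w \<in> K \<Longrightarrow> solves (F w) (T w)"
  by (rule minimizer_solves[OF F_K T_minimizer])

lemma solves_F_mono:
  assumes "solves (F v) v'" "solves (F w) w'" "v \<in> K" "w \<in> K" "AE x in M. v x \<le> w x"
  shows "AE x in M. v' x \<le> w' x"
  by (rule comparison[OF assms(1,2) F_K[OF assms(3)] F_K[OF assms(4)] F_mono[OF assms(3-5)]])

definition iterate :: "real \<Rightarrow> nat \<Rightarrow> 'a \<Rightarrow> real" where
  "iterate c n = (T ^^ n) (\<lambda>_. c)"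

lemma iterate_simps: "iterate c 0 = (\<lambda>_. c)" "iterate c (Suc n) = T (iterate c n)"
  by (simp_all add: iterate_def)

lemma iterate_K:
  assumes "\<epsilon> \<le> c" "c \<le> \<delta>"
  shows "iterate c n \<in> K"
  by (induction n) (use assms const_K T_minimizer(1) in \<open>auto simp: iterate_simps\<close>)

lemma iterate_limit:
  assumes c: "\<epsilon> \<le> c" "c \<le> \<delta>" and mono: "AE x in M. monoseq (\<lambda>n. iterate c n x)"
  obtains V where "weak_solution \<Omega> p \<Psi> f \<epsilon> \<delta> V" "AE x in M. (\<lambda>n. iterate c n x) \<longlonglongrightarrow> V x"
proof (rule iteration_limit[of "iterate c"])
  note cK = iterate_K[OF c]
  show "iterate c n \<in> K" for n by (rule cK)
  show "J (F (iterate c n)) (iterate c (Suc n)) \<le> J (F (iterate c n)) U" if "U \<in> K" for n U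
    unfolding iterate_simps by (rule T_minimizer(2)[OF cK that])
  have "AE x in M. \<forall>n. \<bar>iterate c n x\<bar> \<le> \<bar>\<epsilon>\<bar> + \<bar>\<delta>\<bar>" using K_abs[OF cK] by (simp add: AE_all_countable)
  then show "AE x in M. convergent (\<lambda>n. iterate c n x)"
    using mono by eventually_elim (auto intro!: Bseq_monoseq_convergent BseqI')
qed (rule that)

lemma maximal_weak_solution:
  obtains V where "weak_solution \<Omega> p \<Psi> f \<epsilon> \<delta> V"
    "\<And>U. weak_solution \<Omega> p \<Psi> f \<epsilon> \<delta> U \<Longrightarrow> AE x in M. U x \<le> V x"
proof -
  note dK = iterate_K[OF eps_le_delta order_refl]
  have "AE x in M. iterate \<delta> (Suc n) x \<le> iterate \<delta> n x" for n
  proof (induction n)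
    case 0
    show ?case using K_AE[OF dK[of "Suc 0"]] by (auto simp: iterate_simps(1) elim!: AE_mp)
  next
    case (Suc n)
    show ?case
      unfolding iterate_simps(2)[of \<delta> "Suc n"] iterate_simps(2)[of \<delta> n]
      by (rule solves_F_mono[OF T_solves T_solves]) (use dK T_minimizer(1) Suc in \<open>auto simp: iterate_simps(2)\<close>)
  qed
  then have "AE x in M. \<forall>n. iterate \<delta> (Suc n) x \<le> iterate \<delta> n x" by (simp add: AE_all_countable)
  then have "AE x in M. monoseq (\<lambda>n. iterate \<delta> n x)"
    by eventually_elim (simp add: monoseq_Suc)
  then obtain V where V: "weak_solution \<Omega> p \<Psi> f \<epsilon> \<delta> V" and lim: "AE x in M. (\<lambda>n. iterate \<delta> n x) \<longlonglongrightarrow> V x"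
    by (rule iterate_limit[OF eps_le_delta order_refl]) (rule that)
  show ?thesis
  proof (rule that[OF V])
    fix U assume "weak_solution \<Omega> p \<Psi> f \<epsilon> \<delta> U"
    then have s: "solves (F U) U" by (simp add: solves_F_iff)
    then have U: "U \<in> K" by (simp add: solves_def)
    have "AE x in M. U x \<le> iterate \<delta> n x" for n
    proof (induction n)
      case 0
      show ?case using K_AE[OF U] by (auto simp: iterate_simps(1) elim!: AE_mp)
    next
      case (Suc n)
      show ?case unfolding iterate_simps by (rule solves_F_mono[OF s T_solves[OF dK] U dK Suc])
    qed
    then have "AE x in M. \<forall>n. U x \<le> iterate \<delta> n x" by (simp add: AE_all_countable)
    then show "AE x in M. U x \<le> V x"
      using lim by eventually_elim (auto intro: LIMSEQ_le_const)
  qed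
qed

lemma minimal_weak_solution:
  obtains V where "weak_solution \<Omega> p \<Psi> f \<epsilon> \<delta> V"
    "\<And>U. weak_solution \<Omega> p \<Psi> f \<epsilon> \<delta> U \<Longrightarrow> AE x in M. V x \<le> U x"
proof -
  note eK = iterate_K[OF order_refl eps_le_delta]
  have "AE x in M. iterate \<epsilon> n x \<le> iterate \<epsilon> (Suc n) x" for n
  proof (induction n)
    case 0
    show ?case using K_AE[OF eK[of "Suc 0"]] by (auto simp: iterate_simps(1) elim!: AE_mp)
  next
    case (Suc n)
    show ?case
      unfolding iterate_simps(2)[of \<epsilon> "Suc n"] iterate_simps(2)[of \<epsilon> n]
      by (rule solves_F_mono[OF T_solves T_solves]) (use eK T_minimizer(1) Suc in \<open>auto simp: iterate_simps(2)\<close>)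
  qed
  then have "AE x in M. \<forall>n. iterate \<epsilon> n x \<le> iterate \<epsilon> (Suc n) x" by (simp add: AE_all_countable)
  then have "AE x in M. monoseq (\<lambda>n. iterate \<epsilon> n x)"
    by eventually_elim (simp add: monoseq_Suc)
  then obtain V where V: "weak_solution \<Omega> p \<Psi> f \<epsilon> \<delta> V" and lim: "AE x in M. (\<lambda>n. iterate \<epsilon> n x) \<longlonglongrightarrow> V x"
    by (rule iterate_limit[OF order_refl eps_le_delta]) (rule that)
  show ?thesis
  proof (rule that[OF V])
    fix U assume "weak_solution \<Omega> p \<Psi> f \<epsilon> \<delta> U"
    then have s: "solves (F U) U" by (simp add: solves_F_iff)
    then have U: "U \<in> K" by (simp add: solves_def)
    have "AE x in M. iterate \<epsilon> n x \<le> U x" for n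
    proof (induction n)
      case 0
      show ?case using K_AE[OF U] by (auto simp: iterate_simps(1) elim!: AE_mp)
    next
      case (Suc n)
      show ?case unfolding iterate_simps by (rule solves_F_mono[OF T_solves[OF eK] s eK U Suc])
    qed
    then have "AE x in M. \<forall>n. iterate \<epsilon> n x \<le> U x" by (simp add: AE_all_countable)
    then show "AE x in M. V x \<le> U x"
      using lim by eventually_elim (auto intro: LIMSEQ_le_const2)
  qed
qed

end

subsection \<open>Regularity of the coefficients\<close>

lemma log_holder_on_imp_continuous_on:
  fixes p :: "'a::metric_space \<Rightarrow> real"
  assumes "log_holder_on S p"
  shows "continuous_on S p"
  unfolding continuous_on_iff
proof (intro ballI allI impI)
  fix x :: 'a and e :: real assume x: "x \<in> S" and "0 < e"
  obtain C where C: "0 < C" and le: "\<And>x y. x \<in> S \<Longrightarrow> y \<in> S \<Longrightarrow> 0 < dist x y \<Longrightarrow> dist x y < 1/2 \<Longrightarrow>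
      \<bar>p x - p y\<bar> \<le> C / (- ln (dist x y))"
    using assms unfolding log_holder_on_def by blast
  \<comment> \<open>Below \<open>exp (- (C / e))\<close> the modulus
    \<open>C / (- ln (dist x y))\<close> is smaller than \<open>e\<close>; the bound 1/2 is the
    range of the log-Holder estimate.\<close>
  define d where "d = min (1/2) (exp (- (C / e)))"
  show "\<exists>d>0. \<forall>y\<in>S. dist y x < d \<longrightarrow> dist (p y) (p x) < e"
  proof (intro exI[of _ d] conjI ballI impI)
    show "0 < d" by (simp add: d_def)
    fix y assume y: "y \<in> S" "dist y x < d"
    show "dist (p y) (p x) < e"
    proof (cases "y = x")
      case False
      then have pos: "0 < dist x y" by simp
      have small: "dist x y < 1/2" "dist x y < exp (- (C / e))" using y by (auto simp: d_def dist_commute)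
      have "ln (dist x y) < - (C / e)" using small(2) pos by (metis ln_exp ln_less_cancel_iff exp_gt_zero)
      then have l: "C / e < - ln (dist x y)" by simp
      have "0 < C / e" using C \<open>0 < e\<close> by simp
      then have "0 < - ln (dist x y)" using l by linarith
      then have "C / (- ln (dist x y)) < e" using l \<open>0 < e\<close> by (simp add: field_simps)
      then show ?thesis using le[OF x y(1) pos small(1)] by (simp add: dist_real_def abs_minus_commute)
    qed (use \<open>0 < e\<close> in simp)
  qed
qed

lemma absolutely_continuous_on_interval_imp_continuous_on:
  assumes "absolutely_continuous_on {c..d} g"
  shows "continuous_on {c..d} g"
  unfolding continuous_on_iff
proof (intro ballI allI impI)
  fix x e :: real assume x: "x \<in> {c..d}" and "0 < e"
  from assms[unfolded absolutely_continuous_on_def, THEN spec, THEN mp, OF \<open>0 < e\<close>]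
  obtain \<theta> where "0 < \<theta>" and \<theta>: "\<forall>(n::nat) l r. (\<forall>i<n. l i \<le> r i \<and> {l i..r i} \<subseteq> {c..d}) \<and>
        disjoint_family_on (\<lambda>i. {l i<..<r i}) {..<n} \<and> (\<Sum>i<n. r i - l i) < \<theta> \<longrightarrow>
        (\<Sum>i<n. \<bar>g (r i) - g (l i)\<bar>) < e"
    by (elim exE conjE) (rule that)
  \<comment> \<open>The family of intervals consists of the single interval from \<open>s\<close> to
    \<open>t\<close>.\<close>
  have close: "\<bar>g t - g s\<bar> < e" if "s \<in> {c..d}" "t \<in> {c..d}" "s \<le> t" "t - s < \<theta>" for s t
    using \<theta>[THEN spec[of _ 1], THEN spec[of _ "\<lambda>_. s"], THEN spec[of _ "\<lambda>_. t"]] that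
    by (simp add: disjoint_family_on_def)
  show "\<exists>\<theta>>0. \<forall>y\<in>{c..d}. dist y x < \<theta> \<longrightarrow> dist (g y) (g x) < e"
  proof (intro exI[of _ \<theta>] conjI ballI impI \<open>0 < \<theta>\<close>)
    fix y assume y: "y \<in> {c..d}" "dist y x < \<theta>"
    then show "dist (g y) (g x) < e"
      using close[of x y] close[of y x] x by (cases "x \<le> y") (auto simp: dist_real_def)
  qed
qed

lemma locally_absolutely_continuous_on_imp_continuous_on:
  assumes "locally_absolutely_continuous_on {0<..} g"
  shows "continuous_on {0<..} g"
proof (rule continuous_at_imp_continuous_on, rule ballI)
  fix x :: real assume "x \<in> {0<..}"
  then have "{x/2..2*x} \<subseteq> {0<..}" by auto
  then have "absolutely_continuous_on {x/2..2*x} g" using assms by (simp only: locally_absolutely_continuous_on_def)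
  then have "continuous_on {x/2..2*x} g" by (rule absolutely_continuous_on_interval_imp_continuous_on)
  then have "continuous_on {x/2<..<2*x} g" by (rule continuous_on_subset) auto
  then show "isCont g x" using \<open>x \<in> {0<..}\<close> by (auto simp: continuous_on_eq_continuous_at)
qed

text \<open>Away from 0 continuity is that of a product; the limit assumption supplies continuity at
  0, and positivity of \<open>\<Psi>\<close> supplies the comparison with the value 0 there.\<close>

lemma Phi_continuous_monotone:
  assumes cont: "continuous_on {0<..} (\<Psi> x)" and lim: "((\<lambda>s. \<Psi> x s * s) \<longlongrightarrow> 0) (at_right 0)"
    and mono: "strict_mono_on {0<..} (\<lambda>s. \<Psi> x s * s)" and pos: "\<And>s. 0 < s \<Longrightarrow> 0 < \<Psi> x s"
  shows "continuous_on {0..} (Phi \<Psi> x)" "\<And>s t. 0 \<le> s \<Longrightarrow> s \<le> t \<Longrightarrow> Phi \<Psi> x s \<le> Phi \<Psi> x t"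
proof -
  have eq: "Phi \<Psi> x s = \<Psi> x s * s" if "0 < s" for s using that by (simp add: Phi_def)
  show "Phi \<Psi> x s \<le> Phi \<Psi> x t" if "0 \<le> s" "s \<le> t" for s t
  proof (cases "s = 0 \<or> s = t")
    case True
    then show ?thesis using pos[of t] that by (cases "t = 0") (auto simp: Phi_def intro: mult_nonneg_nonneg less_imp_le)
  next
    case False
    then show ?thesis using strict_mono_onD[OF mono, of s t] that by (simp add: eq)
  qed
  show "continuous_on {0..} (Phi \<Psi> x)"
    unfolding continuous_on_def
  proof
    fix s :: real assume "s \<in> {0..}"
    show "(Phi \<Psi> x \<longlongrightarrow> Phi \<Psi> x s) (at s within {0..})"
    proof (cases "s = 0")
      case True
      have "(Phi \<Psi> x \<longlongrightarrow> 0) (at_right 0)"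
        by (rule Lim_transform_eventually[OF lim]) (auto simp: eventually_at_filter eq)
      moreover have "at (0 :: real) within {0..} = at_right 0"
        by (auto simp: at_within_def intro!: arg_cong[where f = "\<lambda>A. inf (nhds 0) (principal A)"])
      ultimately show ?thesis using True by (simp add: Phi_def)
    next
      case False
      then have "s \<in> {0<..}" using \<open>s \<in> {0..}\<close> by simp
      have "continuous_on {0<..} (\<lambda>s. \<Psi> x s * s)" by (intro continuous_intros cont)
      then have "continuous_on {0<..} (Phi \<Psi> x)" using eq by (simp cong: continuous_on_cong_simp)
      then have "isCont (Phi \<Psi> x) s"
        using \<open>s \<in> {0<..}\<close> by (simp add: continuous_on_eq_continuous_at)
      from continuous_at_imp_continuous_at_within[OF this] show ?thesis by (simp add: continuous_within)
    qed
  qed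
qed

theorem theorem9p1:
  fixes \<Omega> :: "'a::euclidean_space set"
    and p :: "'a \<Rightarrow> real"
    and \<Psi> b f :: "'a \<Rightarrow> real \<Rightarrow> real"
    and \<delta>\<^sub>0 lambda\<^sub>0 \<epsilon> \<delta> :: real
  assumes dim: "DIM('a) \<ge> 2"
    and domain: "lipschitz_domain \<Omega>"
    and p_gt_1: "\<forall>x\<in>closure \<Omega>. 1 < p x"
    and p_reg:
      "(log_holder_on (closure \<Omega>) p \<and> 2 * real DIM('a) / (real DIM('a) + 2) \<le> p_minus \<Omega> p) \<or>
       (continuous_on (closure \<Omega>) p \<and> 2 * real DIM('a) / (real DIM('a) + 2) < p_minus \<Omega> p)"
    and Psi_pos: "\<forall>x\<in>closure \<Omega>. \<forall>s>0. 0 < \<Psi> x s"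
    and Psi_meas: "\<forall>s>0. (\<lambda>x. \<Psi> x s) \<in> borel_measurable (lebesgue_on (closure \<Omega>))"
    and Psi_ac: "AE x in lebesgue_on \<Omega>. locally_absolutely_continuous_on {0<..} (\<Psi> x)"
    and Psi_lim: "AE x in lebesgue_on \<Omega>. ((\<lambda>s. \<Psi> x s * s) \<longlongrightarrow> 0) (at_right 0)"
    and Psi_mono: "AE x in lebesgue_on \<Omega>. strict_mono_on {0<..} (\<lambda>s. \<Psi> x s * s)"
    and Phi_growth:
      "\<forall>v\<in>Lp_var \<Omega> p. (\<lambda>x. Phi \<Psi> x (v x)) \<in> Lp_var \<Omega> (conj_exponent p)"
    and A_coercive:
      "\<forall>V :: nat \<Rightarrow> 'a \<Rightarrow> real.
         (\<forall>n. V n \<in> W1p_var \<Omega> p) \<and>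
         filterlim (\<lambda>n. LINT x|lebesgue_on \<Omega>. norm (weak_gradient \<Omega> (V n) x) powr p x)
           at_top sequentially \<longrightarrow>
         filterlim (\<lambda>n. LINT x|lebesgue_on \<Omega>. A_pot \<Psi> x (weak_gradient \<Omega> (V n) x))
           at_top sequentially"
    and delta0_pos: "0 < \<delta>\<^sub>0"
    and b_nonneg: "\<forall>x\<in>closure \<Omega>. \<forall>s\<in>{0..\<delta>\<^sub>0}. 0 \<le> b x s"
    and b_carath: "caratheodory \<Omega> {0..\<delta>\<^sub>0} b"
    and b_L2: "(\<lambda>x. b x 0) \<in> Lp_var \<Omega> (\<lambda>_. 2)" "(\<lambda>x. b x \<delta>\<^sub>0) \<in> Lp_var \<Omega> (\<lambda>_. 2)"
    and b_mono: "AE x in lebesgue_on \<Omega>. strict_mono_on {0..\<delta>\<^sub>0} (b x)"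
    and f_0: "AE x in lebesgue_on \<Omega>. 0 \<le> f x 0"
    and f_delta0: "AE x in lebesgue_on \<Omega>. f x \<delta>\<^sub>0 \<le> 0"
    and f_carath: "caratheodory \<Omega> {0..\<delta>\<^sub>0} f"
    and lambda0_pos: "0 < lambda\<^sub>0"
    and f_b_mono: "AE x in lebesgue_on \<Omega>. strict_mono_on {0..\<delta>\<^sub>0} (\<lambda>s. f x s + lambda\<^sub>0 * b x s)"
    and eps_delta: "0 \<le> \<epsilon>" "\<epsilon> \<le> \<delta>" "\<delta> \<le> \<delta>\<^sub>0"
    and f_eps: "AE x in lebesgue_on \<Omega>. 0 \<le> f x \<epsilon>"
    and f_delta: "AE x in lebesgue_on \<Omega>. f x \<delta> \<le> 0"
  shows "(\<exists>U. weak_solution \<Omega> p \<Psi> f \<epsilon> \<delta> U) \<and>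
    (\<exists>Umin Umax.
       weak_solution \<Omega> p \<Psi> f \<epsilon> \<delta> Umin \<and> weak_solution \<Omega> p \<Psi> f \<epsilon> \<delta> Umax \<and>
       (\<forall>U. weak_solution \<Omega> p \<Psi> f \<epsilon> \<delta> U \<longrightarrow>
          (AE x in lebesgue_on \<Omega>. Umin x \<le> U x \<and> U x \<le> Umax x)))"
proof -
  have open_dom: "open \<Omega>" and bounded_dom: "bounded \<Omega>" and nonempty: "closure \<Omega> \<noteq> {}"
    using domain by (auto simp: lipschitz_domain_def)
  have compact: "compact (closure \<Omega>)" using bounded_dom by simp
  have sub: "\<Omega> \<subseteq> closure \<Omega>" by (rule closure_subset)
  have p_cont: "continuous_on (closure \<Omega>) p"
    using p_reg log_holder_on_imp_continuous_on by blast
  have comp: "compact (p ` closure \<Omega>)" by (rule compact_continuous_image[OF p_cont compact])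
  then obtain P where P: "\<And>x. x \<in> closure \<Omega> \<Longrightarrow> \<bar>p x\<bar> \<le> P"
    using compact_imp_bounded[OF comp] by (auto simp: bounded_iff)
  obtain x0 where x0: "x0 \<in> closure \<Omega>" "\<And>x. x \<in> closure \<Omega> \<Longrightarrow> p x0 \<le> p x"
    using continuous_attains_inf[OF compact nonempty p_cont] by blast
  \<comment> \<open>The infimum is attained, so the pointwise bound \<open>1 < p x\<close> gives
    \<open>1 < p_minus \<Omega> p\<close>, as the locale demands.\<close>
  have pm: "p_minus \<Omega> p = p x0"
    unfolding p_minus_def using x0 by (intro cInf_eq_minimum) auto
  have restrict: "g \<in> borel_measurable (lebesgue_on \<Omega>)" if "g \<in> borel_measurable (lebesgue_on (closure \<Omega>))"
    for g :: "'a \<Rightarrow> real"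
    using measurable_restrict_mono[OF that sub] .
  have "p \<in> borel_measurable (lebesgue_on \<Omega>)"
    by (rule continuous_imp_measurable_on_sets_lebesgue[OF continuous_on_subset[OF p_cont sub]])
      (use open_dom in simp)
  then interpret var_exponent \<Omega> p "p_minus \<Omega> p" P
    using p_gt_1 x0 P sub by unfold_locales (auto simp: pm open_dom bounded_dom abs_le_iff)
  \<comment> \<open>Both alternatives for the exponent give this inequality; the critical case of
    equality is covered by \<open>W_square_integrable\<close>.\<close>
  have q: "2 * real DIM('a) / (real DIM('a) + 2) \<le> p_minus \<Omega> p" using p_reg by auto
  have regular: "AE x in lebesgue_on \<Omega>. continuous_on {0..} (Phi \<Psi> x) \<and>
      (\<forall>s t. 0 \<le> s \<and> s \<le> t \<longrightarrow> Phi \<Psi> x s \<le> Phi \<Psi> x t)"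
    using Psi_ac Psi_lim Psi_mono AE_space
  proof eventually_elim
    case (elim x)
    have "0 < \<Psi> x s" if "0 < s" for s using Psi_pos sub elim(4) that by auto
    from Phi_continuous_monotone[where \<Psi> = \<Psi> and x = x, OF locally_absolutely_continuous_on_imp_continuous_on[OF elim(1)] elim(2,3) this]
    show ?case by blast
  qed
  have "\<epsilon> \<in> {0..\<delta>\<^sub>0}" "\<delta> \<in> {0..\<delta>\<^sub>0}" using eps_delta by auto
  have sub2: "{\<epsilon>..\<delta>} \<subseteq> {0..\<delta>\<^sub>0}" using eps_delta by auto
  have sources_regular: "AE x in lebesgue_on \<Omega>. continuous_on {\<epsilon>..\<delta>} (b x) \<and> strict_mono_on {\<epsilon>..\<delta>} (b x) \<and>
      continuous_on {\<epsilon>..\<delta>} (f x) \<and>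
      (\<forall>s t. \<epsilon> \<le> s \<and> s \<le> t \<and> t \<le> \<delta> \<longrightarrow> f x s + lambda\<^sub>0 * b x s \<le> f x t + lambda\<^sub>0 * b x t) \<and>
      0 \<le> b x \<epsilon> \<and> 0 \<le> f x \<epsilon> \<and> f x \<delta> \<le> 0"
    using conjunct2[OF b_carath[unfolded caratheodory_def]] conjunct2[OF f_carath[unfolded caratheodory_def]]
      b_mono f_b_mono f_eps f_delta AE_space
  proof eventually_elim
    case (elim x)
    have "f x s + lambda\<^sub>0 * b x s \<le> f x t + lambda\<^sub>0 * b x t" if "\<epsilon> \<le> s \<and> s \<le> t \<and> t \<le> \<delta>" for s t
      using strict_mono_onD[OF elim(4), of s t] that eps_delta by (cases "s = t") auto
    moreover have "strict_mono_on {\<epsilon>..\<delta>} (b x)" by (rule monotone_on_subset[OF elim(3) sub2])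
    moreover have "0 \<le> b x \<epsilon>" using b_nonneg sub elim(7) \<open>\<epsilon> \<in> {0..\<delta>\<^sub>0}\<close> by auto
    ultimately show ?case
      using elim(5,6) continuous_on_subset[OF elim(1) sub2] continuous_on_subset[OF elim(2) sub2] by blast
  qed
  have meas: "(\<lambda>x. b x s) \<in> borel_measurable (lebesgue_on \<Omega>)" "(\<lambda>x. f x s) \<in> borel_measurable (lebesgue_on \<Omega>)"
    if "s \<in> {0..\<delta>\<^sub>0}" for s
    using b_carath f_carath that by (auto simp: caratheodory_def intro: restrict)
  \<comment> \<open>\<open>b x \<delta>\<close> lies between 0 and
    \<open>b x \<delta>\<^sub>0\<close>, which transfers square integrability from
    \<open>\<delta>\<^sub>0\<close> to \<open>\<delta>\<close>.\<close>
  have b_delta_L2: "integrable (lebesgue_on \<Omega>) (\<lambda>x. (b x \<delta>)\<^sup>2)"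
  proof (rule Bochner_Integration.integrable_bound)
    show "integrable (lebesgue_on \<Omega>) (\<lambda>x. \<bar>b x \<delta>\<^sub>0\<bar> powr 2)" using b_L2(2) by (simp add: Lp_var_def)
    show "AE x in lebesgue_on \<Omega>. norm ((b x \<delta>)\<^sup>2) \<le> norm (\<bar>b x \<delta>\<^sub>0\<bar> powr 2)"
      using b_mono AE_space
    proof eventually_elim
      case (elim x)
      have "b x \<delta> \<le> b x \<delta>\<^sub>0"
        using strict_mono_onD[OF elim(1), of \<delta> \<delta>\<^sub>0] eps_delta by (cases "\<delta> = \<delta>\<^sub>0") auto
      moreover have "0 \<le> b x \<delta>" using b_nonneg sub elim(2) \<open>\<delta> \<in> {0..\<delta>\<^sub>0}\<close> by auto
      ultimately have "(b x \<delta>)\<^sup>2 \<le> \<bar>b x \<delta>\<^sub>0\<bar> ^ 2" by (intro power_mono) auto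
      also have "\<dots> = \<bar>b x \<delta>\<^sub>0\<bar> powr 2" by (simp add: powr_numeral)
      finally show ?case by simp
    qed
  qed (use meas(1)[OF \<open>\<delta> \<in> {0..\<delta>\<^sub>0}\<close>] in measurable)
  interpret elliptic \<Omega> p "p_minus \<Omega> p" P \<Psi> b f \<epsilon> \<delta> lambda\<^sub>0
  proof unfold_locales
    show "integrable (lebesgue_on \<Omega>) (\<lambda>x. (u x)\<^sup>2)" if "u \<in> W1p_var \<Omega> p" for u
      by (rule W_square_integrable[OF domain dim q that])
    show "filterlim (\<lambda>n. LINT x|lebesgue_on \<Omega>. A_pot \<Psi> x (weak_gradient \<Omega> (V n) x)) at_top sequentially"
      if "\<And>n. V n \<in> W1p_var \<Omega> p"
        "filterlim (\<lambda>n. LINT x|lebesgue_on \<Omega>. norm (weak_gradient \<Omega> (V n) x) powr p x) at_top sequentially"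
      for V :: "nat \<Rightarrow> 'a \<Rightarrow> real"
      using A_coercive that by blast
  qed (use Phi_growth regular sources_regular b_delta_L2 meas eps_delta lambda0_pos in auto)
  obtain Umax where Umax: "weak_solution \<Omega> p \<Psi> f \<epsilon> \<delta> Umax"
    "\<And>U. weak_solution \<Omega> p \<Psi> f \<epsilon> \<delta> U \<Longrightarrow> AE x in lebesgue_on \<Omega>. U x \<le> Umax x"
    by (rule maximal_weak_solution) (rule that)
  obtain Umin where Umin: "weak_solution \<Omega> p \<Psi> f \<epsilon> \<delta> Umin"
    "\<And>U. weak_solution \<Omega> p \<Psi> f \<epsilon> \<delta> U \<Longrightarrow> AE x in lebesgue_on \<Omega>. Umin x \<le> U x"
    by (rule minimal_weak_solution) (rule that)
  have "AE x in lebesgue_on \<Omega>. Umin x \<le> U x \<and> U x \<le> Umax x" if "weak_solution \<Omega> p \<Psi> f \<epsilon> \<delta> U" for U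
    using Umin(2)[OF that] Umax(2)[OF that] by eventually_elim simp
  with Umin(1) Umax(1) show ?thesis by blast
qed

end
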